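(* Let $\zeta\in\mathbb C\setminus\{0\}$ and $\mathcal A_\zeta:=\{a/b: a,b\in\mathcal A,\ b(\zeta)\neq0\}$. Let $\lambda$ be a partition of $n$, $t$ a standard $\lambda$-tableau, and $1\le r\le s\le n$. For $m\le n$ let $\lambda^{\le m}$ be the shape of the tableau obtained from $t$ by deleting the nodes containing $m+1,\dots,n$, and write $\lambda^{<r}:=\lambda^{\le r-1}$. Let $t^{\le}=t^{\le}_{|r,\dots,s}$ be the $\lambda^{\le s}$-tableau that agrees with $t$ on the nodes containing $r,r+1,\dots,s$ and has $1,2,\dots,r-1$ filled in along rows (top row first) in the remaining nodes. Let $U:=f_{t^{\le}}\,\mathcal H_{\mathcal A_\zeta,r-1}\subseteq S^{\lambda^{\le s}}$ (the $\mathcal A_\zeta$-span of $f_{t^\le}h$, $h\in\mathcal H_{\mathcal A_\zeta,r-1}$, inside the Specht module over $\mathcal K$ for $\mathcal H_{\mathcal K,s}$). Then the rule $f_{t^{\le}}\mapsto e_{\lambda^{<r}}$ defines an isomorphism of $\mathcal H_{\mathcal A_\zeta,r-1}$-modules $\varphi:U\to S^{\lambda^{<r}}_{\mathcal A_\zeta}$.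
   Context: $\mathcal A=\mathbb C[q,q^{-1}]$, $\mathcal K=\mathbb C(q)$. $\mathcal H_{\mathcal A,m}$ is the Iwahori–Hecke algebra over $\mathcal A$ with generators $T_1,\dots,T_{m-1}$ and relations $T_iT_j=T_jT_i$ for $|i-j|>1$, $T_iT_jT_i=T_jT_iT_j$ for $|i-j|=1$, $(T_i-q)(T_i+1)=0$; $\mathcal H_{\mathcal B,m}=\mathcal H_{\mathcal A,m}\otimes_{\mathcal A}\mathcal B$; $\mathcal H_{\mathcal B,m'}\subset\mathcal H_{\mathcal B,m}$ for $m'\le m$ via $T_i\mapsto T_i$. Permutations compose left to right; $s_i=(i,i+1)$; $T_w=T_{i_1}\cdots T_{i_N}$ for reduced $w=s_{i_1}\cdots s_{i_N}$. $[k]_q=(q^k-1)/(q-1)$. For a partition $\nu$ of $m$: a $\nu$-tableau is a bijective filling of its diagram with $1,\dots,m$; standard = increasing along rows and columns; $t^\nu$ has $1,\dots,m$ filled along rows, top first; $S_m$ acts on the right on tableaux by permuting entries and $t=t^\nu d(t)$. Specht module: $x_\nu=\sum_{w\in S_\nu}T_w$ ($S_\nu$ the row stabilizer of $t^\nu$), $x_{uv}=T_{d(u)^{-1}}x_\nu T_{d(v)}$, $\overline N_\nu$ the $\mathcal A$-span of $x_{uv}$ for $\rho$-tableaux $u,v$ with $\rho$ strictly dominating $\nu$; $S^\nu_{\mathcal A}$ is the right $\mathcal H_{\mathcal A,m}$-module generated by $x_\nu+\overline N_\nu$, with basis $e_v=x_{t^\nu v}+\overline N_\nu$, $v$ standard;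 $e_\nu=e_{t^\nu}$; $S^\nu_{\mathcal B}=S^\nu_{\mathcal A}\otimes\mathcal B$, $S^\nu=S^\nu_{\mathcal K}$. Seminormal basis of $S^\nu$: $L_p=\sum_{i=1}^{p-1}q^{-i}T_{(p-i,p)}$; residue of node $(r,c)$ is $[c-r]_q$; $r_v(p)$ = residue of the node containing $p$ in $v$; $\mathrm R$ = set of residues of nodes of partitions of $m$; $E_v=\prod_{p=1}^m\prod_{c\in\mathrm R\setminus\{r_v(p)\}}\frac{L_p-c}{r_v(p)-c}$, $f_v=e_vE_v$. *)

theory Defs
  imports "HOL-Computational_Algebra.Polynomial" "HOL-Computational_Algebra.Fraction_Field"
          "HOL-Combinatorics.Permutations" "HOL-Combinatorics.Transposition"
begin

type_synonym K = "complex poly fract"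

definition qq :: K where "qq = Fract [:0, 1:] 1"

definition kpoly :: "complex poly \<Rightarrow> K" where "kpoly p = Fract p 1"

definition Alaur :: "K set" where
  "Alaur = {kpoly p / qq ^ k | p k. True}"

definition A_zeta :: "complex \<Rightarrow> K set" where
  "A_zeta z = {a / b | a b. a \<in> Alaur \<and>
      (\<exists>p k. b = kpoly p / qq ^ k \<and> poly p z / z ^ k \<noteq> 0)}"

definition qint :: "int \<Rightarrow> K" where "qint k = (qq powi k - 1) / (qq - 1)"

section \<open>Iwahori-Hecke algebra (elements as coefficient functions on the T_w basis)\<close>

text \<open>Permutations are functions nat => nat; S_m = permutations of {1..m}.
  Composition is left to right: the product v w (first v, then w) is the function w o v.\<close>

type_synonym hecke = "(nat \<Rightarrow> nat) \<Rightarrow> K"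

definition sgen :: "nat \<Rightarrow> nat \<Rightarrow> nat" where "sgen i = transpose i (Suc i)"

definition plen :: "(nat \<Rightarrow> nat) \<Rightarrow> nat" where
  "plen w = card {(i, j). i < j \<and> w j < w i}"

definition wprod :: "nat list \<Rightarrow> nat \<Rightarrow> nat" where
  "wprod ws = foldl (\<lambda>acc i. sgen i \<circ> acc) id ws"

definition rword :: "(nat \<Rightarrow> nat) \<Rightarrow> nat list" where
  "rword w = (SOME ws. wprod ws = w \<and> length ws = plen w \<and> (\<forall>i\<in>set ws. 1 \<le> i))"

definition H :: "nat \<Rightarrow> hecke set" where
  "H m = {a. \<forall>w. a w \<noteq> 0 \<longrightarrow> w permutes {1..m}}"

definition H_over :: "K set \<Rightarrow> nat \<Rightarrow> hecke set" where
  "H_over R m = {a \<in> H m. \<forall>w. a w \<in> R}"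

definition Tb :: "(nat \<Rightarrow> nat) \<Rightarrow> hecke" where
  "Tb w = (\<lambda>v. if v = w then 1 else 0)"

definition hadd :: "hecke \<Rightarrow> hecke \<Rightarrow> hecke" where "hadd a b = (\<lambda>w. a w + b w)"
definition hscale :: "K \<Rightarrow> hecke \<Rightarrow> hecke" where "hscale c a = (\<lambda>w. c * a w)"

text \<open>right multiplication by T_i:  T_w T_i = T_{w s_i} if l(w s_i) > l(w),
  else (q-1) T_w + q T_{w s_i}\<close>
definition mulTs :: "hecke \<Rightarrow> nat \<Rightarrow> hecke" where
  "mulTs a i = (\<lambda>v. let u = sgen i \<circ> v in
      if plen u < plen v then a u + (qq - 1) * a v else qq * a u)"

definition mulT :: "hecke \<Rightarrow> (nat \<Rightarrow> nat) \<Rightarrow> hecke" where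
  "mulT a w = foldl mulTs a (rword w)"

definition hmul :: "hecke \<Rightarrow> hecke \<Rightarrow> hecke" (infixl \<open>\<star>\<close> 70) where
  "hmul a b = (\<lambda>v. \<Sum>w\<in>{w. b w \<noteq> 0}. b w * mulT a w v)"

definition span_in :: "K set \<Rightarrow> hecke set \<Rightarrow> hecke set" where
  "span_in R S = {a. \<exists>F c. finite F \<and> F \<subseteq> S \<and> (\<forall>b\<in>F. c b \<in> R) \<and>
                       a = (\<lambda>w. \<Sum>b\<in>F. c b * b w)}"

definition is_part :: "nat list \<Rightarrow> bool" where
  "is_part \<nu> \<longleftrightarrow> sorted_wrt (\<ge>) \<nu> \<and> (\<forall>x\<in>set \<nu>. 0 < x)"

definition partition_of :: "nat \<Rightarrow> nat list \<Rightarrow> bool" where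
  "partition_of m \<nu> \<longleftrightarrow> is_part \<nu> \<and> sum_list \<nu> = m"

definition nodes :: "nat list \<Rightarrow> (nat \<times> nat) set" where
  "nodes \<nu> = {(r, c). 1 \<le> r \<and> r \<le> length \<nu> \<and> 1 \<le> c \<and> c \<le> \<nu> ! (r - 1)}"

definition strictly_dominates :: "nat list \<Rightarrow> nat list \<Rightarrow> bool" where
  "strictly_dominates \<rho> \<nu> \<longleftrightarrow> \<rho> \<noteq> \<nu> \<and> (\<forall>k. sum_list (take k \<nu>) \<le> sum_list (take k \<rho>))"

definition tableau :: "nat list \<Rightarrow> (nat \<times> nat \<Rightarrow> nat) \<Rightarrow> bool" where
  "tableau \<nu> t \<longleftrightarrow> bij_betw t (nodes \<nu>) {1..sum_list \<nu>} \<and> (\<forall>x. x \<notin> nodes \<nu> \<longrightarrow> t x = 0)"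

definition standard :: "nat list \<Rightarrow> (nat \<times> nat \<Rightarrow> nat) \<Rightarrow> bool" where
  "standard \<nu> t \<longleftrightarrow> tableau \<nu> t \<and>
     (\<forall>r c. (r, c) \<in> nodes \<nu> \<longrightarrow> (r, Suc c) \<in> nodes \<nu> \<longrightarrow> t (r, c) < t (r, Suc c)) \<and>
     (\<forall>r c. (r, c) \<in> nodes \<nu> \<longrightarrow> (Suc r, c) \<in> nodes \<nu> \<longrightarrow> t (r, c) < t (Suc r, c))"

definition rowfill :: "(nat \<times> nat) set \<Rightarrow> nat \<times> nat \<Rightarrow> nat" where
  "rowfill N x = (if x \<in> N then
      Suc (card {y \<in> N. fst y < fst x \<or> (fst y = fst x \<and> snd y < snd x)}) else 0)"

definition tnu :: "nat list \<Rightarrow> nat \<times> nat \<Rightarrow> nat" where "tnu \<nu> = rowfill (nodes \<nu>)"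

text \<open>t = t^nu d(t), right action (t w)(x) = w (t x)\<close>
definition dperm :: "nat list \<Rightarrow> (nat \<times> nat \<Rightarrow> nat) \<Rightarrow> nat \<Rightarrow> nat" where
  "dperm \<nu> t = (\<lambda>k. if k \<in> {1..sum_list \<nu>} then t (the_inv_into (nodes \<nu>) (tnu \<nu>) k) else k)"

definition row_stab :: "nat list \<Rightarrow> (nat \<Rightarrow> nat) set" where
  "row_stab \<nu> = {w. w permutes {1..sum_list \<nu>} \<and>
     (\<forall>x\<in>nodes \<nu>. \<forall>y\<in>nodes \<nu>. w (tnu \<nu> x) = tnu \<nu> y \<longrightarrow> fst x = fst y)}"

definition x_nu :: "nat list \<Rightarrow> hecke" where
  "x_nu \<nu> = (\<lambda>v. if v \<in> row_stab \<nu> then 1 else 0)"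

definition x_uv :: "nat list \<Rightarrow> (nat \<times> nat \<Rightarrow> nat) \<Rightarrow> (nat \<times> nat \<Rightarrow> nat) \<Rightarrow> hecke" where
  "x_uv \<nu> u v = Tb (inv (dperm \<nu> u)) \<star> x_nu \<nu> \<star> Tb (dperm \<nu> v)"

definition Nbar :: "nat list \<Rightarrow> hecke set" where
  "Nbar \<nu> = span_in UNIV {x_uv \<rho> u v | \<rho> u v. partition_of (sum_list \<nu>) \<rho> \<and>
      strictly_dominates \<rho> \<nu> \<and> tableau \<rho> u \<and> tableau \<rho> v}"

definition cls :: "nat list \<Rightarrow> hecke \<Rightarrow> hecke set" where
  "cls \<nu> h = (\<lambda>n. hadd h n) ` Nbar \<nu>"

text \<open>e_v (as a coset), and S^nu_R as the R-span of the e_v, v standard, inside S^nu = S^nu_K\<close>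
definition e_t :: "nat list \<Rightarrow> (nat \<times> nat \<Rightarrow> nat) \<Rightarrow> hecke set" where
  "e_t \<nu> v = cls \<nu> (x_uv \<nu> (tnu \<nu>) v)"

definition Specht_over :: "K set \<Rightarrow> nat list \<Rightarrow> hecke set set" where
  "Specht_over R \<nu> = cls \<nu> ` span_in R {x_uv \<nu> (tnu \<nu>) v | v. standard \<nu> v}"

definition Lp :: "nat \<Rightarrow> hecke" where
  "Lp p = (\<lambda>w. \<Sum>i\<in>{1..<p}. qq powi (- int i) * Tb (transpose (p - i) p) w)"

text \<open>contents c - r of nodes of partitions of m; residue = [c - r]_q\<close>
definition contents :: "nat \<Rightarrow> int set" where
  "contents m = {int c - int r | c r \<nu>. partition_of m \<nu> \<and> (r, c) \<in> nodes \<nu>}"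

definition content_of :: "(nat \<times> nat \<Rightarrow> nat) \<Rightarrow> nat \<Rightarrow> int" where
  "content_of v p = (let x = the_inv_into {x. v x \<noteq> 0} v p in int (snd x) - int (fst x))"

definition E_t :: "nat list \<Rightarrow> (nat \<times> nat \<Rightarrow> nat) \<Rightarrow> hecke" where
  "E_t \<nu> v = foldl (\<lambda>acc p.
       foldl (\<lambda>acc' k. acc' \<star> hscale (inverse (qint (content_of v p) - qint k))
                               (hadd (Lp p) (hscale (- qint k) (Tb id))))
             acc [k \<leftarrow> sorted_list_of_set (contents (sum_list \<nu>)). k \<noteq> content_of v p])
     (Tb id) [1..<Suc (sum_list \<nu>)]"

definition f_t :: "nat list \<Rightarrow> (nat \<times> nat \<Rightarrow> nat) \<Rightarrow> hecke" where
  "f_t \<nu> v = x_uv \<nu> (tnu \<nu>) v \<star> E_t \<nu> v"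

definition shape_le :: "nat list \<Rightarrow> (nat \<times> nat \<Rightarrow> nat) \<Rightarrow> nat \<Rightarrow> nat list" where
  "shape_le la t m = (THE \<nu>. is_part \<nu> \<and> nodes \<nu> = {x \<in> nodes la. t x \<le> m})"

definition t_le :: "nat list \<Rightarrow> (nat \<times> nat \<Rightarrow> nat) \<Rightarrow> nat \<Rightarrow> nat \<Rightarrow> nat \<times> nat \<Rightarrow> nat" where
  "t_le la t r s = (let N = nodes (shape_le la t s);
                       R = {x \<in> N. r \<le> t x \<and> t x \<le> s} in
     (\<lambda>x. if x \<in> R then t x else rowfill (N - R) x))"

end

(* The class of f_{t<=} and the class e_mu, mu the shape formed by 1, ..., r - 1 in t<=, have the same
   annihilator in the Hecke algebra of S_{r-1}; this makes f_{t<=} h |-> e_mu h well defined and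
   injective, and integrality of the Murphy basis identifies its image.

   A sesquilinear form on the Hecke algebra, positive for q > 0, makes all T_i self-adjoint, so the ideal
   of more dominant shapes has an orthogonal complement, and the component z of x_nu in it generates a
   copy of the Specht module inside the Hecke algebra itself. There f_{t<=} becomes a nonzero joint
   eigenvector g of the Jucys-Murphy elements; those up to r - 1 act on g by the contents of t^mu, because
   t<= carries the row filling on mu.

   Invertible intertwiners link such a g to an eigenvector absorbing the column antisymmetrizer y_mu.
   Hence g kills everything more dominant than mu, and x_mu k in the ideal implies g k = 0. Conversely,
   let z_mu be the generator of the copy of the Specht module of mu, and let z_mu k be nonzero. The form
   and multiplicity one give k' with z_mu k k' x_mu = c z_mu and c nonzero, and g satisfies the same
   relation g k k' x_mu = c g, so g k is nonzero.

   For integrality, let w = d(u) e carry t^mu to the column filling. The coefficient of T_w in h T_e y_mu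
   is an integral functional of h vanishing on the ideal, and for varying u these functionals are
   unitriangular on the Murphy basis with respect to the length of d(u). *)

theory Submission
  imports Defs
begin

section \<open>Permutations and their length\<close>

text \<open>The map relates vectors in modules of Hecke algebras of different rank, each taken
  modulo its own ideal. What the two sides share is the list of Jucys-Murphy eigenvalues for 1, ...,
  r - 1. Hence all \<open>Hm m\<close> are subspaces of a single algebra \<open>hk\<close>, indexed
  by the permutations of finite support in \<open>SN\<close>, and the statements about eigenvectors
  hold for arbitrary elements of \<open>hk\<close>: a vector from rank s can be tested directly as
  an eigenvector of rank r - 1. No branching rule is invoked. The field C(q) contains the imaginary
  unit, so a bilinear form could have isotropic vectors. Conjugating coefficients while fixing q
  restores positivity, and with it orthogonal complements, nonzero Poincare polynomials and the
  scalar action of T_i at adjacent contents. The target is given as the span of the Murphy vectors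
  e_v, whereas the image of the map is the cyclic module e_mu H. Over C(q) the two agree by
  triangularity against eigenvectors; over the local ring at \<zeta> this argument fails, since
  seminormal coefficients have denominators, and the integral functionals take its place.\<close>

definition SN :: "(nat \<Rightarrow> nat) set" where
  "SN = {w. \<exists>m. w permutes {1..m}}"

lemma SN_I: "w permutes {1..m} \<Longrightarrow> w \<in> SN"
  unfolding SN_def by blast

lemma SN_bij: "w \<in> SN \<Longrightarrow> bij w"
  unfolding SN_def by (auto dest: permutes_bij)

lemma permutes_atLeastAtMost_mono:
  fixes w :: "nat \<Rightarrow> nat"
  shows "w permutes {1..m} \<Longrightarrow> m \<le> n \<Longrightarrow> w permutes {1..n}"
  by (erule permutes_subset) auto

lemma SN_id [simp]: "id \<in> SN"
  unfolding SN_def using permutes_id by blast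

lemma SN_comp: "v \<in> SN \<Longrightarrow> w \<in> SN \<Longrightarrow> v \<circ> w \<in> SN"
proof -
  assume "v \<in> SN" "w \<in> SN"
  then obtain m n where mn: "v permutes {1..m}" "w permutes {1..n}" unfolding SN_def by blast
  have "v permutes {1..max m n}" "w permutes {1..max m n}"
    using mn permutes_atLeastAtMost_mono max.cobounded1 max.cobounded2 by blast+
  then show ?thesis by (meson SN_I permutes_compose)
qed

lemma SN_inv: "w \<in> SN \<Longrightarrow> inv w \<in> SN"
  unfolding SN_def by (auto dest: permutes_inv)

lemma sgen_permutes: "1 \<le> i \<Longrightarrow> i < m \<Longrightarrow> sgen i permutes {1..m}"
  unfolding sgen_def by (intro permutes_swap_id) auto

lemma sgen_SN: "1 \<le> i \<Longrightarrow> sgen i \<in> SN"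
  using sgen_permutes[of i "Suc i"] SN_I by auto

lemma sgen_sgen [simp]: "sgen i (sgen i x) = x"
  by (simp add: sgen_def)

lemma sgen_comp_sgen [simp]: "sgen i \<circ> sgen i = id"
  by (simp add: sgen_def)

lemma sgen_cancel_left [simp]: "sgen i \<circ> (sgen i \<circ> v) = v"
  by (simp add: fun_eq_iff)

lemma sgen_cancel_right [simp]: "(v \<circ> sgen i) \<circ> sgen i = v"
  by (simp add: fun_eq_iff)

lemma inv_sgen [simp]: "inv (sgen i) = sgen i"
  by (simp add: sgen_def)

lemma bij_sgen: "bij (sgen i)"
  by (simp add: sgen_def)

lemma sgen_apply1 [simp]: "sgen i i = Suc i" by (simp add: sgen_def)
lemma sgen_apply2 [simp]: "sgen i (Suc i) = i" by (simp add: sgen_def)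
lemma sgen_other: "x \<noteq> i \<Longrightarrow> x \<noteq> Suc i \<Longrightarrow> sgen i x = x"
  by (simp add: sgen_def)
lemma sgen_if: "sgen i x = (if x = i then Suc i else if x = Suc i then i else x)"
  by (simp add: sgen_def transpose_def)

lemma sgen_less_iff:
  assumes "\<not> (x = j \<and> y = Suc j)" "\<not> (x = Suc j \<and> y = j)"
  shows "sgen j x < sgen j y \<longleftrightarrow> x < y"
  using assms unfolding sgen_if by (auto split: if_splits)

lemma SN_zero: "w \<in> SN \<Longrightarrow> w 0 = 0"
  unfolding SN_def by (auto simp: permutes_def)

lemma sgen_left_SN_iff: "1 \<le> i \<Longrightarrow> sgen i \<circ> v \<in> SN \<longleftrightarrow> v \<in> SN"
  by (metis SN_comp sgen_SN sgen_cancel_left)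

lemma sgen_right_SN_iff: "1 \<le> i \<Longrightarrow> v \<circ> sgen i \<in> SN \<longleftrightarrow> v \<in> SN"
  by (metis SN_comp sgen_SN sgen_cancel_right)

lemma inv_inv_SN: "w \<in> SN \<Longrightarrow> inv (inv w) = w"
  by (simp add: SN_bij inv_inv_eq)

lemma inv_SN_apply: "w \<in> SN \<Longrightarrow> w (inv w x) = x" "w \<in> SN \<Longrightarrow> inv w (w x) = x"
  by (auto dest!: SN_bij simp: bij_is_surj surj_f_inv_f bij_is_inj)

lemma inv_sgen_left: "w \<in> SN \<Longrightarrow> inv (sgen i \<circ> w) = inv w \<circ> sgen i"
  by (simp add: SN_bij bij_sgen o_inv_distrib)

lemma inv_sgen_right: "w \<in> SN \<Longrightarrow> inv (w \<circ> sgen i) = sgen i \<circ> inv w"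
  by (simp add: SN_bij bij_sgen o_inv_distrib)

section \<open>Inversions and length\<close>

definition Invs :: "(nat \<Rightarrow> nat) \<Rightarrow> (nat \<times> nat) set" where
  "Invs w = {(i, j). i < j \<and> w j < w i}"

lemma plen_Invs: "plen w = card (Invs w)"
  unfolding plen_def Invs_def ..

lemma finite_Invs:
  assumes "w \<in> SN" shows "finite (Invs w)"
proof -
  obtain m where w: "w permutes {1..m}" using assms unfolding SN_def by blast
  have "Invs w \<subseteq> {0..m} \<times> {0..m}"
  proof (clarsimp simp: Invs_def)
    fix i j assume ij: "i < j" "w j < w i"
    have "j \<le> m"
    proof (rule ccontr)
      assume "\<not> j \<le> m"
      then have "w j = j" using w by (simp add: permutes_def)
      moreover have "w i \<le> max i m"
        using w permutes_in_image[OF w, of i] by (cases "i \<in> {1..m}") (auto simp: permutes_def)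
      ultimately show False using ij \<open>\<not> j \<le> m\<close> by auto
    qed
    then show "i \<le> m \<and> j \<le> m" using ij by auto
  qed
  then show ?thesis by (rule finite_subset) auto
qed

lemma plen_id [simp]: "plen id = 0"
proof -
  have "Invs id = {}" by (auto simp: Invs_def)
  then show ?thesis by (simp add: plen_Invs)
qed

lemma plen_inv:
  assumes "w \<in> SN" shows "plen (inv w) = plen w"
proof -
  have "bij_betw (\<lambda>(i, j). (w j, w i)) (Invs w) (Invs (inv w))"
    by (rule bij_betw_byWitness[where f' = "\<lambda>(i, j). (inv w j, inv w i)"])
       (auto simp: Invs_def inv_SN_apply[OF assms])
  then show ?thesis by (simp add: plen_Invs bij_betw_same_card)
qed

text \<open>Composing with \<open>sgen i\<close> on the left exchanges the values i and i + 1. The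
  only pair of positions whose order changes is the one carrying these two values, and it becomes an
  inversion.\<close>

lemma plen_sgen_left_asc:
  assumes "w \<in> SN" "inv w i < inv w (Suc i)"
  shows "plen (sgen i \<circ> w) = Suc (plen w)"
proof -
  define a b where "a = inv w i" and "b = inv w (Suc i)"
  have ab: "w a = i" "w b = Suc i" "a < b" using assms by (auto simp: a_def b_def inv_SN_apply)
  have inj: "w x = w y \<Longrightarrow> x = y" for x y
    using SN_bij[OF assms(1)] by (meson bij_is_inj injD)
  have "Invs (sgen i \<circ> w) = insert (a, b) (Invs w)"
  proof (rule set_eqI, clarify)
    fix k l
    have k: "w k = i \<longleftrightarrow> k = a" "w k = Suc i \<longleftrightarrow> k = b" using ab inj by metis+
    have l: "w l = i \<longleftrightarrow> l = a" "w l = Suc i \<longleftrightarrow> l = b" using ab inj by metis+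
    consider "l = a" "k = b" | "k = a" "l = b" | "\<not> (w l = i \<and> w k = Suc i)" "\<not> (w l = Suc i \<and> w k = i)"
      using k l by blast
    then show "(k, l) \<in> Invs (sgen i \<circ> w) \<longleftrightarrow> (k, l) \<in> insert (a, b) (Invs w)"
    proof cases
      case 1
      then show ?thesis using ab by (simp add: Invs_def)
    next
      case 2
      then show ?thesis using ab by (simp add: Invs_def)
    next
      case 3
      then have "sgen i (w l) < sgen i (w k) \<longleftrightarrow> w l < w k" by (rule sgen_less_iff)
      moreover have "\<not> (k = a \<and> l = b)" using 3 ab by auto
      ultimately show ?thesis by (auto simp: Invs_def)
    qed
  qed
  moreover have "(a, b) \<notin> Invs w" using ab by (simp add: Invs_def)
  ultimately show ?thesis using finite_Invs[OF assms(1)] by (simp add: plen_Invs)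
qed

lemma inv_neq_Suc: "w \<in> SN \<Longrightarrow> inv w i \<noteq> inv w (Suc i)"
  by (metis inv_SN_apply(1) n_not_Suc_n)

lemma neq_Suc: "w \<in> SN \<Longrightarrow> w i \<noteq> w (Suc i)"
  by (metis inv_SN_apply(2) n_not_Suc_n)

lemma plen_sgen_left_desc:
  assumes "w \<in> SN" "1 \<le> i" "inv w (Suc i) < inv w i"
  shows "plen w = Suc (plen (sgen i \<circ> w))"
proof -
  have s: "sgen i \<circ> w \<in> SN" using assms by (simp add: sgen_left_SN_iff)
  have "inv (sgen i \<circ> w) i < inv (sgen i \<circ> w) (Suc i)"
    using assms by (simp add: inv_sgen_left)
  from plen_sgen_left_asc[OF s this] show ?thesis by simp
qed

lemma plen_sgen_left:
  assumes "w \<in> SN" "1 \<le> i"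
  shows "plen (sgen i \<circ> w) < plen w \<longleftrightarrow> inv w (Suc i) < inv w i"
    and "plen (sgen i \<circ> w) = Suc (plen w) \<longleftrightarrow> inv w i < inv w (Suc i)"
  using plen_sgen_left_asc[OF assms(1), of i] plen_sgen_left_desc[OF assms] inv_neq_Suc[OF assms(1), of i]
  by (metis lessI less_Suc_eq not_less_iff_gr_or_eq n_not_Suc_n)+

lemma plen_sgen_right_inv:
  assumes "w \<in> SN" "1 \<le> i"
  shows "plen (w \<circ> sgen i) = plen (sgen i \<circ> inv w)"
  by (metis assms inv_sgen_right plen_inv sgen_right_SN_iff)

lemma plen_sgen_right:
  assumes "w \<in> SN" "1 \<le> i"
  shows "plen (w \<circ> sgen i) < plen w \<longleftrightarrow> w (Suc i) < w i"
    and "plen (w \<circ> sgen i) = Suc (plen w) \<longleftrightarrow> w i < w (Suc i)"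
  using plen_sgen_left[OF SN_inv[OF assms(1)] assms(2)]
  unfolding plen_sgen_right_inv[OF assms] plen_inv[OF assms(1)] inv_inv_SN[OF assms(1)] by simp_all

lemma plen_sgen_right_desc':
  assumes "w \<in> SN" "1 \<le> i" "w (Suc i) < w i"
  shows "plen w = Suc (plen (w \<circ> sgen i))"
  using plen_sgen_left_desc[OF SN_inv[OF assms(1)] assms(2)] assms(3)
  unfolding plen_sgen_right_inv[OF assms(1,2)] plen_inv[OF assms(1)] inv_inv_SN[OF assms(1)] by simp

lemma plen_left_cases:
  assumes "w \<in> SN" "1 \<le> i"
  shows "plen (sgen i \<circ> w) = Suc (plen w) \<or> plen w = Suc (plen (sgen i \<circ> w))"
  by (metis assms plen_sgen_left_asc plen_sgen_left_desc inv_neq_Suc nat_neq_iff)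

text \<open>Strict growth gives i \<le> w i by induction from below and w i \<le> i by induction
  from above.\<close>

lemma increasing_permutes_id:
  fixes w :: "nat \<Rightarrow> nat"
  assumes w: "w permutes {1..m}" and inc: "\<And>i. 1 \<le> i \<Longrightarrow> i < m \<Longrightarrow> w i < w (Suc i)"
  shows "w = id"
proof -
  have mono: "1 \<le> i \<Longrightarrow> i < j \<Longrightarrow> j \<le> m \<Longrightarrow> w i < w j" for i j
  proof (induction j)
    case (Suc j)
    then show ?case using inc[of j] by (cases "i = j") auto
  qed simp
  have ge: "1 \<le> i \<Longrightarrow> i \<le> m \<Longrightarrow> i \<le> w i" for i
  proof (induction i)
    case (Suc i)
    show ?case
    proof (cases "i = 0")
      case True
      then show ?thesis using permutes_in_image[OF w, of 1] Suc by auto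
    next
      case False
      then show ?thesis using Suc inc[of i] by auto
    qed
  qed simp
  have le: "1 \<le> m - k \<Longrightarrow> w (m - k) \<le> m - k" for k
  proof (induction k)
    case 0
    then show ?case using permutes_in_image[OF w, of m] by auto
  next
    case (Suc k)
    then have "w (m - Suc k) < w (m - k)" using mono[of "m - Suc k" "m - k"] by auto
    moreover have "w (m - k) \<le> m - k" using Suc by auto
    ultimately show ?case by auto
  qed
  have "w i = i" if "i \<in> {1..m}" for i
    using ge[of i] le[of "m - i"] that by auto
  moreover have "w i = i" if "i \<notin> {1..m}" for i
    using w that by (simp add: permutes_def)
  ultimately show ?thesis by (metis eq_id_iff)
qed

lemma permutes_comp:
  fixes v w :: "nat \<Rightarrow> nat"
  shows "v permutes {1..m} \<Longrightarrow> w permutes {1..m} \<Longrightarrow> v \<circ> w permutes {1..m}"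
  by (rule permutes_compose)

lemma exists_left_descent:
  assumes w: "w permutes {1..m}" and "w \<noteq> id"
  obtains i where "1 \<le> i" "i < m" "inv w (Suc i) < inv w i"
proof -
  have "\<exists>i. 1 \<le> i \<and> i < m \<and> \<not> inv w i < inv w (Suc i)"
  proof (rule ccontr)
    assume "\<not> ?thesis"
    then have "inv w = id" using increasing_permutes_id[OF permutes_inv[OF w]] by blast
    then have "w = id" by (metis SN_I inv_id inv_inv_SN w)
    with assms show False by simp
  qed
  then show ?thesis using that inv_neq_Suc[OF SN_I[OF w]] by (metis linorder_neqE_nat)
qed

text \<open>Every permutation is reached from the identity by ascents, so in the inductive step
  \<open>TT (sgen i \<circ> w)\<close> is simply \<open>TT w * Ti i\<close>, without a correction
  term.\<close>

lemma permutes_length_induct [consumes 1, case_names id step]: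
  assumes w: "w permutes {1..m}"
    and "P id"
    and step: "\<And>w i. w permutes {1..m} \<Longrightarrow> 1 \<le> i \<Longrightarrow> i < m \<Longrightarrow> plen (sgen i \<circ> w) = Suc (plen w)
      \<Longrightarrow> P w \<Longrightarrow> P (sgen i \<circ> w)"
  shows "P w"
  using w
proof (induction "plen w" arbitrary: w rule: less_induct)
  case less
  show ?case
  proof (cases "w = id")
    case False
    then obtain i where i: "1 \<le> i" "i < m" "inv w (Suc i) < inv w i"
      using exists_left_descent less.prems by blast
    let ?u = "sgen i \<circ> w"
    have u: "?u permutes {1..m}" using less.prems i by (meson permutes_compose sgen_permutes)
    have l: "plen w = Suc (plen ?u)" using plen_sgen_left_desc less.prems i SN_I by blast
    have "P ?u" using less.hyps u l by simp
    then have "P (sgen i \<circ> ?u)" using step[OF u i(1,2)] l by simp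
    then show ?thesis by simp
  qed (use assms in simp)
qed

text \<open>Reduced words exist, so the choice made in \<open>rword\<close> is meaningful. Under the
  left to right convention the last letter of a word is the outermost function.\<close>

lemma rword_spec:
  assumes "w \<in> SN"
  shows "wprod (rword w) = w" "length (rword w) = plen w" "\<forall>i\<in>set (rword w). 1 \<le> i"
proof -
  obtain m where w: "w permutes {1..m}" using assms unfolding SN_def by blast
  have "\<exists>ws. wprod ws = w \<and> length ws = plen w \<and> (\<forall>i\<in>set ws. 1 \<le> i)"
    using w
  proof (induction rule: permutes_length_induct)
    case id
    have "wprod [] = id" "length [] = plen id" by (simp_all add: wprod_def)
    then show ?case by (metis empty_iff list.set(1))
  next
    case (step w i)
    then obtain ws where ws: "wprod ws = w" "length ws = plen w" "\<forall>i\<in>set ws. 1 \<le> i" by blast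
    have "wprod (ws @ [i]) = sgen i \<circ> w" using ws by (simp add: wprod_def)
    moreover have "length (ws @ [i]) = plen (sgen i \<circ> w)" using ws step by (simp del: length_append_singleton)
    moreover have "\<forall>i\<in>set (ws @ [i]). 1 \<le> i" using ws step by simp
    ultimately show ?case by metis
  qed
  from someI_ex[OF this] show "wprod (rword w) = w" "length (rword w) = plen w" "\<forall>i\<in>set (rword w). 1 \<le> i"
    unfolding rword_def by auto
qed

lemma wprod_snoc: "wprod (ws @ [i]) = sgen i \<circ> wprod ws"
  by (simp add: wprod_def)

lemma wprod_SN: "\<forall>i\<in>set ws. 1 \<le> i \<Longrightarrow> wprod ws \<in> SN"
  by (induction ws rule: rev_induct) (auto simp: wprod_snoc sgen_left_SN_iff, simp add: wprod_def)

lemma plen_wprod_le: "\<forall>i\<in>set ws. 1 \<le> i \<Longrightarrow> plen (wprod ws) \<le> length ws"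
proof (induction ws rule: rev_induct)
  case (snoc i ws)
  then have "plen (wprod ws) \<le> length ws" "plen (sgen i \<circ> wprod ws) \<le> Suc (plen (wprod ws))"
    using plen_left_cases[OF wprod_SN, of ws i] by auto
  then have "plen (wprod (ws @ [i])) \<le> Suc (length ws)" unfolding wprod_snoc by linarith
  then show ?case by simp
next
  case Nil
  have "wprod [] = id" by (simp add: wprod_def)
  then show ?case by (metis plen_id le_refl list.size(3))
qed

lemma wprod_Cons: "wprod (i # ws) = wprod ws \<circ> sgen i"
  by (induction ws rule: rev_induct) (auto simp: wprod_def comp_assoc simp flip: append_Cons)

section \<open>The multiplication operators\<close>

lemma qq_nz [simp]: "qq \<noteq> 0"
  unfolding qq_def by (simp add: Zero_fract_def eq_fract)

text \<open>Left multiplication by T_j, the mirror image of \<open>mulTs\<close>. Associativity of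
  the product will come down to the commutation of these two families of operators.\<close>

definition lT :: "nat \<Rightarrow> hecke \<Rightarrow> hecke" where
  "lT j a = (\<lambda>v. let u = v \<circ> sgen j in
      if plen u < plen v then a u + (qq - 1) * a v else qq * a u)"

definition FS :: "hecke set" where "FS = {a. \<exists>m. a \<in> H m}"

lemma FS_support:
  assumes "a \<in> FS" shows "finite {w. a w \<noteq> 0}" "{w. a w \<noteq> 0} \<subseteq> SN"
proof -
  obtain m where "a \<in> H m" using assms unfolding FS_def by blast
  then have "{w. a w \<noteq> 0} \<subseteq> {w. w permutes {1..m}}" unfolding H_def by blast
  then show "finite {w. a w \<noteq> 0}" "{w. a w \<noteq> 0} \<subseteq> SN"
    by (auto dest: finite_subset[OF _ finite_permutations] simp: SN_def)
qed

lemma FS_I: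
  assumes "finite {w. a w \<noteq> 0}" "{w. a w \<noteq> 0} \<subseteq> SN"
  shows "a \<in> FS"
proof -
  have "\<forall>w\<in>{w. a w \<noteq> 0}. \<exists>m. w permutes {1..m}" using assms(2) unfolding SN_def by blast
  from bchoice[OF this] obtain f where "\<forall>w\<in>{w. a w \<noteq> 0}. w permutes {1..f w}" ..
  then have f: "\<And>w. a w \<noteq> 0 \<Longrightarrow> w permutes {1..f w}" by blast
  have "a \<in> H (Max (f ` {w. a w \<noteq> 0}))"
    unfolding H_def
  proof (clarify)
    fix w assume "a w \<noteq> 0"
    then show "w permutes {1..Max (f ` {w. a w \<noteq> 0})}"
      using f assms(1) by (intro permutes_atLeastAtMost_mono[OF f]) auto
  qed
  then show ?thesis unfolding FS_def by blast
qed

lemma FS_zero_outside: "a \<in> FS \<Longrightarrow> v \<notin> SN \<Longrightarrow> a v = 0"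
  using FS_support(2) by blast

text \<open>The classical two-case argument: unless s_i v = v s_j, the length comparison on one side
  is not affected by multiplying on the other side, so both orders expand to the same sum.\<close>

lemma mulTs_lT_commute:
  assumes "a \<in> FS" "1 \<le> i" "1 \<le> j"
  shows "mulTs (lT j a) i = lT j (mulTs a i)"
proof
  fix v
  show "mulTs (lT j a) i v = lT j (mulTs a i) v"
  proof (cases "v \<in> SN")
    case False
    then have n: "sgen i \<circ> v \<notin> SN" "v \<circ> sgen j \<notin> SN" "sgen i \<circ> (v \<circ> sgen j) \<notin> SN" "(sgen i \<circ> v) \<circ> sgen j \<notin> SN"
      using assms by (simp_all add: sgen_left_SN_iff sgen_right_SN_iff)
    have z: "a v = 0" "a (sgen i \<circ> v) = 0" "a (v \<circ> sgen j) = 0" "a (sgen i \<circ> (v \<circ> sgen j)) = 0" "a ((sgen i \<circ> v) \<circ> sgen j) = 0"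
      using n False FS_zero_outside[OF assms(1)] by blast+
    show ?thesis unfolding mulTs_def lT_def Let_def z by simp
  next
    case v: True
    have sv: "sgen i \<circ> v \<in> SN" "v \<circ> sgen j \<in> SN" using v assms by (simp_all add: sgen_left_SN_iff sgen_right_SN_iff)
    show ?thesis
    \<comment> \<open>When the two products coincide, both operators at v read the same two
      coefficients by the same rule. Otherwise v does not map {j, j + 1} onto {i, i + 1}, and the
      comparisons \<open>1\<close> and \<open>2\<close> below decouple.\<close>
    proof (cases "sgen i \<circ> v = v \<circ> sgen j")
      case True
      have "(sgen i \<circ> v) \<circ> sgen j = v" unfolding True by simp
      moreover have "sgen i \<circ> (v \<circ> sgen j) = v" by (simp flip: True)
      ultimately show ?thesis unfolding mulTs_def lT_def Let_def True
        by (cases "plen (v \<circ> sgen j) < plen v"; cases "plen v < plen (v \<circ> sgen j)") (simp_all only: if_True if_False)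
    next
      case False
      have ne: "\<not> (v j = i \<and> v (Suc j) = Suc i)" "\<not> (v j = Suc i \<and> v (Suc j) = i)"
      proof -
        have inj: "v x = v y \<longleftrightarrow> x = y" for x y by (metis inv_SN_apply(2) v)
        { assume vj: "v j = i \<and> v (Suc j) = Suc i"
          have "sgen i (v x) = v (sgen j x)" for x
            using vj inj[of x j] inj[of x "Suc j"] by (cases "x = j"; cases "x = Suc j") (simp_all add: sgen_other)
          then have "sgen i \<circ> v = v \<circ> sgen j" by (simp add: fun_eq_iff) }
        moreover
        { assume vj: "v j = Suc i \<and> v (Suc j) = i"
          have "sgen i (v x) = v (sgen j x)" for x
            using vj inj[of x j] inj[of x "Suc j"] by (cases "x = j"; cases "x = Suc j") (simp_all add: sgen_other)
          then have "sgen i \<circ> v = v \<circ> sgen j" by (simp add: fun_eq_iff) }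
        ultimately show "\<not> (v j = i \<and> v (Suc j) = Suc i)" "\<not> (v j = Suc i \<and> v (Suc j) = i)" using False by blast+
      qed
      have ne': "\<not> (inv v i = j \<and> inv v (Suc i) = Suc j)" "\<not> (inv v (Suc i) = j \<and> inv v i = Suc j)"
        using ne v by (metis inv_SN_apply(1))+
      have 1: "plen (sgen i \<circ> (v \<circ> sgen j)) < plen (v \<circ> sgen j) \<longleftrightarrow> plen (sgen i \<circ> v) < plen v"
        unfolding plen_sgen_left(1)[OF sv(2) assms(2)] plen_sgen_left(1)[OF v assms(2)] inv_sgen_right[OF v] comp_apply
        using ne' by (intro sgen_less_iff) blast+
      have 2: "plen ((sgen i \<circ> v) \<circ> sgen j) < plen (sgen i \<circ> v) \<longleftrightarrow> plen (v \<circ> sgen j) < plen v"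
        unfolding plen_sgen_right(1)[OF sv(1) assms(3)] plen_sgen_right(1)[OF v assms(3)] comp_apply
        using ne by (intro sgen_less_iff) blast+
      have 3: "(sgen i \<circ> v) \<circ> sgen j = sgen i \<circ> (v \<circ> sgen j)" by (simp add: comp_assoc)
      show ?thesis unfolding mulTs_def lT_def Let_def 1 2 unfolding 3
        by (cases "plen (sgen i \<circ> v) < plen v"; cases "plen (v \<circ> sgen j) < plen v")
           (simp_all only: if_True if_False, simp_all only: distrib_left mult.assoc add_ac mult.left_commute)
    qed
  qed
qed

lemma FS_Tb: "w \<in> SN \<Longrightarrow> Tb w \<in> FS"
  by (rule FS_I) (auto simp: Tb_def)

lemma FS_mulTs:
  assumes "a \<in> FS" "1 \<le> i" shows "mulTs a i \<in> FS"
proof (rule FS_I)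
  let ?A = "{w. a w \<noteq> 0}"
  have "{w. mulTs a i w \<noteq> 0} \<subseteq> ?A \<union> (\<lambda>w. sgen i \<circ> w) ` ?A"
  proof
    fix v assume "v \<in> {w. mulTs a i w \<noteq> 0}"
    then have "a v \<noteq> 0 \<or> a (sgen i \<circ> v) \<noteq> 0" unfolding mulTs_def Let_def by (auto split: if_splits)
    then show "v \<in> ?A \<union> (\<lambda>w. sgen i \<circ> w) ` ?A"
      by (metis (mono_tags, lifting) UnCI imageI mem_Collect_eq sgen_cancel_left)
  qed
  moreover have "finite (?A \<union> (\<lambda>w. sgen i \<circ> w) ` ?A)" "?A \<union> (\<lambda>w. sgen i \<circ> w) ` ?A \<subseteq> SN"
    using FS_support[OF assms(1)] assms(2) by (auto simp: sgen_left_SN_iff)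
  ultimately show "finite {w. mulTs a i w \<noteq> 0}" "{w. mulTs a i w \<noteq> 0} \<subseteq> SN"
    by (meson finite_subset subset_trans)+
qed

lemma FS_lT:
  assumes "a \<in> FS" "1 \<le> i" shows "lT i a \<in> FS"
proof (rule FS_I)
  let ?A = "{w. a w \<noteq> 0}"
  have "{w. lT i a w \<noteq> 0} \<subseteq> ?A \<union> (\<lambda>w. w \<circ> sgen i) ` ?A"
  proof
    fix v assume "v \<in> {w. lT i a w \<noteq> 0}"
    then have "a v \<noteq> 0 \<or> a (v \<circ> sgen i) \<noteq> 0" unfolding lT_def Let_def by (auto split: if_splits)
    then show "v \<in> ?A \<union> (\<lambda>w. w \<circ> sgen i) ` ?A"
      by (metis (mono_tags, lifting) UnCI imageI mem_Collect_eq sgen_cancel_right)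
  qed
  moreover have "finite (?A \<union> (\<lambda>w. w \<circ> sgen i) ` ?A)" "?A \<union> (\<lambda>w. w \<circ> sgen i) ` ?A \<subseteq> SN"
    using FS_support[OF assms(1)] assms(2) by (auto simp: sgen_right_SN_iff)
  ultimately show "finite {w. lT i a w \<noteq> 0}" "{w. lT i a w \<noteq> 0} \<subseteq> SN"
    by (meson finite_subset subset_trans)+
qed

lemma FS_sum: "(\<And>x. x \<in> X \<Longrightarrow> f x \<in> FS) \<Longrightarrow> finite X \<Longrightarrow> (\<lambda>v. \<Sum>x\<in>X. c x * f x v) \<in> FS"
proof -
  assume f: "\<And>x. x \<in> X \<Longrightarrow> f x \<in> FS" and fin: "finite X"
  have "{w. (\<Sum>x\<in>X. c x * f x w) \<noteq> 0} \<subseteq> (\<Union>x\<in>X. {w. f x w \<noteq> 0})"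
  proof (rule subsetI, rule ccontr)
    fix w assume w: "w \<in> {w. (\<Sum>x\<in>X. c x * f x w) \<noteq> 0}" "w \<notin> (\<Union>x\<in>X. {w. f x w \<noteq> 0})"
    then have "\<forall>x\<in>X. c x * f x w = 0" by auto
    then show False using w(1) by (simp add: sum.neutral)
  qed
  note sub = this
  have "finite (\<Union>x\<in>X. {w. f x w \<noteq> 0})" "(\<Union>x\<in>X. {w. f x w \<noteq> 0}) \<subseteq> SN"
    using f fin FS_support by blast+
  then show ?thesis using FS_I[OF finite_subset[OF sub] subset_trans[OF sub]] by blast
qed

lemma FS_foldl: "\<forall>i\<in>set ws. 1 \<le> i \<Longrightarrow> a \<in> FS \<Longrightarrow> foldl mulTs a ws \<in> FS"
  by (induction ws arbitrary: a) (auto simp: FS_mulTs)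

lemma FS_foldr: "\<forall>i\<in>set ws. 1 \<le> i \<Longrightarrow> a \<in> FS \<Longrightarrow> foldr lT ws a \<in> FS"
  by (induction ws arbitrary: a) (auto simp: FS_lT)

lemma foldl_foldr_commute:
  assumes "\<forall>i\<in>set ws. 1 \<le> i" "\<forall>i\<in>set us. 1 \<le> i" "a \<in> FS"
  shows "foldl mulTs (foldr lT us a) ws = foldr lT us (foldl mulTs a ws)"
proof -
  have *: "mulTs (foldr lT us a) i = foldr lT us (mulTs a i)" if "1 \<le> i" "a \<in> FS" for i a
    using that assms(2)
  proof (induction us)
    case (Cons u us)
    then show ?case by (simp add: mulTs_lT_commute FS_foldr)
  qed simp
  show ?thesis using assms(1,3)
    by (induction ws arbitrary: a) (auto simp: * FS_mulTs)
qed

lemma mulTs_Tb_asc: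
  assumes "plen (sgen i \<circ> w) = Suc (plen w)"
  shows "mulTs (Tb w) i = Tb (sgen i \<circ> w)"
proof
  fix v
  have *: "sgen i \<circ> v = w \<longleftrightarrow> v = sgen i \<circ> w" by auto
  show "mulTs (Tb w) i v = Tb (sgen i \<circ> w) v"
    using assms unfolding mulTs_def Let_def Tb_def by (auto simp: *)
qed

lemma mulTs_Tb_desc:
  assumes "plen w = Suc (plen (sgen i \<circ> w))"
  shows "mulTs (Tb w) i v = qq * Tb (sgen i \<circ> w) v + (qq - 1) * Tb w v"
proof -
  have ne: "sgen i \<circ> w \<noteq> w" using assms by (metis n_not_Suc_n)
  consider "v = w" | "v = sgen i \<circ> w" | "v \<noteq> w" "sgen i \<circ> v \<noteq> w" "v \<noteq> sgen i \<circ> w"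
    by (metis sgen_cancel_left)
  then show ?thesis
  proof cases
    case 1
    then show ?thesis using assms ne unfolding mulTs_def Let_def Tb_def by simp
  next
    case 2
    then show ?thesis using assms ne unfolding mulTs_def Let_def Tb_def by simp
  next
    case 3
    then show ?thesis unfolding mulTs_def Let_def Tb_def by simp
  qed
qed

lemma lT_Tb_asc:
  assumes "plen (w \<circ> sgen i) = Suc (plen w)"
  shows "lT i (Tb w) = Tb (w \<circ> sgen i)"
proof
  fix v
  have *: "v \<circ> sgen i = w \<longleftrightarrow> v = w \<circ> sgen i" by auto
  show "lT i (Tb w) v = Tb (w \<circ> sgen i) v"
    using assms unfolding lT_def Let_def Tb_def by (auto simp: *)
qed

lemma foldl_Tb:
  assumes "\<forall>i\<in>set ws. 1 \<le> i" "length ws = plen (wprod ws)"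
  shows "foldl mulTs (Tb id) ws = Tb (wprod ws)"
  using assms
proof (induction ws rule: rev_induct)
  case (snoc i ws)
  have "plen (wprod ws) \<le> length ws" using snoc plen_wprod_le by auto
  moreover have "plen (sgen i \<circ> wprod ws) = Suc (length ws)"
    using snoc.prems(2) by (metis wprod_snoc length_append_singleton)
  ultimately have "plen (wprod ws) = length ws" "plen (sgen i \<circ> wprod ws) = Suc (plen (wprod ws))"
    using plen_left_cases[OF wprod_SN, of ws i] snoc.prems by auto
  moreover have "foldl mulTs (Tb id) ws = Tb (wprod ws)" using snoc calculation by (simp add: id_def)
  ultimately have "foldl mulTs (Tb id) (ws @ [i]) = Tb (sgen i \<circ> wprod ws)" by (simp only: foldl_append foldl.simps mulTs_Tb_asc)
  then have "foldl mulTs (Tb id) (ws @ [i]) = Tb (wprod (ws @ [i]))" by (simp only: wprod_snoc)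
  then show ?case by (simp add: id_def)
next
  case Nil
  have "wprod [] = id" by (simp add: wprod_def)
  then show ?case by (metis foldl_Nil)
qed

lemma foldr_Tb:
  assumes "\<forall>i\<in>set ws. 1 \<le> i" "length ws = plen (wprod ws)"
  shows "foldr lT ws (Tb id) = Tb (wprod ws)"
  using assms
proof (induction ws)
  case (Cons i ws)
  have le: "plen (wprod ws) \<le> length ws" using Cons plen_wprod_le by auto
  have "plen (wprod ws \<circ> sgen i) = Suc (length ws)"
    using Cons.prems(2) by (metis wprod_Cons length_Cons)
  moreover have "plen (wprod ws \<circ> sgen i) = Suc (plen (wprod ws)) \<or> plen (wprod ws \<circ> sgen i) < plen (wprod ws)"
    using plen_sgen_right[OF wprod_SN, of ws i] neq_Suc[OF wprod_SN, of ws i] Cons.prems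
    by (metis linorder_neqE_nat list.set_intros(1,2))
  ultimately have "plen (wprod ws) = length ws" "plen (wprod ws \<circ> sgen i) = Suc (plen (wprod ws))"
    using le by auto
  moreover have "foldr lT ws (Tb id) = Tb (wprod ws)" using Cons calculation by (simp add: id_def)
  ultimately have "foldr lT (i # ws) (Tb id) = Tb (wprod ws \<circ> sgen i)" by (simp only: foldr.simps comp_apply lT_Tb_asc)
  then have "foldr lT (i # ws) (Tb id) = Tb (wprod (i # ws))" by (simp only: wprod_Cons)
  then show ?case by (simp add: id_def)
next
  case Nil
  have "wprod [] = id" by (simp add: wprod_def)
  then show ?case by (metis foldr.simps(1) id_apply)
qed

text \<open>The product computed from its left factor: \<open>foldr lT (rword w) b\<close> is T_w b.
  It serves to compare with \<open>hmul\<close>, which expands the right factor.\<close>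

definition lmul :: "hecke \<Rightarrow> hecke \<Rightarrow> hecke" where
  "lmul a b = (\<lambda>v. \<Sum>w\<in>{w. a w \<noteq> 0}. a w * foldr lT (rword w) b v)"

lemma mulTs_sum: "mulTs (\<lambda>v. \<Sum>x\<in>X. c x * f x v) i = (\<lambda>v. \<Sum>x\<in>X. c x * mulTs (f x) i v)"
  by (rule ext) (simp add: mulTs_def Let_def sum_distrib_left sum.distrib distrib_left mult.left_commute)

lemma lT_sum: "lT i (\<lambda>v. \<Sum>x\<in>X. c x * f x v) = (\<lambda>v. \<Sum>x\<in>X. c x * lT i (f x) v)"
  by (rule ext) (simp add: lT_def Let_def sum_distrib_left sum.distrib distrib_left mult.left_commute)

lemma foldl_sum: "foldl mulTs (\<lambda>v. \<Sum>x\<in>X. c x * f x v) ws = (\<lambda>v. \<Sum>x\<in>X. c x * foldl mulTs (f x) ws v)"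
  by (induction ws arbitrary: f) (auto simp: mulTs_sum)

lemma foldr_sum: "foldr lT ws (\<lambda>v. \<Sum>x\<in>X. c x * f x v) = (\<lambda>v. \<Sum>x\<in>X. c x * foldr lT ws (f x) v)"
  by (induction ws) (auto simp: lT_sum)

lemma lmul_sum: "lmul a (\<lambda>v. \<Sum>x\<in>X. c x * f x v) = (\<lambda>v. \<Sum>x\<in>X. c x * lmul a (f x) v)"
  unfolding lmul_def foldr_sum
  by (rule ext, simp add: sum_distrib_left, subst sum.swap, simp add: algebra_simps)

lemma FS_nz_SN: "a \<in> FS \<Longrightarrow> a w \<noteq> 0 \<Longrightarrow> w \<in> SN"
  using FS_zero_outside by blast

lemma FS_expand:
  assumes "a \<in> FS" shows "(\<lambda>v. \<Sum>w\<in>{w. a w \<noteq> 0}. a w * Tb w v) = a"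
proof
  fix v
  have "(\<Sum>w\<in>{w. a w \<noteq> 0}. a w * Tb w v) = (\<Sum>w\<in>{w. a w \<noteq> 0}. if v = w then a w else 0)"
    by (intro sum.cong) (simp_all add: Tb_def)
  also have "\<dots> = a v" using FS_support(1)[OF assms] by (simp add: sum.delta')
  finally show "(\<Sum>w\<in>{w. a w \<noteq> 0}. a w * Tb w v) = a v" .
qed

lemma rword_ge1: "w \<in> SN \<Longrightarrow> \<forall>i\<in>set (rword w). 1 \<le> i"
  by (rule rword_spec)

lemma mulT_Tb_id: "w \<in> SN \<Longrightarrow> mulT (Tb id) w = Tb w"
  unfolding mulT_def using foldl_Tb[of "rword w"] rword_spec[of w] by simp

lemma lmul_Tb_id: "a \<in> FS \<Longrightarrow> lmul a (Tb id) = a"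
proof -
  assume a: "a \<in> FS"
  have "foldr lT (rword w) (Tb id) = Tb w" if "a w \<noteq> 0" for w
    using foldr_Tb[of "rword w"] rword_spec[of w] FS_zero_outside[OF a] that by metis
  then have "lmul a (Tb id) = (\<lambda>v. \<Sum>w\<in>{w. a w \<noteq> 0}. a w * Tb w v)"
    unfolding lmul_def by auto
  then show ?thesis using FS_expand[OF a] by simp
qed

lemma mulT_lmul:
  assumes "a \<in> FS" "b \<in> FS" "w \<in> SN"
  shows "mulT (lmul a b) w = lmul a (mulT b w)"
proof -
  have "foldl mulTs (foldr lT (rword u) b) (rword w) = foldr lT (rword u) (foldl mulTs b (rword w))"
    if "a u \<noteq> 0" for u
    using that assms FS_zero_outside[OF assms(1)] rword_ge1 by (intro foldl_foldr_commute) metis+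
  then show ?thesis unfolding mulT_def lmul_def foldl_sum by auto
qed

text \<open>Right multiplication by T_w passes through the left operators of a, which reduces the
  claim to the product of a with T_id.\<close>

lemma hmul_eq_lmul:
  assumes "a \<in> FS" "b \<in> FS" shows "a \<star> b = lmul a b"
proof -
  have 1: "mulT a w = lmul a (Tb w)" if "w \<in> SN" for w
    using mulT_lmul[OF assms(1) FS_Tb that, of id] that by (simp add: lmul_Tb_id assms mulT_Tb_id)
  have "a \<star> b = (\<lambda>v. \<Sum>w\<in>{w. b w \<noteq> 0}. b w * lmul a (Tb w) v)"
    unfolding hmul_def using 1 FS_nz_SN[OF assms(2)] by (intro ext sum.cong) simp_all
  also have "\<dots> = lmul a (\<lambda>v. \<Sum>w\<in>{w. b w \<noteq> 0}. b w * Tb w v)"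
    by (rule lmul_sum[symmetric])
  finally show ?thesis using FS_expand[OF assms(2)] by simp
qed

lemma FS_mulT: "a \<in> FS \<Longrightarrow> w \<in> SN \<Longrightarrow> mulT a w \<in> FS"
  unfolding mulT_def by (intro FS_foldl rword_ge1)

lemma FS_hmul: "a \<in> FS \<Longrightarrow> b \<in> FS \<Longrightarrow> a \<star> b \<in> FS"
  unfolding hmul_def using FS_support[of b] by (intro FS_sum FS_mulT) auto

text \<open>With a acting through left operators and c through right operators, associativity is
  exactly their commutation.\<close>

lemma hmul_assoc:
  assumes "a \<in> FS" "b \<in> FS" "c \<in> FS"
  shows "(a \<star> b) \<star> c = a \<star> (b \<star> c)"
proof -
  have "(a \<star> b) \<star> c = (\<lambda>v. \<Sum>w\<in>{w. c w \<noteq> 0}. c w * lmul a (mulT b w) v)"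
    unfolding hmul_def[of "a \<star> b"] using FS_nz_SN[OF assms(3)] assms
    by (intro ext sum.cong) (simp_all add: hmul_eq_lmul mulT_lmul)
  also have "\<dots> = lmul a (b \<star> c)"
    unfolding hmul_def[of b] lmul_sum ..
  finally show ?thesis using hmul_eq_lmul[OF assms(1) FS_hmul[OF assms(2,3)]] by simp
qed

lemma hmul_superset:
  assumes "finite X" "{w. b w \<noteq> 0} \<subseteq> X"
  shows "(a \<star> b) v = (\<Sum>w\<in>X. b w * mulT a w v)"
  unfolding hmul_def using assms by (intro sum.mono_neutral_left) auto

lemma mulT_add: "mulT (hadd a b) w = hadd (mulT a w) (mulT b w)"
proof -
  have *: "mulTs (hadd a b) i = hadd (mulTs a i) (mulTs b i)" for a b i
    by (rule ext) (simp add: mulTs_def hadd_def Let_def algebra_simps)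
  have "foldl mulTs (hadd a b) ws = hadd (foldl mulTs a ws) (foldl mulTs b ws)" for ws
    by (induction ws arbitrary: a b) (simp_all add: *)
  then show ?thesis unfolding mulT_def .
qed

lemma mulT_scale: "mulT (hscale c a) w = hscale c (mulT a w)"
proof -
  have *: "mulTs (hscale c a) i = hscale c (mulTs a i)" for a i
    by (rule ext) (simp add: mulTs_def hscale_def Let_def algebra_simps)
  have "foldl mulTs (hscale c a) ws = hscale c (foldl mulTs a ws)" for ws
    by (induction ws arbitrary: a) (simp_all add: *)
  then show ?thesis unfolding mulT_def .
qed

lemma hmul_add_left: "hadd a b \<star> c = hadd (a \<star> c) (b \<star> c)"
  unfolding hmul_def mulT_add by (simp add: hadd_def sum.distrib algebra_simps)

lemma hmul_scale_left: "hscale k a \<star> c = hscale k (a \<star> c)"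
  unfolding hmul_def mulT_scale by (simp add: hscale_def sum_distrib_left algebra_simps)

lemma hmul_add_right:
  assumes "b \<in> FS" "c \<in> FS" shows "a \<star> hadd b c = hadd (a \<star> b) (a \<star> c)"
proof
  fix v
  let ?X = "{w. b w \<noteq> 0} \<union> {w. c w \<noteq> 0}"
  have f: "finite ?X" using assms FS_support by auto
  have "{w. hadd b c w \<noteq> 0} \<subseteq> ?X" by (auto simp: hadd_def)
  from hmul_superset[OF f this] have "(a \<star> hadd b c) v = (\<Sum>w\<in>?X. hadd b c w * mulT a w v)" .
  also have "\<dots> = (\<Sum>w\<in>?X. b w * mulT a w v) + (\<Sum>w\<in>?X. c w * mulT a w v)"
    by (simp add: hadd_def distrib_right sum.distrib)
  also have "\<dots> = (a \<star> b) v + (a \<star> c) v"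
    by (intro arg_cong2[where f = plus] hmul_superset[symmetric] f) auto
  finally show "(a \<star> hadd b c) v = hadd (a \<star> b) (a \<star> c) v" by (simp add: hadd_def)
qed

lemma hmul_scale_right:
  assumes "b \<in> FS" shows "a \<star> hscale k b = hscale k (a \<star> b)"
proof
  fix v
  let ?X = "{w. b w \<noteq> 0}"
  have f: "finite ?X" using assms FS_support by auto
  have "{w. hscale k b w \<noteq> 0} \<subseteq> ?X" by (auto simp: hscale_def)
  from hmul_superset[OF f this] have "(a \<star> hscale k b) v = (\<Sum>w\<in>?X. hscale k b w * mulT a w v)" .
  also have "\<dots> = k * (a \<star> b) v"
    unfolding hmul_def by (simp add: hscale_def sum_distrib_left mult.assoc)
  finally show "(a \<star> hscale k b) v = hscale k (a \<star> b) v" by (simp add: hscale_def)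
qed

lemma hmul_one_right: "a \<in> FS \<Longrightarrow> a \<star> Tb id = a"
  by (simp add: hmul_eq_lmul FS_Tb lmul_Tb_id)

lemma hmul_one_left: "a \<in> FS \<Longrightarrow> Tb id \<star> a = a"
proof -
  assume a: "a \<in> FS"
  have "Tb id \<star> a = (\<lambda>v. \<Sum>w\<in>{w. a w \<noteq> 0}. a w * Tb w v)"
    unfolding hmul_def using FS_nz_SN[OF a] by (intro ext sum.cong) (simp_all add: mulT_Tb_id)
  then show ?thesis using FS_expand[OF a] by simp
qed

lemma FS_hadd:
  assumes "a \<in> FS" "b \<in> FS" shows "hadd a b \<in> FS"
proof -
  have sub: "{w. hadd a b w \<noteq> 0} \<subseteq> {w. a w \<noteq> 0} \<union> {w. b w \<noteq> 0}" by (auto simp: hadd_def)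
  have "finite ({w. a w \<noteq> 0} \<union> {w. b w \<noteq> 0})" "{w. a w \<noteq> 0} \<union> {w. b w \<noteq> 0} \<subseteq> SN"
    using assms FS_support by simp_all
  then show ?thesis using FS_I[OF finite_subset[OF sub] subset_trans[OF sub]] by blast
qed

lemma FS_hscale:
  assumes "a \<in> FS" shows "hscale c a \<in> FS"
proof -
  have sub: "{w. hscale c a w \<noteq> 0} \<subseteq> {w. a w \<noteq> 0}" by (auto simp: hscale_def)
  show ?thesis using FS_I[OF finite_subset[OF sub] subset_trans[OF sub]] FS_support[OF assms] by blast
qed

lemma FS_zero: "(\<lambda>_. 0) \<in> FS"
  by (rule FS_I) auto

section \<open>The Hecke algebra as a ring\<close>

text \<open>The ring laws are proved for coefficient functions of finite support in
  \<open>SN\<close>; giving these a type of their own makes ring and vector space reasoning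
  available.\<close>

typedef hk = FS
  by (rule exI[of _ "\<lambda>_. 0"]) (rule FS_zero)

setup_lifting type_definition_hk
lifting_forget fract.lifting
lifting_forget poly.lifting

instantiation hk :: ring_1
begin
lift_definition zero_hk :: hk is "\<lambda>_. 0" by (rule FS_zero)
lift_definition one_hk :: hk is "Tb id" by (simp add: FS_Tb)
lift_definition plus_hk :: "hk \<Rightarrow> hk \<Rightarrow> hk" is hadd by (rule FS_hadd)
lift_definition uminus_hk :: "hk \<Rightarrow> hk" is "hscale (- 1)" by (rule FS_hscale)
lift_definition minus_hk :: "hk \<Rightarrow> hk \<Rightarrow> hk" is "\<lambda>a b. hadd a (hscale (- 1) b)" by (simp add: FS_hadd FS_hscale)
lift_definition times_hk :: "hk \<Rightarrow> hk \<Rightarrow> hk" is hmul by (rule FS_hmul)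
instance
proof
  fix a b c :: hk
  show "a + b + c = a + (b + c)" by transfer (simp add: hadd_def algebra_simps)
  show "a + b = b + a" by transfer (simp add: hadd_def algebra_simps)
  show "0 + a = a" by transfer (simp add: hadd_def)
  show "- a + a = 0" by transfer (simp add: hadd_def hscale_def)
  show "a - b = a + - b" by transfer simp
  show "a * b * c = a * (b * c)" by transfer (rule hmul_assoc)
  show "1 * a = a" by transfer (rule hmul_one_left)
  show "a * 1 = a" by transfer (rule hmul_one_right)
  show "(a + b) * c = a * c + b * c" by transfer (rule hmul_add_left)
  show "a * (b + c) = a * b + a * c" by transfer (rule hmul_add_right)
  show "(0::hk) \<noteq> 1" by transfer (metis Tb_def zero_neq_one)
qed
end

lift_definition smul :: "K \<Rightarrow> hk \<Rightarrow> hk" is hscale by (rule FS_hscale)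
lift_definition cf :: "hk \<Rightarrow> hecke" is "\<lambda>a. a" .
lift_definition TT :: "(nat \<Rightarrow> nat) \<Rightarrow> hk" is "\<lambda>w. if w \<in> SN then Tb w else (\<lambda>_. 0)"
  by (simp add: FS_Tb FS_zero)

abbreviation Ti :: "nat \<Rightarrow> hk" where "Ti i \<equiv> TT (sgen i)"

interpretation hk: vector_space smul
  by standard (transfer; simp add: hscale_def hadd_def algebra_simps)+

lemma smul_mult_left [simp]: "smul c a * b = smul c (a * b)"
  by transfer (rule hmul_scale_left)

lemma smul_mult_right [simp]: "a * smul c b = smul c (a * b)"
  by transfer (rule hmul_scale_right)

lemma hk_eqI: "(\<And>w. w \<in> SN \<Longrightarrow> cf a w = cf b w) \<Longrightarrow> a = b"
  by transfer (metis FS_zero_outside ext)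

lemma cf_FS [simp]: "cf a \<in> FS" by transfer simp
lemma cf_outside: "w \<notin> SN \<Longrightarrow> cf a w = 0" using FS_zero_outside cf_FS by blast
lemma cf_inject: "cf a = cf b \<longleftrightarrow> a = b" by transfer simp
lemma cf_surj: "h \<in> FS \<Longrightarrow> \<exists>a. cf a = h" by transfer auto
lemma cf_add [simp]: "cf (a + b) w = cf a w + cf b w" by transfer (simp add: hadd_def)
lemma cf_smul [simp]: "cf (smul c a) w = c * cf a w" by transfer (simp add: hscale_def)
lemma cf_zero [simp]: "cf 0 w = 0" by transfer simp
lemma cf_diff [simp]: "cf (a - b) w = cf a w - cf b w" by transfer (simp add: hadd_def hscale_def)
lemma cf_mult: "cf (a * b) = cf a \<star> cf b" by transfer simp
lemma cf_TT: "w \<in> SN \<Longrightarrow> cf (TT w) v = (if v = w then 1 else 0)" by transfer (simp add: Tb_def)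
lemma cf_sum [simp]: "cf (sum f X) w = (\<Sum>x\<in>X. cf (f x) w)"
  by (induction X rule: infinite_finite_induct) auto
lemma cf_hadd: "cf (a + b) = hadd (cf a) (cf b)" by transfer simp
lemma finite_cf: "finite {w. cf a w \<noteq> 0}" using FS_support cf_FS by blast

lemma TT_id [simp]: "TT id = 1" by transfer simp

lemma cf_Tb: "w \<in> SN \<Longrightarrow> cf (TT w) = Tb w" by transfer simp

lemma mulTs_eq: "1 \<le> i \<Longrightarrow> a \<in> FS \<Longrightarrow> mulTs a i = a \<star> Tb (sgen i)"
proof -
  assume i: "1 \<le> i" and a: "a \<in> FS"
  have "mulTs (lmul a (Tb id)) i = lmul a (mulTs (Tb id) i)"
  proof -
    have "mulTs (foldr lT (rword u) (Tb id)) i = foldr lT (rword u) (mulTs (Tb id) i)" if "a u \<noteq> 0" for u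
      using foldl_foldr_commute[of "[i]" "rword u" "Tb id"] i that FS_zero_outside[OF a] rword_ge1[of u]
      by (auto simp: FS_Tb)
    then show ?thesis unfolding lmul_def mulTs_sum by auto
  qed
  moreover have "plen (sgen i) = Suc (plen id)"
    using plen_sgen_left(2)[OF SN_id i] by simp
  then have "mulTs (Tb id) i = Tb (sgen i)" using mulTs_Tb_asc[of i id] by simp
  ultimately show ?thesis using a i by (simp add: lmul_Tb_id hmul_eq_lmul FS_Tb sgen_SN)
qed

lemma cf_mult_Ti: "1 \<le> i \<Longrightarrow> cf (a * Ti i) = mulTs (cf a) i"
  by (simp add: cf_mult cf_Tb sgen_SN mulTs_eq)

lemma cf_mult_Ti_left: "1 \<le> i \<Longrightarrow> cf (Ti i * a) = lT i (cf a)"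
proof -
  assume i: "1 \<le> i"
  have r: "rword (sgen i) = [i]"
  proof -
    have p: "plen (sgen i) = Suc 0" using plen_sgen_left(2)[OF SN_id i] by simp
    then obtain j where j: "rword (sgen i) = [j]"
      using rword_spec(2)[OF sgen_SN[OF i]] by (metis length_0_conv length_Suc_conv)
    then have "sgen j = sgen i" using rword_spec(1)[OF sgen_SN[OF i]] by (simp add: wprod_def)
    then have "sgen j j = sgen i j" by simp
    then have "j = i" by (simp add: sgen_if split: if_splits)
    then show ?thesis using j by simp
  qed
  have "{w. Tb (sgen i) w \<noteq> 0} = {sgen i}" by (auto simp: Tb_def)
  then have "lmul (Tb (sgen i)) b = lT i b" for b
    unfolding lmul_def by (simp add: r) (simp add: Tb_def)
  then show ?thesis using i by (simp add: cf_mult cf_Tb sgen_SN hmul_eq_lmul FS_Tb)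
qed

lemma TT_mult_Ti_asc:
  assumes "w \<in> SN" "1 \<le> i" "inv w i < inv w (Suc i)"
  shows "TT w * Ti i = TT (sgen i \<circ> w)"
  using assms plen_sgen_left_asc[OF assms(1,3)]
  by (intro hk_eqI) (simp add: cf_mult_Ti cf_Tb mulTs_Tb_asc sgen_left_SN_iff)

lemma TT_mult_Ti_desc:
  assumes "w \<in> SN" "1 \<le> i" "inv w (Suc i) < inv w i"
  shows "TT w * Ti i = smul qq (TT (sgen i \<circ> w)) + smul (qq - 1) (TT w)"
  using assms plen_sgen_left_desc[OF assms]
  by (intro hk_eqI) (simp add: cf_mult_Ti cf_Tb mulTs_Tb_desc sgen_left_SN_iff)

lemma Ti_mult_TT_asc:
  assumes "w \<in> SN" "1 \<le> i" "w i < w (Suc i)"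
  shows "Ti i * TT w = TT (w \<circ> sgen i)"
  using assms plen_sgen_right(2)[OF assms(1,2)]
  by (intro hk_eqI) (simp add: cf_mult_Ti_left cf_Tb lT_Tb_asc sgen_right_SN_iff)

lemma Ti_sq: "1 \<le> i \<Longrightarrow> Ti i * Ti i = smul qq 1 + smul (qq - 1) (Ti i)"
  using TT_mult_Ti_desc[of "sgen i" i] by (simp add: sgen_SN)

lemma Ti_mult_TT_desc:
  assumes "w \<in> SN" "1 \<le> i" "w (Suc i) < w i"
  shows "Ti i * TT w = smul qq (TT (w \<circ> sgen i)) + smul (qq - 1) (TT w)"
proof -
  have "Ti i * TT (w \<circ> sgen i) = TT w"
    using Ti_mult_TT_asc[of "w \<circ> sgen i" i] assms by (simp add: sgen_right_SN_iff)
  then have "Ti i * TT w = (Ti i * Ti i) * TT (w \<circ> sgen i)" by (simp add: mult.assoc)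
  also have "\<dots> = smul qq (TT (w \<circ> sgen i)) + smul (qq - 1) (TT w)"
    using \<open>Ti i * TT (w \<circ> sgen i) = TT w\<close> by (simp add: Ti_sq[OF assms(2)] distrib_right)
  finally show ?thesis .
qed

section \<open>The field \<open>K\<close>\<close>

text \<open>Conjugation of the coefficients with the variable fixed. At real arguments it conjugates
  the value, so p times its conjugate is nonnegative there; this is the source of all positivity
  below.\<close>

definition cpoly :: "complex poly \<Rightarrow> complex poly" where "cpoly p = map_poly cnj p"

lemma coeff_cpoly [simp]: "coeff (cpoly p) n = cnj (coeff p n)"
  by (simp add: cpoly_def coeff_map_poly)

lemma cpoly_add: "cpoly (p + r) = cpoly p + cpoly r"
  by (rule poly_eqI) simp

lemma cpoly_mult: "cpoly (p * r) = cpoly p * cpoly r"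
  by (rule poly_eqI) (simp add: coeff_mult)

lemma cpoly_eq_0_iff [simp]: "cpoly p = 0 \<longleftrightarrow> p = 0"
  by (simp add: poly_eq_iff)

lemma cpoly_0 [simp]: "cpoly 0 = 0" by simp

lemma cpoly_1 [simp]: "cpoly 1 = 1"
  by (simp add: cpoly_def)

lemma poly_cpoly: "poly (cpoly p) (cnj z) = cnj (poly p z)"
  unfolding cpoly_def by (induction p) (simp_all add: map_poly_pCons)

context includes fract.lifting
begin
lift_definition kc :: "K \<Rightarrow> K" is "\<lambda>(a, b). (cpoly a, cpoly b)"
  by (auto simp: simp flip: cpoly_mult)
lemma kc_Fract: "kc (Fract a b) = Fract (cpoly a) (cpoly b)"
  by (cases "b = 0") (simp_all add: Fract.abs_eq kc.abs_eq)
end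

lemma kc_add [simp]: "kc (x + y) = kc x + kc y"
proof -
  obtain a b c d where xy: "x = Fract a b" "b \<noteq> 0" "y = Fract c d" "d \<noteq> 0"
    by (meson Fract_cases)
  then show ?thesis by (simp add: kc_Fract cpoly_add cpoly_mult)
qed

lemma kc_mult [simp]: "kc (x * y) = kc x * kc y"
  by (cases x; cases y) (simp add: kc_Fract cpoly_mult)

lemma kc_0 [simp]: "kc 0 = 0" by (simp add: Zero_fract_def kc_Fract)
lemma kc_1 [simp]: "kc 1 = 1" by (simp add: One_fract_def kc_Fract)
lemma kc_uminus [simp]: "kc (- x) = - kc x"
proof -
  have "kc (- x) + kc x = 0" by (metis kc_add kc_0 add.left_inverse)
  then show ?thesis by (simp add: eq_neg_iff_add_eq_0)
qed
lemma kc_diff [simp]: "kc (x - y) = kc x - kc y"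
  by (metis kc_add kc_uminus diff_conv_add_uminus)

lemma kc_kc [simp]: "kc (kc x) = x"
proof -
  have "cpoly (cpoly p) = p" for p by (rule poly_eqI) simp
  then show ?thesis by (cases x) (simp add: kc_Fract)
qed

lemma kc_sum [simp]: "kc (sum f X) = (\<Sum>x\<in>X. kc (f x))"
  by (induction X rule: infinite_finite_induct) auto

lemma kc_qq [simp]: "kc qq = qq"
proof -
  have "cpoly [:0, 1:] = [:0, 1:]" by (simp add: cpoly_def map_poly_pCons)
  then show ?thesis by (simp add: qq_def kc_Fract)
qed

lemma kc_power [simp]: "kc (x ^ n) = kc x ^ n" by (induction n) auto

lemma kc_inverse [simp]: "kc (inverse x) = inverse (kc x)"
proof (cases "x = 0")
  case False
  have "kc x * kc (inverse x) = kc (x * inverse x)" by simp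
  also have "\<dots> = 1" using False by simp
  finally show ?thesis by (rule inverse_unique[symmetric])
qed simp

lemma kc_powi [simp]: "kc (x powi n) = kc x powi n"
  by (simp add: power_int_def)

text \<open>Positivity of the values at positive reals makes the form below anisotropic.\<close>

definition nneg :: "complex poly \<Rightarrow> bool" where
  "nneg p \<longleftrightarrow> (\<forall>t>0. \<exists>s\<ge>0. poly p (complex_of_real t) = complex_of_real s)"

lemma nneg_mult: "nneg p \<Longrightarrow> nneg r \<Longrightarrow> nneg (p * r)"
  unfolding nneg_def poly_mult by (metis mult_nonneg_nonneg of_real_mult)

lemma nneg_add: "nneg p \<Longrightarrow> nneg r \<Longrightarrow> nneg (p + r)"
  unfolding nneg_def poly_add by (metis add_nonneg_nonneg of_real_add)

lemma poly_eq_0_if_pos_roots: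
  assumes "\<And>t. t > 0 \<Longrightarrow> poly p (complex_of_real t) = 0" shows "p = 0"
proof (rule ccontr)
  assume "p \<noteq> 0"
  then have "finite {x. poly p x = 0}" by (rule poly_roots_finite)
  moreover have "complex_of_real ` {0<..} \<subseteq> {x. poly p x = 0}" using assms by auto
  ultimately have "finite (complex_of_real ` {0<..})" by (rule finite_subset[rotated])
  then have "finite {0::real<..}" by (rule finite_imageD) (simp add: inj_on_def)
  then show False using infinite_Ioi by blast
qed

lemma nneg_add_eq_0:
  assumes "nneg p" "nneg r" "p + r = 0" shows "p = 0"
proof (rule poly_eq_0_if_pos_roots)
  fix t :: real assume t: "t > 0"
  obtain s s' where s: "s \<ge> 0" "s' \<ge> 0" "poly p (complex_of_real t) = complex_of_real s" "poly r (complex_of_real t) = complex_of_real s'"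
    using assms(1,2) t unfolding nneg_def by blast
  have "poly (p + r) (complex_of_real t) = 0" using assms(3) by simp
  then have "complex_of_real (s + s') = 0" using s by simp
  then have "s + s' = 0" by (simp only: of_real_eq_0_iff)
  then show "poly p (complex_of_real t) = 0" using s by simp
qed

lemma nneg_1: "nneg 1"
  unfolding nneg_def by (metis of_real_1 poly_1 zero_le_one)

lemma nneg_X: "nneg [:0, 1:]"
  unfolding nneg_def by (auto intro!: exI less_imp_le)

lemma nneg_norm: "nneg (p * cpoly p)"
  unfolding nneg_def
proof (intro allI impI)
  fix t :: real assume "t > 0"
  have "poly (cpoly p) (complex_of_real t) = cnj (poly p (complex_of_real t))"
    using poly_cpoly[of p "complex_of_real t"] by simp
  then have "poly (p * cpoly p) (complex_of_real t) = complex_of_real ((cmod (poly p (complex_of_real t)))\<^sup>2)"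
    by (simp add: complex_norm_square[symmetric])
  then show "\<exists>s\<ge>0. poly (p * cpoly p) (complex_of_real t) = complex_of_real s"
    by (metis zero_le_power2)
qed

text \<open>A cone closed under sums and products in which a sum vanishes only if every summand
  does. Besides the form, it shows that 2, q + 1 and the Poincare polynomials are nonzero.\<close>

definition Kpos :: "K \<Rightarrow> bool" where
  "Kpos x \<longleftrightarrow> (\<exists>u v. v \<noteq> 0 \<and> x = Fract u v \<and> nneg u \<and> nneg v)"

lemma Kpos_add: "Kpos x \<Longrightarrow> Kpos y \<Longrightarrow> Kpos (x + y)"
  unfolding Kpos_def
proof (elim exE conjE)
  fix u v u' v' assume *: "v \<noteq> 0" "x = Fract u v" "nneg u" "nneg v" "v' \<noteq> 0" "y = Fract u' v'" "nneg u'" "nneg v'"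
  show "\<exists>u v. v \<noteq> 0 \<and> x + y = Fract u v \<and> nneg u \<and> nneg v"
    by (rule exI[of _ "u * v' + u' * v"], rule exI[of _ "v * v'"]) (use * in \<open>simp add: nneg_mult nneg_add\<close>)
qed

lemma Kpos_mult: "Kpos x \<Longrightarrow> Kpos y \<Longrightarrow> Kpos (x * y)"
  unfolding Kpos_def
proof (elim exE conjE)
  fix u v u' v' assume *: "v \<noteq> 0" "x = Fract u v" "nneg u" "nneg v" "v' \<noteq> 0" "y = Fract u' v'" "nneg u'" "nneg v'"
  show "\<exists>u v. v \<noteq> 0 \<and> x * y = Fract u v \<and> nneg u \<and> nneg v"
    by (rule exI[of _ "u * u'"], rule exI[of _ "v * v'"]) (use * in \<open>simp add: nneg_mult nneg_add\<close>)
qed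

lemma Kpos_1: "Kpos 1"
  unfolding Kpos_def by (rule exI[of _ 1], rule exI[of _ 1]) (simp add: nneg_1 One_fract_def)

lemma Kpos_0: "Kpos 0"
  unfolding Kpos_def by (rule exI[of _ 0], rule exI[of _ 1]) (simp add: nneg_1 Zero_fract_def, simp add: nneg_def)

lemma Kpos_qq: "Kpos qq"
  unfolding Kpos_def by (rule exI[of _ "[:0,1:]"], rule exI[of _ 1]) (simp add: nneg_1 nneg_X qq_def)

lemma Kpos_inverse_qq: "Kpos (inverse qq)"
  unfolding Kpos_def by (rule exI[of _ 1], rule exI[of _ "[:0,1:]"]) (simp add: nneg_1 nneg_X qq_def)

lemma Kpos_power: "Kpos x \<Longrightarrow> Kpos (x ^ n)"
  by (induction n) (auto simp: Kpos_1 Kpos_mult)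

lemma Kpos_norm: "Kpos (x * kc x)"
proof -
  obtain a b where x: "x = Fract a b" "b \<noteq> 0" by (cases x)
  then have "x * kc x = Fract (a * cpoly a) (b * cpoly b)" by (simp add: kc_Fract)
  moreover have "b * cpoly b \<noteq> 0" using x by simp
  ultimately show ?thesis unfolding Kpos_def using nneg_norm by blast
qed

lemma Kpos_add_eq_0:
  assumes "Kpos x" "Kpos y" "x + y = 0" shows "x = 0"
proof -
  obtain u v u' v' where *: "v \<noteq> 0" "x = Fract u v" "nneg u" "nneg v" "v' \<noteq> 0" "y = Fract u' v'" "nneg u'" "nneg v'"
    using assms(1,2) unfolding Kpos_def by blast
  then have "Fract (u * v' + u' * v) (v * v') = Fract 0 1" using assms(3) by (simp add: Zero_fract_def)
  then have "u * v' + u' * v = 0" using * by (simp add: eq_fract)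
  then have "u * v' = 0" using nneg_add_eq_0[of "u * v'" "u' * v"] * nneg_mult by blast
  then have "u = 0" using * by simp
  then show ?thesis using * by (simp add: fract_collapse)
qed

lemma Kpos_sum: "(\<And>x. x \<in> X \<Longrightarrow> Kpos (f x)) \<Longrightarrow> Kpos (sum f X)"
  by (induction X rule: infinite_finite_induct) (auto simp: Kpos_0 Kpos_add)

lemma Kpos_sum_eq_0:
  assumes "finite X" "\<And>x. x \<in> X \<Longrightarrow> Kpos (f x)" "sum f X = 0" "x \<in> X"
  shows "f x = 0"
proof -
  have "f x + sum f (X - {x}) = 0" using assms by (simp add: sum.remove)
  then show ?thesis using Kpos_add_eq_0[of "f x" "sum f (X - {x})"] Kpos_sum[of "X - {x}" f] assms by simp
qed

lemma qq_plus_1 [simp]: "qq + 1 \<noteq> 0"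
  using Kpos_add_eq_0[OF Kpos_qq Kpos_1] by auto

lemma qq_power_eq_1: "qq ^ n = 1 \<Longrightarrow> n = 0"
proof -
  assume "qq ^ n = 1"
  moreover have "qq ^ n = Fract ([:0, 1:] ^ n) 1"
    by (induction n) (simp_all add: qq_def One_fract_def)
  ultimately have "[:0, 1::complex:] ^ n = 1" by (simp add: One_fract_def eq_fract)
  then have "degree ([:0, 1::complex:] ^ n) = 0" by simp
  then show "n = 0" by (simp add: degree_power_eq)
qed

lemma qq_neq_1 [simp]: "qq \<noteq> 1"
  using qq_power_eq_1[of 1] by auto

lemma qq_powi_inj: "qq powi a = qq powi b \<Longrightarrow> a = b"
proof (induction a b rule: linorder_wlog)
  case (le a b)
  have "qq powi b = qq powi a * qq powi (b - a)" by (simp flip: power_int_add)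
  then have "qq powi (b - a) = 1" using le by simp
  then have "qq ^ nat (b - a) = 1" using le by (simp add: power_int_def)
  then have "nat (b - a) = 0" by (rule qq_power_eq_1)
  then show ?case using le by simp
qed simp

lemma qq_powi_eq_iff: "qq powi a = qq powi b \<longleftrightarrow> a = b"
  using qq_powi_inj by blast

lemma qint_eq_iff: "qint a = qint b \<longleftrightarrow> a = b"
  by (simp add: qint_def qq_powi_eq_iff)

section \<open>The finite Hecke algebras and the braid relations\<close>

definition Hm :: "nat \<Rightarrow> hk set" where "Hm m = {a. cf a \<in> H m}"

lemma Hm_iff: "a \<in> Hm m \<longleftrightarrow> (\<forall>w. cf a w \<noteq> 0 \<longrightarrow> w permutes {1..m})"
  by (simp add: Hm_def H_def)

lemma Hm_subspace: "hk.subspace (Hm m)"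
proof (rule hk.subspaceI)
  fix x y c assume x: "x \<in> Hm m"
  show "smul c x \<in> Hm m" using x by (simp add: Hm_iff)
  assume y: "y \<in> Hm m"
  show "x + y \<in> Hm m" unfolding Hm_iff
  proof (intro allI impI)
    fix w assume "cf (x + y) w \<noteq> 0"
    then have "cf x w \<noteq> 0 \<or> cf y w \<noteq> 0" by auto
    then show "w permutes {1..m}" using x y unfolding Hm_iff by blast
  qed
qed (simp add: Hm_iff)

lemmas Hm_zero [simp] = hk.subspace_0[OF Hm_subspace]
lemmas Hm_add = hk.subspace_add[OF Hm_subspace]
lemmas Hm_diff = hk.subspace_diff[OF Hm_subspace]
lemmas Hm_smul = hk.subspace_scale[OF Hm_subspace]
lemmas Hm_sum = hk.subspace_sum[OF Hm_subspace]

lemma Hm_TT: "w permutes {1..m} \<Longrightarrow> TT w \<in> Hm m"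
  using SN_I by (auto simp: Hm_iff cf_TT split: if_splits)

lemma Hm_1 [simp]: "1 \<in> Hm m"
  using Hm_TT[OF permutes_id] by simp

lemma Hm_Ti: "1 \<le> i \<Longrightarrow> i < m \<Longrightarrow> Ti i \<in> Hm m"
  by (intro Hm_TT sgen_permutes)

lemma finite_Sm [simp]: "finite {w. w permutes {1..m::nat}}"
  by (rule finite_permutations) simp

lemma finite_Sm' [simp]: "finite {w. w permutes {Suc 0..m}}"
  using finite_Sm[of m] by simp

lemma Hm_expand:
  assumes "a \<in> Hm m" shows "a = (\<Sum>w | w permutes {1..m}. smul (cf a w) (TT w))"
proof (rule hk_eqI)
  fix v assume "v \<in> SN"
  have "cf (\<Sum>w | w permutes {1..m}. smul (cf a w) (TT w)) v = (\<Sum>w | w permutes {1..m}. if v = w then cf a w else 0)"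
    unfolding cf_sum by (rule sum.cong) (auto simp: cf_TT SN_I)
  also have "\<dots> = cf a v" using assms by (auto simp: sum.delta' Hm_iff)
  finally show "cf a v = cf (\<Sum>w | w permutes {1..m}. smul (cf a w) (TT w)) v" by simp
qed

lemma Hm_induct [consumes 1, case_names zero add TT]:
  assumes "a \<in> Hm m" "P 0" "\<And>a b. P a \<Longrightarrow> P b \<Longrightarrow> P (a + b)"
    "\<And>c w. w permutes {1..m} \<Longrightarrow> P (smul c (TT w))"
  shows "P a"
proof -
  have "P (\<Sum>w\<in>X. smul (cf a w) (TT w))" if "X \<subseteq> {w. w permutes {1..m}}" for X
    using finite_subset[OF that finite_Sm] that
    by (induction X rule: finite_induct) (auto simp: assms)
  then show ?thesis using Hm_expand[OF assms(1)] by (metis order_refl)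
qed

lemma TT_comp_sgen:
  assumes "w permutes {1..m}" "1 \<le> i" "plen (sgen i \<circ> w) = Suc (plen w)"
  shows "TT (sgen i \<circ> w) = TT w * Ti i"
  using TT_mult_Ti_asc[of w i] plen_sgen_left(2)[of w i] SN_I[OF assms(1)] assms by simp

lemma Hm_mult_Ti: "a \<in> Hm m \<Longrightarrow> 1 \<le> i \<Longrightarrow> i < m \<Longrightarrow> a * Ti i \<in> Hm m"
proof (induction rule: Hm_induct)
  case (TT c w)
  have s: "sgen i \<circ> w permutes {1..m}" using TT sgen_permutes permutes_comp by blast
  have "TT w * Ti i \<in> Hm m"
  proof (cases "inv w i < inv w (Suc i)")
    case True
    then show ?thesis using TT_mult_Ti_asc[OF SN_I[OF TT(1)] TT.prems(1)] Hm_TT[OF s] by simp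
  next
    case False
    then have "inv w (Suc i) < inv w i" using inv_neq_Suc[OF SN_I[OF TT(1)], of i] by linarith
    from TT_mult_Ti_desc[OF SN_I[OF TT(1)] TT.prems(1) this] show ?thesis
      using Hm_TT[OF s] Hm_TT[OF TT(1)] by (simp add: Hm_add Hm_smul)
  qed
  then show ?case by (simp add: Hm_smul)
qed (auto simp: distrib_right Hm_add)

lemma Hm_mult: "a \<in> Hm m \<Longrightarrow> b \<in> Hm m \<Longrightarrow> a * b \<in> Hm m"
proof (rotate_tac 1, induction arbitrary: a rule: Hm_induct)
  case (TT c w)
  from TT.hyps have "a * TT w \<in> Hm m" if "a \<in> Hm m" for a
    using that
  proof (induction arbitrary: a rule: permutes_length_induct)
    case (step w i)
    have "a * TT (sgen i \<circ> w) = a * TT w * Ti i" using step by (simp only: TT_comp_sgen mult.assoc)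
    then have "a * TT (sgen i \<circ> w) \<in> Hm m" using step Hm_mult_Ti by simp
    then show ?case by (simp add: comp_def)
  next
    case id
    then show ?case by (simp add: id_def[symmetric])
  qed
  then show ?case using TT.prems by (simp add: Hm_smul)
qed (auto simp: distrib_left Hm_add)

lemma Hm_mono: "m \<le> n \<Longrightarrow> Hm m \<subseteq> Hm n"
proof
  fix a assume m: "m \<le> n" and a: "a \<in> Hm m"
  show "a \<in> Hm n" unfolding Hm_iff
    using a[unfolded Hm_iff] permutes_atLeastAtMost_mono[OF _ m] by blast
qed

lemma plen_comp_le:
  assumes "w permutes {1..m}" "v \<in> SN" shows "plen (w \<circ> v) \<le> plen w + plen v"
  using assms(1)
proof (induction rule: permutes_length_induct)
  case (step w i)
  have "w \<circ> v \<in> SN" using SN_comp[OF SN_I[OF step(1)] assms(2)] .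
  then have "plen (sgen i \<circ> (w \<circ> v)) \<le> Suc (plen (w \<circ> v))"
    using plen_left_cases[of "w \<circ> v" i] step(2) by auto
  then have "plen ((sgen i \<circ> w) \<circ> v) \<le> Suc (plen (w \<circ> v))" by (simp only: comp_assoc)
  then show ?case using step by linarith
qed (simp add: id_def)

lemma TT_mult:
  assumes "w permutes {1..m}" "v \<in> SN" "plen (w \<circ> v) = plen w + plen v"
  shows "TT v * TT w = TT (w \<circ> v)"
  using assms(1,3)
proof (induction rule: permutes_length_induct)
  case id
  have "id \<circ> v = v" by simp
  then show ?case by (metis TT_id mult.right_neutral)
next
  case (step w i)
  have s: "w \<circ> v \<in> SN" using SN_comp[OF SN_I[OF step(1)] assms(2)] .
  have p: "plen (sgen i \<circ> (w \<circ> v)) = Suc (plen w + plen v)"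
    using step.prems step(4) by (simp only: comp_assoc add_Suc)
  \<comment> \<open>Length is subadditive, so additivity for \<open>sgen i \<circ> w\<close> forces
    it already for w, and the step by \<open>sgen i\<close> is an ascent.\<close>
  then have "plen (w \<circ> v) = plen w + plen v"
    using plen_left_cases[OF s step(2)] plen_comp_le[OF step(1) assms(2)] by linarith
  then have "TT v * TT w = TT (w \<circ> v)" and "inv (w \<circ> v) i < inv (w \<circ> v) (Suc i)"
    using step.IH plen_sgen_left(2)[OF s step(2)] p by (simp_all add: comp_def)
  then have "TT v * TT (sgen i \<circ> w) = TT (sgen i \<circ> (w \<circ> v))"
    using TT_mult_Ti_asc[OF s step(2)] TT_comp_sgen[OF step(1,2,4)] by (simp flip: mult.assoc)
  then show ?case by (simp only: comp_assoc)
qed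

lemma braid: "1 \<le> i \<Longrightarrow> Ti i * Ti (Suc i) * Ti i = Ti (Suc i) * Ti i * Ti (Suc i)"
proof -
  assume i: "1 \<le> i"
  note s = sgen_SN[OF i] sgen_SN[of "Suc i"]
  have 1: "Ti i * Ti (Suc i) = TT (sgen (Suc i) \<circ> sgen i)" "Ti (Suc i) * Ti i = TT (sgen i \<circ> sgen (Suc i))"
    using i s by (intro TT_mult_Ti_asc; simp add: sgen_if)+
  have "Ti i * Ti (Suc i) * Ti i = TT (sgen i \<circ> (sgen (Suc i) \<circ> sgen i))"
    unfolding 1 using i s by (intro TT_mult_Ti_asc) (auto simp: SN_comp inv_sgen_left sgen_if)
  moreover have "Ti (Suc i) * Ti i * Ti (Suc i) = TT (sgen (Suc i) \<circ> (sgen i \<circ> sgen (Suc i)))"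
    unfolding 1 using i s by (intro TT_mult_Ti_asc) (auto simp: SN_comp inv_sgen_left sgen_if)
  moreover have "sgen i \<circ> (sgen (Suc i) \<circ> sgen i) = sgen (Suc i) \<circ> (sgen i \<circ> sgen (Suc i))"
    by (rule ext) (simp add: sgen_if)
  ultimately show ?thesis by simp
qed

lemma Ti_commute: "1 \<le> i \<Longrightarrow> Suc i < j \<Longrightarrow> Ti i * Ti j = Ti j * Ti i"
proof -
  assume i: "1 \<le> i" "Suc i < j"
  then have j: "1 \<le> j" by simp
  note s = sgen_SN[OF i(1)] sgen_SN[OF j]
  have 1: "Ti i * Ti j = TT (sgen j \<circ> sgen i)" "Ti j * Ti i = TT (sgen i \<circ> sgen j)"
    using i j s by (intro TT_mult_Ti_asc; simp add: sgen_if)+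
  moreover have "sgen i \<circ> sgen j = sgen j \<circ> sgen i"
    using i by (intro ext) (simp add: sgen_if)
  ultimately show ?thesis by simp
qed

lemma Ti_commute': "1 \<le> i \<Longrightarrow> 1 \<le> j \<Longrightarrow> Suc i < j \<or> Suc j < i \<Longrightarrow> Ti i * Ti j = Ti j * Ti i"
  using Ti_commute by metis

section \<open>Jucys--Murphy elements\<close>

text \<open>The multiplicative variant of \<open>L\<^sub>p\<close>: it equals \<open>1 + (q - 1) L\<^sub>p\<close> and has eigenvalues
  \<open>q\<^sup>c\<close>, where \<open>c\<close> is a content.\<close>

fun JM :: "nat \<Rightarrow> hk" where
  "JM 0 = 1"
| "JM (Suc p) = (if p = 0 then 1 else smul (inverse qq) (Ti p * JM p * Ti p))"

lemma JM_1 [simp]: "JM (Suc 0) = 1" by simp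

lemma JM_Suc: "1 \<le> p \<Longrightarrow> JM (Suc p) = smul (inverse qq) (Ti p * JM p * Ti p)" by simp

declare JM.simps(2) [simp del]

lemma JM_commute_above: "p < i \<Longrightarrow> Ti i * JM p = JM p * Ti i"
proof (induction p)
  case (Suc p)
  show ?case
  proof (cases "p = 0")
    case False
    then have c: "Ti i * Ti p = Ti p * Ti i" using Ti_commute[of p i] Suc.prems by simp
    have "Ti i * (Ti p * JM p * Ti p) = Ti p * (Ti i * JM p) * Ti p" by (simp only: mult.assoc[symmetric] c)
    also have "\<dots> = Ti p * JM p * (Ti i * Ti p)" using Suc by (simp add: mult.assoc)
    finally show ?thesis using False by (simp add: JM_Suc c mult.assoc)
  qed simp
qed simp

lemma JM_commute_below: "1 \<le> i \<Longrightarrow> Suc i < p \<Longrightarrow> Ti i * JM p = JM p * Ti i"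
proof (induction p)
  case (Suc p)
  then have p: "1 \<le> p" by simp
  show ?case
  proof (cases "Suc i < p")
    case True
    then have c: "Ti i * Ti p = Ti p * Ti i" using Ti_commute[of i p] Suc.prems by simp
    have "Ti i * (Ti p * JM p * Ti p) = Ti p * (Ti i * JM p) * Ti p" by (simp only: mult.assoc[symmetric] c)
    also have "\<dots> = Ti p * JM p * (Ti i * Ti p)" using Suc True by (simp add: mult.assoc)
    finally show ?thesis using p by (simp add: JM_Suc c mult.assoc)
  next
    case False
    then have pi: "p = Suc i" using Suc.prems by simp
    \<comment> \<open>Here two steps of the recursion must be unfolded: the braid relation turns T_i
      into T_p, which commutes with \<open>JM i\<close>, and a second braid relation turns it
      back.\<close>
    have b: "Ti i * (Ti p * Ti i) = Ti p * (Ti i * Ti p)" using braid[OF Suc.prems(1)] pi by (simp add: mult.assoc)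
    have c: "Ti p * JM i = JM i * Ti p" by (rule JM_commute_above) (simp add: pi)
    have e: "JM (Suc p) = smul (inverse qq) (smul (inverse qq) (Ti p * (Ti i * (JM i * (Ti i * Ti p)))))"
      using Suc.prems(1) p by (simp add: JM_Suc pi mult.assoc)
    have "Ti i * (Ti p * (Ti i * (JM i * (Ti i * Ti p)))) = (Ti i * (Ti p * Ti i)) * (JM i * (Ti i * Ti p))"
      by (simp only: mult.assoc)
    also have "\<dots> = Ti p * (Ti i * ((Ti p * JM i) * (Ti i * Ti p)))" by (simp only: b mult.assoc)
    also have "\<dots> = Ti p * (Ti i * (JM i * (Ti p * (Ti i * Ti p))))" by (simp only: c mult.assoc)
    also have "\<dots> = Ti p * (Ti i * (JM i * (Ti i * (Ti p * Ti i))))" by (simp only: b)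
    finally show ?thesis unfolding e by (simp add: mult.assoc)
  qed
qed simp

lemma JM_Hm: "p \<le> m \<Longrightarrow> JM p \<in> Hm m"
proof (induction p)
  case (Suc p)
  then show ?case by (cases "p = 0") (auto simp: JM_Suc intro!: Hm_smul Hm_mult Hm_Ti)
qed simp

text \<open>The quadratic relation for T_p yields the commutation rule of the affine Hecke algebra.
  With its mirror image below it produces the intertwiners.\<close>

lemma JM_Suc_Ti: "1 \<le> p \<Longrightarrow> JM (Suc p) * Ti p = Ti p * JM p + smul (qq - 1) (JM (Suc p))"
proof -
  assume p: "1 \<le> p"
  have "Ti p * JM p * (Ti p * Ti p) = smul qq (Ti p * JM p) + smul (qq - 1) (Ti p * JM p * Ti p)"
    unfolding Ti_sq[OF p] by (simp add: distrib_left)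
  note 1 = this
  have "JM (Suc p) * Ti p = smul (inverse qq) (Ti p * JM p * (Ti p * Ti p))"
    unfolding JM_Suc[OF p] by (simp add: mult.assoc)
  also have "\<dots> = Ti p * JM p + smul (qq - 1) (smul (inverse qq) (Ti p * JM p * Ti p))"
    unfolding 1 by (simp add: hk.scale_right_distrib mult.commute[of "inverse qq"])
  finally show ?thesis unfolding JM_Suc[OF p] .
qed

lemma Ti_JM_Suc: "1 \<le> p \<Longrightarrow> Ti p * JM (Suc p) = JM p * Ti p + smul (qq - 1) (JM (Suc p))"
proof -
  assume p: "1 \<le> p"
  have "(Ti p * Ti p) * (JM p * Ti p) = smul qq (JM p * Ti p) + smul (qq - 1) (Ti p * JM p * Ti p)"
    unfolding Ti_sq[OF p] by (simp add: distrib_right mult.assoc)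
  note 1 = this
  have "Ti p * JM (Suc p) = smul (inverse qq) ((Ti p * Ti p) * (JM p * Ti p))"
    unfolding JM_Suc[OF p] by (simp add: mult.assoc)
  also have "\<dots> = JM p * Ti p + smul (qq - 1) (smul (inverse qq) (Ti p * JM p * Ti p))"
    unfolding 1 by (simp add: hk.scale_right_distrib mult.commute[of "inverse qq"])
  finally show ?thesis unfolding JM_Suc[OF p] .
qed

section \<open>Comparison with the additive elements L_p\<close>

definition Lk :: "nat \<Rightarrow> hk" where
  "Lk p = (\<Sum>i\<in>{1..<p}. smul (qq powi (- int i)) (TT (transpose (p - i) p)))"

lemma transpose_SN: "1 \<le> a \<Longrightarrow> 1 \<le> b \<Longrightarrow> transpose a b \<in> SN"
  by (rule SN_I[of _ "max a b"], rule permutes_swap_id) auto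

lemma cf_Lk: "cf (Lk p) = Lp p"
proof
  fix w
  show "cf (Lk p) w = Lp p w"
    unfolding Lk_def Lp_def cf_sum by (rule sum.cong) (auto simp: cf_Tb transpose_SN)
qed

lemma TT_transpose_Suc:
  assumes "1 \<le> k" "k < p" shows "TT (transpose k (Suc p)) = Ti p * TT (transpose k p) * Ti p"
proof -
  have s: "transpose k p \<in> SN" using assms by (intro transpose_SN) auto
  have 1: "Ti p * TT (transpose k p) = TT (transpose k p \<circ> sgen p)"
    using assms s by (intro Ti_mult_TT_asc) (auto simp: transpose_def)
  have "TT (transpose k p \<circ> sgen p) * Ti p = TT (sgen p \<circ> (transpose k p \<circ> sgen p))"
    using assms s by (intro TT_mult_Ti_asc) (auto simp: sgen_right_SN_iff inv_sgen_right sgen_if transpose_def)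
  moreover have "sgen p \<circ> (transpose k p \<circ> sgen p) = transpose k (Suc p)"
    using assms by (intro ext) (auto simp: sgen_def transpose_def)
  ultimately show ?thesis using 1 by simp
qed

text \<open>The transposition (k, p + 1) is s_p (k, p) s_p with lengths adding up, which shifts the
  summation index by one; the remaining summand i = 1 is the single generator T_p.\<close>

lemma Lk_Suc:
  assumes p: "1 \<le> p"
  shows "Lk (Suc p) = smul (inverse qq) (Ti p * Lk p * Ti p + Ti p)"
proof -
  define F where "F i = smul (qq powi (- int i)) (TT (transpose (Suc p - i) (Suc p)))" for i
  have set: "{1..<Suc p} = insert 1 (Suc ` {1..<p})"
    unfolding image_Suc_atLeastLessThan using p by auto
  have "Lk (Suc p) = sum F (insert 1 (Suc ` {1..<p}))"
    unfolding Lk_def set F_def ..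
  also have "\<dots> = F 1 + (\<Sum>i\<in>{1..<p}. F (Suc i))"
  proof -
    have "sum F (Suc ` {1..<p}) = (\<Sum>i\<in>{1..<p}. F (Suc i))"
      by (rule sum.reindex_cong[of Suc]) auto
    moreover have "sum F (insert 1 (Suc ` {1..<p})) = F 1 + sum F (Suc ` {1..<p})"
      by (rule sum.insert) auto
    ultimately show ?thesis by metis
  qed
  also have "F 1 = smul (inverse qq) (Ti p)"
    by (simp add: F_def sgen_def power_int_minus)
  also have "(\<Sum>i\<in>{1..<p}. F (Suc i)) = (\<Sum>i\<in>{1..<p}. smul (qq powi (- int (Suc i))) (TT (transpose (p - i) (Suc p))))"
    by (simp only: F_def diff_Suc_Suc)
  also have "(\<Sum>i\<in>{1..<p}. smul (qq powi (- int (Suc i))) (TT (transpose (p - i) (Suc p))))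
     = (\<Sum>i\<in>{1..<p}. smul (inverse qq) (Ti p * smul (qq powi (- int i)) (TT (transpose (p - i) p)) * Ti p))"
  proof (rule sum.cong)
    fix i assume i: "i \<in> {1..<p}"
    have e: "qq powi (- int (Suc i)) = inverse qq * qq powi (- int i)"
      by (simp only: power_int_minus power_int_of_nat power_Suc inverse_mult_distrib)
    show "smul (qq powi (- int (Suc i))) (TT (transpose (p - i) (Suc p)))
       = smul (inverse qq) (Ti p * smul (qq powi (- int i)) (TT (transpose (p - i) p)) * Ti p)"
      unfolding e using i TT_transpose_Suc[of "p - i" p] by (simp add: Suc_le_eq)
  qed simp
  also have "\<dots> = smul (inverse qq) (Ti p * Lk p * Ti p)"
    unfolding Lk_def by (simp only: sum_distrib_left sum_distrib_right hk.scale_sum_right)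
  finally show ?thesis by (simp add: hk.scale_right_distrib add.commute)
qed

lemma JM_Lk: "JM p = 1 + smul (qq - 1) (Lk p)"
proof (induction p)
  case (Suc p)
  show ?case
  proof (cases "p = 0")
    case True
    then show ?thesis by (simp add: Lk_def)
  next
    case False
    then have p: "1 \<le> p" by simp
    have "Ti p * JM p * Ti p = Ti p * Ti p + smul (qq - 1) (Ti p * Lk p * Ti p)"
      unfolding Suc by (simp add: algebra_simps)
    also have "\<dots> = smul qq 1 + smul (qq - 1) (Ti p * Lk p * Ti p + Ti p)"
      unfolding Ti_sq[OF p] by (simp add: hk.scale_right_distrib add_ac)
    finally show ?thesis using p
      by (simp add: JM_Suc Lk_Suc hk.scale_right_distrib mult.commute[of "inverse qq"])
  qed
qed (simp add: Lk_def)

section \<open>The Hermitian form\<close>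

text \<open>The T_w are orthogonal and T_w has norm q to the power of its length; this weight is
  what makes right multiplication by every T_i self-adjoint. The second argument is
  conjugated.\<close>

definition ip :: "hk \<Rightarrow> hk \<Rightarrow> K" where
  "ip a b = (\<Sum>w\<in>{w. cf a w \<noteq> 0}. qq ^ plen w * cf a w * kc (cf b w))"

lemma ip_superset:
  assumes "finite X" "\<And>w. cf a w \<noteq> 0 \<Longrightarrow> cf b w \<noteq> 0 \<Longrightarrow> w \<in> X"
  shows "ip a b = (\<Sum>w\<in>X. qq ^ plen w * cf a w * kc (cf b w))"
proof -
  have "ip a b = (\<Sum>w\<in>X \<union> {w. cf a w \<noteq> 0}. qq ^ plen w * cf a w * kc (cf b w))"
    unfolding ip_def using finite_cf assms(1) by (intro sum.mono_neutral_left) auto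
  also have "\<dots> = (\<Sum>w\<in>X. qq ^ plen w * cf a w * kc (cf b w))"
  proof (rule sum.mono_neutral_right)
    have "cf b w = 0" if "w \<in> X \<union> {w. cf a w \<noteq> 0} - X" for w using that assms(2) by blast
    then show "\<forall>w\<in>X \<union> {w. cf a w \<noteq> 0} - X. qq ^ plen w * cf a w * kc (cf b w) = 0"
      by (metis kc_0 mult_zero_right)
  qed (use finite_cf assms in auto)
  finally show ?thesis .
qed

lemma ip_add_left: "ip (a + b) c = ip a c + ip b c"
proof -
  let ?X = "{w. cf c w \<noteq> 0}"
  have "ip x c = (\<Sum>w\<in>?X. qq ^ plen w * cf x w * kc (cf c w))" for x
    using finite_cf by (intro ip_superset) auto
  then show ?thesis by (simp add: sum.distrib algebra_simps)
qed

lemma ip_smul_left: "ip (smul k a) c = k * ip a c"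
proof -
  let ?X = "{w. cf c w \<noteq> 0}"
  have "ip x c = (\<Sum>w\<in>?X. qq ^ plen w * cf x w * kc (cf c w))" for x
    using finite_cf by (intro ip_superset) auto
  then show ?thesis by (simp add: sum_distrib_left algebra_simps)
qed

lemma ip_commute: "ip a b = kc (ip b a)"
proof -
  have "ip b a = (\<Sum>w\<in>{w. cf a w \<noteq> 0}. qq ^ plen w * cf b w * kc (cf a w))"
    using finite_cf by (intro ip_superset) auto
  then show ?thesis by (simp add: ip_def mult_ac)
qed

lemma ip_add_right: "ip a (b + c) = ip a b + ip a c"
  by (metis ip_commute ip_add_left kc_add)

lemma ip_smul_right: "ip a (smul k c) = kc k * ip a c"
  by (metis ip_commute ip_smul_left kc_mult kc_kc)

lemma ip_0_left [simp]: "ip 0 a = 0" by (simp add: ip_def)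
lemma ip_0_right [simp]: "ip a 0 = 0" by (metis ip_commute ip_0_left kc_0)

lemma ip_diff_left: "ip (a - b) c = ip a c - ip b c"
  using ip_add_left[of "a - b" b c] by simp

lemma ip_sum_left: "ip (sum f X) c = (\<Sum>x\<in>X. ip (f x) c)"
  by (induction X rule: infinite_finite_induct) (auto simp: ip_add_left)

lemma ip_sum_right: "ip c (sum f X) = (\<Sum>x\<in>X. ip c (f x))"
  by (induction X rule: infinite_finite_induct) (auto simp: ip_add_right)

lemma ip_eq_0: "ip a a = 0 \<Longrightarrow> a = 0"
proof (rule hk_eqI)
  fix w assume z: "ip a a = 0"
  show "cf a w = cf 0 w"
  proof (rule ccontr)
    assume "cf a w \<noteq> cf 0 w"
    then have w: "w \<in> {w. cf a w \<noteq> 0}" by simp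
    have "qq ^ plen w * cf a w * kc (cf a w) = 0"
      by (rule Kpos_sum_eq_0[OF finite_cf _ z[unfolded ip_def] w])
         (simp add: mult.assoc Kpos_mult Kpos_power Kpos_qq Kpos_norm)
    then have "kc (cf a w) = 0" using w by simp
    then show False using w kc_kc[of "cf a w"] by simp
  qed
qed

text \<open>The difference of the two summands at v changes sign when v is replaced by s_i v. Its
  sum over a finite set stable under this involution is therefore zero.\<close>

lemma ip_mult_Ti:
  assumes i: "1 \<le> i" shows "ip (a * Ti i) b = ip a (b * Ti i)"
proof -
  let ?s = "\<lambda>v. sgen i \<circ> v"
  define Y where "Y = {w. cf a w \<noteq> 0} \<union> {w. cf b w \<noteq> 0}"
  define X where "X = Y \<union> ?s ` Y"
  have fin: "finite X" unfolding X_def Y_def using finite_cf by simp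
  have inX: "w \<in> X" if "cf a w \<noteq> 0 \<or> cf b w \<noteq> 0" for w using that by (auto simp: X_def Y_def)
  have sX: "?s w \<in> X" if "w \<in> X" for w
    using that sgen_cancel_left unfolding X_def by (metis UnCI UnE imageE imageI)
  have "w \<in> SN" if "w \<in> Y" for w using that cf_outside[of w] unfolding Y_def by blast
  then have SN: "w \<in> SN" if "w \<in> X" for w
    using that sgen_left_SN_iff[OF i] unfolding X_def by blast
  define F where "F v = qq ^ plen v * cf (a * Ti i) v * kc (cf b v) - qq ^ plen v * cf a v * kc (cf (b * Ti i) v)" for v
  have anti: "F (?s v) = - F v" if "v \<in> X" for v
  proof -
    define u where "u = ?s v"
    have v: "?s u = v" by (simp add: u_def)
    have pl: "plen u = Suc (plen v) \<or> plen v = Suc (plen u)"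
      unfolding u_def using plen_left_cases[OF SN[OF that] i] .
    show ?thesis using pl unfolding u_def[symmetric] F_def cf_mult_Ti[OF i] mulTs_def Let_def v u_def[symmetric]
      by (auto simp: algebra_simps)
  qed
  have "sum F X = sum (\<lambda>v. F (?s v)) X"
    by (rule sum.reindex_bij_witness[of _ ?s ?s]) (auto simp: sX)
  also have "\<dots> = - sum F X" using anti by (simp add: sum_negf)
  finally have "2 * sum F X = 0" by (simp add: eq_neg_iff_add_eq_0)
  moreover have "(2::K) \<noteq> 0" using Kpos_add_eq_0[OF Kpos_1 Kpos_1] by auto
  ultimately have "sum F X = 0" by simp
  moreover have "ip (a * Ti i) b = (\<Sum>w\<in>X. qq ^ plen w * cf (a * Ti i) w * kc (cf b w))"
    using fin inX by (intro ip_superset) auto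
  moreover have "ip a (b * Ti i) = (\<Sum>w\<in>X. qq ^ plen w * cf a w * kc (cf (b * Ti i) w))"
    using fin inX by (intro ip_superset) auto
  ultimately show ?thesis by (simp add: F_def sum_subtractf)
qed

lemma ip_mult_JM: "ip (a * JM p) b = ip a (b * JM p)"
proof (induction p arbitrary: a b)
  case (Suc p)
  show ?case
  proof (cases "p = 0")
    case False
    then have p: "1 \<le> p" by simp
    have "ip (a * Ti p * JM p * Ti p) b = ip a (b * Ti p * JM p * Ti p)"
      by (simp add: ip_mult_Ti[OF p] Suc)
    then show ?thesis using p by (simp add: JM_Suc ip_smul_left ip_smul_right mult.assoc)
  qed simp
qed simp

text \<open>The adjoint reverses a product of the self-adjoint T_i and conjugates scalars, so it
  stays in the same finite Hecke algebra.\<close>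

lemma adjoint_exists:
  assumes "h \<in> Hm m"
  shows "\<exists>h'\<in>Hm m. \<forall>a b. ip (a * h) b = ip a (b * h')"
  using assms
proof (induction rule: Hm_induct)
  case zero
  show ?case by (rule bexI[of _ 0]) auto
next
  case (add x y)
  then obtain x' y' where "x' \<in> Hm m" "y' \<in> Hm m" "\<forall>a b. ip (a * x) b = ip a (b * x')" "\<forall>a b. ip (a * y) b = ip a (b * y')"
    by blast
  then show ?case by (intro bexI[of _ "x' + y'"]) (auto simp: distrib_left ip_add_left ip_add_right Hm_add)
next
  case (TT c w)
  from TT have "\<exists>h'\<in>Hm m. \<forall>a b. ip (a * TT w) b = ip a (b * h')"
  proof (induction rule: permutes_length_induct)
    case id
    show ?case by (rule bexI[of _ 1]) (simp_all add: id_def[symmetric])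
  next
    case (step w i)
    then obtain h' where h': "h' \<in> Hm m" "\<forall>a b. ip (a * TT w) b = ip a (b * h')" by blast
    have "\<forall>a b. ip (a * TT (sgen i \<circ> w)) b = ip a (b * (Ti i * h'))"
      unfolding TT_comp_sgen[OF step(1,2,4)] using h' by (simp add: ip_mult_Ti[OF step(2)] flip: mult.assoc)
    moreover have "Ti i * h' \<in> Hm m" using h' step by (simp add: Hm_mult Hm_Ti)
    ultimately show ?case by metis
  qed
  then obtain h' where "h' \<in> Hm m" "\<forall>a b. ip (a * TT w) b = ip a (b * h')" by blast
  then show ?case by (intro bexI[of _ "smul (kc c) h'"]) (auto simp: ip_smul_left ip_smul_right Hm_smul)
qed

text \<open>Gram-Schmidt, one generator at a time. Dividing by the norm of the new orthogonal
  component b' is possible because the form is anisotropic.\<close>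

lemma orth_projection:
  assumes "finite F"
  shows "\<exists>n\<in>hk.span F. \<forall>b\<in>hk.span F. ip (a - n) b = 0"
proof -
  have "\<exists>n\<in>hk.span F. \<forall>b\<in>F. ip (a - n) b = 0" for a
    using assms
  proof (induction F arbitrary: a rule: finite_induct)
    case empty
    show ?case by (rule bexI[of _ 0]) (auto simp: hk.span_zero)
  next
    case (insert b F)
    obtain nb where nb: "nb \<in> hk.span F" "\<forall>x\<in>F. ip (b - nb) x = 0" using insert by blast
    obtain na where na: "na \<in> hk.span F" "\<forall>x\<in>F. ip (a - na) x = 0" using insert by blast
    have sub: "hk.span F \<subseteq> hk.span (insert b F)" by (rule hk.span_mono) auto
    define b' where "b' = b - nb"
    have orth: "ip x y = 0" if "\<forall>y\<in>F. ip x y = 0" "y \<in> hk.span F" for x y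
      using that(2) by (induction rule: hk.span_induct_alt) (auto simp: ip_add_right ip_smul_right that(1))
    have b'0: "ip b' nb = 0" using orth nb unfolding b'_def by blast
    have bb: "b = b' + nb" by (simp add: b'_def)
    show ?case
    proof (cases "b' = 0")
      case True
      then have "b \<in> hk.span F" using nb bb by simp
      then have "\<forall>y\<in>insert b F. ip (a - na) y = 0" using orth na by blast
      then show ?thesis using na sub by blast
    next
      case False
      define k where "k = ip (a - na) b' / ip b' b'"
      have n: "ip b' b' \<noteq> 0" using False ip_eq_0 by blast
      have 1: "ip (a - (na + smul k b')) y = 0" if "y \<in> F" for y
        using that nb na by (simp add: ip_diff_left ip_add_left ip_smul_left b'_def)
      have "ip (a - na) nb = 0" using orth na nb by blast
      then have "ip (a - na) b' = ip (a - na) b" unfolding bb by (simp add: ip_add_right)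
      moreover have "ip b' b = ip b' b'" unfolding bb using b'0 by (simp add: ip_add_right)
      moreover have "k * ip b' b' = ip (a - na) b'" using n by (simp add: k_def)
      moreover have "ip (a - (na + smul k b')) b = ip (a - na) b - k * ip b' b"
        by (simp add: ip_diff_left ip_add_left ip_smul_left)
      ultimately have 2: "ip (a - (na + smul k b')) b = 0" by simp
      have "na + smul k b' \<in> hk.span (insert b F)"
        unfolding b'_def using na nb sub by (intro hk.span_add hk.span_scale hk.span_diff) (auto intro: hk.span_base)
      then show ?thesis using 1 2 by blast
    qed
  qed
  then obtain n where n: "n \<in> hk.span F" "\<forall>b\<in>F. ip (a - n) b = 0" by blast
  have "ip (a - n) b = 0" if "b \<in> hk.span F" for b
    using that by (induction rule: hk.span_induct_alt) (auto simp: ip_add_right ip_smul_right n(2))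
  then show ?thesis using n by blast
qed

section \<open>Joint eigenvectors of the Jucys--Murphy elements\<close>

definition eigv :: "nat \<Rightarrow> (nat \<Rightarrow> int) \<Rightarrow> hk \<Rightarrow> bool" where
  "eigv m c g \<longleftrightarrow> (\<forall>p. 1 \<le> p \<longrightarrow> p \<le> m \<longrightarrow> g * JM p = smul (qq powi (c p)) g)"

lemma eigvD: "eigv m c g \<Longrightarrow> 1 \<le> p \<Longrightarrow> p \<le> m \<Longrightarrow> g * JM p = smul (qq powi (c p)) g"
  unfolding eigv_def by blast

text \<open>The solution x of x (q^b - q^a) = (q - 1) q^b. For this x, subtracting x g from g T_i
  removes the g component in the commutation rule and exchanges the eigenvalues q^a and q^b.\<close>

definition icoef :: "int \<Rightarrow> int \<Rightarrow> K" where
  "icoef a b = (qq - 1) * qq powi b / (qq powi b - qq powi a)"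

lemma icoef_adjacent:
  "icoef a (a + 1) = qq" "icoef a (a - 1) = -1"
proof -
  have n: "qq powi a \<noteq> 0" by simp
  have "qq powi (a + 1) = qq * qq powi a" by (simp add: power_int_add)
  then have "qq powi (a + 1) - qq powi a = (qq - 1) * qq powi a" by (simp add: algebra_simps)
  then show "icoef a (a + 1) = qq" unfolding icoef_def using n \<open>qq powi (a + 1) = qq * qq powi a\<close> by simp
  have "qq powi a = qq * qq powi (a - 1)" by (simp add: power_int_diff)
  then have "qq powi (a - 1) - qq powi a = - ((qq - 1) * qq powi (a - 1))" by (simp add: algebra_simps)
  then show "icoef a (a - 1) = -1" unfolding icoef_def using n by simp
qed

text \<open>The second equation makes the passage reversible: a further factor in T_i returns to g
  as long as (q - x) (1 + x) is nonzero, which fails only when the two contents are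
  adjacent.\<close>

lemma eigv_intertwine:
  assumes e: "eigv m c g" and i: "1 \<le> i" "i < m" and ne: "c i \<noteq> c (Suc i)"
  defines "x \<equiv> icoef (c i) (c (Suc i))"
  shows "eigv m (c \<circ> sgen i) (g * Ti i - smul x g)"
    and "(g * Ti i - smul x g) * Ti i = smul (qq - 1 - x) (g * Ti i - smul x g) + smul ((qq - x) * (1 + x)) g"
proof -
  define a b where "a = qq powi (c i)" and "b = qq powi (c (Suc i))"
  have ab: "a \<noteq> b" using ne by (simp add: a_def b_def qq_powi_eq_iff)
  have x: "x * (b - a) = (qq - 1) * b" using ab by (simp add: x_def icoef_def a_def b_def)
  have ga: "g * JM i = smul a g" and gb: "g * JM (Suc i) = smul b g"
    using eigvD[OF e] i by (auto simp: a_def b_def)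
  define g' where "g' = g * Ti i - smul x g"
  have 1: "g * Ti i * JM i = smul b (g * Ti i) - smul ((qq - 1) * b) g"
  proof -
    have "g * (JM (Suc i) * Ti i) = g * Ti i * JM i + smul (qq - 1) (g * JM (Suc i))"
      using JM_Suc_Ti[OF i(1)] by (simp add: distrib_left mult.assoc)
    then show ?thesis by (simp add: gb algebra_simps flip: mult.assoc)
  qed
  have 2: "g * Ti i * JM (Suc i) = smul a (g * Ti i) + smul ((qq - 1) * b) g"
  proof -
    have "g * (Ti i * JM (Suc i)) = g * JM i * Ti i + smul (qq - 1) (g * JM (Suc i))"
      using Ti_JM_Suc[OF i(1)] by (simp add: distrib_left mult.assoc)
    then show ?thesis by (simp add: ga gb mult.assoc)
  qed
  have e1: "g' * JM i = smul b g'"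
  proof -
    have "g' * JM i = smul b (g * Ti i) - smul ((qq - 1) * b + x * a) g"
      by (simp add: g'_def left_diff_distrib 1 ga hk.scale_left_distrib)
    also have "(qq - 1) * b + x * a = b * x" using x by (simp add: algebra_simps)
    finally show ?thesis by (simp add: g'_def hk.scale_right_diff_distrib)
  qed
  have e2: "g' * JM (Suc i) = smul a g'"
  proof -
    have "g' * JM (Suc i) = smul a (g * Ti i) + smul ((qq - 1) * b - x * b) g"
      by (simp add: g'_def left_diff_distrib 2 gb hk.scale_left_diff_distrib)
    also have "(qq - 1) * b - x * b = - (a * x)" using x by (simp add: algebra_simps)
    finally show ?thesis by (simp add: g'_def hk.scale_right_diff_distrib)
  qed
  show "eigv m (c \<circ> sgen i) (g * Ti i - smul x g)"
    unfolding eigv_def g'_def[symmetric]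
  proof (intro allI impI)
    fix p assume p: "1 \<le> p" "p \<le> m"
    consider "p = i" | "p = Suc i" | "p < i" | "Suc i < p" by linarith
    then show "g' * JM p = smul (qq powi ((c \<circ> sgen i) p)) g'"
    proof cases
      case 1
      then show ?thesis using e1 by (simp add: b_def)
    next
      case 2
      then show ?thesis using e2 by (simp add: a_def)
    next
      case 3
      then have "Ti i * JM p = JM p * Ti i" by (rule JM_commute_above)
      then have "g' * JM p = g * JM p * Ti i - smul x (g * JM p)" by (simp add: g'_def left_diff_distrib mult.assoc)
      then show ?thesis using 3 eigvD[OF e p]
        by (simp add: g'_def sgen_other hk.scale_right_diff_distrib hk.scale_left_commute mult.commute)
    next
      case 4
      then have "Ti i * JM p = JM p * Ti i" using i by (intro JM_commute_below)
      then have "g' * JM p = g * JM p * Ti i - smul x (g * JM p)" by (simp add: g'_def left_diff_distrib mult.assoc)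
      then show ?thesis using 4 eigvD[OF e p]
        by (simp add: g'_def sgen_other hk.scale_right_diff_distrib hk.scale_left_commute mult.commute)
    qed
  qed
  have "g' * Ti i = g * (Ti i * Ti i) - smul x (g * Ti i)" by (simp add: g'_def left_diff_distrib mult.assoc)
  also have "\<dots> = smul (qq - 1 - x) (g * Ti i) + smul qq g"
    unfolding Ti_sq[OF i(1)] by (simp add: distrib_left hk.scale_left_diff_distrib right_diff_distrib)
  also have "g * Ti i = g' + smul x g" by (simp add: g'_def)
  also have "smul (qq - 1 - x) (g' + smul x g) + smul qq g = smul (qq - 1 - x) g' + smul ((qq - 1 - x) * x + qq) g"
    by (simp add: hk.scale_right_distrib hk.scale_left_distrib add.assoc)
  also have "(qq - 1 - x) * x + qq = (qq - x) * (1 + x)" by (simp add: algebra_simps)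
  finally show "(g * Ti i - smul x g) * Ti i = smul (qq - 1 - x) (g * Ti i - smul x g) + smul ((qq - x) * (1 + x)) g"
    unfolding g'_def .
qed

text \<open>The usual argument for self-adjoint operators; the eigenvalues are powers of q and hence
  fixed by conjugation.\<close>

lemma eigv_orth:
  assumes "eigv m c g" "eigv m c' g'" "1 \<le> p" "p \<le> m" "c p \<noteq> c' p"
  shows "ip g g' = 0"
proof -
  have "qq powi (c p) * ip g g' = ip (g * JM p) g'" using eigvD[OF assms(1,3,4)] by (simp add: ip_smul_left)
  also have "\<dots> = ip g (g' * JM p)" by (rule ip_mult_JM)
  also have "\<dots> = qq powi (c' p) * ip g g'" using eigvD[OF assms(2,3,4)] by (simp add: ip_smul_right)
  finally show ?thesis using assms(5) by (simp add: qq_powi_eq_iff)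
qed

text \<open>At adjacent contents the intertwined vector g' is an eigenvector of T_i. Its contents
  are those of g with i and i + 1 exchanged, so it is orthogonal to g, and moving T_i across the
  form shows that g' has norm zero. Positivity thus replaces the argument that no standard tableau
  has the exchanged contents.\<close>

lemma eigv_adjacent:
  assumes e: "eigv m c g" and i: "1 \<le> i" "i < m" and adj: "c (Suc i) = c i + 1 \<or> c (Suc i) = c i - 1"
  shows "g * Ti i = smul (icoef (c i) (c (Suc i))) g"
proof -
  define x where "x = icoef (c i) (c (Suc i))"
  define g' where "g' = g * Ti i - smul x g"
  have ne: "c i \<noteq> c (Suc i)" using adj by auto
  have x: "(qq - x) * (1 + x) = 0" using adj icoef_adjacent unfolding x_def by auto
  have e': "eigv m (c \<circ> sgen i) g'" and sq: "g' * Ti i = smul (qq - 1 - x) g'"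
    using eigv_intertwine[OF e i ne] x unfolding g'_def x_def[symmetric] by simp_all
  have o: "ip g g' = 0" by (rule eigv_orth[OF e e', of i]) (use i ne in auto)
  have "ip g' g' = ip (g * Ti i) g' - x * ip g g'"
    unfolding g'_def by (simp add: ip_diff_left ip_smul_left)
  also have "ip (g * Ti i) g' = ip g (g' * Ti i)" by (rule ip_mult_Ti[OF i(1)])
  also have "\<dots> = 0" unfolding sq by (simp add: ip_smul_right o)
  finally have "ip g' g' = 0" using o by simp
  then have "g' = 0" by (rule ip_eq_0)
  then show ?thesis by (simp add: g'_def x_def)
qed

lemma icoef_nonadjacent:
  assumes "c i \<noteq> c (Suc i)" "c (Suc i) \<noteq> c i + 1" "c (Suc i) \<noteq> c i - (1::int)"
  shows "(qq - icoef (c i) (c (Suc i))) * (1 + icoef (c i) (c (Suc i))) \<noteq> 0"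
proof -
  define a b where "a = qq powi (c i)" and "b = qq powi (c (Suc i))"
  have ab: "b - a \<noteq> 0" using assms(1) by (simp add: a_def b_def qq_powi_eq_iff)
  have "b \<noteq> qq * a" using assms(2) qq_powi_eq_iff[of "c (Suc i)" "c i + 1"] by (simp add: a_def b_def power_int_add mult.commute)
  moreover have "a \<noteq> qq * b"
    using assms(3) qq_powi_eq_iff[of "c i" "c (Suc i) + 1"] by (auto simp: a_def b_def power_int_add mult.commute)
  moreover have "qq - icoef (c i) (c (Suc i)) = (b - qq * a) / (b - a)"
    unfolding icoef_def a_def[symmetric] b_def[symmetric] using ab by (simp add: field_simps)
  moreover have "1 + icoef (c i) (c (Suc i)) = (qq * b - a) / (b - a)"
    unfolding icoef_def a_def[symmetric] b_def[symmetric] using ab by (simp add: field_simps)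
  ultimately show ?thesis using ab by simp
qed

section \<open>Young subgroups\<close>

text \<open>A Young subgroup is given by a monotone labelling \<open>b\<close> of the blocks.\<close>

definition Yg :: "nat \<Rightarrow> (nat \<Rightarrow> nat) \<Rightarrow> (nat \<Rightarrow> nat) set" where
  "Yg m b = {w. w permutes {1..m} \<and> (\<forall>k\<in>{1..m}. b (w k) = b k)}"

definition same_block :: "nat \<Rightarrow> (nat \<Rightarrow> nat) \<Rightarrow> nat \<Rightarrow> bool" where
  "same_block m b i \<longleftrightarrow> 1 \<le> i \<and> i < m \<and> b i = b (Suc i)"

definition Xs :: "nat \<Rightarrow> (nat \<Rightarrow> nat) \<Rightarrow> hk" where
  "Xs m b = (\<Sum>w\<in>Yg m b. TT w)"

text \<open>The weights (- 1/q) to the length are the ones for which every T_i of the Young subgroup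
  acts by the sign - 1.\<close>

definition Ys :: "nat \<Rightarrow> (nat \<Rightarrow> nat) \<Rightarrow> hk" where
  "Ys m b = (\<Sum>w\<in>Yg m b. smul ((- inverse qq) ^ plen w) (TT w))"

lemma finite_Yg [simp]: "finite (Yg m b)"
  by (rule finite_subset[OF _ finite_Sm[of m]]) (auto simp: Yg_def)

lemma id_Yg [simp]: "id \<in> Yg m b"
  unfolding Yg_def using permutes_id by simp

lemma Yg_permutes: "w \<in> Yg m b \<Longrightarrow> w permutes {1..m}"
  by (simp add: Yg_def)

lemma Yg_SN: "w \<in> Yg m b \<Longrightarrow> w \<in> SN"
  using Yg_permutes SN_I by blast

lemma Yg_label: "w \<in> Yg m b \<Longrightarrow> k \<in> {1..m} \<Longrightarrow> b (w k) = b k"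
  unfolding Yg_def by blast

lemma Yg_comp: "v \<in> Yg m b \<Longrightarrow> w \<in> Yg m b \<Longrightarrow> v \<circ> w \<in> Yg m b"
proof -
  assume v: "v \<in> Yg m b" and w: "w \<in> Yg m b"
  have "b ((v \<circ> w) k) = b k" if "k \<in> {1..m}" for k
    using that permutes_in_image[OF Yg_permutes[OF w], of k] Yg_label[OF w that] Yg_label[OF v, of "w k"]
    by (simp only: comp_apply)
  then show ?thesis unfolding Yg_def using permutes_comp[OF Yg_permutes[OF v] Yg_permutes[OF w]] by blast
qed

lemma Yg_inv: "v \<in> Yg m b \<Longrightarrow> inv v \<in> Yg m b"
proof -
  assume v: "v \<in> Yg m b"
  note p = permutes_inv[OF Yg_permutes[OF v]]
  have "b (inv v k) = b k" if "k \<in> {1..m}" for k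
    using Yg_label[OF v, of "inv v k"] permutes_in_image[OF p, of k] that inv_SN_apply(1)[OF Yg_SN[OF v]] by metis
  then show ?thesis unfolding Yg_def using p by blast
qed

lemma sgen_Yg: "same_block m b i \<Longrightarrow> sgen i \<in> Yg m b"
  unfolding Yg_def same_block_def using sgen_permutes by (auto simp: sgen_if)

lemma sgen_left_Yg: "same_block m b i \<Longrightarrow> w \<in> Yg m b \<Longrightarrow> sgen i \<circ> w \<in> Yg m b"
  by (intro Yg_comp sgen_Yg)

lemma sgen_right_Yg: "same_block m b i \<Longrightarrow> w \<in> Yg m b \<Longrightarrow> w \<circ> sgen i \<in> Yg m b"
  by (intro Yg_comp sgen_Yg)

lemma hk_antisym_sum_zero:
  fixes F :: "'a \<Rightarrow> hk"
  assumes "\<And>x. x \<in> X \<Longrightarrow> s x \<in> X" "\<And>x. x \<in> X \<Longrightarrow> s (s x) = x" "\<And>x. x \<in> X \<Longrightarrow> F (s x) = - F x"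
  shows "sum F X = 0"
proof -
  have "sum F X = sum (\<lambda>x. F (s x)) X"
    by (rule sum.reindex_bij_witness[of _ s s]) (use assms in auto)
  also have "\<dots> = - sum F X" using assms(3) by (simp add: sum_negf)
  finally have "sum F X + sum F X = 0" by (simp add: eq_neg_iff_add_eq_0)
  then have "smul 2 (sum F X) = 0" using hk.scale_left_distrib[of 1 1 "sum F X"] by simp
  moreover have "(2::K) \<noteq> 0" using Kpos_add_eq_0[OF Kpos_1 Kpos_1] by auto
  ultimately show ?thesis by simp
qed

text \<open>Pair w with s_i w: the defect T_w T_i - q T_w changes sign within each pair. The proofs
  for \<open>Ys\<close> and for multiplication from the left use the same pairing.\<close>

lemma Xs_Ti:
  assumes "same_block m b i" shows "Xs m b * Ti i = smul qq (Xs m b)"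
proof -
  define F where "F w = TT w * Ti i - smul qq (TT w)" for w
  have i: "1 \<le> i" using assms by (simp add: same_block_def)
  have asc: "F (sgen i \<circ> w) = - F w" if w: "w \<in> SN" and a: "inv w i < inv w (Suc i)" for w
  proof -
    have s: "sgen i \<circ> w \<in> SN" using w i by (simp add: sgen_left_SN_iff)
    have d: "inv (sgen i \<circ> w) (Suc i) < inv (sgen i \<circ> w) i" using a by (simp add: inv_sgen_left[OF w])
    show ?thesis unfolding F_def TT_mult_Ti_asc[OF w i a] TT_mult_Ti_desc[OF s i d]
      by (simp add: hk.scale_left_diff_distrib)
  qed
  have anti: "F (sgen i \<circ> w) = - F w" if "w \<in> Yg m b" for w
  proof (cases "inv w i < inv w (Suc i)")
    case True
    then show ?thesis using asc Yg_SN[OF that] by blast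
  next
    case False
    note w = Yg_SN[OF that]
    have s: "sgen i \<circ> w \<in> SN" using w i by (simp add: sgen_left_SN_iff)
    have "inv w (Suc i) < inv w i" using False inv_neq_Suc[OF w, of i] by linarith
    then have "inv (sgen i \<circ> w) i < inv (sgen i \<circ> w) (Suc i)" by (simp add: inv_sgen_left[OF w])
    from asc[OF s this] show ?thesis by simp
  qed
  have "sum F (Yg m b) = 0"
    by (rule hk_antisym_sum_zero[of _ "\<lambda>w. sgen i \<circ> w"]) (use anti sgen_left_Yg[OF assms] in auto)
  then show ?thesis by (simp add: F_def Xs_def sum_subtractf sum_distrib_right hk.scale_sum_right)
qed

lemma Ys_Ti:
  assumes "same_block m b i" shows "Ys m b * Ti i = - Ys m b"
proof -
  define F where "F w = smul ((- inverse qq) ^ plen w) (TT w * Ti i + TT w)" for w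
  have i: "1 \<le> i" using assms by (simp add: same_block_def)
  have asc: "F (sgen i \<circ> w) = - F w" if w: "w \<in> SN" and a: "inv w i < inv w (Suc i)" for w
  proof -
    have s: "sgen i \<circ> w \<in> SN" using w i by (simp add: sgen_left_SN_iff)
    have d: "inv (sgen i \<circ> w) (Suc i) < inv (sgen i \<circ> w) i" using a by (simp add: inv_sgen_left[OF w])
    have e: "smul qq (TT (sgen i \<circ> (sgen i \<circ> w))) + smul (qq - 1) (TT (sgen i \<circ> w)) + TT (sgen i \<circ> w)
      = smul qq (TT (sgen i \<circ> w) + TT w)"
      by (simp add: hk.scale_left_diff_distrib hk.scale_right_distrib)
    show ?thesis unfolding F_def TT_mult_Ti_asc[OF w i a] TT_mult_Ti_desc[OF s i d] plen_sgen_left_asc[OF w a] e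
      by simp
  qed
  have anti: "F (sgen i \<circ> w) = - F w" if "w \<in> Yg m b" for w
  proof (cases "inv w i < inv w (Suc i)")
    case True
    then show ?thesis using asc Yg_SN[OF that] by blast
  next
    case False
    note w = Yg_SN[OF that]
    have s: "sgen i \<circ> w \<in> SN" using w i by (simp add: sgen_left_SN_iff)
    have "inv w (Suc i) < inv w i" using False inv_neq_Suc[OF w, of i] by linarith
    then have "inv (sgen i \<circ> w) i < inv (sgen i \<circ> w) (Suc i)" by (simp add: inv_sgen_left[OF w])
    from asc[OF s this] show ?thesis by simp
  qed
  have "sum F (Yg m b) = 0"
    by (rule hk_antisym_sum_zero[of _ "\<lambda>w. sgen i \<circ> w"]) (use anti sgen_left_Yg[OF assms] in auto)
  moreover have "sum F (Yg m b) = Ys m b * Ti i + Ys m b"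
    by (simp add: F_def Ys_def sum.distrib sum_distrib_right hk.scale_right_distrib)
  ultimately show ?thesis by (simp add: eq_neg_iff_add_eq_0)
qed

lemma Ti_Xs:
  assumes "same_block m b i" shows "Ti i * Xs m b = smul qq (Xs m b)"
proof -
  define F where "F w = Ti i * TT w - smul qq (TT w)" for w
  have i: "1 \<le> i" using assms by (simp add: same_block_def)
  have asc: "F (w \<circ> sgen i) = - F w" if w: "w \<in> SN" and a: "w i < w (Suc i)" for w
  proof -
    have s: "w \<circ> sgen i \<in> SN" using w i by (simp add: sgen_right_SN_iff)
    have d: "(w \<circ> sgen i) (Suc i) < (w \<circ> sgen i) i" using a by simp
    show ?thesis unfolding F_def Ti_mult_TT_asc[OF w i a] Ti_mult_TT_desc[OF s i d]
      by (simp add: hk.scale_left_diff_distrib)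
  qed
  have anti: "F (w \<circ> sgen i) = - F w" if "w \<in> Yg m b" for w
  proof (cases "w i < w (Suc i)")
    case True
    then show ?thesis using asc Yg_SN[OF that] by blast
  next
    case False
    note w = Yg_SN[OF that]
    have s: "w \<circ> sgen i \<in> SN" using w i by (simp add: sgen_right_SN_iff)
    have "w (Suc i) < w i" using False neq_Suc[OF w, of i] by linarith
    then have "(w \<circ> sgen i) i < (w \<circ> sgen i) (Suc i)" by simp
    from asc[OF s this] have "F w = - F (w \<circ> sgen i)" unfolding sgen_cancel_right .
    then show ?thesis by simp
  qed
  have "sum F (Yg m b) = 0"
    by (rule hk_antisym_sum_zero[of _ "\<lambda>w. w \<circ> sgen i"]) (use anti sgen_right_Yg[OF assms] in auto)
  then show ?thesis by (simp add: F_def Xs_def sum_subtractf sum_distrib_left hk.scale_sum_right)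
qed

text \<open>At a descent of w the monotone labels of the two preimages are in reversed order, and w
  preserves labels; so i and i + 1 must lie in one block, and the descent is a generator of the
  Young subgroup.\<close>

lemma Yg_descent:
  assumes mono: "mono_on {1..m} b" and w: "w \<in> Yg m b" and "w \<noteq> id"
  obtains i where "same_block m b i" "inv w (Suc i) < inv w i"
proof -
  obtain i where i: "1 \<le> i" "i < m" "inv w (Suc i) < inv w i"
    using exists_left_descent[OF Yg_permutes[OF w] assms(3)] .
  note iw = Yg_inv[OF w]
  have ri: "i \<in> {1..m}" "Suc i \<in> {1..m}" using i by auto
  then have r: "inv w i \<in> {1..m}" "inv w (Suc i) \<in> {1..m}"
    using permutes_in_image[OF Yg_permutes[OF iw]] by blast+
  have "b (inv w (Suc i)) \<le> b (inv w i)" using mono_onD[OF mono r(2,1)] i by simp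
  then have "b (Suc i) \<le> b i" using Yg_label[OF iw ri(1)] Yg_label[OF iw ri(2)] by simp
  moreover have "b i \<le> b (Suc i)" using mono_onD[OF mono ri] by simp
  ultimately show ?thesis using that[of i] i by (simp add: same_block_def)
qed

text \<open>Conclusions are stated for a variable \<open>v\<close> so that unification does not eta-expand \<open>P\<close>.\<close>

lemma Yg_induct [consumes 2, case_names id step]:
  assumes mono: "mono_on {1..m} b" and w: "w \<in> Yg m b"
    and id: "\<And>v. v = id \<Longrightarrow> P v"
    and step: "\<And>v w i. v = sgen i \<circ> w \<Longrightarrow> w \<in> Yg m b \<Longrightarrow> same_block m b i \<Longrightarrow>
      inv w i < inv w (Suc i) \<Longrightarrow> plen v = Suc (plen w) \<Longrightarrow> P w \<Longrightarrow> P v"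
  shows "P w"
  using w
proof (induction "plen w" arbitrary: w rule: less_induct)
  case less
  show ?case
  proof (cases "w = id")
    case False
    obtain i where i: "same_block m b i" "inv w (Suc i) < inv w i"
      using Yg_descent[OF mono less.prems False] .
    note w = Yg_SN[OF less.prems]
    let ?u = "sgen i \<circ> w"
    have u: "?u \<in> Yg m b" using less.prems i sgen_left_Yg by blast
    have i1: "1 \<le> i" using i by (simp add: same_block_def)
    have l: "plen w = Suc (plen ?u)" using plen_sgen_left_desc[OF w i1 i(2)] .
    have "P ?u" using less.hyps u l by simp
    moreover have "inv ?u i < inv ?u (Suc i)" using i(2) by (simp add: inv_sgen_left[OF w])
    moreover have "w = sgen i \<circ> ?u" by simp
    ultimately show ?thesis using step u i(1) l by blast
  qed (rule id)
qed

section \<open>Vectors that absorb a symmetrizer\<close>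

lemma absorb_q:
  assumes "mono_on {1..m} b" and f: "\<And>i. same_block m b i \<Longrightarrow> f * Ti i = smul qq f" and "w \<in> Yg m b"
  shows "f * TT w = smul (qq ^ plen w) f"
  using assms(1,3)
proof (induction rule: Yg_induct)
  case (step v w i)
  have "f * TT v = f * TT w * Ti i"
    using step(1,3) TT_mult_Ti_asc[OF Yg_SN[OF step(2)] _ step(4)] by (simp add: mult.assoc same_block_def)
  also have "\<dots> = smul (qq * qq ^ plen w) f" using f[OF step(3)] step.IH by (simp add: mult.commute)
  finally show ?case using step(5) by simp
next
  case (id v)
  have "f * TT id = smul (qq ^ plen id) f" by simp
  then show ?case using id by (simp add: id_def)
qed

lemma absorb_sign:
  assumes "mono_on {1..m} b" and f: "\<And>i. same_block m b i \<Longrightarrow> f * Ti i = - f" and "w \<in> Yg m b"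
  shows "f * TT w = smul ((- 1) ^ plen w) f"
  using assms(1,3)
proof (induction rule: Yg_induct)
  case (step v w i)
  have "f * TT v = f * TT w * Ti i"
    using step(1,3) TT_mult_Ti_asc[OF Yg_SN[OF step(2)] _ step(4)] by (simp add: mult.assoc same_block_def)
  also have "\<dots> = smul (- ((- 1) ^ plen w)) f" using f[OF step(3)] step.IH by simp
  finally show ?case using step(5) by simp
next
  case (id v)
  have "f * TT id = smul ((- 1) ^ plen id) f" by simp
  then show ?case using id by (simp add: id_def)
qed

definition px :: "nat \<Rightarrow> (nat \<Rightarrow> nat) \<Rightarrow> K" where "px m b = (\<Sum>w\<in>Yg m b. qq ^ plen w)"
definition py :: "nat \<Rightarrow> (nat \<Rightarrow> nat) \<Rightarrow> K" where "py m b = (\<Sum>w\<in>Yg m b. inverse qq ^ plen w)"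

text \<open>All summands of the Poincare polynomial lie in the positive cone, and the identity
  contributes 1.\<close>

lemma px_nz [simp]: "px m b \<noteq> 0"
proof
  assume "px m b = 0"
  then have "qq ^ plen id = 0" unfolding px_def
    by (rule Kpos_sum_eq_0[OF finite_Yg, rotated]) (auto simp: Kpos_power Kpos_qq)
  then show False by simp
qed

lemma py_nz [simp]: "py m b \<noteq> 0"
proof
  assume "py m b = 0"
  then have "inverse qq ^ plen id = 0" unfolding py_def
    by (rule Kpos_sum_eq_0[OF finite_Yg, rotated]) (auto simp: Kpos_power Kpos_inverse_qq)
  then show False by simp
qed

lemma absorb_Xs:
  assumes "mono_on {1..m} b" and f: "\<And>i. same_block m b i \<Longrightarrow> f * Ti i = smul qq f"
  shows "f * Xs m b = smul (px m b) f"
  unfolding Xs_def px_def sum_distrib_left using absorb_q[OF assms] by (simp add: hk.scale_sum_left)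

lemma absorb_Ys:
  assumes "mono_on {1..m} b" and f: "\<And>i. same_block m b i \<Longrightarrow> f * Ti i = - f"
  shows "f * Ys m b = smul (py m b) f"
proof -
  have "f * Ys m b = (\<Sum>w\<in>Yg m b. smul ((- inverse qq) ^ plen w * (- 1) ^ plen w) f)"
    unfolding Ys_def sum_distrib_left using absorb_sign[OF assms] by simp
  also have "\<dots> = smul (py m b) f"
    unfolding py_def hk.scale_sum_left by (simp flip: power_mult_distrib)
  finally show ?thesis .
qed

lemma Xs_Hm: "Xs m b \<in> Hm m"
  unfolding Xs_def by (intro Hm_sum Hm_TT Yg_permutes)

lemma Ys_Hm: "Ys m b \<in> Hm m"
  unfolding Ys_def by (intro Hm_sum Hm_smul Hm_TT Yg_permutes)

lemma increasing_on_block: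
  assumes mono: "mono_on {1..m} b" and inc: "\<And>i. same_block m b i \<Longrightarrow> f i < (f (Suc i)::nat)"
    and "k < l" "k \<in> {1..m}" "l \<in> {1..m}" "b k = b l"
  shows "f k < f l"
proof -
  have "j \<le> l \<Longrightarrow> k < j \<Longrightarrow> f k < f j" for j
  proof (induction j)
    case (Suc j)
    have r: "j \<in> {1..m}" "Suc j \<in> {1..m}" using Suc.prems assms by auto
    have kj: "k \<le> j" using Suc.prems by simp
    have "b k \<le> b j" "b j \<le> b (Suc j)" "b (Suc j) \<le> b l"
      using mono_onD[OF mono assms(4) r(1)] mono_onD[OF mono r] mono_onD[OF mono r(2) assms(5)] Suc.prems kj by simp_all
    then have "same_block m b j" using assms r by (auto simp: same_block_def)
    then have "f j < f (Suc j)" by (rule inc)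
    then show ?case using Suc by (cases "k = j") auto
  qed simp
  then show ?thesis using assms by blast
qed

section \<open>Clashes and the products of an antisymmetrizer with a symmetrizer\<close>

definition clash :: "nat \<Rightarrow> (nat \<Rightarrow> nat) \<Rightarrow> (nat \<Rightarrow> nat) \<Rightarrow> (nat \<Rightarrow> nat) \<Rightarrow> bool" where
  "clash m b b' w \<longleftrightarrow> (\<exists>k\<in>{1..m}. \<exists>l\<in>{1..m}. k \<noteq> l \<and> b k = b l \<and> b' (w k) = b' (w l))"

lemma clash_right:
  assumes "same_block m b i" "clash m b b' w" shows "clash m b b' (w \<circ> sgen i)"
proof -
  obtain k l where kl: "k \<in> {1..m}" "l \<in> {1..m}" "k \<noteq> l" "b k = b l" "b' (w k) = b' (w l)"
    using assms(2) unfolding clash_def by blast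
  note s = sgen_Yg[OF assms(1)]
  have "sgen i k \<in> {1..m}" "sgen i l \<in> {1..m}" using kl permutes_in_image[OF Yg_permutes[OF s]] by blast+
  moreover have "sgen i k \<noteq> sgen i l" using kl(3) by (metis sgen_sgen)
  moreover have "b (sgen i k) = b (sgen i l)" using kl Yg_label[OF s] by simp
  moreover have "b' ((w \<circ> sgen i) (sgen i k)) = b' ((w \<circ> sgen i) (sgen i l))" using kl by simp
  ultimately show ?thesis unfolding clash_def by blast
qed

lemma clash_left:
  assumes "same_block m b' i" "clash m b b' w" "w permutes {1..m}" shows "clash m b b' (sgen i \<circ> w)"
proof -
  obtain k l where kl: "k \<in> {1..m}" "l \<in> {1..m}" "k \<noteq> l" "b k = b l" "b' (w k) = b' (w l)"
    using assms(2) unfolding clash_def by blast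
  note s = sgen_Yg[OF assms(1)]
  have "b' ((sgen i \<circ> w) k) = b' ((sgen i \<circ> w) l)"
    using kl Yg_label[OF s] permutes_in_image[OF assms(3)] by simp
  then show ?thesis using kl unfolding clash_def by blast
qed

text \<open>The minimal length representatives of the double cosets of the two Young subgroups: b
  labels the arguments of w and b' its values.\<close>

definition dmin :: "nat \<Rightarrow> (nat \<Rightarrow> nat) \<Rightarrow> (nat \<Rightarrow> nat) \<Rightarrow> (nat \<Rightarrow> nat) \<Rightarrow> bool" where
  "dmin m b b' w \<longleftrightarrow> (\<forall>i. same_block m b i \<longrightarrow> w i < w (Suc i)) \<and>
     (\<forall>i. same_block m b' i \<longrightarrow> inv w i < inv w (Suc i))"

text \<open>For clashing k < l the monotone labels put k and k + 1 into one block, and their images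
  as well. A value strictly between these images would need a preimage strictly between k and k + 1,
  so the images are consecutive.\<close>

lemma dmin_clash_adjacent:
  assumes mono: "mono_on {1..m} b" "mono_on {1..m} b'" and w: "w permutes {1..m}"
    and dmin: "dmin m b b' w" and "clash m b b' w"
  obtains k where "same_block m b k" "same_block m b' (w k)" "w (Suc k) = Suc (w k)"
proof -
  have inc: "\<And>i. same_block m b i \<Longrightarrow> w i < w (Suc i)" and inc': "\<And>i. same_block m b' i \<Longrightarrow> inv w i < inv w (Suc i)"
    using dmin unfolding dmin_def by blast+
  obtain k l where kl: "k \<in> {1..m}" "l \<in> {1..m}" "k < l" "b k = b l" "b' (w k) = b' (w l)"
    using assms(5) unfolding clash_def by (metis linorder_neqE_nat)
  have r: "Suc k \<in> {1..m}" using kl by auto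
  have "b k \<le> b (Suc k)" "b (Suc k) \<le> b l"
    using mono_onD[OF mono(1) kl(1) r] mono_onD[OF mono(1) r kl(2)] kl(3) by simp_all
  then have bk: "b k = b (Suc k)" using kl by simp
  then have sk: "same_block m b k" using kl r by (auto simp: same_block_def)
  have wk: "w k < w (Suc k)" by (rule inc[OF sk])
  have wl: "w (Suc k) \<le> w l"
    using increasing_on_block[where f = w, OF mono(1) inc, of "Suc k" l] kl r bk by (cases "Suc k = l") auto
  have rw: "w k \<in> {1..m}" "w (Suc k) \<in> {1..m}" "w l \<in> {1..m}" using kl r permutes_in_image[OF w] by blast+
  have "b' (w k) \<le> b' (w (Suc k))" "b' (w (Suc k)) \<le> b' (w l)"
    using mono_onD[OF mono(2) rw(1,2)] mono_onD[OF mono(2) rw(2,3)] wk wl by simp_all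
  then have b'k: "b' (w k) = b' (w (Suc k))" using kl by simp
  have rs: "Suc (w k) \<in> {1..m}" using rw wk by auto
  have "b' (w k) \<le> b' (Suc (w k))" "b' (Suc (w k)) \<le> b' (w (Suc k))"
    using mono_onD[OF mono(2) rw(1) rs] mono_onD[OF mono(2) rs rw(2)] wk by simp_all
  then have b's: "b' (w k) = b' (Suc (w k))" using b'k by simp
  then have sk': "same_block m b' (w k)" using rw rs by (auto simp: same_block_def)
  have "w (Suc k) = Suc (w k)"
  proof (rule ccontr)
    assume "w (Suc k) \<noteq> Suc (w k)"
    then have lt: "Suc (w k) < w (Suc k)" using wk by simp
    have "inv w (w k) < inv w (Suc (w k))" by (rule inc'[OF sk'])
    moreover have "inv w (Suc (w k)) < inv w (w (Suc k))"
      using increasing_on_block[where f = "inv w", OF mono(2) inc' lt rs rw(2)] b'k b's by simp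
    ultimately show False using inv_SN_apply(2)[OF SN_I[OF w]] by simp
  qed
  then show ?thesis using that sk sk' by blast
qed

lemma dmin_cases:
  assumes "w permutes {1..m}"
  obtains (dmin) "dmin m b b' w"
    | (left) i where "same_block m b i" "w (Suc i) < w i"
    | (right) i where "same_block m b' i" "inv w (Suc i) < inv w i"
  using neq_Suc[OF SN_I[OF assms]] inv_neq_Suc[OF SN_I[OF assms]] unfolding dmin_def
  by (meson linorder_neqE_nat)

lemma Ys_TT_desc:
  assumes "same_block m b i" "w permutes {1..m}" "w (Suc i) < w i"
  shows "Ys m b * TT w = - (Ys m b * TT (w \<circ> sgen i))"
    "w \<circ> sgen i permutes {1..m}" "plen (w \<circ> sgen i) < plen w"
proof -
  have i: "1 \<le> i" "i < m" using assms(1) by (auto simp: same_block_def)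
  have s: "w \<circ> sgen i \<in> SN" using SN_I[OF assms(2)] i by (simp add: sgen_right_SN_iff)
  have "TT w = Ti i * TT (w \<circ> sgen i)"
    using Ti_mult_TT_asc[OF s i(1)] assms(3) by simp
  then show "Ys m b * TT w = - (Ys m b * TT (w \<circ> sgen i))"
    using Ys_Ti[OF assms(1)] by (simp flip: mult.assoc)
  show "w \<circ> sgen i permutes {1..m}" using assms(2) sgen_permutes[OF i] permutes_comp by blast
  show "plen (w \<circ> sgen i) < plen w" using plen_sgen_right_desc'[OF SN_I[OF assms(2)] i(1) assms(3)] by simp
qed

lemma TT_Xs_desc:
  assumes "same_block m b i" "w permutes {1..m}" "inv w (Suc i) < inv w i"
  shows "TT w * Xs m b = smul qq (TT (sgen i \<circ> w) * Xs m b)"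
    "sgen i \<circ> w permutes {1..m}" "plen (sgen i \<circ> w) < plen w"
proof -
  have i: "1 \<le> i" "i < m" using assms(1) by (auto simp: same_block_def)
  have s: "sgen i \<circ> w \<in> SN" using SN_I[OF assms(2)] i by (simp add: sgen_left_SN_iff)
  have "inv (sgen i \<circ> w) i < inv (sgen i \<circ> w) (Suc i)"
    using assms(3) by (simp add: inv_sgen_left[OF SN_I[OF assms(2)]])
  then have "TT w = TT (sgen i \<circ> w) * Ti i"
    using TT_mult_Ti_asc[OF s i(1)] by simp
  then show "TT w * Xs m b = smul qq (TT (sgen i \<circ> w) * Xs m b)"
    using Ti_Xs[OF assms(1)] by (simp add: mult.assoc)
  show "sgen i \<circ> w permutes {1..m}" using assms(2) sgen_permutes[OF i] permutes_comp by blast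
  show "plen (sgen i \<circ> w) < plen w" using plen_sgen_left_desc[OF SN_I[OF assms(2)] i(1) assms(3)] by simp
qed

text \<open>For a minimal w with adjacent clash, T_k T_w = T_w T_(w k). The left symmetrizer reads
  this factor as - 1 and the right one as q, so q + 1 kills the product. Any other w loses a descent
  to one of the symmetrizers, and the clash survives.\<close>

lemma Ys_TT_Xs_clash:
  assumes mono: "mono_on {1..m} b" "mono_on {1..m} b'" and "w permutes {1..m}" "clash m b b' w"
  shows "Ys m b * TT w * Xs m b' = 0"
  using assms(3,4)
proof (induction "plen w" arbitrary: w rule: less_induct)
  case less
  note w = SN_I[OF less.prems(1)]
  from less.prems(1) show ?case
  proof (cases rule: dmin_cases[of w m b b'])
    case dmin
    obtain k where k: "same_block m b k" "same_block m b' (w k)" "w (Suc k) = Suc (w k)"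
      using dmin_clash_adjacent[OF mono less.prems(1) dmin less.prems(2)] .
    have k1: "1 \<le> k" "1 \<le> w k" using k by (auto simp: same_block_def)
    have "Ti k * TT w = TT (w \<circ> sgen k)" using k by (intro Ti_mult_TT_asc[OF w k1(1)]) simp
    moreover have "inv w (w k) < inv w (Suc (w k))" using dmin k by (simp add: dmin_def)
    then have "TT w * Ti (w k) = TT (sgen (w k) \<circ> w)" by (intro TT_mult_Ti_asc[OF w k1(2)])
    moreover have "sgen (w k) \<circ> w = w \<circ> sgen k"
    proof
      fix x
      have "w x = w k \<longleftrightarrow> x = k" "w x = w (Suc k) \<longleftrightarrow> x = Suc k" using inv_SN_apply(2)[OF w] by metis+
      then show "(sgen (w k) \<circ> w) x = (w \<circ> sgen k) x" using k by (auto simp: sgen_if)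
    qed
    ultimately have c: "Ti k * TT w = TT w * Ti (w k)" by simp
    have "- (Ys m b * TT w * Xs m b') = Ys m b * Ti k * TT w * Xs m b'"
      using Ys_Ti[OF k(1)] by simp
    also have "\<dots> = Ys m b * TT w * (Ti (w k) * Xs m b')" using c by (simp add: mult.assoc)
    also have "\<dots> = smul qq (Ys m b * TT w * Xs m b')" using Ti_Xs[OF k(2)] by simp
    finally have "smul (qq + 1) (Ys m b * TT w * Xs m b') = 0"
      by (simp add: hk.scale_left_distrib neg_eq_iff_add_eq_0 add.commute)
    then show ?thesis by simp
  next
    case (left i)
    note l = Ys_TT_desc[OF left(1) less.prems(1) left(2)]
    have "Ys m b * TT (w \<circ> sgen i) * Xs m b' = 0"
      using less.hyps[OF l(3,2)] clash_right[OF left(1) less.prems(2)] by blast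
    then show ?thesis using l(1) by simp
  next
    case (right i)
    note l = TT_Xs_desc[OF right(1) less.prems(1) right(2)]
    have "Ys m b * TT (sgen i \<circ> w) * Xs m b' = 0"
      using less.hyps[OF l(3,2)] clash_left[OF right(1) less.prems(2,1)] by blast
    then show ?thesis using l(1) by (simp add: mult.assoc)
  qed
qed

text \<open>Stripping descents changes the product by signs and powers of q until a minimal
  representative is left; by assumption \<open>w0\<close> is the only one without a clash.\<close>

lemma Ys_TT_Xs_multiple:
  assumes mono: "mono_on {1..m} b" "mono_on {1..m} b'" and "w permutes {1..m}"
    and unique: "\<And>w. w permutes {1..m} \<Longrightarrow> dmin m b b' w \<Longrightarrow> \<not> clash m b b' w \<Longrightarrow> w = w0"
  shows "\<exists>c. Ys m b * TT w * Xs m b' = smul c (Ys m b * TT w0 * Xs m b')"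
  using assms(3)
proof (induction "plen w" arbitrary: w rule: less_induct)
  case less
  from less.prems show ?case
  proof (cases rule: dmin_cases[of w m b b'])
    case dmin
    show ?thesis
    proof (cases "clash m b b' w")
      case True
      have "Ys m b * TT w * Xs m b' = smul 0 (Ys m b * TT w0 * Xs m b')"
        using Ys_TT_Xs_clash[OF mono less.prems True] by simp
      then show ?thesis ..
    next
      case False
      then have "w = w0" using unique less.prems dmin by blast
      then have "Ys m b * TT w * Xs m b' = smul 1 (Ys m b * TT w0 * Xs m b')" by simp
      then show ?thesis ..
    qed
  next
    case (left i)
    note l = Ys_TT_desc[OF left(1) less.prems left(2)]
    obtain c where "Ys m b * TT (w \<circ> sgen i) * Xs m b' = smul c (Ys m b * TT w0 * Xs m b')"
      using less.hyps[OF l(3,2)] by blast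
    then have "Ys m b * TT w * Xs m b' = smul (- c) (Ys m b * TT w0 * Xs m b')"
      using l(1) by simp
    then show ?thesis ..
  next
    case (right i)
    note l = TT_Xs_desc[OF right(1) less.prems right(2)]
    obtain c where "Ys m b * TT (sgen i \<circ> w) * Xs m b' = smul c (Ys m b * TT w0 * Xs m b')"
      using less.hyps[OF l(3,2)] by blast
    then have "Ys m b * TT w * Xs m b' = smul (qq * c) (Ys m b * TT w0 * Xs m b')"
      using l(1) by (simp add: mult.assoc)
    then show ?thesis ..
  qed
qed

lemma Ys_Hm_Xs_zero:
  assumes mono: "mono_on {1..m} b" "mono_on {1..m} b'"
    and all: "\<And>w. w permutes {1..m} \<Longrightarrow> clash m b b' w" and "h \<in> Hm m"
  shows "Ys m b * h * Xs m b' = 0"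
  using assms(4)
proof (induction rule: Hm_induct)
  case (TT c w)
  then show ?case using Ys_TT_Xs_clash[OF mono TT all[OF TT]] by simp
qed (auto simp: distrib_left distrib_right)

lemma Ys_Hm_Xs_multiple:
  assumes mono: "mono_on {1..m} b" "mono_on {1..m} b'"
    and unique: "\<And>w. w permutes {1..m} \<Longrightarrow> dmin m b b' w \<Longrightarrow> \<not> clash m b b' w \<Longrightarrow> w = w0"
    and "h \<in> Hm m"
  shows "\<exists>c. Ys m b * h * Xs m b' = smul c (Ys m b * TT w0 * Xs m b')"
  using assms(4)
proof (induction rule: Hm_induct)
  case zero
  show ?case by (rule exI[of _ 0]) simp
next
  case (add x y)
  then obtain c d where "Ys m b * x * Xs m b' = smul c (Ys m b * TT w0 * Xs m b')"
    "Ys m b * y * Xs m b' = smul d (Ys m b * TT w0 * Xs m b')" by blast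
  then have "Ys m b * (x + y) * Xs m b' = smul (c + d) (Ys m b * TT w0 * Xs m b')"
    by (simp add: distrib_left distrib_right hk.scale_left_distrib)
  then show ?case ..
next
  case (TT d w)
  obtain c where "Ys m b * TT w * Xs m b' = smul c (Ys m b * TT w0 * Xs m b')"
    using Ys_TT_Xs_multiple[OF mono TT unique] by blast
  then have "Ys m b * smul d (TT w) * Xs m b' = smul (d * c) (Ys m b * TT w0 * Xs m b')" by simp
  then show ?case ..
qed

lemma TT_invertible:
  assumes "w permutes {1..m}" shows "\<exists>u\<in>Hm m. TT w * u = 1"
  using assms
proof (induction rule: permutes_length_induct)
  case id
  show ?case by (rule bexI[of _ 1]) (simp_all add: id_def[symmetric])
next
  case (step w i)
  then obtain u where u: "u \<in> Hm m" "TT w * u = 1" by blast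
  \<comment> \<open>The inverse of T_i, read off the quadratic relation.\<close>
  define v where "v = smul (inverse qq) (Ti i - smul (qq - 1) 1)"
  have v: "Ti i * v = 1"
    unfolding v_def using Ti_sq[OF step(2)] by (simp add: right_diff_distrib)
  have "TT (sgen i \<circ> w) * (v * u) = TT w * (Ti i * v) * u"
    by (simp only: TT_comp_sgen[OF step(1,2,4)] mult.assoc)
  then have "TT (sgen i \<circ> w) * (v * u) = 1" using v u by simp
  moreover have "v * u \<in> Hm m"
    unfolding v_def using u step by (intro Hm_mult Hm_smul Hm_diff Hm_Ti) auto
  ultimately show ?case by metis
qed

text \<open>If \<open>d\<close> maps the blocks of \<open>b\<close> increasingly onto the blocks of \<open>b'\<close>, then \<open>T\<^sub>d\<close> conjugates
  one Young symmetrizer into the other.\<close>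

lemma Xs_block_permutation:
  assumes mono: "mono_on {1..m} b" "mono_on {1..m} b'" and d: "d permutes {1..m}"
    and lab: "\<And>k l. k \<in> {1..m} \<Longrightarrow> l \<in> {1..m} \<Longrightarrow> b' (d k) = b' (d l) \<longleftrightarrow> b k = b l"
    and suc: "\<And>i. same_block m b i \<Longrightarrow> d (Suc i) = Suc (d i)"
  shows "Xs m b * TT d = TT d * Xs m b'"
proof -
  note dS = SN_I[OF d]
  note id = permutes_inv[OF d]
  define \<phi> where "\<phi> w = d \<circ> w \<circ> inv d" for w
  have \<phi>S: "\<phi> w \<in> SN" if "w \<in> SN" for w unfolding \<phi>_def using that dS SN_inv SN_comp by blast
  have inv\<phi>: "inv (\<phi> w) = d \<circ> inv w \<circ> inv d" if "w \<in> SN" for w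
    unfolding \<phi>_def using SN_bij[OF dS] SN_bij[OF that] SN_bij[OF SN_inv[OF dS]] inv_inv_SN[OF dS]
    by (simp add: o_inv_distrib bij_comp comp_assoc)
  have dinc: "d k < d l" if "k < l" "k \<in> {1..m}" "l \<in> {1..m}" "b k = b l" for k l
    using increasing_on_block[where f = d, OF mono(1) _ that] suc by simp
  have conj: "TT w * TT d = TT d * TT (\<phi> w)" if "w \<in> Yg m b" for w
    using mono(1) that
  proof (induction rule: Yg_induct)
    case (id v)
    have "\<phi> id = id" using inv_SN_apply(1)[OF dS] by (simp add: \<phi>_def fun_eq_iff)
    then have "TT id * TT d = TT d * TT (\<phi> id)" by simp
    then show ?case using id by (simp add: id_def)
  next
    case (step v w i)
    have i: "1 \<le> i" "i < m" "b i = b (Suc i)" using step(3) by (auto simp: same_block_def)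
    then have ri: "i \<in> {1..m}" "Suc i \<in> {1..m}" by auto
    note wS = Yg_SN[OF step(2)]
    have di: "1 \<le> d i" using permutes_in_image[OF d] ri by fastforce
    have s: "sgen (d i) \<circ> d = d \<circ> sgen i"
    proof
      fix x
      have "d x = d i \<longleftrightarrow> x = i" "d x = d (Suc i) \<longleftrightarrow> x = Suc i" using inv_SN_apply(2)[OF dS] by metis+
      then show "(sgen (d i) \<circ> d) x = (d \<circ> sgen i) x" using suc[OF step(3)] by (auto simp: sgen_if)
    qed
    have "Ti i * TT d = TT (d \<circ> sgen i)" using suc[OF step(3)] by (intro Ti_mult_TT_asc[OF dS i(1)]) simp
    moreover have "TT d * Ti (d i) = TT (sgen (d i) \<circ> d)"
      using inv_SN_apply(2)[OF dS] suc[OF step(3)] by (intro TT_mult_Ti_asc[OF dS di]) (metis lessI)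
    ultimately have c: "Ti i * TT d = TT d * Ti (d i)" using s by simp
    have "TT v = TT w * Ti i" unfolding step(1) by (rule TT_mult_Ti_asc[OF wS i(1) step(4), symmetric])
    then have "TT v * TT d = TT w * TT d * Ti (d i)" using c by (simp add: mult.assoc)
    also have "\<dots> = TT d * (TT (\<phi> w) * Ti (d i))" using step.IH by (simp add: mult.assoc)
    also have "TT (\<phi> w) * Ti (d i) = TT (sgen (d i) \<circ> \<phi> w)"
    proof (rule TT_mult_Ti_asc[OF \<phi>S[OF wS] di])
      note iw = Yg_inv[OF step(2)]
      have r: "inv w i \<in> {1..m}" "inv w (Suc i) \<in> {1..m}"
        using permutes_in_image[OF Yg_permutes[OF iw]] ri by blast+
      have "b (inv w i) = b (inv w (Suc i))" using Yg_label[OF iw] ri i(3) by simp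
      then have "d (inv w i) < d (inv w (Suc i))" using dinc[OF step(4) r] by simp
      then show "inv (\<phi> w) (d i) < inv (\<phi> w) (Suc (d i))"
        unfolding inv\<phi>[OF wS] using suc[OF step(3)] inv_SN_apply(2)[OF dS] by (metis comp_apply)
    qed
    also have "sgen (d i) \<circ> \<phi> w = \<phi> v"
    proof -
      have "sgen (d i) \<circ> \<phi> w = (sgen (d i) \<circ> d) \<circ> (w \<circ> inv d)" by (simp add: \<phi>_def comp_assoc)
      then show ?thesis unfolding s step(1) by (simp add: \<phi>_def comp_assoc)
    qed
    finally show ?case .
  qed
  have "bij_betw \<phi> (Yg m b) (Yg m b')"
  proof (rule bij_betw_byWitness[where f' = "\<lambda>w. inv d \<circ> w \<circ> d"])
    have dd: "inv d (d x) = x" "d (inv d x) = x" for x using inv_SN_apply[OF dS] by auto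
    show "\<forall>w\<in>Yg m b. inv d \<circ> \<phi> w \<circ> d = w" by (simp add: \<phi>_def fun_eq_iff dd)
    show "\<forall>w\<in>Yg m b'. \<phi> (inv d \<circ> w \<circ> d) = w" by (simp add: \<phi>_def fun_eq_iff dd)
    show "\<phi> ` Yg m b \<subseteq> Yg m b'"
    proof (rule image_subsetI)
      fix w assume w: "w \<in> Yg m b"
      have "b' (\<phi> w k) = b' k" if k: "k \<in> {1..m}" for k
      proof -
        have r: "inv d k \<in> {1..m}" using permutes_in_image[OF id] k by blast
        then have "w (inv d k) \<in> {1..m}" using permutes_in_image[OF Yg_permutes[OF w]] by blast
        then have "b' (d (w (inv d k))) = b' (d (inv d k))" using lab[OF _ r] Yg_label[OF w r] by blast
        then show ?thesis by (simp add: \<phi>_def dd)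
      qed
      moreover have "\<phi> w permutes {1..m}" unfolding \<phi>_def using d id Yg_permutes[OF w] permutes_comp by blast
      ultimately show "\<phi> w \<in> Yg m b'" unfolding Yg_def by blast
    qed
    show "(\<lambda>w. inv d \<circ> w \<circ> d) ` Yg m b' \<subseteq> Yg m b"
    proof (rule image_subsetI)
      fix w assume w: "w \<in> Yg m b'"
      have "b ((inv d \<circ> w \<circ> d) k) = b k" if k: "k \<in> {1..m}" for k
      proof -
        have r: "d k \<in> {1..m}" using permutes_in_image[OF d] k by blast
        then have "w (d k) \<in> {1..m}" using permutes_in_image[OF Yg_permutes[OF w]] by blast
        then have r2: "inv d (w (d k)) \<in> {1..m}" using permutes_in_image[OF id] by blast
        have "b' (d (inv d (w (d k)))) = b' (d k)" using Yg_label[OF w r] by (simp add: dd)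
        then show ?thesis using lab[OF r2 k] by simp
      qed
      moreover have "inv d \<circ> w \<circ> d permutes {1..m}" using d id Yg_permutes[OF w] permutes_comp by blast
      ultimately show "inv d \<circ> w \<circ> d \<in> Yg m b" unfolding Yg_def by blast
    qed
  qed
  then have e: "Xs m b' = (\<Sum>w\<in>Yg m b. TT (\<phi> w))"
    unfolding Xs_def by (rule sum.reindex_bij_betw[symmetric])
  show ?thesis unfolding e unfolding Xs_def sum_distrib_left sum_distrib_right using conj by simp
qed

section \<open>Diagrams and tableaux\<close>

text \<open>Row reading order of the nodes; \<open>clt\<close> is column reading order. The ranks in
  these two orders are the row filling and the column filling.\<close>

definition rlt :: "nat \<times> nat \<Rightarrow> nat \<times> nat \<Rightarrow> bool" where
  "rlt y x \<longleftrightarrow> fst y < fst x \<or> (fst y = fst x \<and> snd y < snd x)"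

definition clt :: "nat \<times> nat \<Rightarrow> nat \<times> nat \<Rightarrow> bool" where
  "clt y x \<longleftrightarrow> snd y < snd x \<or> (snd y = snd x \<and> fst y < fst x)"

definition strict_linear :: "('a \<Rightarrow> 'a \<Rightarrow> bool) \<Rightarrow> bool" where
  "strict_linear R \<longleftrightarrow> (\<forall>x. \<not> R x x) \<and> (\<forall>x y z. R x y \<longrightarrow> R y z \<longrightarrow> R x z) \<and> (\<forall>x y. x \<noteq> y \<longrightarrow> R x y \<or> R y x)"

lemma strict_linear_rlt: "strict_linear rlt"
  unfolding strict_linear_def rlt_def by (auto simp: prod_eq_iff)

lemma strict_linear_clt: "strict_linear clt"
  unfolding strict_linear_def clt_def by (auto simp: prod_eq_iff)

definition rank :: "('a \<Rightarrow> 'a \<Rightarrow> bool) \<Rightarrow> 'a set \<Rightarrow> 'a \<Rightarrow> nat" where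
  "rank R N x = Suc (card {y \<in> N. R y x})"

lemma rank_less:
  assumes "strict_linear R" "finite N" "x \<in> N" "R x y" shows "rank R N x < rank R N y"
proof -
  have "{z \<in> N. R z x} \<subset> {z \<in> N. R z y}"
    using assms unfolding strict_linear_def by blast
  then show ?thesis using assms(2) by (simp add: rank_def psubset_card_mono)
qed

lemma rank_less_iff:
  assumes "strict_linear R" "finite N" "x \<in> N" "y \<in> N"
  shows "rank R N x < rank R N y \<longleftrightarrow> R x y"
  using rank_less[OF assms(1,2,3), of y] rank_less[OF assms(1,2,4), of x] assms(1) unfolding strict_linear_def
  by (metis less_asym less_irrefl)

lemma rank_bij:
  assumes "strict_linear R" "finite N" shows "bij_betw (rank R N) N {1..card N}"
proof -
  have inj: "inj_on (rank R N) N"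
  proof (rule inj_onI)
    fix x y assume "x \<in> N" "y \<in> N" "rank R N x = rank R N y"
    then show "x = y" using rank_less_iff[OF assms] assms(1) unfolding strict_linear_def by (metis less_irrefl)
  qed
  have "rank R N x \<in> {1..card N}" if "x \<in> N" for x
  proof -
    have "{y \<in> N. R y x} \<subset> N" using that assms(1) unfolding strict_linear_def by blast
    then have "card {y \<in> N. R y x} < card N" using assms(2) psubset_card_mono by blast
    then show ?thesis by (simp add: rank_def)
  qed
  then have "rank R N ` N = {1..card N}"
    using card_image[OF inj] by (intro card_subset_eq) auto
  with inj show ?thesis by (simp add: bij_betw_def)
qed

text \<open>The values below v x are exactly those of the predecessors of x, so v x counts them.
  This recognizes a row or column filling by monotonicity alone.\<close>

lemma rank_unique:
  assumes R: "strict_linear R" and fin: "finite N" and v: "bij_betw v N {1..card N}"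
    and mono: "\<And>x y. x \<in> N \<Longrightarrow> y \<in> N \<Longrightarrow> R x y \<Longrightarrow> v x < v y" and x: "x \<in> N"
  shows "v x = rank R N x"
proof -
  have iff: "R y x \<longleftrightarrow> v y < v x" if "y \<in> N" for y
    using mono[OF that x] mono[OF x that] R unfolding strict_linear_def by (metis less_asym less_irrefl)
  have vx: "v x \<in> {1..card N}" using v x bij_betwE by blast
  have "v ` {y \<in> N. R y x} = {1..<v x}"
  proof (rule set_eqI)
    fix k
    show "k \<in> v ` {y \<in> N. R y x} \<longleftrightarrow> k \<in> {1..<v x}"
    proof
      assume "k \<in> v ` {y \<in> N. R y x}"
      then obtain y where "y \<in> N" "R y x" "k = v y" by blast
      then show "k \<in> {1..<v x}" using iff bij_betwE[OF v] by fastforce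
    next
      assume k: "k \<in> {1..<v x}"
      then have "k \<in> {1..card N}" using vx by simp
      then obtain y where "y \<in> N" "k = v y" using v unfolding bij_betw_def by blast
      then show "k \<in> v ` {y \<in> N. R y x}" using iff k by auto
    qed
  qed
  moreover have "inj_on v {y \<in> N. R y x}" using v unfolding bij_betw_def by (auto intro: inj_on_subset)
  ultimately have "card {y \<in> N. R y x} = card {1..<v x}" using card_image by metis
  then show ?thesis using vx by (simp add: rank_def)
qed

section \<open>Partitions and their diagrams\<close>

lemma is_part_nth: "is_part \<nu> \<Longrightarrow> i \<le> j \<Longrightarrow> j < length \<nu> \<Longrightarrow> \<nu> ! j \<le> \<nu> ! i"
  unfolding is_part_def using sorted_wrt_nth_less[of "(\<ge>)" \<nu> i j] by (cases "i = j") auto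

lemma is_part_pos: "is_part \<nu> \<Longrightarrow> j < length \<nu> \<Longrightarrow> 0 < \<nu> ! j"
  unfolding is_part_def by simp

lemma nodes_iff: "(r, c) \<in> nodes \<nu> \<longleftrightarrow> 1 \<le> r \<and> r \<le> length \<nu> \<and> 1 \<le> c \<and> c \<le> \<nu> ! (r - 1)"
  by (simp add: nodes_def)

lemma nodes_down:
  assumes "is_part \<nu>" "(r, c) \<in> nodes \<nu>" "1 \<le> r'" "r' \<le> r" "1 \<le> c'" "c' \<le> c"
  shows "(r', c') \<in> nodes \<nu>"
proof -
  have "\<nu> ! (r - 1) \<le> \<nu> ! (r' - 1)" using assms by (intro is_part_nth) (auto simp: nodes_iff)
  then show ?thesis using assms by (auto simp: nodes_iff)
qed

lemma nodes_Sigma: "nodes \<nu> = (SIGMA r:{1..length \<nu>}. {1..\<nu> ! (r - 1)})"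
  by (auto simp: nodes_def)

lemma finite_nodes [simp]: "finite (nodes \<nu>)"
  unfolding nodes_Sigma by auto

lemma card_nodes: "card (nodes \<nu>) = sum_list \<nu>"
proof -
  have "card (nodes \<nu>) = (\<Sum>r\<in>{1..length \<nu>}. \<nu> ! (r - 1))"
    unfolding nodes_Sigma by (subst card_SigmaI) auto
  also have "\<dots> = (\<Sum>r\<in>{0..<length \<nu>}. \<nu> ! r)"
    by (rule sum.reindex_bij_witness[of _ Suc "\<lambda>r. r - 1"]) auto
  finally show ?thesis by (simp add: sum_list_sum_nth)
qed

lemma nodes_row_lengths:
  assumes "is_part \<nu>"
  shows "r < length \<nu> \<longleftrightarrow> (Suc r, 1) \<in> nodes \<nu>" and "r < length \<nu> \<Longrightarrow> c \<le> \<nu> ! r \<and> 1 \<le> c \<longleftrightarrow> (Suc r, c) \<in> nodes \<nu>"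
  using is_part_pos[OF assms, of r] by (auto simp: nodes_iff Suc_le_eq)

lemma nodes_inject:
  assumes "is_part \<nu>" "is_part \<rho>" "nodes \<nu> = nodes \<rho>" shows "\<nu> = \<rho>"
proof (rule nth_equalityI)
  have "r < length \<nu> \<longleftrightarrow> r < length \<rho>" for r
    using nodes_row_lengths(1)[OF assms(1)] nodes_row_lengths(1)[OF assms(2)] assms(3) by simp
  then show l: "length \<nu> = length \<rho>" by (metis linorder_neqE_nat less_irrefl)
  fix r assume r: "r < length \<nu>"
  have c: "c \<le> \<nu> ! r \<and> 1 \<le> c \<longleftrightarrow> c \<le> \<rho> ! r \<and> 1 \<le> c" for c
    using nodes_row_lengths(2)[OF assms(1) r] nodes_row_lengths(2)[OF assms(2)] r l assms(3) by simp
  show "\<nu> ! r = \<rho> ! r"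
    using c[of "\<nu> ! r"] c[of "\<rho> ! r"] is_part_pos[OF assms(1) r] is_part_pos[OF assms(2)] r l
    by (simp add: Suc_le_eq)
qed

text \<open>Needed for the shape of a truncated tableau, which is specified only through its set of
  nodes. The parts are the cardinalities of the rows, each row being an initial segment.\<close>

lemma down_closed_diagram:
  assumes fin: "finite S" and pos: "\<And>r c. (r, c) \<in> S \<Longrightarrow> 1 \<le> r \<and> 1 \<le> c"
    and down: "\<And>r c r' c'. (r, c) \<in> S \<Longrightarrow> 1 \<le> r' \<Longrightarrow> r' \<le> r \<Longrightarrow> 1 \<le> c' \<Longrightarrow> c' \<le> c \<Longrightarrow> (r', c') \<in> S"
  shows "\<exists>\<nu>. is_part \<nu> \<and> nodes \<nu> = S"
proof -
  define L where "L = card {r. (r, 1) \<in> S}"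
  define f where "f r = card {c. (r, c) \<in> S}" for r
  have interval: "A = {1..card A}" if A: "finite A" "0 \<notin> A" "\<And>a b. a \<in> A \<Longrightarrow> 1 \<le> b \<Longrightarrow> b \<le> a \<Longrightarrow> b \<in> A" for A :: "nat set"
  proof (cases "A = {}")
    case False
    have "A = {1..Max A}"
    proof
      show "A \<subseteq> {1..Max A}" using A(1,2) by (auto simp: Suc_le_eq intro!: gr0I)
      show "{1..Max A} \<subseteq> A" using A(3)[OF Max_in[OF A(1) False]] by auto
    qed
    then have "card A = Max A" by (metis card_atLeastAtMost diff_Suc_1)
    then show ?thesis using \<open>A = {1..Max A}\<close> by simp
  qed simp
  have fin1: "finite {r. (r, 1) \<in> S}" by (rule finite_subset[of _ "fst ` S"]) (use fin in force)+
  have fin2: "finite {c. (r, c) \<in> S}" for r by (rule finite_subset[of _ "snd ` S"]) (use fin in force)+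
  have rows: "{r. (r, 1) \<in> S} = {1..L}"
    unfolding L_def
  proof (rule interval[OF fin1])
    show "0 \<notin> {r. (r, 1) \<in> S}" using pos[of 0 1] by auto
    fix a b assume "a \<in> {r. (r, 1) \<in> S}" "1 \<le> b" "b \<le> a"
    then show "b \<in> {r. (r, 1) \<in> S}" using down[of a 1 b 1] by simp
  qed
  have cols: "{c. (r, c) \<in> S} = {1..f r}" for r
    unfolding f_def
  proof (rule interval[OF fin2])
    show "0 \<notin> {c. (r, c) \<in> S}" using pos[of r 0] by auto
    fix a b assume "a \<in> {c. (r, c) \<in> S}" "1 \<le> b" "b \<le> a"
    then show "b \<in> {c. (r, c) \<in> S}" using down[of r a r b] pos[of r a] by simp
  qed
  define \<nu> where "\<nu> = map (\<lambda>r. f (Suc r)) [0..<L]"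
  have iff: "(r, c) \<in> S \<longleftrightarrow> 1 \<le> c \<and> c \<le> f r" for r c using cols[of r] by (metis atLeastAtMost_iff mem_Collect_eq)
  have iff1: "(r, 1) \<in> S \<longleftrightarrow> 1 \<le> r \<and> r \<le> L" for r using rows by (metis atLeastAtMost_iff mem_Collect_eq)
  have "nodes \<nu> = S"
  proof (rule set_eqI, clarify)
    fix r c
    have "(r, c) \<in> S \<Longrightarrow> 1 \<le> r \<and> r \<le> L" using down[of r c r 1] pos[of r c] iff1 by simp
    moreover have "1 \<le> r \<Longrightarrow> r \<le> L \<Longrightarrow> \<nu> ! (r - 1) = f r" by (cases r) (simp_all add: \<nu>_def)
    ultimately show "(r, c) \<in> nodes \<nu> \<longleftrightarrow> (r, c) \<in> S"
      using iff[of r c] by (auto simp: nodes_iff \<nu>_def)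
  qed
  moreover have "is_part \<nu>"
  proof -
    have "f (Suc j) \<le> f (Suc i)" if "i < j" "j < L" for i j
    proof (cases "f (Suc j) = 0")
      case False
      then have "(Suc j, f (Suc j)) \<in> S" by (simp add: iff)
      then have "(Suc i, f (Suc j)) \<in> S" using down[of "Suc j" "f (Suc j)" "Suc i" "f (Suc j)"] that False by simp
      then show ?thesis by (simp add: iff)
    qed simp
    moreover have "0 < f (Suc j)" if "j < L" for j
      using iff1[of "Suc j"] iff[of "Suc j" 1] that by simp
    ultimately show ?thesis unfolding is_part_def \<nu>_def by (auto simp: sorted_wrt_iff_nth_less)
  qed
  ultimately show ?thesis by blast
qed

section \<open>Positions, contents and standard tableaux\<close>

definition pos :: "nat list \<Rightarrow> (nat \<times> nat \<Rightarrow> nat) \<Rightarrow> nat \<Rightarrow> nat \<times> nat" where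
  "pos \<nu> v k = the_inv_into (nodes \<nu>) v k"

lemma tableau_bij: "tableau \<nu> v \<Longrightarrow> bij_betw v (nodes \<nu>) {1..sum_list \<nu>}"
  by (simp add: tableau_def)

lemma pos_in: "tableau \<nu> v \<Longrightarrow> k \<in> {1..sum_list \<nu>} \<Longrightarrow> pos \<nu> v k \<in> nodes \<nu>"
  unfolding pos_def using tableau_bij[of \<nu> v] by (metis bij_betw_def subset_refl the_inv_into_into)

lemma tab_pos: "tableau \<nu> v \<Longrightarrow> k \<in> {1..sum_list \<nu>} \<Longrightarrow> v (pos \<nu> v k) = k"
  unfolding pos_def using tableau_bij[of \<nu> v] by (metis bij_betw_def f_the_inv_into_f)

lemma pos_tab: "tableau \<nu> v \<Longrightarrow> x \<in> nodes \<nu> \<Longrightarrow> pos \<nu> v (v x) = x"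
  unfolding pos_def using tableau_bij[of \<nu> v] by (metis bij_betw_def the_inv_into_f_f)

lemma tab_range: "tableau \<nu> v \<Longrightarrow> x \<in> nodes \<nu> \<Longrightarrow> v x \<in> {1..sum_list \<nu>}"
  using tableau_bij bij_betwE by blast

lemma tab_out: "tableau \<nu> v \<Longrightarrow> x \<notin> nodes \<nu> \<Longrightarrow> v x = 0"
  unfolding tableau_def by blast

lemma tab_inj: "tableau \<nu> v \<Longrightarrow> x \<in> nodes \<nu> \<Longrightarrow> y \<in> nodes \<nu> \<Longrightarrow> v x = v y \<Longrightarrow> x = y"
  by (metis pos_tab)

lemma tab_support: "tableau \<nu> v \<Longrightarrow> {x. v x \<noteq> 0} = nodes \<nu>"
  using tab_range[of \<nu> v] tab_out[of \<nu> v] by fastforce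

lemma tab_eqI: "tableau \<nu> u \<Longrightarrow> tableau \<nu> v \<Longrightarrow> (\<And>x. x \<in> nodes \<nu> \<Longrightarrow> u x = v x) \<Longrightarrow> u = v"
  by (metis ext tab_out)

lemma tab_eqI_pos:
  assumes "tableau \<nu> u" "tableau \<nu> v" "\<And>k. k \<in> {1..sum_list \<nu>} \<Longrightarrow> pos \<nu> u k = pos \<nu> v k" shows "u = v"
  using assms(1,2)
proof (rule tab_eqI)
  fix x assume x: "x \<in> nodes \<nu>"
  then have "pos \<nu> v (u x) = x" using assms(3)[OF tab_range[OF assms(1) x]] pos_tab[OF assms(1) x] by simp
  then show "u x = v x" using tab_pos[OF assms(2) tab_range[OF assms(1) x]] by simp
qed

definition cont :: "nat list \<Rightarrow> (nat \<times> nat \<Rightarrow> nat) \<Rightarrow> nat \<Rightarrow> int" where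
  "cont \<nu> v p = int (snd (pos \<nu> v p)) - int (fst (pos \<nu> v p))"

lemma content_of_eq:
  assumes "tableau \<nu> v" shows "content_of v p = cont \<nu> v p"
  unfolding content_of_def cont_def pos_def Let_def tab_support[OF assms] ..

lemma standard_tab: "standard \<nu> v \<Longrightarrow> tableau \<nu> v"
  by (simp add: standard_def)

lemma standard_le:
  assumes \<nu>: "is_part \<nu>" and v: "standard \<nu> v" and "(r', c') \<in> nodes \<nu>" "1 \<le> r" "r \<le> r'" "1 \<le> c" "c \<le> c'"
  shows "v (r, c) \<le> v (r', c')"
proof -
  have *: "(r + i, c + j) \<in> nodes \<nu> \<Longrightarrow> v (r, c) \<le> v (r + i, c + j)" for i j
  proof (induction i)
    case 0
    then show ?case
    proof (induction j)
      case (Suc j)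
      have "(r + 0, c + j) \<in> nodes \<nu>" using nodes_down[OF \<nu> Suc.prems] assms by simp
      moreover from this have "v (r, c + j) < v (r, Suc (c + j))" using v Suc.prems by (simp add: standard_def)
      ultimately show ?case using Suc.IH by simp
    qed simp
  next
    case (Suc i)
    have "(r + i, c + j) \<in> nodes \<nu>" using nodes_down[OF \<nu> Suc.prems] assms by simp
    moreover from this have "v (r + i, c + j) < v (Suc (r + i), c + j)" using v Suc.prems by (simp add: standard_def)
    ultimately show ?case using Suc.IH by simp
  qed
  show ?thesis using *[of "r' - r" "c' - c"] assms by simp
qed

lemma standard_less:
  assumes "is_part \<nu>" "standard \<nu> v" "x \<in> nodes \<nu>" "y \<in> nodes \<nu>" "fst x \<le> fst y" "snd x \<le> snd y" "x \<noteq> y"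
  shows "v x < v y"
proof -
  have "v x \<le> v y" using standard_le[OF assms(1,2), of "fst y" "snd y" "fst x" "snd x"] assms
    by (auto simp: nodes_def)
  moreover have "v x \<noteq> v y" using tab_inj[OF standard_tab[OF assms(2)] assms(3,4)] assms(7) by blast
  ultimately show ?thesis by simp
qed

lemma standardI:
  assumes "tableau \<nu> v" "\<And>x y. x \<in> nodes \<nu> \<Longrightarrow> y \<in> nodes \<nu> \<Longrightarrow> fst x \<le> fst y \<Longrightarrow> snd x \<le> snd y \<Longrightarrow> x \<noteq> y \<Longrightarrow> v x < v y"
  shows "standard \<nu> v"
  unfolding standard_def using assms by auto

text \<open>Take the first k placed differently. Its two nodes lie on one diagonal, and the one
  further up is filled in the other tableau by an entry smaller than k. By minimality this entry
  sits there in both tableaux, leaving no room for k. So content vectors separate standard tableaux,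
  which the elements E_v rely on.\<close>

lemma cont_inject:
  assumes \<nu>: "is_part \<nu>" and u: "standard \<nu> u" and v: "standard \<nu> v"
    and c: "\<And>p. p \<in> {1..sum_list \<nu>} \<Longrightarrow> cont \<nu> u p = cont \<nu> v p"
  shows "u = v"
proof (rule tab_eqI_pos[OF standard_tab[OF u] standard_tab[OF v]])
  note tu = standard_tab[OF u] and tv = standard_tab[OF v]
  fix k assume "k \<in> {1..sum_list \<nu>}"
  then show "pos \<nu> u k = pos \<nu> v k"
  proof (induction k rule: less_induct)
    case (less k)
    have aux: "\<not> (fst (pos \<nu> u' k) < fst (pos \<nu> v' k))"
      if s: "standard \<nu> u'" "standard \<nu> v'" and ih: "\<And>j. j < k \<Longrightarrow> j \<in> {1..sum_list \<nu>} \<Longrightarrow> pos \<nu> u' j = pos \<nu> v' j"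
        and ck: "cont \<nu> u' k = cont \<nu> v' k" for u' v'
    proof
      assume lt: "fst (pos \<nu> u' k) < fst (pos \<nu> v' k)"
      then have "snd (pos \<nu> u' k) < snd (pos \<nu> v' k)" using ck unfolding cont_def by linarith
      note tu = standard_tab[OF s(1)] and tv = standard_tab[OF s(2)]
      have "v' (pos \<nu> u' k) < v' (pos \<nu> v' k)"
        using standard_less[OF \<nu> s(2) pos_in[OF tu less.prems] pos_in[OF tv less.prems]] lt \<open>snd _ < snd _\<close>
        by (metis less_imp_le less_irrefl)
      then have j: "v' (pos \<nu> u' k) < k" using tab_pos[OF tv less.prems] by simp
      have jr: "v' (pos \<nu> u' k) \<in> {1..sum_list \<nu>}" using tab_range[OF tv pos_in[OF tu less.prems]] .
      have "pos \<nu> u' (v' (pos \<nu> u' k)) = pos \<nu> u' k" using ih[OF j jr] pos_tab[OF tv pos_in[OF tu less.prems]] by simp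
      then have "v' (pos \<nu> u' k) = k" using tab_pos[OF tu jr] tab_pos[OF tu less.prems] by simp
      then show False using j by simp
    qed
    have ih: "\<And>j. j < k \<Longrightarrow> j \<in> {1..sum_list \<nu>} \<Longrightarrow> pos \<nu> u j = pos \<nu> v j" using less.IH by blast
    have "fst (pos \<nu> u k) = fst (pos \<nu> v k)"
      using aux[OF u v ih c[OF less.prems]] aux[OF v u ih[symmetric] c[OF less.prems, symmetric]] by linarith
    moreover from this have "snd (pos \<nu> u k) = snd (pos \<nu> v k)" using c[OF less.prems] unfolding cont_def by linarith
    ultimately show ?case by (simp add: prod_eq_iff)
  qed
qed

text \<open>If the node of i + 1 is weakly below and to the right of that of i, then a further node
  in the rectangle between them would carry an entry strictly between i and i + 1. So the two nodes
  are neighbours or lie in strictly opposite directions.\<close>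

lemma standard_consecutive:
  assumes \<nu>: "is_part \<nu>" and v: "standard \<nu> v" and i: "1 \<le> i" "i < sum_list \<nu>"
  shows "(fst (pos \<nu> v (Suc i)) = fst (pos \<nu> v i) \<and> snd (pos \<nu> v (Suc i)) = Suc (snd (pos \<nu> v i)))
    \<or> (snd (pos \<nu> v (Suc i)) = snd (pos \<nu> v i) \<and> fst (pos \<nu> v (Suc i)) = Suc (fst (pos \<nu> v i)))
    \<or> (fst (pos \<nu> v i) < fst (pos \<nu> v (Suc i)) \<and> snd (pos \<nu> v (Suc i)) < snd (pos \<nu> v i))
    \<or> (fst (pos \<nu> v (Suc i)) < fst (pos \<nu> v i) \<and> snd (pos \<nu> v i) < snd (pos \<nu> v (Suc i)))"
proof -
  note t = standard_tab[OF v]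
  define x y where "x = pos \<nu> v i" and "y = pos \<nu> v (Suc i)"
  have r: "i \<in> {1..sum_list \<nu>}" "Suc i \<in> {1..sum_list \<nu>}" using i by auto
  have xy: "x \<in> nodes \<nu>" "y \<in> nodes \<nu>" "v x = i" "v y = Suc i"
    using pos_in[OF t] tab_pos[OF t] r by (auto simp: x_def y_def)
  have ne: "x \<noteq> y" using xy by auto
  have no: False if z: "z \<in> nodes \<nu>" "z \<noteq> x" "z \<noteq> y" "fst x \<le> fst z" "snd x \<le> snd z" "fst z \<le> fst y" "snd z \<le> snd y" for z
    using standard_less[OF \<nu> v xy(1) z(1)] standard_less[OF \<nu> v z(1) xy(2)] z xy by auto
  have n1: "\<not> (fst y \<le> fst x \<and> snd y \<le> snd x)" using standard_less[OF \<nu> v xy(2,1)] xy ne by auto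
  have xpos: "1 \<le> fst x" "1 \<le> snd x" using xy(1) by (auto simp: nodes_def)
  have yy: "(fst y, snd y) \<in> nodes \<nu>" using xy(2) by simp
  consider "fst x \<le> fst y" "snd x \<le> snd y" | "fst x < fst y" "snd y < snd x" | "fst y < fst x" "snd x < snd y"
    using n1 by linarith
  then show ?thesis unfolding x_def[symmetric] y_def[symmetric]
  proof cases
    case 1
    have z1: "(fst x, Suc (snd x)) \<in> nodes \<nu>" if "snd x < snd y"
      by (rule nodes_down[OF \<nu> yy]) (use 1 that xpos in auto)
    have z2: "(Suc (fst x), snd x) \<in> nodes \<nu>" if "fst x < fst y"
      by (rule nodes_down[OF \<nu> yy]) (use 1 that xpos in auto)
    show "fst y = fst x \<and> snd y = Suc (snd x) \<or> snd y = snd x \<and> fst y = Suc (fst x) \<or>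
      fst x < fst y \<and> snd y < snd x \<or> fst y < fst x \<and> snd x < snd y"
    proof (cases "snd x < snd y")
      case True
      then have "(fst x, Suc (snd x)) = y" using no[OF z1[OF True]] 1 by (auto simp: prod_eq_iff)
      then show ?thesis by auto
    next
      case False
      then have lt: "fst x < fst y" using 1 ne by (auto simp: prod_eq_iff)
      then have "(Suc (fst x), snd x) = y" using no[OF z2[OF lt]] 1 by (auto simp: prod_eq_iff)
      then show ?thesis by auto
    qed
  qed auto
qed

section \<open>Exchanging two consecutive entries\<close>

lemma sgen_tableau:
  assumes t: "tableau \<nu> v" and i: "1 \<le> i" "i < sum_list \<nu>"
  shows "tableau \<nu> (sgen i \<circ> v)"
proof -
  have "bij_betw (sgen i) {1..sum_list \<nu>} {1..sum_list \<nu>}"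
    using sgen_permutes[OF i] by (rule permutes_imp_bij)
  then have "bij_betw (sgen i \<circ> v) (nodes \<nu>) {1..sum_list \<nu>}" using tableau_bij[OF t] bij_betw_trans by blast
  moreover have "(sgen i \<circ> v) x = 0" if "x \<notin> nodes \<nu>" for x using tab_out[OF t that] i by (simp add: sgen_if)
  ultimately show ?thesis by (simp add: tableau_def)
qed

lemma pos_sgen:
  assumes t: "tableau \<nu> v" and i: "1 \<le> i" "i < sum_list \<nu>" and k: "k \<in> {1..sum_list \<nu>}"
  shows "pos \<nu> (sgen i \<circ> v) k = pos \<nu> v (sgen i k)"
proof -
  have r: "sgen i k \<in> {1..sum_list \<nu>}" using permutes_in_image[OF sgen_permutes[OF i]] k by blast
  have "(sgen i \<circ> v) (pos \<nu> v (sgen i k)) = k" using tab_pos[OF t r] by simp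
  then show ?thesis using pos_tab[OF sgen_tableau[OF t i] pos_in[OF t r]] by simp
qed

lemma cont_sgen:
  assumes "tableau \<nu> v" "1 \<le> i" "i < sum_list \<nu>" "k \<in> {1..sum_list \<nu>}"
  shows "cont \<nu> (sgen i \<circ> v) k = (cont \<nu> v \<circ> sgen i) k"
  using pos_sgen[OF assms] by (simp add: cont_def)

lemma standard_sgen:
  assumes \<nu>: "is_part \<nu>" and v: "standard \<nu> v" and i: "1 \<le> i" "i < sum_list \<nu>"
    and far: "fst (pos \<nu> v i) < fst (pos \<nu> v (Suc i)) \<and> snd (pos \<nu> v (Suc i)) < snd (pos \<nu> v i)
      \<or> fst (pos \<nu> v (Suc i)) < fst (pos \<nu> v i) \<and> snd (pos \<nu> v i) < snd (pos \<nu> v (Suc i))"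
  shows "standard \<nu> (sgen i \<circ> v)"
proof (rule standardI[OF sgen_tableau[OF standard_tab[OF v] i]])
  note t = standard_tab[OF v]
  fix x y assume xy: "x \<in> nodes \<nu>" "y \<in> nodes \<nu>" "fst x \<le> fst y" "snd x \<le> snd y" "x \<noteq> y"
  have lt: "v x < v y" using standard_less[OF \<nu> v xy] .
  have "\<not> (v x = i \<and> v y = Suc i)"
    using far pos_tab[OF t xy(1)] pos_tab[OF t xy(2)] xy(3,4) by auto
  moreover have "\<not> (v x = Suc i \<and> v y = i)" using lt by simp
  ultimately show "(sgen i \<circ> v) x < (sgen i \<circ> v) y" using sgen_less_iff lt by simp
qed

section \<open>Row and column fillings, and the permutations d(v)\<close>

lemma tnu_eq: "x \<in> nodes \<nu> \<Longrightarrow> tnu \<nu> x = rank rlt (nodes \<nu>) x"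
  unfolding tnu_def rowfill_def rank_def rlt_def by simp

lemma tnu_tableau: "tableau \<nu> (tnu \<nu>)"
proof -
  have "bij_betw (tnu \<nu>) (nodes \<nu>) {1..sum_list \<nu>}"
    using rank_bij[OF strict_linear_rlt finite_nodes, of \<nu>] card_nodes[of \<nu>] tnu_eq bij_betw_cong by metis
  then show ?thesis by (simp add: tableau_def tnu_def rowfill_def)
qed

lemma tnu_less_iff: "x \<in> nodes \<nu> \<Longrightarrow> y \<in> nodes \<nu> \<Longrightarrow> tnu \<nu> x < tnu \<nu> y \<longleftrightarrow> rlt x y"
  by (simp add: tnu_eq rank_less_iff[OF strict_linear_rlt])

lemma tnu_standard: "standard \<nu> (tnu \<nu>)"
  by (rule standardI[OF tnu_tableau]) (auto simp: tnu_less_iff rlt_def prod_eq_iff)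

definition tcol :: "nat list \<Rightarrow> nat \<times> nat \<Rightarrow> nat" where
  "tcol \<nu> x = (if x \<in> nodes \<nu> then rank clt (nodes \<nu>) x else 0)"

lemma tcol_tableau: "tableau \<nu> (tcol \<nu>)"
proof -
  have e: "tcol \<nu> x = rank clt (nodes \<nu>) x" if "x \<in> nodes \<nu>" for x using that by (simp add: tcol_def)
  have "bij_betw (tcol \<nu>) (nodes \<nu>) {1..sum_list \<nu>}"
    using rank_bij[OF strict_linear_clt finite_nodes, of \<nu>] card_nodes[of \<nu>] e bij_betw_cong by metis
  then show ?thesis by (simp add: tableau_def tcol_def)
qed

lemma tcol_less_iff: "x \<in> nodes \<nu> \<Longrightarrow> y \<in> nodes \<nu> \<Longrightarrow> tcol \<nu> x < tcol \<nu> y \<longleftrightarrow> clt x y"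
  by (simp add: tcol_def rank_less_iff[OF strict_linear_clt])

lemma tcol_standard: "standard \<nu> (tcol \<nu>)"
  by (rule standardI[OF tcol_tableau]) (auto simp: tcol_less_iff clt_def prod_eq_iff)

lemma dperm_eq: "k \<in> {1..sum_list \<nu>} \<Longrightarrow> dperm \<nu> v k = v (pos \<nu> (tnu \<nu>) k)"
  unfolding dperm_def pos_def by simp

lemma dperm_permutes:
  assumes t: "tableau \<nu> v" shows "dperm \<nu> v permutes {1..sum_list \<nu>}"
proof (rule bij_imp_permutes)
  have "bij_betw (pos \<nu> (tnu \<nu>)) {1..sum_list \<nu>} (nodes \<nu>)"
    unfolding pos_def using bij_betw_the_inv_into[OF tableau_bij[OF tnu_tableau]] by simp
  from bij_betw_trans[OF this tableau_bij[OF t]]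
  have "bij_betw (v \<circ> pos \<nu> (tnu \<nu>)) {1..sum_list \<nu>} {1..sum_list \<nu>}" .
  moreover have "(v \<circ> pos \<nu> (tnu \<nu>)) k = dperm \<nu> v k" if "k \<in> {1..sum_list \<nu>}" for k
    by (simp only: dperm_eq[OF that] comp_apply)
  ultimately show "bij_betw (dperm \<nu> v) {1..sum_list \<nu>} {1..sum_list \<nu>}"
    using bij_betw_cong by blast
  show "dperm \<nu> v x = x" if "x \<notin> {1..sum_list \<nu>}" for x
    using that unfolding dperm_def by (rule if_not_P)
qed

lemma dperm_SN: "tableau \<nu> v \<Longrightarrow> dperm \<nu> v \<in> SN"
  using dperm_permutes SN_I by blast

lemma dperm_tnu_node: "tableau \<nu> v \<Longrightarrow> x \<in> nodes \<nu> \<Longrightarrow> dperm \<nu> v (tnu \<nu> x) = v x"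
  using dperm_eq[OF tab_range[OF tnu_tableau]] pos_tab[OF tnu_tableau] by simp

lemma inv_dperm:
  assumes t: "tableau \<nu> v" and k: "k \<in> {1..sum_list \<nu>}"
  shows "inv (dperm \<nu> v) k = tnu \<nu> (pos \<nu> v k)"
proof -
  have "dperm \<nu> v (tnu \<nu> (pos \<nu> v k)) = k"
    using dperm_tnu_node[OF t pos_in[OF t k]] tab_pos[OF t k] by simp
  then show ?thesis using inv_SN_apply(2)[OF dperm_SN[OF t]] by metis
qed

lemma dperm_sgen:
  assumes t: "tableau \<nu> v" and i: "1 \<le> i" "i < sum_list \<nu>"
  shows "dperm \<nu> (sgen i \<circ> v) = sgen i \<circ> dperm \<nu> v"
proof
  fix k
  show "dperm \<nu> (sgen i \<circ> v) k = (sgen i \<circ> dperm \<nu> v) k"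
  proof (cases "k \<in> {1..sum_list \<nu>}")
    case True
    then show ?thesis by (simp add: dperm_eq)
  next
    case False
    then have "k \<noteq> i" "k \<noteq> Suc i" using i by auto
    moreover have "dperm \<nu> w k = k" for w using False unfolding dperm_def by (rule if_not_P)
    ultimately show ?thesis by (simp add: sgen_other)
  qed
qed

lemma dperm_tnu: "dperm \<nu> (tnu \<nu>) = id"
proof
  fix k show "dperm \<nu> (tnu \<nu>) k = id k"
    using tab_pos[OF tnu_tableau, of k \<nu>] dperm_eq[of k \<nu> "tnu \<nu>"] by (cases "k \<in> {1..sum_list \<nu>}") (auto simp: dperm_def)
qed

lemma dperm_inject: "tableau \<nu> u \<Longrightarrow> tableau \<nu> v \<Longrightarrow> dperm \<nu> u = dperm \<nu> v \<Longrightarrow> u = v"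
  by (metis tab_eqI dperm_tnu_node)

lemma dperm_asc_iff:
  assumes t: "tableau \<nu> v" and i: "1 \<le> i" "i < sum_list \<nu>"
  shows "inv (dperm \<nu> v) i < inv (dperm \<nu> v) (Suc i) \<longleftrightarrow> rlt (pos \<nu> v i) (pos \<nu> v (Suc i))"
proof -
  have r: "i \<in> {1..sum_list \<nu>}" "Suc i \<in> {1..sum_list \<nu>}" using i by auto
  show ?thesis using tnu_less_iff[OF pos_in[OF t r(1)] pos_in[OF t r(2)]] inv_dperm[OF t] r by simp
qed

lemma finite_standard: "finite {v. standard \<nu> v}"
proof (rule finite_subset)
  show "{v. standard \<nu> v} \<subseteq> {v. tableau \<nu> v}" using standard_tab by blast
  have "inj_on (dperm \<nu>) {v. tableau \<nu> v}" by (rule inj_onI) (use dperm_inject in blast)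
  moreover have "dperm \<nu> ` {v. tableau \<nu> v} \<subseteq> {w. w permutes {1..sum_list \<nu>}}" using dperm_permutes by blast
  then have "finite (dperm \<nu> ` {v. tableau \<nu> v})" by (rule finite_subset[OF _ finite_Sm])
  ultimately show "finite {v. tableau \<nu> v}" by (rule finite_imageD[rotated])
qed

text \<open>A descent of d(v) says that i + 1 precedes i in row reading order. Among the possible
  relative positions this leaves only i + 1 strictly above and to the right of i, where the exchange
  keeps the tableau standard.\<close>

lemma standard_down_step:
  assumes \<nu>: "is_part \<nu>" and v: "standard \<nu> v" and ne: "v \<noteq> tnu \<nu>"
  obtains i where "1 \<le> i" "i < sum_list \<nu>" "standard \<nu> (sgen i \<circ> v)" "inv (dperm \<nu> v) (Suc i) < inv (dperm \<nu> v) i"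
    "fst (pos \<nu> v (Suc i)) < fst (pos \<nu> v i)" "snd (pos \<nu> v i) < snd (pos \<nu> v (Suc i))"
proof -
  note t = standard_tab[OF v]
  have "dperm \<nu> v \<noteq> id" using dperm_inject[OF t tnu_tableau] dperm_tnu ne by metis
  then obtain i where i: "1 \<le> i" "i < sum_list \<nu>" "inv (dperm \<nu> v) (Suc i) < inv (dperm \<nu> v) i"
    using exists_left_descent[OF dperm_permutes[OF t]] by blast
  then have "\<not> rlt (pos \<nu> v i) (pos \<nu> v (Suc i))" using dperm_asc_iff[OF t i(1,2)] by simp
  then have "fst (pos \<nu> v (Suc i)) < fst (pos \<nu> v i) \<and> snd (pos \<nu> v i) < snd (pos \<nu> v (Suc i))"
    using standard_consecutive[OF \<nu> v i(1,2)] unfolding rlt_def by auto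
  then show ?thesis using that i standard_sgen[OF \<nu> v i(1,2)] by blast
qed

text \<open>If consecutive entries always follow column reading order, v is the column filling by
  uniqueness of ranks. Otherwise some i + 1 lies strictly below and to the left of i, and exchanging
  them lengthens d(v).\<close>

lemma standard_up_step:
  assumes \<nu>: "is_part \<nu>" and v: "standard \<nu> v" and ne: "v \<noteq> tcol \<nu>"
  obtains i where "1 \<le> i" "i < sum_list \<nu>" "standard \<nu> (sgen i \<circ> v)" "inv (dperm \<nu> v) i < inv (dperm \<nu> v) (Suc i)"
    "fst (pos \<nu> v i) < fst (pos \<nu> v (Suc i))" "snd (pos \<nu> v (Suc i)) < snd (pos \<nu> v i)"
proof -
  note t = standard_tab[OF v]
  let ?m = "sum_list \<nu>"
  have "\<exists>i. 1 \<le> i \<and> i < ?m \<and> \<not> clt (pos \<nu> v i) (pos \<nu> v (Suc i))"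
  proof (rule ccontr)
    assume "\<not> ?thesis"
    then have c: "clt (pos \<nu> v i) (pos \<nu> v (Suc i))" if "1 \<le> i" "i < ?m" for i using that by blast
    have lt: "1 \<le> i \<Longrightarrow> i < j \<Longrightarrow> j \<le> ?m \<Longrightarrow> clt (pos \<nu> v i) (pos \<nu> v j)" for i j
    proof (induction j)
      case (Suc j)
      show ?case
      proof (cases "i = j")
        case True
        then show ?thesis using c[of j] Suc.prems by simp
      next
        case False
        then have "clt (pos \<nu> v i) (pos \<nu> v j)" using Suc by simp
        moreover have "clt (pos \<nu> v j) (pos \<nu> v (Suc j))" using c[of j] Suc.prems by simp
        ultimately show ?thesis using strict_linear_clt unfolding strict_linear_def by blast
      qed
    qed simp
    have "v x = rank clt (nodes \<nu>) x" if "x \<in> nodes \<nu>" for x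
    proof (rule rank_unique[OF strict_linear_clt finite_nodes _ _ that])
      show "bij_betw v (nodes \<nu>) {1..card (nodes \<nu>)}" using tableau_bij[OF t] by (simp add: card_nodes)
      fix x y assume xy: "x \<in> nodes \<nu>" "y \<in> nodes \<nu>" "clt x y"
      show "v x < v y"
      proof (rule ccontr)
        assume "\<not> v x < v y"
        then consider "v x = v y" | "v y < v x" by linarith
        then show False
        proof cases
          case 1
          then have "x = y" using tab_inj[OF t xy(1,2)] by blast
          then show False using xy(3) by (simp add: clt_def)
        next
          case 2
          have "clt (pos \<nu> v (v y)) (pos \<nu> v (v x))"
            using lt[OF _ 2] tab_range[OF t xy(1)] tab_range[OF t xy(2)] by simp
          then show False using pos_tab[OF t xy(1)] pos_tab[OF t xy(2)] xy(3) by (auto simp: clt_def)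
        qed
      qed
    qed
    then have "v = tcol \<nu>" by (intro tab_eqI[OF t tcol_tableau]) (simp add: tcol_def)
    then show False using ne by simp
  qed
  then obtain i where i: "1 \<le> i" "i < ?m" "\<not> clt (pos \<nu> v i) (pos \<nu> v (Suc i))" by blast
  then have far: "fst (pos \<nu> v i) < fst (pos \<nu> v (Suc i)) \<and> snd (pos \<nu> v (Suc i)) < snd (pos \<nu> v i)"
    using standard_consecutive[OF \<nu> v i(1,2)] unfolding clt_def by auto
  then have "rlt (pos \<nu> v i) (pos \<nu> v (Suc i))" by (simp add: rlt_def)
  then show ?thesis using that[OF i(1,2) standard_sgen[OF \<nu> v i(1,2)]] far dperm_asc_iff[OF t i(1,2)] by blast
qed

section \<open>Row and column blocks\<close>

definition psum :: "nat list \<Rightarrow> nat \<Rightarrow> nat" where "psum \<eta> k = sum_list (take k \<eta>)"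

text \<open>The row of k in the row filling, counted from 1. It makes sense for every composition,
  which is needed because moving a node from one row to another may leave the partitions.\<close>

definition blk :: "nat list \<Rightarrow> nat \<Rightarrow> nat" where "blk \<eta> k = (LEAST a. k \<le> psum \<eta> a)"

lemma psum_0 [simp]: "psum \<eta> 0 = 0" by (simp add: psum_def)

lemma psum_Suc: "k < length \<eta> \<Longrightarrow> psum \<eta> (Suc k) = psum \<eta> k + \<eta> ! k"
  by (simp add: psum_def take_Suc_conv_app_nth)

lemma psum_beyond: "length \<eta> \<le> k \<Longrightarrow> psum \<eta> k = sum_list \<eta>"
  by (simp add: psum_def)

lemma psum_Suc_ge: "psum \<eta> k \<le> psum \<eta> (Suc k)"
  by (cases "k < length \<eta>") (auto simp: psum_Suc psum_beyond)

lemma psum_mono: "k \<le> l \<Longrightarrow> psum \<eta> k \<le> psum \<eta> l"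
  using lift_Suc_mono_le[of "psum \<eta>", OF psum_Suc_ge] .

lemma psum_le: "psum \<eta> k \<le> sum_list \<eta>"
  using psum_mono[of k "max k (length \<eta>)" \<eta>] psum_beyond[of \<eta> "max k (length \<eta>)"] by simp

lemma blk_le_iff:
  assumes "k \<le> sum_list \<eta>" shows "blk \<eta> k \<le> a \<longleftrightarrow> k \<le> psum \<eta> a"
proof
  have "k \<le> psum \<eta> (length \<eta>)" using assms by (simp add: psum_beyond)
  then have *: "k \<le> psum \<eta> (blk \<eta> k)" unfolding blk_def by (rule LeastI)
  show "k \<le> psum \<eta> a" if "blk \<eta> k \<le> a" using * psum_mono[OF that, of \<eta>] by linarith
  show "blk \<eta> k \<le> a" if "k \<le> psum \<eta> a" unfolding blk_def using that by (rule Least_le)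
qed

lemma blk_eq_iff:
  assumes "k \<le> sum_list \<eta>" shows "blk \<eta> k = Suc a \<longleftrightarrow> psum \<eta> a < k \<and> k \<le> psum \<eta> (Suc a)"
  using blk_le_iff[OF assms, of a] blk_le_iff[OF assms, of "Suc a"] by linarith

lemma blk_pos: "1 \<le> k \<Longrightarrow> k \<le> sum_list \<eta> \<Longrightarrow> 1 \<le> blk \<eta> k"
  using blk_le_iff[of k \<eta> 0] by simp

lemma blk_mono: "mono_on {1..sum_list \<eta>} (blk \<eta>)"
proof (rule mono_onI)
  fix k l assume "k \<in> {1..sum_list \<eta>}" "l \<in> {1..sum_list \<eta>}" "k \<le> l"
  then show "blk \<eta> k \<le> blk \<eta> l" using blk_le_iff[of k \<eta> "blk \<eta> l"] blk_le_iff[of l \<eta> "blk \<eta> l"] by simp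
qed

lemma blk_le_length: "k \<le> sum_list \<eta> \<Longrightarrow> blk \<eta> k \<le> length \<eta>"
  by (simp add: blk_le_iff psum_beyond)

lemma card_nodes_rows: "card {y \<in> nodes \<nu>. fst y \<le> a} = psum \<nu> a"
proof -
  have "{y \<in> nodes \<nu>. fst y \<le> a} = nodes (take a \<nu>)"
    by (auto simp: nodes_def)
  then show ?thesis by (simp add: card_nodes psum_def)
qed

lemma blk_tnu:
  assumes x: "x \<in> nodes \<nu>" shows "blk \<nu> (tnu \<nu> x) = fst x"
proof -
  have r: "tnu \<nu> x \<le> sum_list \<nu>" using tab_range[OF tnu_tableau x] by simp
  obtain a where a: "fst x = Suc a" using x by (cases "fst x") (auto simp: nodes_def)
  have e: "tnu \<nu> x = Suc (card {y \<in> nodes \<nu>. rlt y x})" using tnu_eq[OF x] by (simp add: rank_def)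
  have "insert x {y \<in> nodes \<nu>. rlt y x} \<subseteq> {y \<in> nodes \<nu>. fst y \<le> Suc a}"
    using x a by (auto simp: rlt_def)
  then have "card (insert x {y \<in> nodes \<nu>. rlt y x}) \<le> card {y \<in> nodes \<nu>. fst y \<le> Suc a}"
    by (rule card_mono[rotated]) simp
  moreover have "x \<notin> {y \<in> nodes \<nu>. rlt y x}" by (simp add: rlt_def)
  ultimately have 1: "tnu \<nu> x \<le> psum \<nu> (Suc a)" unfolding e card_nodes_rows by simp
  have "{y \<in> nodes \<nu>. fst y \<le> a} \<subseteq> {y \<in> nodes \<nu>. rlt y x}" using a by (auto simp: rlt_def)
  then have "card {y \<in> nodes \<nu>. fst y \<le> a} \<le> card {y \<in> nodes \<nu>. rlt y x}" by (rule card_mono[rotated]) simp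
  then have 2: "psum \<nu> a < tnu \<nu> x" unfolding e card_nodes_rows by simp
  show ?thesis using blk_eq_iff[OF r, of a] 1 2 a by simp
qed

lemma fst_pos_tnu: "k \<in> {1..sum_list \<nu>} \<Longrightarrow> fst (pos \<nu> (tnu \<nu>) k) = blk \<nu> k"
  using blk_tnu[OF pos_in[OF tnu_tableau]] tab_pos[OF tnu_tableau] by metis

lemma blk_inv_dperm: "tableau \<nu> v \<Longrightarrow> k \<in> {1..sum_list \<nu>} \<Longrightarrow> blk \<nu> (inv (dperm \<nu> v) k) = fst (pos \<nu> v k)"
  using inv_dperm blk_tnu pos_in by metis

lemma row_stab_eq: "row_stab \<nu> = Yg (sum_list \<nu>) (blk \<nu>)"
proof (rule set_eqI)
  fix w
  let ?m = "sum_list \<nu>"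
  show "w \<in> row_stab \<nu> \<longleftrightarrow> w \<in> Yg ?m (blk \<nu>)"
  proof
    assume w: "w \<in> row_stab \<nu>"
    then have p: "w permutes {1..?m}" by (simp add: row_stab_def)
    have "blk \<nu> (w k) = blk \<nu> k" if k: "k \<in> {1..?m}" for k
    proof -
      have wk: "w k \<in> {1..?m}" using permutes_in_image[OF p] k by blast
      let ?x = "pos \<nu> (tnu \<nu>) k" and ?y = "pos \<nu> (tnu \<nu>) (w k)"
      have "?x \<in> nodes \<nu>" "?y \<in> nodes \<nu>" "w (tnu \<nu> ?x) = tnu \<nu> ?y"
        using pos_in[OF tnu_tableau] tab_pos[OF tnu_tableau] k wk by simp_all
      then have "fst ?x = fst ?y" using w unfolding row_stab_def by blast
      then show ?thesis using fst_pos_tnu k wk by metis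
    qed
    then show "w \<in> Yg ?m (blk \<nu>)" using p unfolding Yg_def by blast
  next
    assume w: "w \<in> Yg ?m (blk \<nu>)"
    have "fst x = fst y" if "x \<in> nodes \<nu>" "y \<in> nodes \<nu>" "w (tnu \<nu> x) = tnu \<nu> y" for x y
      using Yg_label[OF w tab_range[OF tnu_tableau that(1)]] that blk_tnu by metis
    then show "w \<in> row_stab \<nu>" using Yg_permutes[OF w] unfolding row_stab_def by blast
  qed
qed

text \<open>In the column filling the columns are consecutive blocks of numbers, so that the column
  stabilizer becomes a Young subgroup with monotone labels.\<close>

definition bcol :: "nat list \<Rightarrow> nat \<Rightarrow> nat" where "bcol \<nu> k = snd (pos \<nu> (tcol \<nu>) k)"

lemma bcol_mono: "mono_on {1..sum_list \<nu>} (bcol \<nu>)"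
proof (rule mono_onI, rule ccontr)
  fix k l assume k: "k \<in> {1..sum_list \<nu>}" and l: "l \<in> {1..sum_list \<nu>}" and kl: "k \<le> l" and "\<not> bcol \<nu> k \<le> bcol \<nu> l"
  then have "clt (pos \<nu> (tcol \<nu>) l) (pos \<nu> (tcol \<nu>) k)" by (simp add: clt_def bcol_def)
  then have "tcol \<nu> (pos \<nu> (tcol \<nu>) l) < tcol \<nu> (pos \<nu> (tcol \<nu>) k)"
    using tcol_less_iff[OF pos_in[OF tcol_tableau l] pos_in[OF tcol_tableau k]] by simp
  then show False using tab_pos[OF tcol_tableau k] tab_pos[OF tcol_tableau l] kl by simp
qed

text \<open>Without a clash the entries of one column of \<open>\<nu>\<close> have different row
  labels, so at most a of them have a label up to a, and never more than the column contains. The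
  right side is at least the first bound if the column reaches row a; otherwise, for positive a, it
  equals the second.\<close>

lemma column_count:
  assumes \<nu>: "is_part \<nu>" and w: "w permutes {1..sum_list \<nu>}" and sum: "sum_list \<rho> = sum_list \<nu>"
    and nc: "\<not> clash (sum_list \<nu>) (bcol \<nu>) (blk \<rho>) w"
  shows "card {j \<in> {1..sum_list \<nu>}. bcol \<nu> j = c \<and> blk \<rho> (w j) \<le> a} \<le> card {x \<in> nodes \<nu>. snd x = c \<and> fst x \<le> a}"
    (is "card ?A \<le> card ?B")
proof -
  have wj: "w j \<in> {1..sum_list \<rho>}" if "j \<in> {1..sum_list \<nu>}" for j using permutes_in_image[OF w] that sum by simp
  have blk1: "1 \<le> blk \<rho> (w j)" if "j \<in> {1..sum_list \<nu>}" for j using blk_pos[of "w j" \<rho>] wj[OF that] by simp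
  have finA: "finite ?A" by simp
  show ?thesis
  proof (cases "(a, c) \<in> nodes \<nu>")
    case True
    have inj: "inj_on (\<lambda>j. blk \<rho> (w j)) ?A"
      using nc unfolding clash_def inj_on_def by blast
    have "(\<lambda>j. blk \<rho> (w j)) ` ?A \<subseteq> {1..a}" using blk1 by auto
    then have "card ?A \<le> card {1..a}" using card_inj_on_le[OF inj] by blast
    moreover have "(\<lambda>r. (r, c)) ` {1..a} \<subseteq> ?B"
    proof (rule image_subsetI)
      fix r assume "r \<in> {1..a}"
      then show "(r, c) \<in> ?B" using nodes_down[OF \<nu> True, of r c] True by (simp add: nodes_iff)
    qed
    then have "card ((\<lambda>r. (r, c)) ` {1..a}) \<le> card ?B" by (rule card_mono[rotated]) simp
    moreover have "card ((\<lambda>r. (r, c)) ` {1..a}) = card {1..a}" by (rule card_image) (simp add: inj_on_def)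
    ultimately show ?thesis by linarith
  next
    case False
    show ?thesis
    proof (cases "a = 0")
      case True
      then have "?A = {}" using blk1 by fastforce
      then have "card ?A = 0" by (rule arg_cong[where f = card, THEN trans]) simp
      then show ?thesis by linarith
    next
      case a: False
      have le: "fst x \<le> a" if "x \<in> nodes \<nu>" "snd x = c" for x
      proof (rule ccontr)
        assume "\<not> fst x \<le> a"
        moreover have "(fst x, c) \<in> nodes \<nu>" using that by (metis prod.collapse)
        ultimately have "(a, c) \<in> nodes \<nu>" using nodes_down[OF \<nu> _, of "fst x" c a c] a by (simp add: nodes_iff)
        then show False using False by simp
      qed
      have "?A \<subseteq> tcol \<nu> ` ?B"
      proof
        fix j assume "j \<in> ?A"
        then have j: "j \<in> {1..sum_list \<nu>}" "snd (pos \<nu> (tcol \<nu>) j) = c" by (auto simp: bcol_def)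
        then have "pos \<nu> (tcol \<nu>) j \<in> ?B" using pos_in[OF tcol_tableau j(1)] le by simp
        then show "j \<in> tcol \<nu> ` ?B" by (rule image_eqI[where f = "tcol \<nu>" and x = "pos \<nu> (tcol \<nu>) j", OF tab_pos[OF tcol_tableau j(1), symmetric]])
      qed
      then have "card ?A \<le> card (tcol \<nu> ` ?B)" by (rule card_mono[rotated]) simp
      also have "\<dots> \<le> card ?B" by (rule card_image_le) simp
      finally show ?thesis .
    qed
  qed
qed

lemma card_sum_fibres:
  assumes "finite J" "finite C" "\<And>j. j \<in> J \<Longrightarrow> f j \<in> C"
  shows "card J = (\<Sum>c\<in>C. card {j \<in> J. f j = c})"
proof -
  have "f ` J \<subseteq> C" using assms(3) by blast
  then show ?thesis using sum.group[of J C f "\<lambda>_. 1::nat"] assms by simp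
qed

lemma card_column_rows:
  assumes w: "w permutes {1..sum_list \<nu>}" and sum: "sum_list \<rho> = sum_list \<nu>"
  shows "(\<Sum>c\<in>snd ` nodes \<nu>. card {j \<in> {1..sum_list \<nu>}. bcol \<nu> j = c \<and> blk \<rho> (w j) \<le> a}) = psum \<rho> a"
    and "(\<Sum>c\<in>snd ` nodes \<nu>. card {x \<in> nodes \<nu>. snd x = c \<and> fst x \<le> a}) = psum \<nu> a"
proof -
  let ?m = "sum_list \<nu>"
  let ?J = "{j \<in> {1..?m}. blk \<rho> (w j) \<le> a}"
  have "card ?J = (\<Sum>c\<in>snd ` nodes \<nu>. card {j \<in> ?J. bcol \<nu> j = c})"
  proof (rule card_sum_fibres)
    fix j assume "j \<in> ?J"
    then have "j \<in> {1..?m}" by blast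
    then show "bcol \<nu> j \<in> snd ` nodes \<nu>" unfolding bcol_def using pos_in[OF tcol_tableau] by blast
  qed simp_all
  moreover have "w ` ?J = {1..psum \<rho> a}"
  proof (rule set_eqI)
    fix k
    show "k \<in> w ` ?J \<longleftrightarrow> k \<in> {1..psum \<rho> a}"
    proof
      assume "k \<in> w ` ?J"
      then obtain j where j: "j \<in> {1..?m}" "blk \<rho> (w j) \<le> a" "k = w j" by blast
      have "w j \<in> {1..?m}" using permutes_in_image[OF w] j(1) by blast
      then show "k \<in> {1..psum \<rho> a}" using blk_le_iff[of "w j" \<rho> a] j sum by simp
    next
      assume k: "k \<in> {1..psum \<rho> a}"
      then have km: "k \<in> {1..?m}" using psum_le[of \<rho> a] sum by simp
      have "inv w k \<in> {1..?m}" "w (inv w k) = k"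
        using permutes_in_image[OF permutes_inv[OF w]] km permutes_inverses(1)[OF w] by blast+
      moreover have "blk \<rho> k \<le> a" using k km sum by (simp add: blk_le_iff)
      ultimately show "k \<in> w ` ?J" by (intro image_eqI[of _ _ "inv w k"]) simp_all
    qed
  qed
  then have "card ?J = psum \<rho> a"
    using card_image[of w ?J] permutes_inj_on[OF w] by simp
  ultimately show "(\<Sum>c\<in>snd ` nodes \<nu>. card {j \<in> {1..?m}. bcol \<nu> j = c \<and> blk \<rho> (w j) \<le> a}) = psum \<rho> a"
    by (simp add: conj_ac)
  let ?K = "{x \<in> nodes \<nu>. fst x \<le> a}"
  have "card ?K = (\<Sum>c\<in>snd ` nodes \<nu>. card {x \<in> ?K. snd x = c})"
    by (rule card_sum_fibres) auto
  then show "(\<Sum>c\<in>snd ` nodes \<nu>. card {x \<in> nodes \<nu>. snd x = c \<and> fst x \<le> a}) = psum \<nu> a"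
    unfolding card_nodes_rows by (simp add: conj_ac)
qed

text \<open>Summed over all columns, the bounds of \<open>column_count\<close> become the dominance
  inequalities. A strictly more dominant shape therefore always clashes.\<close>

lemma no_clash_psum:
  assumes "is_part \<nu>" "w permutes {1..sum_list \<nu>}" "sum_list \<rho> = sum_list \<nu>"
    "\<not> clash (sum_list \<nu>) (bcol \<nu>) (blk \<rho>) w"
  shows "psum \<rho> a \<le> psum \<nu> a"
  unfolding card_column_rows(1)[OF assms(2,3), of a, symmetric] card_column_rows(2)[OF assms(2,3), of a, symmetric]
  by (rule sum_mono) (rule column_count[OF assms])

lemma psum_inject:
  assumes "is_part \<nu>" "is_part \<rho>" "\<And>k. psum \<nu> k = psum \<rho> k" shows "\<nu> = \<rho>"
proof (rule nth_equalityI)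
  have le: "length \<alpha> \<le> length \<beta>" if "is_part \<alpha>" "\<And>k. psum \<alpha> k = psum \<beta> k" for \<alpha> \<beta>
  proof (rule ccontr)
    assume "\<not> length \<alpha> \<le> length \<beta>"
    then have l: "length \<beta> < length \<alpha>" by simp
    then have "psum \<alpha> (Suc (length \<beta>)) = psum \<alpha> (length \<beta>) + \<alpha> ! length \<beta>" by (rule psum_Suc)
    moreover have "psum \<beta> (Suc (length \<beta>)) = psum \<beta> (length \<beta>)" by (simp add: psum_beyond)
    ultimately have "\<alpha> ! length \<beta> = 0" using that(2) by simp
    then show False using is_part_pos[OF that(1) l] by simp
  qed
  show l: "length \<nu> = length \<rho>" using le[OF assms(1,3)] le[OF assms(2), of \<nu>] assms(3) by simp
  fix i assume i: "i < length \<nu>"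
  show "\<nu> ! i = \<rho> ! i" using psum_Suc[OF i] psum_Suc[of i \<rho>] i l assms(3)[of i] assms(3)[of "Suc i"] by simp
qed

lemma dominating_clash:
  assumes "is_part \<nu>" "is_part \<rho>" "sum_list \<rho> = sum_list \<nu>" "strictly_dominates \<rho> \<nu>" "w permutes {1..sum_list \<nu>}"
  shows "clash (sum_list \<nu>) (bcol \<nu>) (blk \<rho>) w"
proof (rule ccontr)
  assume n: "\<not> ?thesis"
  have "psum \<nu> k = psum \<rho> k" for k
    using no_clash_psum[OF assms(1,5,3) n, of k] assms(4) unfolding strictly_dominates_def psum_def by (simp add: le_antisym)
  then have "\<nu> = \<rho>" by (rule psum_inject[OF assms(1,2)])
  then show False using assms(4) by (simp add: strictly_dominates_def)
qed

definition wcol :: "nat list \<Rightarrow> nat \<Rightarrow> nat" where "wcol \<nu> = dperm \<nu> (tcol \<nu>)"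

lemma wcol_permutes: "wcol \<nu> permutes {1..sum_list \<nu>}"
  unfolding wcol_def by (rule dperm_permutes[OF tcol_tableau])

text \<open>For equal shapes every column bound is attained. This forces the entries of each column
  into the rows in their natural order, and minimality then leaves the inverse of
  \<open>wcol\<close> as the only candidate.\<close>

lemma wcol_no_clash_unique:
  assumes \<nu>: "is_part \<nu>" and w: "w permutes {1..sum_list \<nu>}"
    and nc: "\<not> clash (sum_list \<nu>) (bcol \<nu>) (blk \<nu>) w" and dm: "dmin (sum_list \<nu>) (bcol \<nu>) (blk \<nu>) w"
  shows "w = inv (wcol \<nu>)"
proof -
  let ?m = "sum_list \<nu>"
  let ?u = "\<lambda>x. w (tcol \<nu> x)"
  \<comment> \<open>Termwise bounds with equal sums are equalities.\<close>
  have eqc: "card {j \<in> {1..?m}. bcol \<nu> j = c \<and> blk \<nu> (w j) \<le> a} = card {x \<in> nodes \<nu>. snd x = c \<and> fst x \<le> a}"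
    if "c \<in> snd ` nodes \<nu>" for a c
    using sum_mono_inv[of "\<lambda>c. card {j \<in> {1..?m}. bcol \<nu> j = c \<and> blk \<nu> (w j) \<le> a}" "snd ` nodes \<nu>"
        "\<lambda>c. card {x \<in> nodes \<nu>. snd x = c \<and> fst x \<le> a}" c]
      card_column_rows[OF w refl, of a] column_count[OF \<nu> w refl nc] that by simp
  have urange: "?u x \<in> {1..?m}" if "x \<in> nodes \<nu>" for x
    using tab_range[OF tcol_tableau that] permutes_in_image[OF w] by blast
  have incw: "w k < w l" if "k < l" "k \<in> {1..?m}" "l \<in> {1..?m}" "bcol \<nu> k = bcol \<nu> l" for k l
    using increasing_on_block[where f = w, OF bcol_mono _ that] dm unfolding dmin_def by blast
  have incb: "blk \<nu> (w k) < blk \<nu> (w l)" if "k < l" "k \<in> {1..?m}" "l \<in> {1..?m}" "bcol \<nu> k = bcol \<nu> l" for k l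
  proof -
    have "w k \<in> {1..?m}" "w l \<in> {1..?m}" using that(2,3) permutes_in_image[OF w] by blast+
    then have "blk \<nu> (w k) \<le> blk \<nu> (w l)" using mono_onD[OF blk_mono] incw[OF that] by simp
    moreover have "blk \<nu> (w k) \<noteq> blk \<nu> (w l)" using nc that unfolding clash_def by (metis less_irrefl)
    ultimately show ?thesis by simp
  qed
  have bc: "bcol \<nu> (tcol \<nu> x) = snd x" if "x \<in> nodes \<nu>" for x
    using pos_tab[OF tcol_tableau that] by (simp add: bcol_def)
  have row: "blk \<nu> (?u x) = fst x" if x: "x \<in> nodes \<nu>" for x
  proof -
    define c where "c = snd x"
    \<comment> \<open>Row labels increase strictly down a column, so the entry in row r has label at
      least r.\<close>
    have ge: "(r, c) \<in> nodes \<nu> \<Longrightarrow> r \<le> blk \<nu> (?u (r, c))" for r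
    proof (induction r)
      case (Suc r)
      show ?case
      proof (cases "r = 0")
        case True
        then show ?thesis using blk_pos[of "?u (Suc r, c)" \<nu>] urange[OF Suc.prems] by simp
      next
        case False
        then have n: "(r, c) \<in> nodes \<nu>" using nodes_down[OF \<nu> Suc.prems, of r c] Suc.prems by (simp add: nodes_iff)
        have "tcol \<nu> (r, c) < tcol \<nu> (Suc r, c)" using tcol_less_iff[OF n Suc.prems] by (simp add: clt_def)
        then have "blk \<nu> (?u (r, c)) < blk \<nu> (?u (Suc r, c))"
          using incb tab_range[OF tcol_tableau n] tab_range[OF tcol_tableau Suc.prems] bc[OF n] bc[OF Suc.prems] by simp
        then show ?thesis using Suc.IH[OF n] by simp
      qed
    qed simp
    have xc: "x = (fst x, c)" by (simp add: c_def)
    have g: "fst x \<le> blk \<nu> (?u x)" using ge[of "fst x"] x xc by simp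
    have "blk \<nu> (?u x) \<le> fst x"
    proof (rule ccontr)
      assume n: "\<not> blk \<nu> (?u x) \<le> fst x"
      let ?J = "{j \<in> {1..?m}. bcol \<nu> j = c \<and> blk \<nu> (w j) \<le> fst x}"
      let ?B = "{y \<in> nodes \<nu>. snd y = c \<and> fst y \<le> fst x}"
      \<comment> \<open>A label that is too large would exclude x from the count and make it one too
        small for \<open>eqc\<close>.\<close>
      have "?J \<subseteq> tcol \<nu> ` (?B - {x})"
      proof
        fix j assume j: "j \<in> ?J"
        let ?y = "pos \<nu> (tcol \<nu>) j"
        have jr: "j \<in> {1..?m}" using j by simp
        have y: "?y \<in> nodes \<nu>" "tcol \<nu> ?y = j" "snd ?y = c"
          using pos_in[OF tcol_tableau jr] tab_pos[OF tcol_tableau jr] j by (auto simp: bcol_def)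
        have "blk \<nu> (?u ?y) \<le> fst x" using j y by simp
        moreover have "fst ?y \<le> blk \<nu> (?u ?y)" using ge[of "fst ?y"] y by (metis prod.collapse)
        moreover have "?y \<noteq> x" using n calculation(1) by auto
        ultimately have "?y \<in> ?B - {x}" using y by simp
        then show "j \<in> tcol \<nu> ` (?B - {x})" by (rule image_eqI[where f = "tcol \<nu>" and x = "pos \<nu> (tcol \<nu>) j", OF y(2)[symmetric]])
      qed
      then have "card ?J \<le> card (tcol \<nu> ` (?B - {x}))" by (rule card_mono[rotated]) simp
      also have "\<dots> \<le> card (?B - {x})" by (rule card_image_le) simp
      also have "\<dots> < card ?B" by (rule card_Diff1_less) (use x c_def in auto)
      finally show False using eqc[of c "fst x"] x c_def by auto
    qed
    then show ?thesis using g by simp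
  qed
  have tab: "tableau \<nu> (\<lambda>x. if x \<in> nodes \<nu> then ?u x else 0)"
  proof -
    have "bij_betw (w \<circ> tcol \<nu>) (nodes \<nu>) {1..?m}"
      using bij_betw_trans[OF tableau_bij[OF tcol_tableau] permutes_imp_bij[OF w]] .
    then have "bij_betw (\<lambda>x. if x \<in> nodes \<nu> then ?u x else 0) (nodes \<nu>) {1..?m}"
      by (rule bij_betw_cong[THEN iffD1, rotated]) simp
    then show ?thesis by (simp add: tableau_def)
  qed
  \<comment> \<open>The labels now agree with the rows, and minimality of w orders the entries
    inside each row, so \<open>?u\<close> is the row filling.\<close>
  have u: "?u x = tnu \<nu> x" if "x \<in> nodes \<nu>" for x
  proof -
    have "bij_betw ?u (nodes \<nu>) {1..card (nodes \<nu>)}"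
      using bij_betw_trans[OF tableau_bij[OF tcol_tableau] permutes_imp_bij[OF w]] by (simp add: card_nodes comp_def)
    moreover have "?u x < ?u y" if xy: "x \<in> nodes \<nu>" "y \<in> nodes \<nu>" "rlt x y" for x y
    proof (rule ccontr)
      assume n: "\<not> ?u x < ?u y"
      have "?u x \<noteq> ?u y"
        using xy tab_inj[OF tcol_tableau xy(1,2)] permutes_inj[OF w] by (auto simp: rlt_def dest: injD)
      then have lt: "?u y < ?u x" using n by simp
      then have "fst y \<le> fst x"
        using mono_onD[OF blk_mono urange[OF xy(2)] urange[OF xy(1)]] row[OF xy(1)] row[OF xy(2)] by simp
      then have f: "fst x = fst y" "snd x < snd y" using xy(3) by (auto simp: rlt_def)
      have "inv w (?u y) < inv w (?u x)"
        using increasing_on_block[where f = "inv w", OF blk_mono _ lt urange[OF xy(2)] urange[OF xy(1)]] dm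
          row[OF xy(1)] row[OF xy(2)] f unfolding dmin_def by simp
      then have "tcol \<nu> y < tcol \<nu> x" using inv_SN_apply(2)[OF SN_I[OF w]] by simp
      then show False using tcol_less_iff[OF xy(2,1)] f by (simp add: clt_def)
    qed
    ultimately show ?thesis using rank_unique[OF strict_linear_rlt finite_nodes _ _ that, of ?u] tnu_eq[OF that] by simp
  qed
  show ?thesis
  proof
    fix k
    show "w k = inv (wcol \<nu>) k"
    proof (cases "k \<in> {1..?m}")
      case True
      show ?thesis
        unfolding wcol_def inv_dperm[OF tcol_tableau True] u[OF pos_in[OF tcol_tableau True], symmetric] tab_pos[OF tcol_tableau True]
        by (rule refl)
    next
      case False
      then have "w k = k" "inv (wcol \<nu>) k = k"
        using w permutes_inv[OF wcol_permutes] unfolding permutes_def by blast+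
      then show ?thesis by simp
    qed
  qed
qed

section \<open>Inversions across rows\<close>

text \<open>Here \<open>\<rho>\<close> assigns a row to each entry, and a pair counts if the larger
  entry lies in an earlier row. For standard tableaux this number is the length of d(v), but it
  depends on the rows alone and so survives multiplication by row permutations.\<close>

definition xinv :: "nat \<Rightarrow> (nat \<Rightarrow> nat) \<Rightarrow> (nat \<times> nat) set" where
  "xinv m \<rho> = {(k, l). k \<in> {1..m} \<and> l \<in> {1..m} \<and> k < l \<and> \<rho> l < \<rho> k}"

lemma finite_xinv [simp]: "finite (xinv m \<rho>)"
  by (rule finite_subset[of _ "{1..m} \<times> {1..m}"]) (auto simp: xinv_def)

lemma xinv_cong: "(\<And>k. k \<in> {1..m} \<Longrightarrow> \<rho> k = \<rho>' k) \<Longrightarrow> xinv m \<rho> = xinv m \<rho>'"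
  unfolding xinv_def by auto

lemma card_xinv_swap:
  assumes k: "k \<in> {1..m}" and l: "l \<in> {1..m}" and kl: "k < l" "\<rho> l < \<rho> k"
  shows "card (xinv m (\<rho> \<circ> transpose k l)) < card (xinv m \<rho>)"
proof -
  let ?s = "transpose k l"
  \<comment> \<open>An involution on ordered pairs: a pair that starts before k or ends after l has
    its other endpoint exchanged by the transposition, and pairs inside the interval stay. It sends
    inversions after the swap to inversions before it and misses the fixed pair (k, l).\<close>
  define \<phi> where "\<phi> = (\<lambda>(a, b). if a < k then (a, ?s b) else if l < b then (?s a, b) else (a, b))"
  have s: "?s x = (if x = k then l else if x = l then k else x)" for x by (simp add: transpose_def)
  have invol: "\<phi> (\<phi> (a, b)) = (a, b)" if "a < b" for a b
    using that kl unfolding \<phi>_def by (auto simp: s)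
  have inj: "inj_on \<phi> (xinv m (\<rho> \<circ> ?s))"
    by (rule inj_on_inverseI[where g = \<phi>]) (auto simp: xinv_def invol)
  have "\<phi> (a, b) \<in> xinv m \<rho> - {(k, l)}" if ab: "(a, b) \<in> xinv m (\<rho> \<circ> ?s)" for a b
  proof -
    have r: "a \<in> {1..m}" "b \<in> {1..m}" "a < b" "\<rho> (?s b) < \<rho> (?s a)" using ab by (auto simp: xinv_def)
    consider "a < k" | "k \<le> a" "l < b" | "k \<le> a" "b \<le> l" by linarith
    then have "\<phi> (a, b) \<in> xinv m \<rho>"
    proof cases
      case 1
      then show ?thesis using r k l kl unfolding \<phi>_def xinv_def by (auto simp: s split: if_splits)
    next
      case 2
      then show ?thesis using r k l kl unfolding \<phi>_def xinv_def by (auto simp: s split: if_splits)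
    next
      case 3
      then have e: "\<phi> (a, b) = (a, b)" by (simp add: \<phi>_def)
      have "\<rho> b < \<rho> a" using 3 r kl by (auto simp: s split: if_splits)
      then show ?thesis unfolding e using r by (simp add: xinv_def)
    qed
    moreover have "\<phi> (a, b) \<noteq> (k, l)"
    proof
      assume "\<phi> (a, b) = (k, l)"
      then have "(a, b) = \<phi> (k, l)" using invol[OF r(3)] by simp
      also have "\<phi> (k, l) = (k, l)" by (simp add: \<phi>_def)
      finally show False using r kl by (simp add: s)
    qed
    ultimately show ?thesis by simp
  qed
  note img = this
  have "\<phi> ` xinv m (\<rho> \<circ> ?s) \<subseteq> xinv m \<rho> - {(k, l)}"
  proof (rule image_subsetI)
    fix y assume y: "y \<in> xinv m (\<rho> \<circ> ?s)"
    obtain a b where "y = (a, b)" by (cases y)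
    then show "\<phi> y \<in> xinv m \<rho> - {(k, l)}" using img y by blast
  qed
  then have "card (xinv m (\<rho> \<circ> ?s)) \<le> card (xinv m \<rho> - {(k, l)})"
    by (rule card_inj_on_le[OF inj]) simp
  also have "\<dots> < card (xinv m \<rho>)"
  proof (rule card_Diff1_less)
    show "(k, l) \<in> xinv m \<rho>" using k l kl by (simp add: xinv_def)
  qed simp
  finally show ?thesis .
qed

text \<open>Sorting the columns one transposition at a time removes inversions across rows.\<close>

lemma card_xinv_column_sorted:
  assumes bij: "bij_betw (\<lambda>k. (\<rho> k, \<kappa> k)) {1..m} N" and bij0: "bij_betw (\<lambda>k. (\<rho>0 k, \<kappa> k)) {1..m} N"
    and down: "\<And>r c r'. (r, c) \<in> N \<Longrightarrow> 1 \<le> r' \<Longrightarrow> r' \<le> r \<Longrightarrow> (r', c) \<in> N" and pos: "\<And>r c. (r, c) \<in> N \<Longrightarrow> 1 \<le> r"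
    and sorted0: "\<And>k l. k \<in> {1..m} \<Longrightarrow> l \<in> {1..m} \<Longrightarrow> k < l \<Longrightarrow> \<kappa> k = \<kappa> l \<Longrightarrow> \<rho>0 k < \<rho>0 l"
  shows "card (xinv m \<rho>0) \<le> card (xinv m \<rho>)"
    and "card (xinv m \<rho>) = card (xinv m \<rho>0) \<Longrightarrow> \<forall>k\<in>{1..m}. \<rho> k = \<rho>0 k"
proof -
  have row: "\<rho> k = card {l \<in> {1..m}. \<kappa> l = \<kappa> k \<and> l \<le> k}"
    if b: "bij_betw (\<lambda>k. (\<rho> k, \<kappa> k)) {1..m} N" and k: "k \<in> {1..m}"
      and sorted: "\<And>k l. k \<in> {1..m} \<Longrightarrow> l \<in> {1..m} \<Longrightarrow> k < l \<Longrightarrow> \<kappa> k = \<kappa> l \<Longrightarrow> \<rho> k < \<rho> l"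
    for \<rho> k
  proof -
    let ?L = "{l \<in> {1..m}. \<kappa> l = \<kappa> k \<and> l \<le> k}"
    have inN: "(\<rho> l, \<kappa> l) \<in> N" if "l \<in> {1..m}" for l using bij_betwE[OF b] that by blast
    have inj: "inj_on \<rho> ?L"
    proof (rule inj_onI)
      fix x y assume xy: "x \<in> ?L" "y \<in> ?L" "\<rho> x = \<rho> y"
      then have "(\<rho> x, \<kappa> x) = (\<rho> y, \<kappa> y)" by simp
      then show "x = y" using inj_onD[OF bij_betw_imp_inj_on[OF b]] xy by blast
    qed
    have "\<rho> ` ?L = {1..\<rho> k}"
    proof (rule set_eqI)
      fix j
      show "j \<in> \<rho> ` ?L \<longleftrightarrow> j \<in> {1..\<rho> k}"
      proof
        assume "j \<in> \<rho> ` ?L"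
        then obtain l where l: "l \<in> {1..m}" "\<kappa> l = \<kappa> k" "l \<le> k" "j = \<rho> l" by blast
        have "\<rho> l \<le> \<rho> k" using sorted[OF l(1) k _ l(2)] l(3) by (cases "l = k") auto
        then show "j \<in> {1..\<rho> k}" using pos[OF inN[OF l(1)]] l(4) by simp
      next
        assume j: "j \<in> {1..\<rho> k}"
        then have "(j, \<kappa> k) \<in> N" using down[OF inN[OF k]] by simp
        then have "(j, \<kappa> k) \<in> (\<lambda>k. (\<rho> k, \<kappa> k)) ` {1..m}" using bij_betw_imp_surj_on[OF b] by blast
        then obtain l where l0: "(j, \<kappa> k) = (\<rho> l, \<kappa> l)" "l \<in> {1..m}" by (rule imageE)
        then have l: "l \<in> {1..m}" "\<rho> l = j" "\<kappa> l = \<kappa> k" by simp_all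
        have "l \<le> k"
        proof (rule ccontr)
          assume "\<not> l \<le> k"
          then have "\<rho> k < \<rho> l" using sorted[OF k l(1)] l(3) by simp
          then show False using j l by simp
        qed
        then show "j \<in> \<rho> ` ?L" using l by blast
      qed
    qed
    then show ?thesis using card_image[OF inj] by simp
  qed
  have "card (xinv m \<rho>0) \<le> card (xinv m \<rho>) \<and> (card (xinv m \<rho>) = card (xinv m \<rho>0) \<longrightarrow> (\<forall>k\<in>{1..m}. \<rho> k = \<rho>0 k))"
    using bij
  proof (induction "card (xinv m \<rho>)" arbitrary: \<rho> rule: less_induct)
    case less
    show ?case
    proof (cases "\<exists>k\<in>{1..m}. \<exists>l\<in>{1..m}. k < l \<and> \<kappa> k = \<kappa> l \<and> \<not> \<rho> k < \<rho> l")
      case True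
      then obtain k l where kl: "k \<in> {1..m}" "l \<in> {1..m}" "k < l" "\<kappa> k = \<kappa> l" "\<not> \<rho> k < \<rho> l" by blast
      have "\<rho> k \<noteq> \<rho> l"
      proof
        assume "\<rho> k = \<rho> l"
        then have "(\<rho> k, \<kappa> k) = (\<rho> l, \<kappa> l)" using kl(4) by simp
        then have "k = l" using inj_onD[OF bij_betw_imp_inj_on[OF less.prems]] kl(1,2) by blast
        then show False using kl(3) by simp
      qed
      then have lt: "\<rho> l < \<rho> k" using kl by simp
      let ?\<rho> = "\<rho> \<circ> transpose k l"
      have c: "card (xinv m ?\<rho>) < card (xinv m \<rho>)" by (rule card_xinv_swap[OF kl(1-3) lt])
      have "bij_betw ((\<lambda>k. (\<rho> k, \<kappa> k)) \<circ> transpose k l) {1..m} N"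
        using bij_betw_trans[OF permutes_imp_bij[OF permutes_swap_id[OF kl(1,2)]] less.prems] .
      moreover have "((\<lambda>k. (\<rho> k, \<kappa> k)) \<circ> transpose k l) = (\<lambda>k. (?\<rho> k, \<kappa> k))"
        using kl(4) by (auto simp: fun_eq_iff transpose_def)
      ultimately have "bij_betw (\<lambda>k. (?\<rho> k, \<kappa> k)) {1..m} N" by simp
      from less.hyps[OF c this] show ?thesis using c by linarith
    next
      case False
      then have sorted: "\<And>k l. k \<in> {1..m} \<Longrightarrow> l \<in> {1..m} \<Longrightarrow> k < l \<Longrightarrow> \<kappa> k = \<kappa> l \<Longrightarrow> \<rho> k < \<rho> l" by blast
      have "\<rho> k = \<rho>0 k" if "k \<in> {1..m}" for k
        by (rule trans[OF row[OF less.prems that sorted] row[OF bij0 that sorted0, symmetric]])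
      then have "xinv m \<rho> = xinv m \<rho>0" "\<forall>k\<in>{1..m}. \<rho> k = \<rho>0 k" using xinv_cong[of m \<rho> \<rho>0] by blast+
      then show ?thesis by (metis le_refl)
    qed
  qed
  then show "card (xinv m \<rho>0) \<le> card (xinv m \<rho>)"
    and "card (xinv m \<rho>) = card (xinv m \<rho>0) \<Longrightarrow> \<forall>k\<in>{1..m}. \<rho> k = \<rho>0 k" by blast+
qed

text \<open>Row labels are monotone, so a pair inverted across rows is an inversion of the inverse
  of x.\<close>

lemma card_xinv_le_plen:
  assumes x: "x permutes {1..sum_list \<nu>}"
  shows "card (xinv (sum_list \<nu>) (\<lambda>k. blk \<nu> (inv x k))) \<le> plen x"
proof -
  note xS = SN_I[OF x]
  have "xinv (sum_list \<nu>) (\<lambda>k. blk \<nu> (inv x k)) \<subseteq> Invs (inv x)"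
  proof
    fix y assume "y \<in> xinv (sum_list \<nu>) (\<lambda>k. blk \<nu> (inv x k))"
    then obtain k l where y: "y = (k, l)" "k \<in> {1..sum_list \<nu>}" "l \<in> {1..sum_list \<nu>}" "k < l" "blk \<nu> (inv x l) < blk \<nu> (inv x k)"
      by (auto simp: xinv_def)
    have "inv x k \<in> {1..sum_list \<nu>}" "inv x l \<in> {1..sum_list \<nu>}"
      using y permutes_in_image[OF permutes_inv[OF x]] by blast+
    then have "inv x l < inv x k" using mono_onD[OF blk_mono, of "inv x k" \<nu> "inv x l"] y(5) by (meson leD leI)
    then show "y \<in> Invs (inv x)" using y by (simp add: Invs_def)
  qed
  then have "card (xinv (sum_list \<nu>) (\<lambda>k. blk \<nu> (inv x k))) \<le> card (Invs (inv x))"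
    by (rule card_mono[OF finite_Invs[OF SN_inv[OF xS]]])
  then show ?thesis using plen_inv[OF xS] by (simp add: plen_Invs)
qed

text \<open>Entries of a standard tableau increase within each row, so that every inversion is one
  across rows.\<close>

lemma plen_dperm_standard:
  assumes \<nu>: "is_part \<nu>" and v: "standard \<nu> v"
  shows "plen (dperm \<nu> v) = card (xinv (sum_list \<nu>) (\<lambda>k. fst (pos \<nu> v k)))"
proof -
  note t = standard_tab[OF v]
  let ?m = "sum_list \<nu>"
  have "Invs (inv (dperm \<nu> v)) = xinv ?m (\<lambda>k. fst (pos \<nu> v k))"
  proof (rule set_eqI, clarify)
    fix k l
    show "(k, l) \<in> Invs (inv (dperm \<nu> v)) \<longleftrightarrow> (k, l) \<in> xinv ?m (\<lambda>k. fst (pos \<nu> v k))"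
    proof (cases "k \<in> {1..?m} \<and> l \<in> {1..?m}")
      case True
      then have k: "k \<in> {1..?m}" and l: "l \<in> {1..?m}" by auto
      let ?x = "pos \<nu> v k" and ?y = "pos \<nu> v l"
      have n: "?x \<in> nodes \<nu>" "?y \<in> nodes \<nu>" using pos_in[OF t] k l by blast+
      have "rlt ?y ?x \<longleftrightarrow> fst ?y < fst ?x" if "k < l"
      proof -
        have "\<not> (fst ?y = fst ?x \<and> snd ?y < snd ?x)"
        proof
          assume *: "fst ?y = fst ?x \<and> snd ?y < snd ?x"
          then have "v ?y < v ?x" using standard_less[OF \<nu> v n(2,1)] by (metis le_refl less_imp_le less_irrefl)
          then show False using tab_pos[OF t k] tab_pos[OF t l] that by simp
        qed
        then show ?thesis by (auto simp: rlt_def)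
      qed
      then show ?thesis using tnu_less_iff[OF n(2,1)] inv_dperm[OF t k] inv_dperm[OF t l] k l
        by (auto simp: Invs_def xinv_def)
    next
      case False
      have p: "inv (dperm \<nu> v) permutes {1..?m}" using permutes_inv[OF dperm_permutes[OF t]] .
      have "(k, l) \<notin> Invs (inv (dperm \<nu> v))"
      proof
        assume "(k, l) \<in> Invs (inv (dperm \<nu> v))"
        then have kl: "k < l" "inv (dperm \<nu> v) l < inv (dperm \<nu> v) k" by (auto simp: Invs_def)
        have fix_out: "inv (dperm \<nu> v) x = x" if "x \<notin> {1..?m}" for x using p that unfolding permutes_def by blast
        have in_in: "inv (dperm \<nu> v) x \<in> {1..?m}" if "x \<in> {1..?m}" for x using permutes_in_image[OF p] that by blast
        show False
        proof (cases "k \<in> {1..?m}")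
          case True
          then have "l \<notin> {1..?m}" using False by simp
          then show False using fix_out[of l] in_in[OF True] True kl by auto
        next
          case k: False
          then show False using fix_out[of k] fix_out[of l] in_in[of l] kl by (cases "l \<in> {1..?m}") auto
        qed
      qed
      moreover have "(k, l) \<notin> xinv ?m (\<lambda>k. fst (pos \<nu> v k))" using False by (auto simp: xinv_def)
      ultimately show ?thesis by simp
    qed
  qed
  then show ?thesis using plen_inv[OF dperm_SN[OF t]] by (simp add: plen_Invs)
qed

section \<open>The ideal of more dominant shapes\<close>

abbreviation Xp :: "nat list \<Rightarrow> hk" where "Xp \<rho> \<equiv> Xs (sum_list \<rho>) (blk \<rho>)"

lemma cf_Xp: "cf (Xp \<rho>) = x_nu \<rho>"
proof
  fix v
  have "cf (Xp \<rho>) v = (\<Sum>w\<in>Yg (sum_list \<rho>) (blk \<rho>). if v = w then 1 else 0)"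
    unfolding Xs_def cf_sum by (rule sum.cong) (simp_all add: cf_TT Yg_SN)
  also have "\<dots> = x_nu \<rho> v" unfolding x_nu_def row_stab_eq by simp
  finally show "cf (Xp \<rho>) v = x_nu \<rho> v" .
qed

lemma x_uv_eq:
  assumes "tableau \<rho> u" "tableau \<rho> v"
  shows "x_uv \<rho> u v = cf (TT (inv (dperm \<rho> u)) * Xp \<rho> * TT (dperm \<rho> v))"
  unfolding x_uv_def cf_mult cf_Xp cf_Tb[OF SN_inv[OF dperm_SN[OF assms(1)]]] cf_Tb[OF dperm_SN[OF assms(2)]] ..

lemma cf_sum_smul: "(\<lambda>w. \<Sum>g\<in>t. c g * cf g w) = cf (\<Sum>g\<in>t. smul (c g) g)"
  by (rule ext) simp

lemma inj_cf: "inj cf"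
  by (rule injI) (simp add: cf_inject)

lemma span_in_cf:
  "cf a \<in> span_in R (cf ` S) \<longleftrightarrow>
    (\<exists>t c. finite t \<and> t \<subseteq> S \<and> (\<forall>g\<in>t. c g \<in> R) \<and> a = (\<Sum>g\<in>t. smul (c g) g))"
proof
  assume "cf a \<in> span_in R (cf ` S)"
  then obtain F c where F: "finite F" "F \<subseteq> cf ` S" "\<forall>b\<in>F. c b \<in> R" "cf a = (\<lambda>w. \<Sum>b\<in>F. c b * b w)"
    unfolding span_in_def by blast
  then obtain t where t: "t \<subseteq> S" "F = cf ` t" by (meson subset_imageE)
  have inj: "inj_on cf t" using inj_cf by (rule inj_on_subset) simp
  have "cf a = (\<lambda>w. \<Sum>g\<in>t. c (cf g) * cf g w)"
  proof
    fix w
    show "cf a w = (\<Sum>g\<in>t. c (cf g) * cf g w)"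
      unfolding F(4) t(2) sum.reindex[OF inj] comp_def ..
  qed
  then have "a = (\<Sum>g\<in>t. smul (c (cf g)) g)" unfolding cf_sum_smul by (simp only: cf_inject)
  moreover have "finite t" using F(1) inj unfolding t(2) by (rule finite_imageD)
  ultimately show "\<exists>t c. finite t \<and> t \<subseteq> S \<and> (\<forall>g\<in>t. c g \<in> R) \<and> a = (\<Sum>g\<in>t. smul (c g) g)"
    using t F(3) by (intro exI[of _ t] exI[of _ "\<lambda>g. c (cf g)"]) simp
next
  assume "\<exists>t c. finite t \<and> t \<subseteq> S \<and> (\<forall>g\<in>t. c g \<in> R) \<and> a = (\<Sum>g\<in>t. smul (c g) g)"
  then obtain t c where t: "finite t" "t \<subseteq> S" "\<forall>g\<in>t. c g \<in> R" "a = (\<Sum>g\<in>t. smul (c g) g)" by blast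
  have inj: "inj_on cf t" using inj_cf by (rule inj_on_subset) simp
  define d where "d b = c (the_inv cf b)" for b
  have d: "d (cf g) = c g" for g unfolding d_def by (simp add: the_inv_f_f[OF inj_cf])
  have "cf a = (\<lambda>w. \<Sum>b\<in>cf ` t. d b * b w)"
    unfolding t(4) cf_sum_smul[symmetric] sum.reindex[OF inj] comp_def d ..
  then show "cf a \<in> span_in R (cf ` S)"
    unfolding span_in_def using t d by (intro CollectI exI[of _ "cf ` t"] exI[of _ d]) auto
qed

lemma span_in_UNIV_cf: "cf a \<in> span_in UNIV (cf ` S) \<longleftrightarrow> a \<in> hk.span S"
  unfolding span_in_cf hk.span_explicit by blast

definition NN :: "nat list \<Rightarrow> hk set" where "NN \<nu> = {a. cf a \<in> Nbar \<nu>}"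

definition dominating :: "nat list \<Rightarrow> nat list \<Rightarrow> bool" where
  "dominating \<nu> \<rho> \<longleftrightarrow> partition_of (sum_list \<nu>) \<rho> \<and> strictly_dominates \<rho> \<nu>"

lemma dominatingD: "dominating \<nu> \<rho> \<Longrightarrow> is_part \<rho>" "dominating \<nu> \<rho> \<Longrightarrow> sum_list \<rho> = sum_list \<nu>"
  "dominating \<nu> \<rho> \<Longrightarrow> strictly_dominates \<rho> \<nu>"
  by (auto simp: dominating_def partition_of_def)

lemma tableau_of_perm:
  assumes "w permutes {1..sum_list \<rho>}"
  obtains v where "tableau \<rho> v" "dperm \<rho> v = w"
proof -
  have t: "tableau \<rho> (w \<circ> tnu \<rho>)"
  proof -
    have "bij_betw (w \<circ> tnu \<rho>) (nodes \<rho>) {1..sum_list \<rho>}"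
      using bij_betw_trans[OF tableau_bij[OF tnu_tableau] permutes_imp_bij[OF assms]] .
    moreover have "(w \<circ> tnu \<rho>) x = 0" if "x \<notin> nodes \<rho>" for x
      using tab_out[OF tnu_tableau that] SN_zero[OF SN_I[OF assms]] by simp
    ultimately show ?thesis by (simp add: tableau_def)
  qed
  have "dperm \<rho> (w \<circ> tnu \<rho>) = w"
  proof
    fix k
    show "dperm \<rho> (w \<circ> tnu \<rho>) k = w k"
    proof (cases "k \<in> {1..sum_list \<rho>}")
      case True
      then show ?thesis by (simp only: dperm_eq comp_apply tab_pos[OF tnu_tableau])
    next
      case False
      then have "dperm \<rho> (w \<circ> tnu \<rho>) k = k" unfolding dperm_def by (rule if_not_P)
      then show ?thesis using assms False unfolding permutes_def by metis
    qed
  qed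
  then show ?thesis using that t by blast
qed

text \<open>Every permutation is some d(u), so the generators become all T_w x_\<rho> T_w'. In this
  form the two-sided ideal property is visible.\<close>

lemma NN_span:
  "NN \<nu> = hk.span {TT w * Xp \<rho> * TT w' | w w' \<rho>. dominating \<nu> \<rho> \<and> w permutes {1..sum_list \<nu>} \<and> w' permutes {1..sum_list \<nu>}}"
  (is "_ = hk.span ?G")
proof -
  have "{x_uv \<rho> u v | \<rho> u v. partition_of (sum_list \<nu>) \<rho> \<and> strictly_dominates \<rho> \<nu> \<and> tableau \<rho> u \<and> tableau \<rho> v} = cf ` ?G"
    (is "?L = _")
  proof
    show "?L \<subseteq> cf ` ?G"
    proof
      fix y assume "y \<in> ?L"
      then obtain \<rho> u v where y: "y = x_uv \<rho> u v" "dominating \<nu> \<rho>" "tableau \<rho> u" "tableau \<rho> v"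
        by (auto simp: dominating_def)
      note s = dominatingD(2)[OF y(2)]
      have p: "inv (dperm \<rho> u) permutes {1..sum_list \<nu>}" "dperm \<rho> v permutes {1..sum_list \<nu>}"
        using permutes_inv[OF dperm_permutes[OF y(3)]] dperm_permutes[OF y(4)] unfolding s by blast+
      show "y \<in> cf ` ?G" unfolding y(1) x_uv_eq[OF y(3,4)] using p y(2) by (intro imageI) blast
    qed
    show "cf ` ?G \<subseteq> ?L"
    proof (rule image_subsetI)
      fix g assume "g \<in> ?G"
      then obtain w w' \<rho> where g: "g = TT w * Xp \<rho> * TT w'" "dominating \<nu> \<rho>" "w permutes {1..sum_list \<nu>}" "w' permutes {1..sum_list \<nu>}"
        by blast
      note s = dominatingD(2)[OF g(2)]
      obtain u where u: "tableau \<rho> u" "dperm \<rho> u = inv w"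
        using tableau_of_perm[of "inv w" \<rho>] permutes_inv[OF g(3)] unfolding s by blast
      obtain v where v: "tableau \<rho> v" "dperm \<rho> v = w'"
        using tableau_of_perm[of w' \<rho>] g(4) unfolding s by blast
      have "cf g = x_uv \<rho> u v"
        unfolding x_uv_eq[OF u(1) v(1)] g(1) u(2) v(2) inv_inv_SN[OF SN_I[OF g(3)]] ..
      then show "cf g \<in> ?L" using g(2) u(1) v(1) unfolding dominating_def by blast
    qed
  qed
  then have "Nbar \<nu> = span_in UNIV (cf ` ?G)" unfolding Nbar_def by simp
  then show ?thesis unfolding NN_def using span_in_UNIV_cf by blast
qed

lemma NN_subspace: "hk.subspace (NN \<nu>)"
  unfolding NN_span by (rule hk.subspace_span)

lemmas NN_zero [simp] = hk.subspace_0[OF NN_subspace]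
lemmas NN_add = hk.subspace_add[OF NN_subspace]
lemmas NN_diff = hk.subspace_diff[OF NN_subspace]
lemmas NN_smul = hk.subspace_scale[OF NN_subspace]

lemma NN_induct [consumes 1, case_names zero add gen]:
  assumes "a \<in> NN \<nu>" "P 0" "\<And>a b. P a \<Longrightarrow> P b \<Longrightarrow> P (a + b)"
    "\<And>c w w' \<rho>. dominating \<nu> \<rho> \<Longrightarrow> w permutes {1..sum_list \<nu>} \<Longrightarrow> w' permutes {1..sum_list \<nu>} \<Longrightarrow> P (smul c (TT w * Xp \<rho> * TT w'))"
  shows "P a"
  using assms(1) unfolding NN_span
proof (induction rule: hk.span_induct_alt)
  case base
  show ?case by (rule assms(2))
next
  case (step c x y)
  then show ?case using assms(3,4) by blast
qed

lemma NN_sandwich: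
  assumes \<rho>: "dominating \<nu> \<rho>" and "a \<in> Hm (sum_list \<nu>)" "b \<in> Hm (sum_list \<nu>)"
  shows "a * Xp \<rho> * b \<in> NN \<nu>"
proof -
  have 1: "TT w * Xp \<rho> * b \<in> NN \<nu>" if w: "w permutes {1..sum_list \<nu>}" for w
    using assms(3)
  proof (induction rule: Hm_induct)
    case (TT c w')
    have "TT w * Xp \<rho> * TT w' \<in> NN \<nu>" unfolding NN_span using \<rho> w TT by (intro hk.span_base) blast
    then show ?case by (simp add: NN_smul)
  qed (auto simp: distrib_left NN_add)
  show ?thesis using assms(2)
  proof (induction rule: Hm_induct)
    case (TT c w)
    then show ?case using 1[OF TT] by (simp add: NN_smul)
  qed (auto simp: distrib_right NN_add)
qed

lemma NN_left: "h \<in> Hm (sum_list \<nu>) \<Longrightarrow> a \<in> NN \<nu> \<Longrightarrow> h * a \<in> NN \<nu>"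
proof (rotate_tac 1, induction rule: NN_induct)
  case (gen c w w' \<rho>)
  have "(h * TT w) * Xp \<rho> * TT w' \<in> NN \<nu>"
    using gen by (intro NN_sandwich Hm_mult Hm_TT)
  then show ?case by (simp add: NN_smul mult.assoc)
qed (auto simp: distrib_left NN_add)

lemma NN_right: "h \<in> Hm (sum_list \<nu>) \<Longrightarrow> a \<in> NN \<nu> \<Longrightarrow> a * h \<in> NN \<nu>"
proof (rotate_tac 1, induction rule: NN_induct)
  case (gen c w w' \<rho>)
  have "TT w * Xp \<rho> * (TT w' * h) \<in> NN \<nu>"
    using gen by (intro NN_sandwich Hm_mult Hm_TT)
  then show ?case by (simp add: NN_smul mult.assoc)
qed (auto simp: distrib_right NN_add)

lemma Xp_Hm: "Xp \<nu> \<in> Hm (sum_list \<nu>)" by (rule Xs_Hm)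

lemma NN_Hm: "a \<in> NN \<nu> \<Longrightarrow> a \<in> Hm (sum_list \<nu>)"
proof (induction rule: NN_induct)
  case (gen c w w' \<rho>)
  have "Xp \<rho> \<in> Hm (sum_list \<nu>)" using Xp_Hm[of \<rho>] dominatingD(2)[OF gen(1)] by simp
  then show ?case using gen by (intro Hm_smul Hm_mult Hm_TT)
qed (auto simp: Hm_add)

text \<open>Orthogonal projection is available for finite spanning sets. A basis of the ideal is
  finite because it is independent inside the span of finitely many T_w.\<close>

lemma NN_projection:
  "\<exists>z. Xp \<nu> - z \<in> NN \<nu> \<and> (\<forall>b\<in>NN \<nu>. ip z b = 0)"
proof -
  obtain B where B: "B \<subseteq> NN \<nu>" "hk.independent B" "NN \<nu> \<subseteq> hk.span B"
    by (rule hk.basis_exists)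
  let ?T = "TT ` {w. w permutes {1..sum_list \<nu>}}"
  have "B \<subseteq> hk.span ?T"
  proof
    fix a assume "a \<in> B"
    then have "a \<in> Hm (sum_list \<nu>)" using B(1) NN_Hm by blast
    then have "a = (\<Sum>w | w permutes {1..sum_list \<nu>}. smul (cf a w) (TT w))" by (rule Hm_expand)
    also have "\<dots> \<in> hk.span ?T" by (intro hk.span_sum hk.span_scale hk.span_base) blast
    finally show "a \<in> hk.span ?T" .
  qed
  moreover have "finite ?T" by (intro finite_imageI finite_Sm)
  ultimately have "finite B" using hk.independent_span_bound[OF _ B(2)] by blast
  from orth_projection[OF this, of "Xp \<nu>"] obtain n where n: "n \<in> hk.span B" "\<forall>b\<in>hk.span B. ip (Xp \<nu> - n) b = 0" by blast
  have "hk.span B \<subseteq> NN \<nu>" using B(1) NN_subspace by (rule hk.span_minimal)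
  then have "Xp \<nu> - (Xp \<nu> - n) \<in> NN \<nu>" using n(1) by (simp add: subset_iff)
  then show ?thesis using n(2) B(3) by blast
qed

definition zz :: "nat list \<Rightarrow> hk" where
  "zz \<nu> = (SOME z. Xp \<nu> - z \<in> NN \<nu> \<and> (\<forall>b\<in>NN \<nu>. ip z b = 0))"

lemma zz_NN: "Xp \<nu> - zz \<nu> \<in> NN \<nu>" and zz_orth: "b \<in> NN \<nu> \<Longrightarrow> ip (zz \<nu>) b = 0"
  using someI_ex[OF NN_projection[of \<nu>]] unfolding zz_def by blast+

lemma zz_orth_mult:
  assumes "h \<in> Hm (sum_list \<nu>)" "b \<in> NN \<nu>" shows "ip (zz \<nu> * h) b = 0"
proof -
  obtain h' where "h' \<in> Hm (sum_list \<nu>)" "\<forall>a b. ip (a * h) b = ip a (b * h')" using adjoint_exists[OF assms(1)] by blast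
  then show ?thesis using zz_orth[OF NN_right[OF _ assms(2)]] by simp
qed

text \<open>So \<open>z h\<close> for \<open>h\<close> in the Hecke algebra models the Specht module inside the Hecke algebra.\<close>

lemma Xp_mult_NN_iff:
  assumes h: "h \<in> Hm (sum_list \<nu>)" shows "Xp \<nu> * h \<in> NN \<nu> \<longleftrightarrow> zz \<nu> * h = 0"
proof -
  have d: "Xp \<nu> * h - zz \<nu> * h \<in> NN \<nu>" using NN_right[OF h zz_NN] by (simp add: left_diff_distrib)
  have "zz \<nu> * h = 0" if "zz \<nu> * h \<in> NN \<nu>"
    using zz_orth_mult[OF h that] by (rule ip_eq_0)
  moreover have "Xp \<nu> * h \<in> NN \<nu> \<longleftrightarrow> zz \<nu> * h \<in> NN \<nu>"
    using NN_diff[OF _ d] NN_add[OF d] by (metis diff_add_cancel diff_diff_eq2 add_diff_cancel_left')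
  ultimately show ?thesis by (metis NN_zero)
qed

section \<open>Moving one node up\<close>

lemma same_block_blk_iff:
  "same_block (sum_list \<eta>) (blk \<eta>) j \<longleftrightarrow> 1 \<le> j \<and> j < sum_list \<eta> \<and> (\<forall>x. j \<noteq> psum \<eta> x)"
proof -
  have "blk \<eta> j = blk \<eta> (Suc j) \<longleftrightarrow> (\<forall>x. j \<noteq> psum \<eta> x)" if "j < sum_list \<eta>"
  proof
    assume e: "blk \<eta> j = blk \<eta> (Suc j)"
    show "\<forall>x. j \<noteq> psum \<eta> x"
    proof
      fix x show "j \<noteq> psum \<eta> x" using blk_le_iff[of j \<eta> x] blk_le_iff[of "Suc j" \<eta> x] that e by auto
    qed
  next
    assume n: "\<forall>x. j \<noteq> psum \<eta> x"
    have iff: "blk \<eta> j \<le> x \<longleftrightarrow> blk \<eta> (Suc j) \<le> x" for x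
    proof -
      have "j \<noteq> psum \<eta> x" using n by blast
      then show ?thesis using blk_le_iff[of j \<eta> x] blk_le_iff[of "Suc j" \<eta> x] that by auto
    qed
    show "blk \<eta> j = blk \<eta> (Suc j)" using iff[of "blk \<eta> j"] iff[of "blk \<eta> (Suc j)"] by simp
  qed
  then show ?thesis unfolding same_block_def by blast
qed

text \<open>Permuting the parts of a composition moves whole blocks rigidly; the corresponding T_d
  intertwines the two symmetrizers and is invertible.\<close>

lemma block_permutation_exists:
  assumes sum: "sum_list \<rho> = sum_list \<eta>" and len: "length \<rho> = length \<eta>" and \<sigma>: "\<sigma> permutes {..<length \<eta>}"
    and \<sigma>n: "\<And>r. r < length \<eta> \<Longrightarrow> \<eta> ! r = \<rho> ! \<sigma> r"
  shows "\<exists>d\<in>Hm (sum_list \<eta>). \<exists>d'\<in>Hm (sum_list \<eta>). Xs (sum_list \<eta>) (blk \<eta>) = d * Xs (sum_list \<eta>) (blk \<rho>) * d'"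
proof -
  let ?m = "sum_list \<eta>"
  \<comment> \<open>Block number \<open>blk \<eta> k\<close> goes onto block \<open>\<sigma>\<close>
    of it in \<open>\<rho>\<close>, keeping the offset inside the block. The subtraction of 1 turns
    labels counted from 1 into list indices.\<close>
  define d where "d k = (if k \<in> {1..?m} then psum \<rho> (\<sigma> (blk \<eta> k - 1)) + (k - psum \<eta> (blk \<eta> k - 1)) else k)" for k
  have ex: "\<exists>r. r < length \<eta> \<and> blk \<eta> k = Suc r \<and> psum \<eta> r < k \<and> k \<le> psum \<eta> (Suc r) \<and> d k = psum \<rho> (\<sigma> r) + (k - psum \<eta> r)
      \<and> \<sigma> r < length \<eta> \<and> d k \<in> {1..?m} \<and> blk \<rho> (d k) = Suc (\<sigma> r)"
    if k: "k \<in> {1..?m}" for k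
  proof -
    have kk: "1 \<le> k" "k \<le> ?m" using k by auto
    obtain r where r: "blk \<eta> k = Suc r" using blk_pos[OF kk] by (cases "blk \<eta> k") auto
    have rl: "r < length \<eta>" using blk_le_length[OF kk(2)] r by simp
    have p: "psum \<eta> r < k" "k \<le> psum \<eta> (Suc r)" using blk_eq_iff[OF kk(2)] r by blast+
    have \<sigma>r: "\<sigma> r < length \<eta>" using permutes_in_image[OF \<sigma>, of r] rl by simp
    have dk: "d k = psum \<rho> (\<sigma> r) + (k - psum \<eta> r)" using k by (simp add: d_def r)
    have "psum \<rho> (Suc (\<sigma> r)) = psum \<rho> (\<sigma> r) + \<eta> ! r" using psum_Suc[of "\<sigma> r" \<rho>] \<sigma>r len \<sigma>n[OF rl] by simp
    moreover have "psum \<eta> (Suc r) = psum \<eta> r + \<eta> ! r" by (rule psum_Suc[OF rl])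
    ultimately have b: "psum \<rho> (\<sigma> r) < d k" "d k \<le> psum \<rho> (Suc (\<sigma> r))" using dk p by linarith+
    have le: "d k \<le> sum_list \<rho>" using b(2) psum_le[of \<rho> "Suc (\<sigma> r)"] by linarith
    then have "blk \<rho> (d k) = Suc (\<sigma> r)" using blk_eq_iff[OF le] b by blast
    moreover have "d k \<in> {1..?m}" using le sum b by simp
    ultimately show ?thesis using r rl p dk \<sigma>r by blast
  qed
  have inj\<sigma>: "\<sigma> r = \<sigma> r' \<longleftrightarrow> r = r'" for r r' using permutes_inj[OF \<sigma>] by (auto dest: injD)
  have lab: "blk \<rho> (d k) = blk \<rho> (d l) \<longleftrightarrow> blk \<eta> k = blk \<eta> l" if "k \<in> {1..?m}" "l \<in> {1..?m}" for k l
    using ex[OF that(1)] ex[OF that(2)] inj\<sigma> by (metis nat.inject)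
  have inj: "inj_on d {1..?m}"
  proof (rule inj_onI)
    fix k l assume kl: "k \<in> {1..?m}" "l \<in> {1..?m}" "d k = d l"
    then have e: "blk \<eta> k = blk \<eta> l" using lab by metis
    obtain r where r: "blk \<eta> k = Suc r" "psum \<eta> r < k" "d k = psum \<rho> (\<sigma> r) + (k - psum \<eta> r)" using ex[OF kl(1)] by blast
    obtain r' where r': "blk \<eta> l = Suc r'" "psum \<eta> r' < l" "d l = psum \<rho> (\<sigma> r') + (l - psum \<eta> r')" using ex[OF kl(2)] by blast
    have "r' = r" using e r r' by simp
    then show "k = l" using r r' kl(3) by simp
  qed
  have "d ` {1..?m} \<subseteq> {1..?m}" using ex by blast
  then have "d ` {1..?m} = {1..?m}" by (rule endo_inj_surj[OF finite_atLeastAtMost _ inj])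
  then have dp: "d permutes {1..?m}"
    using inj by (intro bij_imp_permutes) (auto simp: bij_betw_def d_def)
  have "Xs ?m (blk \<eta>) * TT d = TT d * Xs ?m (blk \<rho>)"
  proof (rule Xs_block_permutation[OF blk_mono _ dp lab])
    show "mono_on {1..?m} (blk \<rho>)" using blk_mono[of \<rho>] sum by simp
    fix i assume i: "same_block ?m (blk \<eta>) i"
    then have ir: "i \<in> {1..?m}" "Suc i \<in> {1..?m}" "blk \<eta> i = blk \<eta> (Suc i)" by (auto simp: same_block_def)
    obtain r where r: "blk \<eta> i = Suc r" "psum \<eta> r < i" "d i = psum \<rho> (\<sigma> r) + (i - psum \<eta> r)" using ex[OF ir(1)] by blast
    obtain r' where r': "blk \<eta> (Suc i) = Suc r'" "d (Suc i) = psum \<rho> (\<sigma> r') + (Suc i - psum \<eta> r')" using ex[OF ir(2)] by blast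
    have "r' = r" using ir(3) r r' by simp
    then show "d (Suc i) = Suc (d i)" using r r' by simp
  qed
  moreover obtain u where u: "u \<in> Hm ?m" "TT d * u = 1" using TT_invertible[OF dp] by blast
  ultimately have "Xs ?m (blk \<eta>) = TT d * Xs ?m (blk \<rho>) * u" by (metis mult.assoc mult.right_neutral)
  then show ?thesis using u(1) Hm_TT[OF dp] by blast
qed

text \<open>One node moves from row i to row a, both counted from 0. The result is in general only a
  composition.\<close>

definition mvup :: "nat list \<Rightarrow> nat \<Rightarrow> nat \<Rightarrow> nat list" where
  "mvup \<nu> a i = \<nu>[a := Suc (\<nu> ! a), i := \<nu> ! i - 1]"

lemma length_mvup [simp]: "length (mvup \<nu> a i) = length \<nu>"
  by (simp add: mvup_def)

lemma nth_mvup: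
  assumes "a \<noteq> i" "a < length \<nu>" "i < length \<nu>"
  shows "mvup \<nu> a i ! x = (if x = a then Suc (\<nu> ! a) else if x = i then \<nu> ! i - 1 else \<nu> ! x)"
  using assms by (auto simp: mvup_def nth_list_update)

lemma psum_mvup:
  assumes ai: "a < i" "i < length \<nu>" and pos: "0 < \<nu> ! i"
  shows "psum (mvup \<nu> a i) x + (if i < x then 1 else 0) = psum \<nu> x + (if a < x then 1 else 0)"
proof (induction x)
  case (Suc x)
  show ?case
  proof (cases "x < length \<nu>")
    case True
    have n: "mvup \<nu> a i ! x = (if x = a then Suc (\<nu> ! a) else if x = i then \<nu> ! i - 1 else \<nu> ! x)"
      using ai by (intro nth_mvup) auto
    have 1: "psum (mvup \<nu> a i) (Suc x) = psum (mvup \<nu> a i) x + mvup \<nu> a i ! x" "psum \<nu> (Suc x) = psum \<nu> x + \<nu> ! x"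
      using True by (auto intro: psum_Suc)
    consider "x < a" | "x = a" | "a < x" "x < i" | "x = i" | "i < x" by linarith
    then show ?thesis unfolding 1 n
      by cases (use Suc ai pos in auto)
  next
    case False
    then have "psum (mvup \<nu> a i) (Suc x) = psum (mvup \<nu> a i) x" "psum \<nu> (Suc x) = psum \<nu> x"
      by (simp_all add: psum_beyond)
    then show ?thesis using Suc ai False by simp
  qed
qed simp

lemma sum_list_mvup:
  assumes "a < i" "i < length \<nu>" "0 < \<nu> ! i"
  shows "sum_list (mvup \<nu> a i) = sum_list \<nu>"
  using psum_mvup[OF assms, of "length \<nu>"] assms by (simp add: psum_beyond)

text \<open>Take the node instead from the last row as long as row i and give it to the first row as
  long as row a. This yields a partition strictly dominating \<open>\<nu>\<close>, whose parts are a
  rearrangement of those of the composition, so the two symmetrizers differ by outer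
  factors.\<close>

lemma Xs_mvup_NN:
  assumes \<nu>: "is_part \<nu>" and ai: "a < i" "i < length \<nu>"
  shows "Xs (sum_list \<nu>) (blk (mvup \<nu> a i)) \<in> NN \<nu>"
proof -
  let ?L = "length \<nu>" and ?m = "sum_list \<nu>"
  have pos: "0 < \<nu> ! x" if "x < ?L" for x using is_part_pos[OF \<nu> that] .
  define a' where "a' = (LEAST x. \<nu> ! x = \<nu> ! a)"
  define i' where "i' = (GREATEST x. x < ?L \<and> \<nu> ! x = \<nu> ! i)"
  have a'e: "\<nu> ! a' = \<nu> ! a" unfolding a'_def by (rule LeastI[of _ a]) simp
  have a'le: "a' \<le> a" unfolding a'_def by (rule Least_le) simp
  have a'min: "\<nu> ! x \<noteq> \<nu> ! a" if "x < a'" for x using not_less_Least[of x] that unfolding a'_def by blast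
  have i'e: "i' < ?L \<and> \<nu> ! i' = \<nu> ! i" unfolding i'_def by (rule GreatestI_nat[of _ i ?L]) (use ai in auto)
  have i'ge: "i \<le> i'" unfolding i'_def by (rule Greatest_le_nat[of _ i ?L]) (use ai in auto)
  have i'max: "\<nu> ! x \<noteq> \<nu> ! i" if "i' < x" "x < ?L" for x
  proof
    assume "\<nu> ! x = \<nu> ! i"
    then have "x \<le> i'" unfolding i'_def using that(2) by (intro Greatest_le_nat[of _ x ?L]) auto
    then show False using that by simp
  qed
  have l': "a' < i'" "i' < ?L" using a'le i'ge ai i'e by auto
  define \<rho>0 where "\<rho>0 = mvup \<nu> a' i'"
  \<comment> \<open>The move may empty the last row, which is dropped here. Partial sums, and hence
    the labels \<open>blk\<close>, do not change.\<close>
  define \<rho> where "\<rho> = takeWhile (\<lambda>x. 0 < x) \<rho>0"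
  have n\<rho>: "\<rho>0 ! x = (if x = a' then Suc (\<nu> ! a) else if x = i' then \<nu> ! i - 1 else \<nu> ! x)" for x
    unfolding \<rho>0_def using nth_mvup[of a' i' \<nu> x] l' a'e i'e by auto
  have sorted: "\<rho>0 ! y \<le> \<rho>0 ! x" if xy: "x < y" "y < ?L" for x y
  proof -
    have yx: "\<nu> ! y \<le> \<nu> ! x" using is_part_nth[OF \<nu>] xy by simp
    consider "y = a'" | "x = a'" | "y \<noteq> a'" "x \<noteq> a'" "x = i'" | "y \<noteq> a'" "x \<noteq> a'" "x \<noteq> i'" by blast
    then show ?thesis
    proof cases
      case 1
      then have "\<nu> ! x \<noteq> \<nu> ! a" "x \<noteq> i'" using a'min xy l' by auto
      then show ?thesis using 1 yx a'e xy n\<rho>[of x] n\<rho>[of y] by simp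
    next
      case 2
      then show ?thesis using yx a'e i'e xy n\<rho>[of x] n\<rho>[of y] by auto
    next
      case 3
      then have "\<nu> ! y \<noteq> \<nu> ! i" using i'max xy by simp
      then show ?thesis using 3 yx i'e xy l' n\<rho>[of x] n\<rho>[of y] by simp
    next
      case 4
      then show ?thesis using yx i'e n\<rho>[of x] n\<rho>[of y] by auto
    qed
  qed
  have len0: "length \<rho>0 = ?L" by (simp add: \<rho>0_def)
  have part: "is_part \<rho>"
    unfolding is_part_def
  proof
    have "sorted_wrt (\<ge>) \<rho>0" using sorted len0 by (auto simp: sorted_wrt_iff_nth_less)
    then show "sorted_wrt (\<ge>) \<rho>" unfolding \<rho>_def by (metis sorted_wrt_append takeWhile_dropWhile_id)
    show "\<forall>x\<in>set \<rho>. 0 < x" unfolding \<rho>_def by (auto dest: set_takeWhileD)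
  qed
  have ps: "psum \<rho> x = psum \<rho>0 x" for x
  proof (cases "x \<le> length \<rho>")
    case True
    have "\<rho> = take (length \<rho>) \<rho>0" unfolding \<rho>_def by (rule takeWhile_eq_take)
    then have "take x \<rho> = take x \<rho>0" using True by (metis min.absorb1 take_take)
    then show ?thesis by (simp add: psum_def)
  next
    case False
    have d0: "\<rho>0 ! y = 0" if y: "length \<rho> \<le> y" "y < ?L" for y
    proof -
      have l: "length \<rho> < length \<rho>0" using y len0 by simp
      then have "\<rho>0 ! length \<rho> = 0" using nth_length_takeWhile[of "\<lambda>x. 0 < x" \<rho>0] unfolding \<rho>_def by simp
      then show ?thesis using sorted[of "length \<rho>" y] y by (cases "y = length \<rho>") auto
    qed
    have "psum \<rho>0 (length \<rho> + k) = psum \<rho>0 (length \<rho>)" for k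
    proof (induction k)
      case (Suc k)
      show ?case
      proof (cases "length \<rho> + k < ?L")
        case True
        then show ?thesis using Suc d0[of "length \<rho> + k"] psum_Suc[of "length \<rho> + k" \<rho>0] len0 by simp
      next
        case False
        then show ?thesis using Suc len0 by (simp add: psum_beyond)
      qed
    qed simp
    from this[of "x - length \<rho>"] have "psum \<rho>0 x = psum \<rho>0 (length \<rho>)" using False by simp
    also have "\<dots> = sum_list \<rho>" unfolding psum_def \<rho>_def takeWhile_eq_take[symmetric] ..
    also have "\<dots> = psum \<rho> x" using False by (simp add: psum_beyond)
    finally show ?thesis by simp
  qed
  have blk0: "blk \<rho> = blk \<rho>0" unfolding blk_def ps ..
  have pos': "0 < \<nu> ! i'" using pos l' by blast
  note pm = psum_mvup[OF l' pos', folded \<rho>0_def]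
  have sum0: "sum_list \<rho>0 = ?m" unfolding \<rho>0_def by (rule sum_list_mvup[OF l' pos'])
  have sum\<rho>: "sum_list \<rho> = ?m"
    using ps[of "length \<rho> + ?L"] sum0 len0 by (simp add: psum_beyond)
  have dom: "dominating \<nu> \<rho>"
    unfolding dominating_def partition_of_def strictly_dominates_def
  proof (intro conjI allI part sum\<rho>)
    show "\<rho> \<noteq> \<nu>" using pm[of "Suc a'"] ps[of "Suc a'"] l' by auto
    fix k show "sum_list (take k \<nu>) \<le> sum_list (take k \<rho>)"
      using pm[of k] ps[of k] l' unfolding psum_def by (auto split: if_splits)
  qed
  define \<eta> where "\<eta> = mvup \<nu> a i"
  have sum\<eta>: "sum_list \<eta> = ?m" unfolding \<eta>_def using sum_list_mvup[OF ai pos[OF ai(2)]] .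
  have n\<eta>: "\<eta> ! x = (if x = a then Suc (\<nu> ! a) else if x = i then \<nu> ! i - 1 else \<nu> ! x)" for x
    unfolding \<eta>_def using ai by (intro nth_mvup) auto
  \<comment> \<open>The two compositions differ only in which of equally long rows give and receive
    the node, so exchanging a with a' and i with i' matches them.\<close>
  define \<sigma> where "\<sigma> = transpose a a' \<circ> transpose i i'"
  have ne: "a \<noteq> i" "a \<noteq> i'" "a' \<noteq> i" "a' \<noteq> i'" using ai l' a'le i'ge by auto
  have "\<sigma> permutes {..<?L}"
    unfolding \<sigma>_def using ai l' by (intro permutes_compose permutes_swap_id) auto
  moreover have "\<eta> ! r = \<rho>0 ! \<sigma> r" for r
  proof -
    consider "r = a" | "r = a'" "r \<noteq> a" | "r = i" | "r = i'" "r \<noteq> i" | "r \<noteq> a" "r \<noteq> a'" "r \<noteq> i" "r \<noteq> i'" by blast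
    then show ?thesis
    proof cases
      case 1
      then have "\<sigma> r = a'" using ne by (simp add: \<sigma>_def transpose_def)
      then show ?thesis using 1 n\<eta> n\<rho> by simp
    next
      case 2
      then have "\<sigma> r = a" using ne by (simp add: \<sigma>_def transpose_def)
      then show ?thesis using 2 n\<eta>[of r] n\<rho>[of a] ne a'e by simp
    next
      case 3
      then have "\<sigma> r = i'" using ne by (simp add: \<sigma>_def transpose_def)
      then show ?thesis using 3 n\<eta>[of r] n\<rho>[of i'] ne by simp
    next
      case 4
      then have "\<sigma> r = i" using ne by (simp add: \<sigma>_def transpose_def)
      then show ?thesis using 4 n\<eta>[of r] n\<rho>[of i] ne i'e by simp
    next
      case 5
      then have "\<sigma> r = r" by (simp add: \<sigma>_def transpose_def)
      then show ?thesis using 5 n\<eta>[of r] n\<rho>[of r] by simp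
    qed
  qed
  moreover have "length \<eta> = ?L" by (simp add: \<eta>_def)
  ultimately obtain d d' where d: "d \<in> Hm ?m" "d' \<in> Hm ?m" "Xs ?m (blk \<eta>) = d * Xs ?m (blk \<rho>0) * d'"
    using block_permutation_exists[of \<rho>0 \<eta> \<sigma>] sum0 sum\<eta> len0 by auto
  have "d * Xp \<rho> * d' \<in> NN \<nu>" by (rule NN_sandwich[OF dom d(1,2)])
  then show ?thesis using d(3) unfolding sum\<rho> blk0 \<eta>_def by simp
qed

section \<open>The eigenvalues on the generator of a Specht module\<close>

text \<open>The descending product T_\<beta> T_(\<beta>-1) ... with n factors; \<open>up\<close> is
  its mirror image. Up to a power of q, a Jucys-Murphy element is a product of both.\<close>

fun dn :: "nat \<Rightarrow> nat \<Rightarrow> hk" where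
  "dn \<beta> 0 = 1"
| "dn \<beta> (Suc n) = dn \<beta> n * Ti (\<beta> - n)"

fun up :: "nat \<Rightarrow> nat \<Rightarrow> hk" where
  "up \<beta> 0 = 1"
| "up \<beta> (Suc n) = Ti (\<beta> - n) * up \<beta> n"

lemma dn_Hm: "n \<le> \<beta> \<Longrightarrow> \<beta> < m \<Longrightarrow> dn \<beta> n \<in> Hm m"
  by (induction n) (auto intro!: Hm_mult Hm_Ti)

lemma up_Hm: "n \<le> \<beta> \<Longrightarrow> \<beta> < m \<Longrightarrow> up \<beta> n \<in> Hm m"
  by (induction n) (auto intro!: Hm_mult Hm_Ti)

lemma dn_Suc_left: "dn (Suc \<beta>) (Suc n) = Ti (Suc \<beta>) * dn \<beta> n"
  by (induction n) (simp_all add: mult.assoc)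

lemma up_Suc_right: "up (Suc \<beta>) (Suc n) = up \<beta> n * Ti (Suc \<beta>)"
  by (induction n) (simp_all add: mult.assoc)

lemma dn_add: "dn \<beta> (n + k) = dn \<beta> n * dn (\<beta> - n) k"
  by (induction k) (simp_all add: mult.assoc)

lemma up_add: "up \<beta> (n + k) = up (\<beta> - n) k * up \<beta> n"
  by (induction k) (simp_all add: mult.assoc)

lemma dn_commute:
  assumes "n \<le> \<beta>" "1 \<le> j" "j + n < \<beta> \<or> Suc \<beta> < j"
  shows "dn \<beta> n * Ti j = Ti j * dn \<beta> n"
  using assms
proof (induction n)
  case (Suc n)
  have c: "Ti (\<beta> - n) * Ti j = Ti j * Ti (\<beta> - n)" using Suc.prems by (intro Ti_commute') auto
  have "dn \<beta> (Suc n) * Ti j = dn \<beta> n * (Ti (\<beta> - n) * Ti j)" by (simp add: mult.assoc)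
  also have "\<dots> = dn \<beta> n * Ti j * Ti (\<beta> - n)" unfolding c by (simp add: mult.assoc)
  also have "dn \<beta> n * Ti j = Ti j * dn \<beta> n" using Suc by auto
  finally show ?case by (simp add: mult.assoc)
qed simp

text \<open>The braid relation lets T_k slide through a descending product that covers both k and k
  - 1, at the price of lowering its index by one.\<close>

lemma dn_shift:
  assumes "n < \<beta>" "\<beta> - n < k" "k \<le> \<beta>"
  shows "dn \<beta> (Suc n) * Ti k = Ti (k - 1) * dn \<beta> (Suc n)"
  using assms
proof (induction n)
  case (Suc n)
  show ?case
  proof (cases "k = \<beta> - n")
    case True
    define j where "j = \<beta> - Suc n"
    have j: "1 \<le> j" "\<beta> - n = Suc j" "k = Suc j" using Suc.prems True by (auto simp: j_def)
    have c: "dn \<beta> n * Ti j = Ti j * dn \<beta> n" using j Suc.prems by (intro dn_commute) (auto simp: j_def)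
    have "dn \<beta> (Suc (Suc n)) * Ti k = dn \<beta> n * (Ti (Suc j) * Ti j * Ti (Suc j))"
      by (simp add: j j_def[symmetric] mult.assoc)
    also have "\<dots> = dn \<beta> n * Ti j * (Ti (Suc j) * Ti j)" unfolding braid[OF j(1), symmetric] by (simp add: mult.assoc)
    also have "\<dots> = Ti j * dn \<beta> (Suc (Suc n))" unfolding c by (simp add: j j_def[symmetric] mult.assoc)
    finally show ?thesis using j by simp
  next
    case False
    then have lt: "\<beta> - n < k" using Suc.prems by linarith
    have c: "Ti (\<beta> - Suc n) * Ti k = Ti k * Ti (\<beta> - Suc n)" using Suc.prems lt by (intro Ti_commute') auto
    have "dn \<beta> (Suc (Suc n)) * Ti k = dn \<beta> (Suc n) * (Ti (\<beta> - Suc n) * Ti k)"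
      unfolding dn.simps(2)[of \<beta> "Suc n"] by (simp only: mult.assoc)
    also have "\<dots> = dn \<beta> (Suc n) * Ti k * Ti (\<beta> - Suc n)" unfolding c by (simp only: mult.assoc)
    also have "dn \<beta> (Suc n) * Ti k = Ti (k - 1) * dn \<beta> (Suc n)" using Suc lt by simp
    finally show ?thesis unfolding dn.simps(2)[of \<beta> "Suc n"] by (simp only: mult.assoc)
  qed
qed simp

lemma absorb_dn_up:
  assumes g: "\<And>j. \<beta> - n \<le> j \<Longrightarrow> j < \<beta> \<Longrightarrow> g * Ti j = smul qq g" and n: "n < \<beta>"
  shows "k \<le> n \<Longrightarrow> g * dn \<beta> (Suc n) * up \<beta> k = smul (qq ^ k) (g * dn \<beta> (Suc n))"
proof (induction k)
  case (Suc k)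
  have "g * dn \<beta> (Suc n) * up \<beta> (Suc k) = g * (dn \<beta> (Suc n) * Ti (\<beta> - k)) * up \<beta> k"
    by (simp only: up.simps mult.assoc)
  also have "dn \<beta> (Suc n) * Ti (\<beta> - k) = Ti (\<beta> - k - 1) * dn \<beta> (Suc n)"
    using n Suc.prems by (intro dn_shift) auto
  also have "g * (Ti (\<beta> - k - 1) * dn \<beta> (Suc n)) = smul qq (g * dn \<beta> (Suc n))"
    using g[of "\<beta> - k - 1"] n Suc.prems by (simp flip: mult.assoc)
  finally show ?case using Suc by simp
qed simp

text \<open>The sum over shortest coset representatives of S_n in S_(n+1), acting on n + 1
  consecutive points up to \<beta> + 1. It turns a vector symmetric on the first n of these points
  into one symmetric on all of them.\<close>

definition Ysum :: "nat \<Rightarrow> nat \<Rightarrow> hk" where "Ysum \<beta> n = (\<Sum>k\<le>n. dn \<beta> k)"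

lemma Ysum_Hm: "n \<le> \<beta> \<Longrightarrow> \<beta> < m \<Longrightarrow> Ysum \<beta> n \<in> Hm m"
  unfolding Ysum_def by (intro Hm_sum dn_Hm) auto

text \<open>The innermost square is expanded by the quadratic relation, and the linear term
  collapses by \<open>absorb_dn_up\<close>. The result is expressed through g and the symmetrized
  vector g \<open>Ysum\<close>, because the latter will lie in the ideal.\<close>

lemma absorb_dn_up_square:
  assumes "\<And>j. \<beta> - n < j \<Longrightarrow> j < \<beta> \<Longrightarrow> g * Ti j = smul qq g" and "n \<le> \<beta>"
  shows "g * dn \<beta> n * up \<beta> n = smul (qq ^ n) g + smul ((qq - 1) * inverse qq * qq ^ n) (g * Ysum \<beta> n - g)"
  using assms
proof (induction n)
  case (Suc n)
  have i: "1 \<le> \<beta> - n" using Suc.prems by simp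
  have g: "g * Ti j = smul qq g" if "\<beta> - n \<le> j" "j < \<beta>" for j using Suc.prems(1)[of j] that Suc.prems(2) by simp
  have IH: "g * dn \<beta> n * up \<beta> n = smul (qq ^ n) g + smul ((qq - 1) * inverse qq * qq ^ n) (g * Ysum \<beta> n - g)"
    using Suc g by simp
  have "g * dn \<beta> (Suc n) * up \<beta> (Suc n) = g * dn \<beta> n * (Ti (\<beta> - n) * Ti (\<beta> - n)) * up \<beta> n"
    by (simp add: mult.assoc)
  also have "\<dots> = smul qq (g * dn \<beta> n * up \<beta> n) + smul (qq - 1) (g * dn \<beta> (Suc n) * up \<beta> n)"
    unfolding Ti_sq[OF i] by (simp add: distrib_left distrib_right mult.assoc)
  also have "g * dn \<beta> (Suc n) * up \<beta> n = smul (qq ^ n) (g * dn \<beta> (Suc n))"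
    using g Suc.prems by (intro absorb_dn_up) auto
  also have "smul qq (g * dn \<beta> n * up \<beta> n) + smul (qq - 1) (smul (qq ^ n) (g * dn \<beta> (Suc n)))
    = smul (qq ^ Suc n) g + smul ((qq - 1) * inverse qq * qq ^ Suc n) (g * Ysum \<beta> n - g + g * dn \<beta> (Suc n))"
    unfolding IH by (simp add: hk.scale_right_distrib hk.scale_right_diff_distrib mult_ac)
  also have "g * Ysum \<beta> n - g + g * dn \<beta> (Suc n) = g * Ysum \<beta> (Suc n) - g"
    by (simp add: Ysum_def distrib_left)
  finally show ?case .
qed (simp add: Ysum_def)

text \<open>All summands absorb T_j separately except those with index \<beta> - j and \<beta> - j +
  1. These two are exchanged by T_j up to the quadratic relation, and their defects cancel.\<close>

lemma absorb_Ysum: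
  assumes g: "\<And>j. \<beta> - n < j \<Longrightarrow> j < \<beta> \<Longrightarrow> g * Ti j = smul qq g" and n: "n \<le> \<beta>" and j: "\<beta> - n < j" "j \<le> \<beta>"
  shows "g * Ysum \<beta> n * Ti j = smul qq (g * Ysum \<beta> n)"
proof -
  define F where "F k = g * dn \<beta> k * Ti j - smul qq (g * dn \<beta> k)" for k
  define k0 where "k0 = \<beta> - j"
  have jk: "\<beta> - k0 = j" "k0 < n" "1 \<le> j" using j n by (auto simp: k0_def)
  have z: "F k = 0" if "k \<le> n" "k \<noteq> k0" "k \<noteq> Suc k0" for k
  proof -
    consider "k < k0" | "Suc k0 < k" using \<open>k \<noteq> k0\<close> \<open>k \<noteq> Suc k0\<close> by linarith
    then show ?thesis
    proof cases
      case 1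
      have "dn \<beta> k * Ti j = Ti j * dn \<beta> k" using 1 jk n that by (intro dn_commute) auto
      moreover have "g * Ti j = smul qq g" using g[of j] j 1 jk by simp
      ultimately have "g * dn \<beta> k * Ti j = smul qq (g * dn \<beta> k)" by (metis mult.assoc smul_mult_left)
      then show ?thesis by (simp add: F_def)
    next
      case 2
      then obtain k' where k': "k = Suc k'" by (cases k) auto
      have "dn \<beta> k * Ti j = Ti (j - 1) * dn \<beta> k" unfolding k' using 2 jk n that k' j by (intro dn_shift) auto
      moreover have "g * Ti (j - 1) = smul qq g" using g[of "j - 1"] 2 jk n that j by simp
      ultimately have "g * dn \<beta> k * Ti j = smul qq (g * dn \<beta> k)" by (metis mult.assoc smul_mult_left)
      then show ?thesis by (simp add: F_def)
    qed
  qed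
  have dS: "dn \<beta> (Suc k0) = dn \<beta> k0 * Ti j" using jk by simp
  have "g * dn \<beta> (Suc k0) * Ti j = g * dn \<beta> k0 * (Ti j * Ti j)" unfolding dS by (simp only: mult.assoc)
  also have "\<dots> = smul qq (g * dn \<beta> k0) + smul (qq - 1) (g * dn \<beta> (Suc k0))"
    unfolding Ti_sq[OF jk(3)] dS by (simp add: distrib_left mult.assoc)
  finally have 1: "g * dn \<beta> (Suc k0) * Ti j = smul qq (g * dn \<beta> k0) + smul (qq - 1) (g * dn \<beta> (Suc k0))" .
  have 2: "g * dn \<beta> k0 * Ti j = g * dn \<beta> (Suc k0)" unfolding dS by (simp only: mult.assoc)
  have "F k0 + F (Suc k0) = 0"
    unfolding F_def 1 2 by (simp add: hk.scale_left_diff_distrib del: dn.simps)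
  moreover have "sum F {..n} = sum F {k0, Suc k0}"
    by (rule sum.mono_neutral_right) (use jk z in auto)
  ultimately have "sum F {..n} = 0" by simp
  then show ?thesis
    by (simp add: F_def Ysum_def sum_subtractf sum_distrib_left sum_distrib_right hk.scale_sum_right)
qed

lemma Ysum_commute:
  assumes "n \<le> \<beta>" "1 \<le> j" "j + n < \<beta> \<or> Suc \<beta> < j"
  shows "Ysum \<beta> n * Ti j = Ti j * Ysum \<beta> n"
proof -
  have "dn \<beta> k * Ti j = Ti j * dn \<beta> k" if "k \<in> {..n}" for k using that assms by (intro dn_commute) auto
  then show ?thesis unfolding Ysum_def sum_distrib_left sum_distrib_right by (rule sum.cong[OF refl])
qed

text \<open>Interpolates between 1 for n = 0 and the Jucys-Murphy element of p + 1 for n = p, so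
  that the rows above p + 1 can be processed one at a time.\<close>

definition GJ :: "nat \<Rightarrow> nat \<Rightarrow> hk" where
  "GJ p n = smul (inverse qq ^ n) (dn p n * up p n)"

lemma JM_GJ: "JM (Suc p) = GJ p p"
proof (induction p)
  case 0
  then show ?case by (simp add: GJ_def)
next
  case (Suc p)
  have "JM (Suc (Suc p)) = smul (inverse qq) (Ti (Suc p) * GJ p p * Ti (Suc p))" using JM_Suc[of "Suc p"] Suc by simp
  then show ?case unfolding GJ_def dn_Suc_left up_Suc_right by (simp add: mult.assoc)
qed

text \<open>With p + 1 the first number of row i, each row a above contributes a factor 1/q modulo
  the ideal. The error term is symmetric for the composition in which a node has moved from row i up
  to row a, and so lies in the ideal.\<close>

lemma row_step:
  assumes \<nu>: "is_part \<nu>" and ai: "a < i" "i < length \<nu>"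
  defines "p \<equiv> psum \<nu> i"
  shows "Xp \<nu> * GJ p (p - psum \<nu> a) - smul (inverse qq) (Xp \<nu> * GJ p (p - psum \<nu> (Suc a))) \<in> NN \<nu>"
proof -
  let ?m = "sum_list \<nu>"
  define X where "X = Xp \<nu>"
  define \<beta> n N where "\<beta> = psum \<nu> (Suc a)" and "n = \<nu> ! a" and "N = p - \<beta>"
  have al: "a < length \<nu>" using ai by simp
  have \<beta>n: "\<beta> = psum \<nu> a + n" unfolding \<beta>_def n_def by (rule psum_Suc[OF al])
  have n1: "1 \<le> n" using is_part_pos[OF \<nu> al] by (simp add: n_def)
  have \<beta>p: "\<beta> \<le> p" unfolding \<beta>_def p_def using ai by (intro psum_mono) simp
  have pm: "p < ?m"
    using psum_Suc[OF ai(2)] is_part_pos[OF \<nu> ai(2)] psum_le[of \<nu> "Suc i"] unfolding p_def by linarith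
  have XT: "X * Ti j = smul qq X" if "1 \<le> j" "j < ?m" "\<And>x. j \<noteq> psum \<nu> x" for j
    unfolding X_def by (rule Xs_Ti) (use that in \<open>simp add: same_block_blk_iff\<close>)
  define U U' where "U = dn p N" and "U' = up p N"
  have pN: "p - N = \<beta>" "N \<le> p" using \<beta>p by (auto simp: N_def)
  have UT: "U * Ti j = Ti j * U" if "1 \<le> j" "j < \<beta> \<or> Suc p < j" for j
    unfolding U_def using that pN by (intro dn_commute) auto
  have not_psum: "j \<noteq> psum \<nu> x" if "psum \<nu> b < j" "j < psum \<nu> (Suc b)" for j b x
    using psum_mono[of x b \<nu>] psum_mono[of "Suc b" x \<nu>] that by (cases "x \<le> b") auto
  define g where "g = X * U"
  have gT: "g * Ti j = smul qq g" if "\<beta> - n < j" "j < \<beta>" for j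
  proof -
    have j: "psum \<nu> a < j" "j < psum \<nu> (Suc a)" using that \<beta>n by (auto simp: \<beta>_def)
    have "X * Ti j = smul qq X" using not_psum[OF j] that \<beta>p pm by (intro XT) auto
    moreover have "U * Ti j = Ti j * U" using that \<beta>n by (intro UT) auto
    ultimately show ?thesis unfolding g_def by (metis mult.assoc smul_mult_left)
  qed
  have nb: "n \<le> \<beta>" using \<beta>n by simp
  define Y where "Y = Ysum \<beta> n"
  define \<eta> where "\<eta> = mvup \<nu> a i"
  have ps: "psum \<eta> x + (if i < x then 1 else 0) = psum \<nu> x + (if a < x then 1 else 0)" for x
    unfolding \<eta>_def using psum_mvup[OF ai is_part_pos[OF \<nu> ai(2)]] .
  have sum\<eta>: "sum_list \<eta> = ?m" unfolding \<eta>_def using sum_list_mvup[OF ai is_part_pos[OF \<nu> ai(2)]] .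
  \<comment> \<open>The factor \<open>U\<close> shifts the rows between a and i by one place and
    frees the place directly after row a; \<open>Y\<close> then symmetrizes row a together with this
    place. Hence the four ranges of j, with index j - 1 in the shifted range.\<close>
  have inv: "g * Y * Ti j = smul qq (g * Y)" if "same_block ?m (blk \<eta>) j" for j
  proof -
    have j: "1 \<le> j" "j < ?m" and jn: "\<And>x. j \<noteq> psum \<eta> x"
      using that same_block_blk_iff[of \<eta> j] sum\<eta> by auto
    have ps1: "psum \<eta> x = psum \<nu> x" if "x \<le> a" for x using ps[of x] that ai by simp
    have ps2: "psum \<eta> x = Suc (psum \<nu> x)" if "a < x" "x \<le> i" for x using ps[of x] that ai by simp
    have ps3: "psum \<eta> x = psum \<nu> x" if "i < x" for x using ps[of x] that ai by simp
    have e1: "j \<noteq> psum \<nu> a" using jn[of a] ps1[of a] by simp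
    have e2: "j \<noteq> Suc \<beta>" using jn[of "Suc a"] ps2[of "Suc a"] ai by (simp add: \<beta>_def)
    have e3: "j \<noteq> Suc p" using jn[of i] ps2[of i] ai by (simp add: p_def)
    consider "j < psum \<nu> a" | "psum \<nu> a < j" "j \<le> \<beta>" | "Suc \<beta> < j" "j \<le> p" | "Suc p < j"
      using e1 e2 e3 by linarith
    then show ?thesis
    proof cases
      case 1
      have "j \<noteq> psum \<nu> x" for x using jn[of x] ps1[of x] psum_mono[of a x \<nu>] 1 by (cases "x \<le> a") auto
      then have x: "X * Ti j = smul qq X" using j by (intro XT)
      have y: "Y * Ti j = Ti j * Y" unfolding Y_def using 1 \<beta>n j by (intro Ysum_commute) auto
      have u: "U * Ti j = Ti j * U" using 1 \<beta>n j by (intro UT) auto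
      have "g * Y * Ti j = X * (U * Ti j) * Y" unfolding g_def by (simp only: mult.assoc y)
      also have "\<dots> = (X * Ti j) * U * Y" unfolding u by (simp only: mult.assoc)
      finally show ?thesis unfolding x g_def by simp
    next
      case 2
      then show ?thesis unfolding Y_def using \<beta>n by (intro absorb_Ysum[OF gT nb]) auto
    next
      case 3
      have "j - 1 \<noteq> psum \<nu> x" for x
      proof -
        consider "x \<le> Suc a" | "Suc a < x" "x \<le> i" | "i < x" by linarith
        then show ?thesis
        proof cases
          case 1
          then show ?thesis using psum_mono[of x "Suc a" \<nu>] 3 by (simp add: \<beta>_def)
        next
          case 2
          then show ?thesis using jn[of x] ps2[of x] 3 by simp
        next
          case x3: 3
          then show ?thesis using psum_mono[of i x \<nu>] 3 j by (simp add: p_def)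
        qed
      qed
      then have x: "X * Ti (j - 1) = smul qq X" using j 3 by (intro XT) auto
      have y: "Y * Ti j = Ti j * Y" unfolding Y_def using 3 nb j by (intro Ysum_commute) auto
      obtain N' where N': "N = Suc N'" using 3 pN by (cases N) auto
      have u: "U * Ti j = Ti (j - 1) * U" unfolding U_def N' using 3 pN N' by (intro dn_shift) auto
      have "g * Y * Ti j = X * (U * Ti j) * Y" unfolding g_def by (simp only: mult.assoc y)
      also have "\<dots> = (X * Ti (j - 1)) * U * Y" unfolding u by (simp only: mult.assoc)
      finally show ?thesis unfolding x g_def by simp
    next
      case 4
      have "j \<noteq> psum \<nu> x" for x using jn[of x] ps3[of x] psum_mono[of x i \<nu>] 4 by (cases "x \<le> i") (auto simp: p_def)
      then have x: "X * Ti j = smul qq X" using j by (intro XT)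
      have y: "Y * Ti j = Ti j * Y" unfolding Y_def using 4 \<beta>p nb j by (intro Ysum_commute) auto
      have u: "U * Ti j = Ti j * U" using 4 j by (intro UT) auto
      have "g * Y * Ti j = X * (U * Ti j) * Y" unfolding g_def by (simp only: mult.assoc y)
      also have "\<dots> = (X * Ti j) * U * Y" unfolding u by (simp only: mult.assoc)
      finally show ?thesis unfolding x g_def by simp
    qed
  qed
  have gH: "g \<in> Hm ?m" unfolding g_def X_def U_def using pN pm by (intro Hm_mult Xp_Hm dn_Hm)
  have YH: "Y \<in> Hm ?m" unfolding Y_def using nb \<beta>p pm by (intro Ysum_Hm) auto
  have UH: "U' \<in> Hm ?m" unfolding U'_def using pN pm by (intro up_Hm)
  \<comment> \<open>The symmetrizer of the composition lies in the ideal and only rescales g Y by a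
    nonzero Poincare polynomial, so g Y itself is in the ideal.\<close>
  have "g * Y * Xs ?m (blk \<eta>) = smul (px ?m (blk \<eta>)) (g * Y)"
    using blk_mono[of \<eta>] sum\<eta> inv by (intro absorb_Xs) auto
  moreover have "g * Y * Xs ?m (blk \<eta>) \<in> NN \<nu>"
    unfolding \<eta>_def using Xs_mvup_NN[OF \<nu> ai] gH YH by (intro NN_left Hm_mult)
  ultimately have "smul (inverse (px ?m (blk \<eta>))) (smul (px ?m (blk \<eta>)) (g * Y)) \<in> NN \<nu>" by (metis NN_smul)
  then have "g * Y \<in> NN \<nu>" by simp
  then have gY: "g * Y * U' \<in> NN \<nu>" by (rule NN_right[OF UH])
  have sq: "g * dn \<beta> n * up \<beta> n = smul (qq ^ n) g + smul ((qq - 1) * inverse qq * qq ^ n) (g * Y - g)"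
    unfolding Y_def by (rule absorb_dn_up_square[OF gT nb])
  have pa: "p - psum \<nu> a = N + n" using \<beta>n \<beta>p by (simp add: N_def)
  have "X * GJ p (p - psum \<nu> a) = smul (inverse qq ^ (N + n)) (g * dn \<beta> n * up \<beta> n * U')"
    unfolding pa GJ_def dn_add up_add pN g_def U_def U'_def by (simp add: mult.assoc)
  also have "\<dots> = smul (inverse qq ^ N) (smul (inverse qq ^ n) (smul (qq ^ n) (g * U') + smul ((qq - 1) * inverse qq * qq ^ n) (g * Y * U' - g * U')))"
    unfolding sq by (simp add: power_add distrib_right left_diff_distrib)
  also have "smul (inverse qq ^ n) (smul (qq ^ n) (g * U') + smul ((qq - 1) * inverse qq * qq ^ n) (g * Y * U' - g * U'))
    = g * U' + smul ((qq - 1) * inverse qq) (g * Y * U' - g * U')"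
  proof -
    have e: "inverse qq ^ n * qq ^ n = 1" by (simp flip: power_mult_distrib)
    have "inverse qq ^ n * ((qq - 1) * inverse qq * qq ^ n) = (inverse qq ^ n * qq ^ n) * ((qq - 1) * inverse qq)"
      by (simp only: mult_ac)
    then show ?thesis by (simp only: hk.scale_right_distrib hk.scale_scale e hk.scale_one mult_1)
  qed
  \<comment> \<open>Since (q - 1)/q = 1 - 1/q, exactly 1/q times g U' remains besides the term in
    the ideal.\<close>
  also have "\<dots> = smul (inverse qq) (g * U') + smul ((qq - 1) * inverse qq) (g * Y * U')"
  proof -
    have "(qq - 1) * inverse qq = 1 - inverse qq" by (simp add: left_diff_distrib)
    then show ?thesis by (simp add: hk.scale_left_diff_distrib hk.scale_right_diff_distrib)
  qed
  finally have e: "X * GJ p (p - psum \<nu> a) = smul (inverse qq ^ N) (smul (inverse qq) (g * U') + smul ((qq - 1) * inverse qq) (g * Y * U'))" .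
  have "X * GJ p (p - psum \<nu> (Suc a)) = smul (inverse qq ^ N) (g * U')"
    unfolding \<beta>_def[symmetric] N_def[symmetric] GJ_def g_def U_def U'_def by (simp add: mult.assoc)
  then have "X * GJ p (p - psum \<nu> a) - smul (inverse qq) (X * GJ p (p - psum \<nu> (Suc a)))
      = smul (inverse qq ^ N * ((qq - 1) * inverse qq)) (g * Y * U')"
    unfolding e by (simp add: hk.scale_right_distrib mult.commute)
  then show ?thesis unfolding X_def using NN_smul[OF gY] by metis
qed

text \<open>With i counted from 0, the i rows above contribute 1/q each; this is q to the content -
  i of the first node.\<close>

lemma first_in_row:
  assumes \<nu>: "is_part \<nu>" and i: "i < length \<nu>"
  shows "Xp \<nu> * JM (Suc (psum \<nu> i)) - smul (qq powi (- int i)) (Xp \<nu>) \<in> NN \<nu>"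
proof -
  let ?p = "psum \<nu> i"
  have "k \<le> i \<Longrightarrow> Xp \<nu> * GJ ?p (?p - psum \<nu> (i - k)) - smul (inverse qq ^ k) (Xp \<nu>) \<in> NN \<nu>" for k
  proof (induction k)
    case 0
    then show ?case by (simp add: GJ_def)
  next
    case (Suc k)
    define a where "a = i - Suc k"
    have a: "a < i" "i - k = Suc a" using Suc.prems by (auto simp: a_def)
    have 1: "Xp \<nu> * GJ ?p (?p - psum \<nu> (Suc a)) - smul (inverse qq ^ k) (Xp \<nu>) \<in> NN \<nu>" using Suc a by simp
    have 2: "Xp \<nu> * GJ ?p (?p - psum \<nu> a) - smul (inverse qq) (Xp \<nu> * GJ ?p (?p - psum \<nu> (Suc a))) \<in> NN \<nu>"
      by (rule row_step[OF \<nu> a(1) i])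
    have "(Xp \<nu> * GJ ?p (?p - psum \<nu> a) - smul (inverse qq) (Xp \<nu> * GJ ?p (?p - psum \<nu> (Suc a))))
      + smul (inverse qq) (Xp \<nu> * GJ ?p (?p - psum \<nu> (Suc a)) - smul (inverse qq ^ k) (Xp \<nu>)) \<in> NN \<nu>"
      by (intro NN_add NN_smul 1 2)
    then show ?case by (simp add: hk.scale_right_diff_distrib a_def)
  qed
  from this[of i] have "Xp \<nu> * GJ ?p ?p - smul (inverse qq ^ i) (Xp \<nu>) \<in> NN \<nu>" by simp
  then show ?thesis unfolding JM_GJ by (simp add: power_int_minus power_inverse)
qed

lemma tnu_formula:
  assumes "(r, c) \<in> nodes \<nu>" shows "tnu \<nu> (r, c) = psum \<nu> (r - 1) + c"
proof -
  have rc: "1 \<le> r" "1 \<le> c" using assms by (auto simp: nodes_iff)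
  have "{y \<in> nodes \<nu>. rlt y (r, c)} = {y \<in> nodes \<nu>. fst y \<le> r - 1} \<union> (\<lambda>c'. (r, c')) ` {1..<c}"
    using assms rc by (auto simp: rlt_def nodes_iff)
  moreover have "card ({y \<in> nodes \<nu>. fst y \<le> r - 1} \<union> (\<lambda>c'. (r, c')) ` {1..<c}) = psum \<nu> (r - 1) + (c - 1)"
  proof (subst card_Un_disjoint)
    show "{y \<in> nodes \<nu>. fst y \<le> r - 1} \<inter> (\<lambda>c'. (r, c')) ` {1..<c} = {}" using rc by auto
    have "card ((\<lambda>c'. (r, c')) ` {1..<c}) = card {1..<c}" by (rule card_image) (simp add: inj_on_def)
    then show "card {y \<in> nodes \<nu>. fst y \<le> r - 1} + card ((\<lambda>c'. (r, c')) ` {1..<c}) = psum \<nu> (r - 1) + (c - 1)"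
      unfolding card_nodes_rows by simp
  qed auto
  ultimately show ?thesis unfolding tnu_eq[OF assms] rank_def using rc by simp
qed

text \<open>Along a row x_\<nu> T_p = q x_\<nu>. In the recursion for the next Jucys-Murphy element
  the left T_p cancels the factor 1/q and the right one multiplies the eigenvalue by q, as the
  content grows by one.\<close>

lemma Xp_eigen_node:
  assumes \<nu>: "is_part \<nu>"
  shows "(r, c) \<in> nodes \<nu> \<Longrightarrow> Xp \<nu> * JM (tnu \<nu> (r, c)) - smul (qq powi (int c - int r)) (Xp \<nu>) \<in> NN \<nu>"
proof (induction c)
  case (Suc c)
  have r: "1 \<le> r" "r \<le> length \<nu>" using Suc.prems by (auto simp: nodes_iff)
  show ?case
  proof (cases "c = 0")
    case True
    have "- int (r - 1) = int (Suc c) - int r" using True r by simp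
    then show ?thesis using first_in_row[OF \<nu>, of "r - 1"] r tnu_formula[OF Suc.prems] True by simp
  next
    case False
    have n: "(r, c) \<in> nodes \<nu>" using nodes_down[OF \<nu> Suc.prems, of r c] r False by simp
    let ?p = "tnu \<nu> (r, c)"
    have p: "tnu \<nu> (r, Suc c) = Suc ?p" using tnu_formula[OF n] tnu_formula[OF Suc.prems] by simp
    have p1: "1 \<le> ?p" "?p < sum_list \<nu>" using tab_range[OF tnu_tableau n] tab_range[OF tnu_tableau Suc.prems] p by auto
    have "blk \<nu> ?p = blk \<nu> (Suc ?p)" using blk_tnu[OF n] blk_tnu[OF Suc.prems] p by simp
    then have T: "Xp \<nu> * Ti ?p = smul qq (Xp \<nu>)" using p1 by (intro Xs_Ti) (simp add: same_block_def)
    let ?e = "qq powi (int c - int r)"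
    have "(Xp \<nu> * JM ?p - smul ?e (Xp \<nu>)) * Ti ?p \<in> NN \<nu>"
      by (rule NN_right[OF Hm_Ti[OF p1] Suc.IH[OF n]])
    also have "(Xp \<nu> * JM ?p - smul ?e (Xp \<nu>)) * Ti ?p = Xp \<nu> * JM (Suc ?p) - smul (?e * qq) (Xp \<nu>)"
    proof -
      have "Xp \<nu> * JM (Suc ?p) = smul (inverse qq) ((Xp \<nu> * Ti ?p) * JM ?p * Ti ?p)"
        unfolding JM_Suc[OF p1(1)] by (simp add: mult.assoc)
      also have "\<dots> = Xp \<nu> * JM ?p * Ti ?p" unfolding T by simp
      finally show ?thesis using T by (simp add: left_diff_distrib)
    qed
    also have "?e * qq = qq powi (int (Suc c) - int r)"
    proof -
      have "int (Suc c) - int r = (int c - int r) + 1" by simp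
      then show ?thesis by (simp only: power_int_add[OF disjI1[OF qq_nz]] power_int_1_right)
    qed
    finally show ?thesis unfolding p .
  qed
qed (simp add: nodes_iff)

lemma Xp_eigen:
  assumes "is_part \<nu>" "p \<in> {1..sum_list \<nu>}"
  shows "Xp \<nu> * JM p - smul (qq powi (cont \<nu> (tnu \<nu>) p)) (Xp \<nu>) \<in> NN \<nu>"
proof -
  obtain r c where rc: "pos \<nu> (tnu \<nu>) p = (r, c)" by (cases "pos \<nu> (tnu \<nu>) p")
  then have "(r, c) \<in> nodes \<nu>" "tnu \<nu> (r, c) = p"
    using pos_in[OF tnu_tableau assms(2)] tab_pos[OF tnu_tableau assms(2)] by metis+
  then show ?thesis using Xp_eigen_node[OF assms(1), of r c] rc by (simp add: cont_def)
qed

lemma zz_eigv: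
  assumes \<nu>: "is_part \<nu>" shows "eigv (sum_list \<nu>) (cont \<nu> (tnu \<nu>)) (zz \<nu>)"
  unfolding eigv_def
proof (intro allI impI)
  fix p assume p: "1 \<le> p" "p \<le> sum_list \<nu>"
  let ?h = "JM p - smul (qq powi (cont \<nu> (tnu \<nu>) p)) 1"
  have "?h \<in> Hm (sum_list \<nu>)" using p by (intro Hm_diff Hm_smul JM_Hm) auto
  moreover have "Xp \<nu> * ?h \<in> NN \<nu>" using Xp_eigen[OF \<nu>, of p] p by (simp add: right_diff_distrib)
  ultimately have "zz \<nu> * ?h = 0" using Xp_mult_NN_iff by blast
  then show "zz \<nu> * JM p = smul (qq powi (cont \<nu> (tnu \<nu>) p)) (zz \<nu>)" by (simp add: right_diff_distrib)
qed

section \<open>Intertwining along standard tableaux\<close>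

lemma eigv_cong: "(\<And>k. k \<in> {1..m} \<Longrightarrow> c k = c' k) \<Longrightarrow> eigv m c g \<longleftrightarrow> eigv m c' g"
  unfolding eigv_def by auto

lemma eigv_sgen:
  assumes "tableau \<nu> v" "1 \<le> i" "i < sum_list \<nu>"
  shows "eigv (sum_list \<nu>) (cont \<nu> v \<circ> sgen i) g \<longleftrightarrow> eigv (sum_list \<nu>) (cont \<nu> (sgen i \<circ> v)) g"
  by (rule eigv_cong) (rule cont_sgen[OF assms, symmetric])

text \<open>The entries i and i + 1 lie in strictly opposite directions. Then their contents differ
  by at least two, and exchanging them gives a standard tableau again.\<close>

definition far :: "nat list \<Rightarrow> (nat \<times> nat \<Rightarrow> nat) \<Rightarrow> nat \<Rightarrow> bool" where
  "far \<nu> v i \<longleftrightarrow> 1 \<le> i \<and> i < sum_list \<nu> \<and>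
    (fst (pos \<nu> v i) < fst (pos \<nu> v (Suc i)) \<and> snd (pos \<nu> v (Suc i)) < snd (pos \<nu> v i)
      \<or> fst (pos \<nu> v (Suc i)) < fst (pos \<nu> v i) \<and> snd (pos \<nu> v i) < snd (pos \<nu> v (Suc i)))"

lemma far_cont:
  assumes "far \<nu> v i"
  shows "cont \<nu> v i \<noteq> cont \<nu> v (Suc i)" "cont \<nu> v (Suc i) \<noteq> cont \<nu> v i + 1" "cont \<nu> v (Suc i) \<noteq> cont \<nu> v i - 1"
  using assms unfolding far_def cont_def by auto

lemma far_standard: "is_part \<nu> \<Longrightarrow> standard \<nu> v \<Longrightarrow> far \<nu> v i \<Longrightarrow> standard \<nu> (sgen i \<circ> v)"
  unfolding far_def using standard_sgen by blast

lemma near_or_far: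
  assumes "is_part \<nu>" "standard \<nu> v" "1 \<le> i" "i < sum_list \<nu>"
  shows "far \<nu> v i \<or> cont \<nu> v (Suc i) = cont \<nu> v i + 1 \<or> cont \<nu> v (Suc i) = cont \<nu> v i - 1"
  using standard_consecutive[OF assms] assms(3,4) unfolding far_def cont_def by auto

text \<open>A single pair h, h' serves all eigenvectors g of \<open>hk\<close>, including those that
  come from Hecke algebras of larger rank. This uniformity is what later transfers statements from
  one eigenvector to another.\<close>

definition linked :: "nat list \<Rightarrow> (nat \<times> nat \<Rightarrow> nat) \<Rightarrow> (nat \<times> nat \<Rightarrow> nat) \<Rightarrow> bool" where
  "linked \<nu> v u \<longleftrightarrow> (\<exists>h\<in>Hm (sum_list \<nu>). \<exists>h'\<in>Hm (sum_list \<nu>).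
     \<forall>g. eigv (sum_list \<nu>) (cont \<nu> v) g \<longrightarrow> eigv (sum_list \<nu>) (cont \<nu> u) (g * h) \<and> g * h * h' = g)"

lemma linkedI:
  assumes "h \<in> Hm (sum_list \<nu>)" "h' \<in> Hm (sum_list \<nu>)"
    "\<And>g. eigv (sum_list \<nu>) (cont \<nu> v) g \<Longrightarrow> eigv (sum_list \<nu>) (cont \<nu> u) (g * h) \<and> g * h * h' = g"
  shows "linked \<nu> v u"
  unfolding linked_def using assms by blast

lemma linked_refl: "linked \<nu> v v"
  by (rule linkedI[of 1 _ 1]) auto

lemma linked_trans:
  assumes "linked \<nu> v u" "linked \<nu> u t" shows "linked \<nu> v t"
proof -
  obtain h h' where h: "h \<in> Hm (sum_list \<nu>)" "h' \<in> Hm (sum_list \<nu>)"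
    "\<And>g. eigv (sum_list \<nu>) (cont \<nu> v) g \<Longrightarrow> eigv (sum_list \<nu>) (cont \<nu> u) (g * h) \<and> g * h * h' = g"
    using assms(1) unfolding linked_def by blast
  obtain k k' where k: "k \<in> Hm (sum_list \<nu>)" "k' \<in> Hm (sum_list \<nu>)"
    "\<And>g. eigv (sum_list \<nu>) (cont \<nu> u) g \<Longrightarrow> eigv (sum_list \<nu>) (cont \<nu> t) (g * k) \<and> g * k * k' = g"
    using assms(2) unfolding linked_def by blast
  show ?thesis
  proof (rule linkedI[of "h * k" _ "k' * h'"])
    show "h * k \<in> Hm (sum_list \<nu>)" "k' * h' \<in> Hm (sum_list \<nu>)" using h k by (auto intro: Hm_mult)
    fix g assume g: "eigv (sum_list \<nu>) (cont \<nu> v) g"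
    note 1 = h(3)[OF g]
    note 2 = k(3)[OF conjunct1[OF 1]]
    have a: "g * h * k * k' = g * h" and b: "g * h * h' = g" using 1 2 by blast+
    have "g * (h * k) * (k' * h') = (g * h * k * k') * h'" "g * (h * k) = g * h * k" by (simp_all only: mult.assoc)
    then show "eigv (sum_list \<nu>) (cont \<nu> t) (g * (h * k)) \<and> g * (h * k) * (k' * h') = g"
      using 2 unfolding a b by simp
  qed
qed

lemma linked_far:
  assumes v: "standard \<nu> v" and f: "far \<nu> v i"
  defines "x \<equiv> icoef (cont \<nu> v i) (cont \<nu> v (Suc i))"
  shows "\<And>g. eigv (sum_list \<nu>) (cont \<nu> v) g \<Longrightarrow> eigv (sum_list \<nu>) (cont \<nu> (sgen i \<circ> v)) (g * Ti i - smul x g)"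
    and "linked \<nu> v (sgen i \<circ> v)"
    and "\<And>g. eigv (sum_list \<nu>) (cont \<nu> v) g \<Longrightarrow> g \<noteq> 0 \<Longrightarrow> g * Ti i - smul x g \<noteq> 0"
proof -
  have i: "1 \<le> i" "i < sum_list \<nu>" using f by (auto simp: far_def)
  note fc = far_cont[OF f]
  have nz: "(qq - x) * (1 + x) \<noteq> 0"
    unfolding x_def by (rule icoef_nonadjacent[OF fc])
  define \<kappa> where "\<kappa> = (qq - x) * (1 + x)"
  \<comment> \<open>The element h' is solved from the quadratic equation of
    \<open>eigv_intertwine\<close>; division by \<open>\<kappa>\<close> is possible because far
    entries have nonadjacent contents.\<close>
  define h h' where "h = Ti i - smul x 1" and "h' = smul (inverse \<kappa>) (Ti i - smul (qq - 1 - x) 1)"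
  have gh: "g * h = g * Ti i - smul x g" for g by (simp add: h_def right_diff_distrib)
  have undo: "(g * Ti i - smul x g) * h' = g" if e: "eigv (sum_list \<nu>) (cont \<nu> v) g" for g
  proof -
    define g' where "g' = g * Ti i - smul x g"
    have "g' * Ti i = smul (qq - 1 - x) g' + smul \<kappa> g"
      unfolding g'_def \<kappa>_def x_def by (rule eigv_intertwine(2)[OF e i fc(1)])
    then have "g' * h' = smul (inverse \<kappa>) (smul \<kappa> g)" by (simp add: h'_def right_diff_distrib)
    moreover have "\<kappa> \<noteq> 0" using nz unfolding \<kappa>_def .
    then have "smul (inverse \<kappa>) (smul \<kappa> g) = g" by simp
    ultimately show ?thesis unfolding g'_def by (rule trans)
  qed
  show 1: "eigv (sum_list \<nu>) (cont \<nu> (sgen i \<circ> v)) (g * Ti i - smul x g)"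
    if e: "eigv (sum_list \<nu>) (cont \<nu> v) g" for g
    using eigv_intertwine(1)[OF e i fc(1)] eigv_sgen[OF standard_tab[OF v] i] unfolding x_def by blast
  show "linked \<nu> v (sgen i \<circ> v)"
  proof (rule linkedI[of h _ h'])
    show "h \<in> Hm (sum_list \<nu>)" "h' \<in> Hm (sum_list \<nu>)"
      unfolding h_def h'_def using i by (auto intro!: Hm_smul Hm_diff Hm_Ti)
  qed (use 1 undo gh in simp)
  show "g * Ti i - smul x g \<noteq> 0" if "eigv (sum_list \<nu>) (cont \<nu> v) g" "g \<noteq> 0" for g
    using undo[OF that(1)] that(2) by auto
qed

lemma linked_tnu:
  assumes \<nu>: "is_part \<nu>" and v: "standard \<nu> v"
  shows "linked \<nu> v (tnu \<nu>)"
  using v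
proof (induction "plen (dperm \<nu> v)" arbitrary: v rule: less_induct)
  case less
  show ?case
  proof (cases "v = tnu \<nu>")
    case True
    then show ?thesis by (simp add: linked_refl)
  next
    case False
    obtain i where i: "1 \<le> i" "i < sum_list \<nu>" "standard \<nu> (sgen i \<circ> v)" "inv (dperm \<nu> v) (Suc i) < inv (dperm \<nu> v) i"
      "fst (pos \<nu> v (Suc i)) < fst (pos \<nu> v i)" "snd (pos \<nu> v i) < snd (pos \<nu> v (Suc i))"
      by (rule standard_down_step[OF \<nu> less.prems False])
    note t = standard_tab[OF less.prems]
    have "plen (dperm \<nu> (sgen i \<circ> v)) < plen (dperm \<nu> v)"
      unfolding dperm_sgen[OF t i(1,2)] using plen_sgen_left_desc[OF dperm_SN[OF t] i(1,4)] by simp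
    then have "linked \<nu> (sgen i \<circ> v) (tnu \<nu>)" using less.hyps i(3) by blast
    moreover have "far \<nu> v i" unfolding far_def using i by blast
    ultimately show ?thesis using linked_far(2)[OF less.prems] linked_trans by blast
  qed
qed

text \<open>Induction that starts at the column filling and descends along ascents of d(v). It is
  well founded because these lengths are bounded on the finite set of standard tableaux.\<close>

lemma up_induct [consumes 2, case_names col step]:
  assumes \<nu>: "is_part \<nu>" and v: "standard \<nu> v"
    and col: "P (tcol \<nu>)"
    and step: "\<And>v u i. standard \<nu> v \<Longrightarrow> far \<nu> v i \<Longrightarrow> u = sgen i \<circ> v \<Longrightarrow> standard \<nu> u \<Longrightarrow>
      inv (dperm \<nu> v) i < inv (dperm \<nu> v) (Suc i) \<Longrightarrow> P u \<Longrightarrow> P v"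
  shows "P v"
proof -
  define K where "K = Max ((\<lambda>v. plen (dperm \<nu> v)) ` {v. standard \<nu> v})"
  have le: "plen (dperm \<nu> v) \<le> K" if "standard \<nu> v" for v
    unfolding K_def using that finite_standard by (intro Max_ge) auto
  show ?thesis using v
  proof (induction "K - plen (dperm \<nu> v)" arbitrary: v rule: less_induct)
    case less
    show ?case
    proof (cases "v = tcol \<nu>")
      case True
      then show ?thesis using col by simp
    next
      case False
      obtain i where i: "1 \<le> i" "i < sum_list \<nu>" "standard \<nu> (sgen i \<circ> v)" "inv (dperm \<nu> v) i < inv (dperm \<nu> v) (Suc i)"
        "fst (pos \<nu> v i) < fst (pos \<nu> v (Suc i))" "snd (pos \<nu> v (Suc i)) < snd (pos \<nu> v i)"
        by (rule standard_up_step[OF \<nu> less.prems False])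
      note t = standard_tab[OF less.prems]
      have "plen (dperm \<nu> (sgen i \<circ> v)) = Suc (plen (dperm \<nu> v))"
        unfolding dperm_sgen[OF t i(1,2)] by (rule plen_sgen_left_asc[OF dperm_SN[OF t] i(4)])
      then have "K - plen (dperm \<nu> (sgen i \<circ> v)) < K - plen (dperm \<nu> v)" using le[OF i(3)] by linarith
      then have "P (sgen i \<circ> v)" using less.hyps i(3) by blast
      moreover have "far \<nu> v i" unfolding far_def using i by blast
      ultimately show ?thesis using step[OF less.prems _ refl i(3,4)] by blast
    qed
  qed
qed

lemma linked_tcol:
  assumes \<nu>: "is_part \<nu>" and v: "standard \<nu> v"
  shows "linked \<nu> v (tcol \<nu>)"
  using \<nu> v
proof (induction rule: up_induct)
  case col
  show ?case by (rule linked_refl)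
next
  case (step v u i)
  then show ?case using linked_far(2)[OF step(1,2)] linked_trans by blast
qed

text \<open>In the column filling consecutive entries of a column have contents decreasing by one,
  so each T_i of the column group acts by - 1.\<close>

lemma tcol_absorb:
  assumes \<nu>: "is_part \<nu>" and g: "eigv (sum_list \<nu>) (cont \<nu> (tcol \<nu>)) g"
  shows "g * Ys (sum_list \<nu>) (bcol \<nu>) = smul (py (sum_list \<nu>) (bcol \<nu>)) g"
proof (rule absorb_Ys[OF bcol_mono])
  fix i assume "same_block (sum_list \<nu>) (bcol \<nu>) i"
  then have i: "1 \<le> i" "i < sum_list \<nu>" "snd (pos \<nu> (tcol \<nu>) i) = snd (pos \<nu> (tcol \<nu>) (Suc i))"
    by (auto simp: same_block_def bcol_def)
  have c: "cont \<nu> (tcol \<nu>) (Suc i) = cont \<nu> (tcol \<nu>) i - 1"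
    using standard_consecutive[OF \<nu> tcol_standard i(1,2)] i(3) by (auto simp: cont_def)
  show "g * Ti i = - g" using eigv_adjacent[OF g i(1,2)] c icoef_adjacent(2) by simp
qed

lemma tnu_absorb:
  assumes \<nu>: "is_part \<nu>" and g: "eigv (sum_list \<nu>) (cont \<nu> (tnu \<nu>)) g"
  shows "g * Xp \<nu> = smul (px (sum_list \<nu>) (blk \<nu>)) g"
proof (rule absorb_Xs[OF blk_mono])
  fix i assume sb: "same_block (sum_list \<nu>) (blk \<nu>) i"
  then have i: "1 \<le> i" "i < sum_list \<nu>" by (auto simp: same_block_def)
  have "fst (pos \<nu> (tnu \<nu>) i) = fst (pos \<nu> (tnu \<nu>) (Suc i))"
    using sb i fst_pos_tnu[of i \<nu>] fst_pos_tnu[of "Suc i" \<nu>] by (simp add: same_block_def)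
  then have c: "cont \<nu> (tnu \<nu>) (Suc i) = cont \<nu> (tnu \<nu>) i + 1"
    using standard_consecutive[OF \<nu> tnu_standard i(1,2)] by (auto simp: cont_def)
  show "g * Ti i = smul qq g" using eigv_adjacent[OF g i(1,2)] c icoef_adjacent(1) by simp
qed

text \<open>Intertwine to the column filling, where the antisymmetrizer acts by the nonzero scalar
  \<open>py\<close>, and return. This inserts the antisymmetrizer into any eigenvector.\<close>

lemma tnu_factor:
  assumes \<nu>: "is_part \<nu>" and f: "eigv (sum_list \<nu>) (cont \<nu> (tnu \<nu>)) f"
  obtains g h where "h \<in> Hm (sum_list \<nu>)" "f = g * Ys (sum_list \<nu>) (bcol \<nu>) * h"
proof -
  obtain h h' where h: "h' \<in> Hm (sum_list \<nu>)" "eigv (sum_list \<nu>) (cont \<nu> (tcol \<nu>)) (f * h)" "f * h * h' = f"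
    using linked_tcol[OF \<nu> tnu_standard] f unfolding linked_def by blast
  define k where "k = py (sum_list \<nu>) (bcol \<nu>)"
  have "smul (inverse k) (f * h) * Ys (sum_list \<nu>) (bcol \<nu>) * h' = f"
    using tcol_absorb[OF \<nu> h(2)] h(3) by (simp add: k_def)
  then show ?thesis using that[OF h(1)] by metis
qed

lemma eigv_tnu_NN:
  assumes \<nu>: "is_part \<nu>" and f: "eigv (sum_list \<nu>) (cont \<nu> (tnu \<nu>)) f" and b: "b \<in> NN \<nu>"
  shows "f * b = 0"
proof -
  obtain g h where h: "h \<in> Hm (sum_list \<nu>)" "f = g * Ys (sum_list \<nu>) (bcol \<nu>) * h" by (rule tnu_factor[OF \<nu> f])
  show ?thesis using b
  proof (induction rule: NN_induct)
    case (gen c w w' \<rho>)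
    note d = dominatingD[OF gen(1)]
    have "Ys (sum_list \<nu>) (bcol \<nu>) * (h * TT w) * Xs (sum_list \<nu>) (blk \<rho>) = 0"
    proof (rule Ys_Hm_Xs_zero[OF bcol_mono])
      show "mono_on {1..sum_list \<nu>} (blk \<rho>)" using blk_mono[of \<rho>] d(2) by simp
      show "clash (sum_list \<nu>) (bcol \<nu>) (blk \<rho>) w" if "w permutes {1..sum_list \<nu>}" for w
        by (rule dominating_clash[OF \<nu> d that])
      show "h * TT w \<in> Hm (sum_list \<nu>)" by (intro Hm_mult Hm_TT h gen)
    qed
    then have z: "Ys (sum_list \<nu>) (bcol \<nu>) * (h * TT w) * Xp \<rho> = 0" using d(2) by simp
    have "f * (TT w * Xp \<rho> * TT w') = g * (Ys (sum_list \<nu>) (bcol \<nu>) * (h * TT w) * Xp \<rho>) * TT w'"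
      unfolding h(2) by (simp only: mult.assoc)
    then show ?case unfolding z by simp
  qed (simp_all add: distrib_left)
qed

text \<open>Multiplicity one: only one double coset is free of clashes, so y_\<nu> H x_\<nu> is
  spanned by one element. The vector f lies on the resulting line because it absorbs
  x_\<nu>.\<close>

lemma eigv_tnu_scalar:
  assumes \<nu>: "is_part \<nu>" and f: "eigv (sum_list \<nu>) (cont \<nu> (tnu \<nu>)) f" and k: "k \<in> Hm (sum_list \<nu>)"
  shows "\<exists>c. f * k * Xp \<nu> = smul c f"
proof (cases "f = 0")
  case False
  obtain g h where h: "h \<in> Hm (sum_list \<nu>)" "f = g * Ys (sum_list \<nu>) (bcol \<nu>) * h" by (rule tnu_factor[OF \<nu> f])
  define B where "B = g * (Ys (sum_list \<nu>) (bcol \<nu>) * TT (inv (wcol \<nu>)) * Xp \<nu>)"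
  have mult: "\<exists>c. f * k * Xp \<nu> = smul c B" if k: "k \<in> Hm (sum_list \<nu>)" for k
  proof -
    have "\<exists>c. Ys (sum_list \<nu>) (bcol \<nu>) * (h * k) * Xp \<nu> = smul c (Ys (sum_list \<nu>) (bcol \<nu>) * TT (inv (wcol \<nu>)) * Xp \<nu>)"
    proof (rule Ys_Hm_Xs_multiple[OF bcol_mono blk_mono])
      show "w = inv (wcol \<nu>)" if "w permutes {1..sum_list \<nu>}" "dmin (sum_list \<nu>) (bcol \<nu>) (blk \<nu>) w"
        "\<not> clash (sum_list \<nu>) (bcol \<nu>) (blk \<nu>) w" for w
        by (rule wcol_no_clash_unique[OF \<nu> that(1,3,2)])
      show "h * k \<in> Hm (sum_list \<nu>)" by (intro Hm_mult h k)
    qed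
    then obtain c where c: "Ys (sum_list \<nu>) (bcol \<nu>) * (h * k) * Xp \<nu> = smul c (Ys (sum_list \<nu>) (bcol \<nu>) * TT (inv (wcol \<nu>)) * Xp \<nu>)" ..
    have "f * k * Xp \<nu> = g * (Ys (sum_list \<nu>) (bcol \<nu>) * (h * k) * Xp \<nu>)" unfolding h(2) by (simp only: mult.assoc)
    then have "f * k * Xp \<nu> = smul c B" unfolding c B_def by simp
    then show ?thesis ..
  qed
  \<comment> \<open>The choice k = 1 expresses a nonzero multiple of f through \<open>B\<close>; as
    f is nonzero, \<open>B\<close> is in turn a multiple of f.\<close>
  obtain c1 where c1: "f * 1 * Xp \<nu> = smul c1 B" using mult[OF Hm_1] by blast
  then have c1': "smul (px (sum_list \<nu>) (blk \<nu>)) f = smul c1 B" using tnu_absorb[OF \<nu> f] by simp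
  have "c1 \<noteq> 0" using c1' False by auto
  then have "B = smul (inverse c1) (smul c1 B)" by simp
  then have B: "B = smul (inverse c1 * px (sum_list \<nu>) (blk \<nu>)) f" unfolding c1'[symmetric] by simp
  obtain c where "f * k * Xp \<nu> = smul c B" using mult[OF k] by blast
  then have "f * k * Xp \<nu> = smul (c * (inverse c1 * px (sum_list \<nu>) (blk \<nu>))) f" unfolding B by simp
  then show ?thesis ..
qed simp

section \<open>Self-adjointness of the symmetrizers\<close>

lemma ip_TT:
  assumes "w permutes {1..m}" shows "ip (a * TT w) b = ip a (b * TT (inv w))"
proof -
  \<comment> \<open>Under constant labels the whole symmetric group is a Young subgroup, so its
    induction rule applies.\<close>
  have "w \<in> Yg m (\<lambda>_. 0)" "mono_on {1..m} (\<lambda>_. 0::nat)" using assms by (auto simp: Yg_def mono_on_def)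
  from this(2,1) show ?thesis
  proof (induction arbitrary: a b rule: Yg_induct)
    case (id v)
    then show ?case by (metis TT_id inv_id mult.right_neutral)
  next
    case (step v w i)
    note w = Yg_SN[OF step(2)]
    have i: "1 \<le> i" using step(3) by (simp add: same_block_def)
    have 1: "TT v = TT w * Ti i" unfolding step(1) by (rule TT_mult_Ti_asc[OF w i step(4), symmetric])
    have "inv v = inv w \<circ> sgen i" unfolding step(1) by (rule inv_sgen_left[OF w])
    then have 2: "TT (inv v) = Ti i * TT (inv w)" using Ti_mult_TT_asc[OF SN_inv[OF w] i step(4)] by simp
    have "ip (a * TT w * Ti i) b = ip a (b * Ti i * TT (inv w))" by (simp add: ip_mult_Ti[OF i] step.IH)
    then have "ip (a * TT v) b = ip a (b * TT (inv v))" unfolding 1 2 by (simp only: mult.assoc)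
    then show ?case .
  qed
qed

lemma Yg_inv_bij: "bij_betw inv (Yg m b) (Yg m b)"
  by (rule bij_betw_byWitness[where f' = inv]) (auto simp: Yg_inv inv_inv_SN Yg_SN)

lemma ip_Xs: "ip (a * Xs m b) c = ip a (c * Xs m b)"
proof -
  have "ip (a * Xs m b) c = (\<Sum>w\<in>Yg m b. ip a (c * TT (inv w)))"
    unfolding Xs_def sum_distrib_left ip_sum_left using ip_TT[OF Yg_permutes] by (intro sum.cong) auto
  also have "\<dots> = (\<Sum>w\<in>Yg m b. ip a (c * TT w))" by (rule sum.reindex_bij_betw[OF Yg_inv_bij])
  finally show ?thesis unfolding Xs_def sum_distrib_left ip_sum_right .
qed

lemma ip_Ys: "ip (a * Ys m b) c = ip a (c * Ys m b)"
proof -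
  let ?k = "\<lambda>w. (- inverse qq) ^ plen w"
  have "ip (a * Ys m b) c = (\<Sum>w\<in>Yg m b. ?k (inv w) * ip a (c * TT (inv w)))"
    unfolding Ys_def sum_distrib_left ip_sum_left
  proof (rule sum.cong[OF refl])
    fix w assume w: "w \<in> Yg m b"
    show "ip (a * smul (?k w) (TT w)) c = ?k (inv w) * ip a (c * TT (inv w))"
      using ip_TT[OF Yg_permutes[OF w]] plen_inv[OF Yg_SN[OF w]] by (simp add: ip_smul_left)
  qed
  also have "\<dots> = (\<Sum>w\<in>Yg m b. ?k w * ip a (c * TT w))"
    by (rule sum.reindex_bij_betw[OF Yg_inv_bij, of "\<lambda>w. ?k w * ip a (c * TT w)"])
  finally show ?thesis unfolding Ys_def sum_distrib_left ip_sum_right by (simp add: ip_smul_right)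
qed

text \<open>Moving the self-adjoint outer factors and h across the form reverses the order of the
  product, so the element pairs to zero with everything, in particular with itself.\<close>

lemma Xs_Hm_Ys_zero:
  assumes z: "\<And>h. h \<in> Hm m \<Longrightarrow> Ys m b * h * Xs m b' = 0" and h: "h \<in> Hm m"
  shows "Xs m b' * h * Ys m b = 0"
proof (rule ip_eq_0)
  obtain h' where h': "h' \<in> Hm m" "\<forall>a c. ip (a * h) c = ip a (c * h')" using adjoint_exists[OF h] by blast
  have "ip (Xs m b' * h * Ys m b) c = ip 1 (c * (Ys m b * h' * Xs m b'))" for c
  proof -
    have "ip (Xs m b' * h * Ys m b) c = ip (Xs m b' * h) (c * Ys m b)" by (rule ip_Ys)
    also have "\<dots> = ip (1 * Xs m b') (c * Ys m b * h')" using h'(2) by simp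
    also have "\<dots> = ip 1 (c * Ys m b * h' * Xs m b')" by (rule ip_Xs)
    finally show ?thesis by (simp only: mult.assoc)
  qed
  then show "ip (Xs m b' * h * Ys m b) (Xs m b' * h * Ys m b) = 0" using z[OF h'(1)] by simp
qed

section \<open>Cyclic modules generated by a highest eigenvector\<close>

theorem eigv_tnu_annihilator:
  assumes \<nu>: "is_part \<nu>" and f: "eigv (sum_list \<nu>) (cont \<nu> (tnu \<nu>)) f" "f \<noteq> 0" and k: "k \<in> Hm (sum_list \<nu>)"
  shows "f * k = 0 \<longleftrightarrow> Xp \<nu> * k \<in> NN \<nu>"
proof
  let ?p = "px (sum_list \<nu>) (blk \<nu>)"
  \<comment> \<open>The vector f kills the ideal, and in f x_\<nu> b the factor x_\<nu> is absorbed
    as a nonzero scalar.\<close>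
  have key: "f * b = 0" if "Xp \<nu> * b \<in> NN \<nu>" for b
  proof -
    have "f * (Xp \<nu> * b) = 0" by (rule eigv_tnu_NN[OF \<nu> f(1) that])
    then have "smul ?p (f * b) = 0" using tnu_absorb[OF \<nu> f(1)] by (simp flip: mult.assoc)
    then show ?thesis by simp
  qed
  show "f * k = 0" if "Xp \<nu> * k \<in> NN \<nu>" using key[OF that] .
  show "Xp \<nu> * k \<in> NN \<nu>" if fk: "f * k = 0"
  proof (rule ccontr)
    assume "Xp \<nu> * k \<notin> NN \<nu>"
    then have nz: "zz \<nu> * k \<noteq> 0" using Xp_mult_NN_iff[OF k] by simp
    obtain k' where k': "k' \<in> Hm (sum_list \<nu>)" "\<forall>a b. ip (a * k) b = ip a (b * k')" using adjoint_exists[OF k] by blast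
    note ze = zz_eigv[OF \<nu>]
    have "ip (zz \<nu> * k) (zz \<nu> * k) \<noteq> 0" using nz ip_eq_0 by blast
    then have "ip (zz \<nu>) (zz \<nu> * k * k') \<noteq> 0" using k'(2) by simp
    \<comment> \<open>Absorption inserts x_\<nu> next to z at the cost of a nonzero factor; by
      self-adjointness it moves to the other argument, which is thereby shown to be nonzero.\<close>
    moreover have "ip (zz \<nu> * Xp \<nu>) (zz \<nu> * k * k') = ?p * ip (zz \<nu>) (zz \<nu> * k * k')"
      unfolding tnu_absorb[OF \<nu> ze] by (rule ip_smul_left)
    ultimately have "ip (zz \<nu>) (zz \<nu> * k * k' * Xp \<nu>) \<noteq> 0" unfolding ip_Xs by simp
    then have nz2: "zz \<nu> * k * k' * Xp \<nu> \<noteq> 0" by auto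
    have kk: "k * k' \<in> Hm (sum_list \<nu>)" using k k' by (intro Hm_mult)
    obtain c where c: "zz \<nu> * (k * k') * Xp \<nu> = smul c (zz \<nu>)" using eigv_tnu_scalar[OF \<nu> ze kk] by blast
    have c0: "c \<noteq> 0" using c nz2 by (auto simp: mult.assoc)
    \<comment> \<open>The relation z b = 0 is passed on to f through the ideal: it means that
      x_\<nu> b lies there, whence f b = 0.\<close>
    let ?b = "k * k' * Xp \<nu> - smul c 1"
    have "zz \<nu> * ?b = 0" using c by (simp add: right_diff_distrib mult.assoc)
    moreover have "?b \<in> Hm (sum_list \<nu>)" using k k'(1) by (intro Hm_diff Hm_mult Xp_Hm Hm_smul) auto
    ultimately have "Xp \<nu> * ?b \<in> NN \<nu>" using Xp_mult_NN_iff by blast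
    then have "f * ?b = 0" by (rule key)
    then have "f * k * (k' * Xp \<nu>) = smul c f" by (simp add: right_diff_distrib mult.assoc)
    then show False using fk c0 f(2) by simp
  qed
qed

section \<open>Integral functionals separating the Murphy basis\<close>

text \<open>Each letter of a reduced word of x is either composed into g or dropped through the
  quadratic relation. What is composed in total is x itself or something shorter in the same Young
  subgroup.\<close>

lemma TT_mult_support:
  assumes mono: "mono_on {1..m} b" and x: "x \<in> Yg m b" and g: "g \<in> SN"
  shows "TT x * TT g \<in> hk.span {TT (g \<circ> x') | x'. x' \<in> Yg m b \<and> (x' = x \<or> plen x' < plen x)}"
  using mono x g
proof (induction arbitrary: g rule: Yg_induct)
  case (id v)
  have e: "TT v * TT g = TT (g \<circ> v)" unfolding id by simp
  have "TT (g \<circ> v) \<in> {TT (g \<circ> x') | x'. x' \<in> Yg m b \<and> (x' = v \<or> plen x' < plen v)}"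
    unfolding id by (rule CollectI, rule exI[of _ "Fun.id"]) simp
  then show ?case unfolding e by (rule hk.span_base)
next
  case (step v w i)
  have i: "1 \<le> i" using step(3) by (simp add: same_block_def)
  have v: "TT v = TT w * Ti i" unfolding step(1) by (rule TT_mult_Ti_asc[OF Yg_SN[OF step(2)] i step(4), symmetric])
  let ?S = "hk.span {TT (g \<circ> x') | x'. x' \<in> Yg m b \<and> (x' = v \<or> plen x' < plen v)}"
  have gs: "g \<circ> sgen i \<in> SN" using step.prems i by (simp add: sgen_right_SN_iff)
  have 1: "TT w * TT g \<in> ?S"
  proof -
    have "{TT (g \<circ> x') | x'. x' \<in> Yg m b \<and> (x' = w \<or> plen x' < plen w)}
      \<subseteq> {TT (g \<circ> x') | x'. x' \<in> Yg m b \<and> (x' = v \<or> plen x' < plen v)}"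
      using step(5) by fastforce
    then show ?thesis using step.IH[OF step.prems] hk.span_mono by blast
  qed
  have 2: "TT w * TT (g \<circ> sgen i) \<in> ?S"
  proof -
    have "{TT ((g \<circ> sgen i) \<circ> x') | x'. x' \<in> Yg m b \<and> (x' = w \<or> plen x' < plen w)}
      \<subseteq> {TT (g \<circ> x') | x'. x' \<in> Yg m b \<and> (x' = v \<or> plen x' < plen v)}"
    proof clarify
      fix x' assume x': "x' \<in> Yg m b" "x' = w \<or> plen x' < plen w"
      have "sgen i \<circ> x' \<in> Yg m b" using sgen_left_Yg[OF step(3) x'(1)] .
      moreover have "sgen i \<circ> x' = v \<or> plen (sgen i \<circ> x') < plen v"
        using x'(2) step(1,5) plen_left_cases[OF Yg_SN[OF x'(1)] i] by auto
      moreover have "TT ((g \<circ> sgen i) \<circ> x') = TT (g \<circ> (sgen i \<circ> x'))" by (simp only: comp_assoc)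
      ultimately show "\<exists>x''. TT ((g \<circ> sgen i) \<circ> x') = TT (g \<circ> x'') \<and> x'' \<in> Yg m b \<and> (x'' = v \<or> plen x'' < plen v)" by blast
    qed
    then show ?thesis using step.IH[OF gs] hk.span_mono by blast
  qed
  have e: "TT v * TT g = TT w * (Ti i * TT g)" unfolding v by (simp only: mult.assoc)
  show ?case
  proof (cases "g i < g (Suc i)")
    case True
    show ?thesis unfolding e Ti_mult_TT_asc[OF step.prems i True] by (rule 2)
  next
    case False
    then have d: "g (Suc i) < g i" using neq_Suc[OF step.prems, of i] by linarith
    show ?thesis unfolding e Ti_mult_TT_desc[OF step.prems i d] distrib_left smul_mult_right
      by (intro hk.span_add hk.span_scale 1 2)
  qed
qed

text \<open>The condition makes w a shortest coset representative, so every letter of c stays an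
  ascent and lengths add. The next lemma is the mirror image.\<close>

lemma TT_mult_right_additive:
  assumes mono: "mono_on {1..m} b" and c: "c \<in> Yg m b" and w: "w \<in> SN"
    and inc: "\<And>k l. k < l \<Longrightarrow> k \<in> {1..m} \<Longrightarrow> l \<in> {1..m} \<Longrightarrow> b k = b l \<Longrightarrow> inv w k < inv w l"
  shows "TT w * TT c = TT (c \<circ> w)"
  using mono c
proof (induction rule: Yg_induct)
  case (id v)
  then show ?case by (metis TT_id mult.right_neutral comp_id id_comp)
next
  case (step v c i)
  have i: "1 \<le> i" "i \<in> {1..m}" "Suc i \<in> {1..m}" "b i = b (Suc i)" using step(3) by (auto simp: same_block_def)
  note cS = Yg_SN[OF step(2)] and ic = Yg_inv[OF step(2)]
  have cw: "c \<circ> w \<in> SN" using cS w SN_comp by blast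
  have r: "inv c i \<in> {1..m}" "inv c (Suc i) \<in> {1..m}"
    using permutes_in_image[OF Yg_permutes[OF ic]] i by blast+
  have "b (inv c i) = b (inv c (Suc i))" using Yg_label[OF ic] i by simp
  then have "inv w (inv c i) < inv w (inv c (Suc i))" using inc[OF step(4) r] by simp
  moreover have "inv (c \<circ> w) = inv w \<circ> inv c" using SN_bij[OF cS] SN_bij[OF w] by (rule o_inv_distrib)
  ultimately have a: "inv (c \<circ> w) i < inv (c \<circ> w) (Suc i)" by simp
  have "TT v = TT c * Ti i" unfolding step(1) by (rule TT_mult_Ti_asc[OF cS i(1) step(4), symmetric])
  then have "TT w * TT v = TT w * TT c * Ti i" by (simp flip: mult.assoc)
  also have "TT w * TT c = TT (c \<circ> w)" using step.IH by (simp add: comp_def)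
  finally have "TT w * TT v = TT (c \<circ> w) * Ti i" .
  also have "\<dots> = TT (sgen i \<circ> (c \<circ> w))" by (rule TT_mult_Ti_asc[OF cw i(1) a])
  also have "sgen i \<circ> (c \<circ> w) = v \<circ> w" unfolding step(1) by (simp only: comp_assoc)
  finally show ?case .
qed

lemma TT_mult_left_additive:
  assumes mono: "mono_on {1..m} b" and r: "r \<in> Yg m b" and w: "w \<in> SN"
    and inc: "\<And>k l. k < l \<Longrightarrow> k \<in> {1..m} \<Longrightarrow> l \<in> {1..m} \<Longrightarrow> b k = b l \<Longrightarrow> w k < w l"
  shows "TT r * TT w = TT (w \<circ> r)"
  using r
proof (induction "plen r" arbitrary: r rule: less_induct)
  case less
  show ?case
  proof (cases "r = id")
    case True
    then show ?thesis by simp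
  next
    case False
    note rS = Yg_SN[OF less.prems]
    have "inv r \<noteq> id" using False inv_inv_SN[OF rS] by (metis inv_id)
    then obtain i where sb: "same_block m b i" and "inv (inv r) (Suc i) < inv (inv r) i"
      using Yg_descent[OF mono Yg_inv[OF less.prems]] by blast
    then have d: "r (Suc i) < r i" using inv_inv_SN[OF rS] by simp
    have i: "1 \<le> i" "i \<in> {1..m}" "Suc i \<in> {1..m}" "b i = b (Suc i)" using sb by (auto simp: same_block_def)
    let ?r = "r \<circ> sgen i"
    have rY: "?r \<in> Yg m b" using sgen_right_Yg[OF sb less.prems] .
    have l: "plen ?r < plen r" using plen_sgen_right_desc'[OF rS i(1) d] by simp
    have a: "?r i < ?r (Suc i)" using d by simp
    have e: "TT r = Ti i * TT ?r"
      using Ti_mult_TT_asc[OF Yg_SN[OF rY] i(1) a] unfolding sgen_cancel_right by (rule sym)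
    have rr: "?r i \<in> {1..m}" "?r (Suc i) \<in> {1..m}" using permutes_in_image[OF Yg_permutes[OF rY]] i by blast+
    have "b (?r i) = b (?r (Suc i))" using Yg_label[OF rY i(2)] Yg_label[OF rY i(3)] i(4) by simp
    then have wa: "(w \<circ> ?r) i < (w \<circ> ?r) (Suc i)" using inc[OF a rr] by simp
    have "TT r * TT w = Ti i * TT (w \<circ> ?r)" unfolding e mult.assoc using less.hyps[OF l rY] by simp
    also have "\<dots> = TT (w \<circ> ?r \<circ> sgen i)" by (rule Ti_mult_TT_asc[OF SN_comp[OF w Yg_SN[OF rY]] i(1) wa])
    also have "w \<circ> ?r \<circ> sgen i = w \<circ> r" by (simp only: comp_assoc sgen_comp_sgen comp_id)
    finally show ?thesis .
  qed
qed

section \<open>Factorizations of the column permutation through d(u)\<close>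

definition ecol :: "nat list \<Rightarrow> (nat \<times> nat \<Rightarrow> nat) \<Rightarrow> nat \<Rightarrow> nat" where
  "ecol \<nu> u = wcol \<nu> \<circ> inv (dperm \<nu> u)"

lemma ecol_permutes: "tableau \<nu> u \<Longrightarrow> ecol \<nu> u permutes {1..sum_list \<nu>}"
  unfolding ecol_def by (intro permutes_comp wcol_permutes permutes_inv dperm_permutes)

lemma ecol_comp: "tableau \<nu> u \<Longrightarrow> ecol \<nu> u \<circ> dperm \<nu> u = wcol \<nu>"
  unfolding ecol_def using inv_SN_apply(2)[OF dperm_SN] by (simp add: fun_eq_iff)

lemma ecol_apply:
  assumes t: "tableau \<nu> u" and k: "k \<in> {1..sum_list \<nu>}" shows "ecol \<nu> u k = tcol \<nu> (pos \<nu> u k)"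
  unfolding ecol_def wcol_def comp_apply inv_dperm[OF t k] by (rule dperm_tnu_node[OF tcol_tableau pos_in[OF t k]])

lemma inv_ecol:
  assumes t: "tableau \<nu> u" and k: "k \<in> {1..sum_list \<nu>}" shows "inv (ecol \<nu> u) k = u (pos \<nu> (tcol \<nu>) k)"
proof -
  have n: "pos \<nu> (tcol \<nu>) k \<in> nodes \<nu>" by (rule pos_in[OF tcol_tableau k])
  have "ecol \<nu> u (u (pos \<nu> (tcol \<nu>) k)) = k"
    using ecol_apply[OF t tab_range[OF t n]] pos_tab[OF t n] tab_pos[OF tcol_tableau k] by simp
  then show ?thesis using inv_SN_apply(2)[OF SN_I[OF ecol_permutes[OF t]]] by metis
qed

text \<open>An ascent from v to u lengthens d(v) by one, while \<open>ecol\<close> loses at most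
  one. Together with subadditivity of length this forces equality all the way down from the column
  filling.\<close>

lemma ecol_length:
  assumes \<nu>: "is_part \<nu>" and u: "standard \<nu> u"
  shows "plen (wcol \<nu>) = plen (ecol \<nu> u) + plen (dperm \<nu> u)"
  using \<nu> u
proof (induction rule: up_induct)
  case col
  have "ecol \<nu> (tcol \<nu>) = id" unfolding ecol_def wcol_def[symmetric]
    using inv_SN_apply(1)[OF SN_I[OF wcol_permutes]] by (simp add: fun_eq_iff)
  then have "plen (ecol \<nu> (tcol \<nu>)) = 0" using plen_id by metis
  then show ?case by (simp add: wcol_def)
next
  case (step v u i)
  note t = standard_tab[OF step(1)] and t' = standard_tab[OF step(4)]
  have i: "1 \<le> i" "i < sum_list \<nu>" using step(2) by (auto simp: far_def)
  have d: "dperm \<nu> u = sgen i \<circ> dperm \<nu> v" unfolding step(3) by (rule dperm_sgen[OF t i])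
  have l: "plen (dperm \<nu> u) = Suc (plen (dperm \<nu> v))" unfolding d by (rule plen_sgen_left_asc[OF dperm_SN[OF t] step(5)])
  have e: "ecol \<nu> v = ecol \<nu> u \<circ> sgen i"
    unfolding ecol_def d inv_sgen_left[OF dperm_SN[OF t]] by (simp add: fun_eq_iff)
  note eS = SN_I[OF ecol_permutes[OF t']]
  have "plen (ecol \<nu> u \<circ> sgen i) \<le> Suc (plen (ecol \<nu> u))"
  proof (cases "ecol \<nu> u (Suc i) < ecol \<nu> u i")
    case True
    then show ?thesis using plen_sgen_right_desc'[OF eS i(1)] by simp
  next
    case False
    then have "ecol \<nu> u i < ecol \<nu> u (Suc i)" using neq_Suc[OF eS, of i] by linarith
    then show ?thesis using plen_sgen_right(2)[OF eS i(1)] by simp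
  qed
  then have 1: "plen (ecol \<nu> v) \<le> Suc (plen (ecol \<nu> u))" unfolding e .
  have 2: "plen (wcol \<nu>) \<le> plen (ecol \<nu> v) + plen (dperm \<nu> v)"
    using plen_comp_le[OF ecol_permutes[OF t] dperm_SN[OF t]] unfolding ecol_comp[OF t] .
  have "plen (wcol \<nu>) = plen (ecol \<nu> u) + plen (dperm \<nu> u)" using step.IH .
  then have "plen (wcol \<nu>) = plen (ecol \<nu> v) + plen (dperm \<nu> v)" using 1 2 l by linarith
  then show ?case .
qed

lemma TT_wcol:
  assumes \<nu>: "is_part \<nu>" and u: "standard \<nu> u"
  shows "TT (dperm \<nu> u) * TT (ecol \<nu> u) = TT (wcol \<nu>)"
  using TT_mult[OF ecol_permutes[OF standard_tab[OF u]] dperm_SN[OF standard_tab[OF u]]] ecol_comp[OF standard_tab[OF u]]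
    ecol_length[OF assms] by simp

text \<open>The equation says that the row labels attached to x arise from those of u by permuting
  entries inside the columns of u. Since the columns of u are sorted, u has the fewest inversions
  across rows among such rearrangements, and it is the only one attaining this minimum; so x cannot
  be shorter than d(u).\<close>

lemma wcol_support:
  assumes \<nu>: "is_part \<nu>" and u: "standard \<nu> u" and c: "c \<in> Yg (sum_list \<nu>) (bcol \<nu>)"
    and r: "r \<in> Yg (sum_list \<nu>) (blk \<nu>)" and x: "x permutes {1..sum_list \<nu>}" and le: "plen x \<le> plen (dperm \<nu> u)"
    and eq: "c \<circ> ecol \<nu> u \<circ> x \<circ> r = wcol \<nu>"
  shows "plen x = plen (dperm \<nu> u)" "\<And>k. k \<in> {1..sum_list \<nu>} \<Longrightarrow> blk \<nu> (inv x k) = fst (pos \<nu> u k)"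
proof -
  let ?m = "sum_list \<nu>" and ?e = "ecol \<nu> u" and ?d = "dperm \<nu> u"
  note t = standard_tab[OF u]
  note eS = SN_I[OF ecol_permutes[OF t]] and dS = dperm_SN[OF t] and cS = Yg_SN[OF c] and rS = Yg_SN[OF r] and xS = SN_I[OF x]
  \<comment> \<open>The column permutation c transported to the entries of u: it permutes them
    inside the columns of u.\<close>
  define \<gamma> where "\<gamma> = inv ?e \<circ> c \<circ> ?e"
  have \<gamma>p: "\<gamma> permutes {1..?m}" unfolding \<gamma>_def using ecol_permutes[OF t] Yg_permutes[OF c]
    by (intro permutes_comp permutes_inv)
  have e1: "c (?e (x (r j))) = ?e (?d j)" for j
    using fun_cong[OF eq, of j] fun_cong[OF ecol_comp[OF t], of j] by simp
  have xinv: "inv x k = r (inv ?d (\<gamma> k))" for k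
  proof -
    define j where "j = inv r (inv x k)"
    have k: "x (r j) = k" using inv_SN_apply(1)[OF rS] inv_SN_apply(1)[OF xS] by (simp add: j_def)
    have "c (?e k) = ?e (?d j)" using e1[of j] k by simp
    then have "\<gamma> k = ?d j" using inv_SN_apply(2)[OF eS] by (simp add: \<gamma>_def)
    then have "inv ?d (\<gamma> k) = j" using inv_SN_apply(2)[OF dS] by simp
    then show ?thesis using k inv_SN_apply(2)[OF xS] by metis
  qed
  have \<gamma>m: "\<gamma> k \<in> {1..?m}" if "k \<in> {1..?m}" for k using permutes_in_image[OF \<gamma>p] that by blast
  have row: "blk \<nu> (inv x k) = fst (pos \<nu> u (\<gamma> k))" if k: "k \<in> {1..?m}" for k
  proof -
    have "inv ?d (\<gamma> k) \<in> {1..?m}" using permutes_in_image[OF permutes_inv[OF dperm_permutes[OF t]]] \<gamma>m[OF k] by blast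
    then show ?thesis unfolding xinv using Yg_label[OF r] blk_inv_dperm[OF t \<gamma>m[OF k]] by simp
  qed
  have col: "snd (pos \<nu> u k) = bcol \<nu> (?e k)" if k: "k \<in> {1..?m}" for k
    unfolding ecol_apply[OF t k] bcol_def using pos_tab[OF tcol_tableau pos_in[OF t k]] by simp
  have col2: "snd (pos \<nu> u (\<gamma> k)) = snd (pos \<nu> u k)" if k: "k \<in> {1..?m}" for k
  proof -
    have ek: "?e k \<in> {1..?m}" using permutes_in_image[OF ecol_permutes[OF t]] k by blast
    have "?e (\<gamma> k) = c (?e k)" using inv_SN_apply(1)[OF eS] by (simp add: \<gamma>_def)
    then show ?thesis using col[OF \<gamma>m[OF k]] col[OF k] Yg_label[OF c ek] by simp
  qed
  have bp: "bij_betw (pos \<nu> u) {1..?m} (nodes \<nu>)"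
    unfolding pos_def using bij_betw_the_inv_into[OF tableau_bij[OF t]] by simp
  have b1: "bij_betw (\<lambda>k. (blk \<nu> (inv x k), snd (pos \<nu> u k))) {1..?m} (nodes \<nu>)"
  proof (rule bij_betw_cong[THEN iffD1, OF _ bij_betw_trans[OF permutes_imp_bij[OF \<gamma>p] bp]])
    fix k assume k: "k \<in> {1..?m}"
    show "(pos \<nu> u \<circ> \<gamma>) k = (blk \<nu> (inv x k), snd (pos \<nu> u k))"
      using row[OF k] col2[OF k] by (simp add: prod_eq_iff)
  qed
  have b0: "bij_betw (\<lambda>k. (fst (pos \<nu> u k), snd (pos \<nu> u k))) {1..?m} (nodes \<nu>)" using bp by simp
  have sorted: "fst (pos \<nu> u k) < fst (pos \<nu> u l)"
    if kl: "k \<in> {1..?m}" "l \<in> {1..?m}" "k < l" "snd (pos \<nu> u k) = snd (pos \<nu> u l)" for k l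
  proof (rule ccontr)
    assume n: "\<not> fst (pos \<nu> u k) < fst (pos \<nu> u l)"
    show False
    proof (cases "pos \<nu> u k = pos \<nu> u l")
      case True
      have "k = l"
        by (rule trans[OF tab_pos[OF t kl(1), symmetric] trans[OF arg_cong[OF True, of u] tab_pos[OF t kl(2)]]])
      then show False using kl(3) by simp
    next
      case False
      have le: "fst (pos \<nu> u l) \<le> fst (pos \<nu> u k)" "snd (pos \<nu> u l) \<le> snd (pos \<nu> u k)"
        using n kl(4) by linarith+
      have "u (pos \<nu> u l) < u (pos \<nu> u k)"
        by (rule standard_less[OF \<nu> u pos_in[OF t kl(2)] pos_in[OF t kl(1)] le not_sym[OF False]])
      then show False unfolding tab_pos[OF t kl(1)] tab_pos[OF t kl(2)] using kl(3) by linarith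
    qed
  qed
  have down: "(r', c') \<in> nodes \<nu>" if "(r'', c') \<in> nodes \<nu>" "1 \<le> r'" "r' \<le> r''" for r'' c' r'
    using nodes_down[OF \<nu> that(1), of r' c'] that by (simp add: nodes_iff)
  have pos1: "1 \<le> r'" if "(r', c') \<in> nodes \<nu>" for r' c' using that by (simp add: nodes_iff)
  have main1: "card (xinv ?m (\<lambda>k. fst (pos \<nu> u k))) \<le> card (xinv ?m (\<lambda>k. blk \<nu> (inv x k)))"
    by (rule card_xinv_column_sorted(1)[OF b1 b0]) (erule (2) down, erule pos1, erule (3) sorted)
  have main2: "\<forall>k\<in>{1..?m}. blk \<nu> (inv x k) = fst (pos \<nu> u k)"
    if "card (xinv ?m (\<lambda>k. blk \<nu> (inv x k))) = card (xinv ?m (\<lambda>k. fst (pos \<nu> u k)))"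
    by (rule card_xinv_column_sorted(2)[OF b1 b0 _ _ _ that]) (erule (2) down, erule pos1, erule (3) sorted)
  have "card (xinv ?m (\<lambda>k. fst (pos \<nu> u k))) = plen ?d" using plen_dperm_standard[OF \<nu> u] by simp
  moreover have "card (xinv ?m (\<lambda>k. blk \<nu> (inv x k))) \<le> plen x" by (rule card_xinv_le_plen[OF x])
  ultimately have "plen x = plen ?d" and e: "card (xinv ?m (\<lambda>k. blk \<nu> (inv x k))) = card (xinv ?m (\<lambda>k. fst (pos \<nu> u k)))"
    using main1 le by linarith+
  then show "plen x = plen ?d" by simp
  show "\<And>k. k \<in> {1..?m} \<Longrightarrow> blk \<nu> (inv x k) = fst (pos \<nu> u k)" using main2[OF e] by blast
qed

text \<open>Rows of a standard tableau increase, so the column of k is the number of entries up to k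
  in its row and can be recovered from the rows.\<close>

lemma standard_rows_inject:
  assumes \<nu>: "is_part \<nu>" and u: "standard \<nu> u" and v: "standard \<nu> v"
    and rows: "\<And>k. k \<in> {1..sum_list \<nu>} \<Longrightarrow> fst (pos \<nu> u k) = fst (pos \<nu> v k)"
  shows "u = v"
proof (rule tab_eqI_pos[OF standard_tab[OF u] standard_tab[OF v]])
  let ?m = "sum_list \<nu>"
  have cnt: "snd (pos \<nu> v k) = card {l \<in> {1..?m}. fst (pos \<nu> v l) = fst (pos \<nu> v k) \<and> l \<le> k}"
    if v: "standard \<nu> v" and k: "k \<in> {1..?m}" for v k
  proof -
    note t = standard_tab[OF v]
    let ?x = "pos \<nu> v k"
    have x: "?x \<in> nodes \<nu>" "v ?x = k" using pos_in[OF t k] tab_pos[OF t k] by simp_all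
    have "{l \<in> {1..?m}. fst (pos \<nu> v l) = fst ?x \<and> l \<le> k} = (\<lambda>c. v (fst ?x, c)) ` {1..snd ?x}"
    proof (rule set_eqI)
      fix l
      show "l \<in> {l \<in> {1..?m}. fst (pos \<nu> v l) = fst ?x \<and> l \<le> k} \<longleftrightarrow> l \<in> (\<lambda>c. v (fst ?x, c)) ` {1..snd ?x}"
      proof
        assume l: "l \<in> {l \<in> {1..?m}. fst (pos \<nu> v l) = fst ?x \<and> l \<le> k}"
        then have lm: "l \<in> {1..?m}" by blast
        let ?y = "pos \<nu> v l"
        have y: "?y \<in> nodes \<nu>" "v ?y = l" using pos_in[OF t lm] tab_pos[OF t lm] by simp_all
        have "snd ?y \<le> snd ?x"
        proof (rule ccontr)
          assume "\<not> snd ?y \<le> snd ?x"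
          moreover from this have "?x \<noteq> ?y" by auto
          ultimately have "v ?x < v ?y" using standard_less[OF \<nu> v x(1) y(1)] l by simp
          then show False using x y l by simp
        qed
        moreover have "1 \<le> snd ?y" using y(1) by (auto simp: nodes_def)
        moreover have "l = v (fst ?x, snd ?y)" using l y(2) by (metis (mono_tags, lifting) mem_Collect_eq prod.collapse)
        ultimately show "l \<in> (\<lambda>c. v (fst ?x, c)) ` {1..snd ?x}" by (intro image_eqI[where x = "snd ?y"]) auto
      next
        assume "l \<in> (\<lambda>c. v (fst ?x, c)) ` {1..snd ?x}"
        then obtain c where c: "l = v (fst ?x, c)" "c \<in> {1..snd ?x}" by (rule imageE)
        have n: "(fst ?x, c) \<in> nodes \<nu>"
          using nodes_down[OF \<nu>, of "fst ?x" "snd ?x" "fst ?x" c] x(1) c(2) by (auto simp: nodes_def)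
        have "v (fst ?x, c) \<le> v (fst ?x, snd ?x)"
          using standard_le[OF \<nu> v, of "fst ?x" "snd ?x" "fst ?x" c] x(1) c(2) n by (auto simp: nodes_iff)
        then have "l \<le> k" using c(1) x(2) by simp
        moreover have "fst (pos \<nu> v l) = fst ?x" using pos_tab[OF t n] c(1) by simp
        moreover have "l \<in> {1..?m}" using tab_range[OF t n] c(1) by simp
        ultimately show "l \<in> {l \<in> {1..?m}. fst (pos \<nu> v l) = fst ?x \<and> l \<le> k}" by simp
      qed
    qed
    moreover have "inj_on (\<lambda>c. v (fst ?x, c)) {1..snd ?x}"
    proof (rule inj_onI)
      fix c c' assume c: "c \<in> {1..snd ?x}" "c' \<in> {1..snd ?x}" "v (fst ?x, c) = v (fst ?x, c')"
      have "(fst ?x, c) \<in> nodes \<nu>" "(fst ?x, c') \<in> nodes \<nu>"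
        using nodes_down[OF \<nu>, of "fst ?x" "snd ?x" "fst ?x"] x(1) c by (auto simp: nodes_def)
      then have "(fst ?x, c) = (fst ?x, c')" using tab_inj[OF t] c(3) by blast
      then show "c = c'" by simp
    qed
    ultimately show ?thesis using card_image by (metis card_atLeastAtMost diff_Suc_1)
  qed
  fix k assume k: "k \<in> {1..?m}"
  have "{l \<in> {1..?m}. fst (pos \<nu> u l) = fst (pos \<nu> u k) \<and> l \<le> k} = {l \<in> {1..?m}. fst (pos \<nu> v l) = fst (pos \<nu> v k) \<and> l \<le> k}"
    using rows k by auto
  note e = this
  have "snd (pos \<nu> u k) = snd (pos \<nu> v k)"
    by (rule trans[OF cnt[OF u k] trans[OF arg_cong[OF e, of card] cnt[OF v k, symmetric]]])
  then show "pos \<nu> u k = pos \<nu> v k" using rows[OF k] by (simp add: prod_eq_iff)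
qed

section \<open>The functionals and their unitriangularity\<close>

definition phi :: "nat list \<Rightarrow> (nat \<times> nat \<Rightarrow> nat) \<Rightarrow> hk \<Rightarrow> K" where
  "phi \<nu> u h = cf (h * TT (ecol \<nu> u) * Ys (sum_list \<nu>) (bcol \<nu>)) (wcol \<nu>)"

lemma phi_add: "phi \<nu> u (a + b) = phi \<nu> u a + phi \<nu> u b"
  by (simp add: phi_def distrib_right)

lemma phi_smul: "phi \<nu> u (smul c a) = c * phi \<nu> u a"
  by (simp add: phi_def)

lemma phi_diff: "phi \<nu> u (a - b) = phi \<nu> u a - phi \<nu> u b"
  by (simp add: phi_def left_diff_distrib)

lemma phi_sum: "phi \<nu> u (sum f X) = (\<Sum>x\<in>X. phi \<nu> u (f x))"
  by (simp add: phi_def sum_distrib_right)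

lemma phi_NN:
  assumes \<nu>: "is_part \<nu>" and t: "tableau \<nu> u" and "b \<in> NN \<nu>" shows "phi \<nu> u b = 0"
  using assms(3)
proof (induction rule: NN_induct)
  case zero
  show ?case by (simp add: phi_def)
next
  case (gen c w w' \<rho>)
  note d = dominatingD[OF gen(1)]
  let ?m = "sum_list \<nu>"
  have mono: "mono_on {1..?m} (blk \<rho>)" using blk_mono[of \<rho>] d(2) by simp
  have z: "Xs ?m (blk \<rho>) * (TT w' * TT (ecol \<nu> u)) * Ys ?m (bcol \<nu>) = 0"
  proof (rule Xs_Hm_Ys_zero)
    show "Ys ?m (bcol \<nu>) * h * Xs ?m (blk \<rho>) = 0" if "h \<in> Hm ?m" for h
      by (rule Ys_Hm_Xs_zero[OF bcol_mono mono _ that]) (rule dominating_clash[OF \<nu> d])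
    show "TT w' * TT (ecol \<nu> u) \<in> Hm ?m" by (intro Hm_mult Hm_TT gen ecol_permutes t)
  qed
  have "TT w * Xp \<rho> * TT w' * TT (ecol \<nu> u) * Ys ?m (bcol \<nu>) = TT w * (Xs ?m (blk \<rho>) * (TT w' * TT (ecol \<nu> u)) * Ys ?m (bcol \<nu>))"
    using d(2) by (simp add: mult.assoc)
  then show ?case unfolding z by (simp add: phi_def)
qed (simp add: phi_add)

text \<open>The product is supported on permutations built from c, \<open>ecol\<close>, some x that
  is d(v) or shorter, and a row permutation. If one of them were \<open>wcol\<close>, then
  \<open>wcol_support\<close> would give x = d(v) with the rows of u, hence u = v; and then c is
  trivial, because row and column stabilizers meet trivially.\<close>

lemma wcol_coefficient:
  assumes \<nu>: "is_part \<nu>" and u: "standard \<nu> u" and v: "standard \<nu> v" and le: "plen (dperm \<nu> v) \<le> plen (dperm \<nu> u)"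
    and r: "r \<in> Yg (sum_list \<nu>) (blk \<nu>)" and c: "c \<in> Yg (sum_list \<nu>) (bcol \<nu>)" and ne: "u \<noteq> v \<or> c \<noteq> id"
  shows "cf (TT r * TT (dperm \<nu> v) * TT (ecol \<nu> u) * TT c) (wcol \<nu>) = 0"
proof -
  let ?m = "sum_list \<nu>" and ?e = "ecol \<nu> u"
  note tu = standard_tab[OF u] and tv = standard_tab[OF v]
  note eS = SN_I[OF ecol_permutes[OF tu]]
  have einc: "inv ?e k < inv ?e l" if kl: "k < l" "k \<in> {1..?m}" "l \<in> {1..?m}" "bcol \<nu> k = bcol \<nu> l" for k l
  proof -
    let ?x = "pos \<nu> (tcol \<nu>) k" and ?y = "pos \<nu> (tcol \<nu>) l"
    have n: "?x \<in> nodes \<nu>" "?y \<in> nodes \<nu>" using pos_in[OF tcol_tableau] kl by blast+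
    have "tcol \<nu> ?x < tcol \<nu> ?y" using tab_pos[OF tcol_tableau kl(2)] tab_pos[OF tcol_tableau kl(3)] kl(1) by simp
    then have "clt ?x ?y" using tcol_less_iff[OF n] by simp
    then have "fst ?x < fst ?y" "snd ?x = snd ?y" using kl(4) by (auto simp: clt_def bcol_def)
    moreover from this have "?x \<noteq> ?y" by auto
    ultimately have "u ?x < u ?y" using standard_less[OF \<nu> u n] by simp
    then show ?thesis using inv_ecol[OF tu] kl by simp
  qed
  have ec: "TT ?e * TT c = TT (c \<circ> ?e)" by (rule TT_mult_right_additive[OF bcol_mono c eS einc])
  have ceS: "c \<circ> ?e \<in> SN" using Yg_SN[OF c] eS SN_comp by blast
  define D where "D = {x. x permutes {1..?m} \<and> (x = dperm \<nu> v \<or> plen x < plen (dperm \<nu> v))}"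
  define G where "G = {TT (c \<circ> ?e \<circ> x \<circ> r') | x r'. x \<in> D \<and> r' \<in> Yg ?m (blk \<nu>)}"
  \<comment> \<open>With constant labels, \<open>TT_mult_support\<close> applies to d(v) as an
    element of the full symmetric group.\<close>
  have triv: "dperm \<nu> v \<in> Yg ?m (\<lambda>_. 0)" using dperm_permutes[OF tv] by (simp add: Yg_def)
  have "TT (dperm \<nu> v) * TT (c \<circ> ?e) \<in> hk.span {TT (c \<circ> ?e \<circ> x) | x. x \<in> Yg ?m (\<lambda>_. 0) \<and> (x = dperm \<nu> v \<or> plen x < plen (dperm \<nu> v))}"
    by (rule TT_mult_support[OF _ triv ceS]) (simp add: mono_on_def)
  then have 1: "TT (dperm \<nu> v) * TT (c \<circ> ?e) \<in> hk.span {TT (c \<circ> ?e \<circ> x) | x. x \<in> D}"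
    unfolding D_def Yg_def by simp
  have 2: "TT r * y \<in> hk.span G" if "y \<in> hk.span {TT (c \<circ> ?e \<circ> x) | x. x \<in> D}" for y
    using that
  proof (induction rule: hk.span_induct_alt)
    case base
    show ?case by (simp add: hk.span_zero)
  next
    case (step k y z)
    then obtain x where x: "y = TT (c \<circ> ?e \<circ> x)" "x \<in> D" by blast
    have xS: "c \<circ> ?e \<circ> x \<in> SN" using x(2) ceS SN_comp SN_I unfolding D_def by blast
    have "TT r * y \<in> hk.span {TT (c \<circ> ?e \<circ> x \<circ> r') | r'. r' \<in> Yg ?m (blk \<nu>) \<and> (r' = r \<or> plen r' < plen r)}"
      unfolding x(1) by (rule TT_mult_support[OF blk_mono r xS])
    moreover have "{TT (c \<circ> ?e \<circ> x \<circ> r') | r'. r' \<in> Yg ?m (blk \<nu>) \<and> (r' = r \<or> plen r' < plen r)} \<subseteq> G"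
      unfolding G_def using x(2) by blast
    ultimately have "TT r * y \<in> hk.span G" using hk.span_mono by blast
    then show ?case using step by (simp add: distrib_left hk.span_add hk.span_scale)
  qed
  have 3: "cf y (wcol \<nu>) = 0" if "y \<in> hk.span G" for y
    using that
  proof (induction rule: hk.span_induct_alt)
    case (step k y z)
    then obtain x r' where x: "y = TT (c \<circ> ?e \<circ> x \<circ> r')" "x \<in> D" "r' \<in> Yg ?m (blk \<nu>)" unfolding G_def by blast
    have xp: "x permutes {1..?m}" and xle: "plen x \<le> plen (dperm \<nu> v)" using x(2) unfolding D_def by auto
    have S: "c \<circ> ?e \<circ> x \<circ> r' \<in> SN" using ceS SN_I[OF xp] Yg_SN[OF x(3)] SN_comp by blast
    have "c \<circ> ?e \<circ> x \<circ> r' \<noteq> wcol \<nu>"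
    proof
      assume eq: "c \<circ> ?e \<circ> x \<circ> r' = wcol \<nu>"
      note ws = wcol_support[OF \<nu> u c x(3) xp order_trans[OF xle le] eq]
      have "\<not> plen x < plen (dperm \<nu> v)" using ws(1) le by linarith
      then have xv: "x = dperm \<nu> v" using x(2) unfolding D_def by blast
      have "u = v"
      proof (rule standard_rows_inject[OF \<nu> u v])
        fix k assume k: "k \<in> {1..?m}"
        show "fst (pos \<nu> u k) = fst (pos \<nu> v k)" using ws(2)[OF k] blk_inv_dperm[OF tv k] unfolding xv by simp
      qed
      then have "c \<circ> wcol \<nu> \<circ> r' = wcol \<nu>" using eq ecol_comp[OF tu] unfolding xv by (metis comp_assoc)
      then have cw: "c (wcol \<nu> (r' j)) = wcol \<nu> j" for j by (metis comp_apply)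
      have node: "bcol \<nu> (wcol \<nu> j) = snd (pos \<nu> (tnu \<nu>) j)" if j: "j \<in> {1..?m}" for j
        unfolding wcol_def dperm_eq[OF j] bcol_def pos_tab[OF tcol_tableau pos_in[OF tnu_tableau j]] ..
      \<comment> \<open>Here r' preserves rows and c preserves columns, so both coordinates of the
        node are unchanged.\<close>
      have r'id: "r' j = j" for j
      proof (cases "j \<in> {1..?m}")
        case True
        have rj: "r' j \<in> {1..?m}" using permutes_in_image[OF Yg_permutes[OF x(3)]] True by blast
        have wr: "wcol \<nu> (r' j) \<in> {1..?m}" using permutes_in_image[OF wcol_permutes] rj by blast
        have "snd (pos \<nu> (tnu \<nu>) (r' j)) = snd (pos \<nu> (tnu \<nu>) j)"
          using node[OF True] node[OF rj] cw[of j] Yg_label[OF c wr] by simp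
        moreover have "fst (pos \<nu> (tnu \<nu>) (r' j)) = fst (pos \<nu> (tnu \<nu>) j)"
          using fst_pos_tnu[OF True] fst_pos_tnu[OF rj] Yg_label[OF x(3) True] by simp
        ultimately have "pos \<nu> (tnu \<nu>) (r' j) = pos \<nu> (tnu \<nu>) j" by (simp add: prod_eq_iff)
        then show ?thesis using tab_pos[OF tnu_tableau True] tab_pos[OF tnu_tableau rj] by simp
      next
        case False
        then show ?thesis using Yg_permutes[OF x(3)] unfolding permutes_def by blast
      qed
      have "c k = k" for k
        using cw[of "inv (wcol \<nu>) k"] r'id inv_SN_apply(1)[OF SN_I[OF wcol_permutes]] by simp
      then have "c = id" by (simp add: fun_eq_iff)
      then show False using ne \<open>u = v\<close> by simp
    qed
    then have "cf y (wcol \<nu>) = 0" unfolding x(1) using cf_TT[OF S] by simp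
    then show ?case using step by simp
  qed simp
  have "TT r * TT (dperm \<nu> v) * TT ?e * TT c = TT r * (TT (dperm \<nu> v) * TT (c \<circ> ?e))"
    unfolding ec[symmetric] by (simp only: mult.assoc)
  then show ?thesis using 3[OF 2[OF 1]] by simp
qed

text \<open>After expanding both symmetrizers only u = v with trivial c can contribute. There T_r
  T_w, with w = \<open>wcol\<close>, is a single basis element because w increases along rows, and
  it is T_w only for trivial r.\<close>

lemma phi_Murphy:
  assumes \<nu>: "is_part \<nu>" and u: "standard \<nu> u" and v: "standard \<nu> v" and le: "plen (dperm \<nu> v) \<le> plen (dperm \<nu> u)"
  shows "phi \<nu> u (Xp \<nu> * TT (dperm \<nu> v)) = (if u = v then 1 else 0)"
proof -
  let ?m = "sum_list \<nu>"
  let ?F = "\<lambda>c r. (- inverse qq) ^ plen c * cf (TT r * TT (dperm \<nu> v) * TT (ecol \<nu> u) * TT c) (wcol \<nu>)"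
  have e: "phi \<nu> u (Xp \<nu> * TT (dperm \<nu> v)) = (\<Sum>c\<in>Yg ?m (bcol \<nu>). \<Sum>r\<in>Yg ?m (blk \<nu>). ?F c r)"
    unfolding phi_def Xs_def Ys_def by (simp add: sum_distrib_left sum_distrib_right)
  show ?thesis
  proof (cases "u = v")
    case False
    then have "?F c r = 0" if "c \<in> Yg ?m (bcol \<nu>)" "r \<in> Yg ?m (blk \<nu>)" for c r
      using wcol_coefficient[OF \<nu> u v le that(2,1)] by simp
    then show ?thesis unfolding e using False by simp
  next
    case True
    have z: "(\<Sum>r\<in>Yg ?m (blk \<nu>). ?F c r) = 0" if "c \<in> Yg ?m (bcol \<nu>) - {id}" for c
      using wcol_coefficient[OF \<nu> u v le, of _ c] that by (intro sum.neutral) simp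
    have winc: "wcol \<nu> k < wcol \<nu> l" if kl: "k < l" "k \<in> {1..?m}" "l \<in> {1..?m}" "blk \<nu> k = blk \<nu> l" for k l
    proof -
      let ?x = "pos \<nu> (tnu \<nu>) k" and ?y = "pos \<nu> (tnu \<nu>) l"
      have n: "?x \<in> nodes \<nu>" "?y \<in> nodes \<nu>" using pos_in[OF tnu_tableau] kl by blast+
      have "tnu \<nu> ?x < tnu \<nu> ?y" using tab_pos[OF tnu_tableau kl(2)] tab_pos[OF tnu_tableau kl(3)] kl(1) by simp
      then have "rlt ?x ?y" using tnu_less_iff[OF n] by simp
      then have "snd ?x < snd ?y" "fst ?x = fst ?y" using kl fst_pos_tnu by (auto simp: rlt_def)
      then have "tcol \<nu> ?x < tcol \<nu> ?y" using tcol_less_iff[OF n] by (simp add: clt_def)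
      then show ?thesis unfolding wcol_def dperm_eq[OF kl(2)] dperm_eq[OF kl(3)] .
    qed
    have "?F id r = (if r = id then 1 else 0)" if r: "r \<in> Yg ?m (blk \<nu>)" for r
    proof -
      note wS = SN_I[OF wcol_permutes[of \<nu>]]
      have "TT r * TT (dperm \<nu> v) * TT (ecol \<nu> u) * TT id = TT r * TT (wcol \<nu>)"
        using TT_wcol[OF \<nu> u] True by (simp add: mult.assoc)
      also have "\<dots> = TT (wcol \<nu> \<circ> r)" by (rule TT_mult_left_additive[OF blk_mono r wS winc])
      finally have f: "TT r * TT (dperm \<nu> v) * TT (ecol \<nu> u) * TT id = TT (wcol \<nu> \<circ> r)" .
      have "wcol \<nu> = wcol \<nu> \<circ> r \<longleftrightarrow> r = id"
      proof
        assume "wcol \<nu> = wcol \<nu> \<circ> r"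
        then have "r j = j" for j using inv_SN_apply(2)[OF wS] by (metis comp_apply)
        then show "r = id" by (simp add: fun_eq_iff)
      qed simp
      then show ?thesis unfolding f using cf_TT[OF SN_comp[OF wS Yg_SN[OF r]]] by simp
    qed
    then have "(\<Sum>r\<in>Yg ?m (blk \<nu>). ?F id r) = (\<Sum>r\<in>Yg ?m (blk \<nu>). if r = id then 1 else 0)" by (rule sum.cong[OF refl])
    also have "\<dots> = 1" by simp
    finally have one: "(\<Sum>r\<in>Yg ?m (blk \<nu>). ?F id r) = 1" .
    have "phi \<nu> u (Xp \<nu> * TT (dperm \<nu> v)) = (\<Sum>r\<in>Yg ?m (blk \<nu>). ?F id r) + (\<Sum>c\<in>Yg ?m (bcol \<nu>) - {id}. \<Sum>r\<in>Yg ?m (blk \<nu>). ?F c r)"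
      unfolding e by (rule sum.remove) simp_all
    also have "(\<Sum>c\<in>Yg ?m (bcol \<nu>) - {id}. \<Sum>r\<in>Yg ?m (blk \<nu>). ?F c r) = 0" by (rule sum.neutral) (use z in blast)
    finally have "phi \<nu> u (Xp \<nu> * TT (dperm \<nu> v)) = 1" unfolding one by simp
    then show ?thesis using True by simp
  qed
qed

section \<open>Seminormal decomposition of the Specht module\<close>

lemma Xp_notin_NN:
  assumes \<nu>: "is_part \<nu>" shows "Xp \<nu> \<notin> NN \<nu>"
proof
  assume "Xp \<nu> \<in> NN \<nu>"
  then have "phi \<nu> (tnu \<nu>) (Xp \<nu>) = 0" by (rule phi_NN[OF \<nu> tnu_tableau])
  then show False using phi_Murphy[OF \<nu> tnu_standard tnu_standard order.refl] by (simp add: dperm_tnu)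
qed

lemma zz_nonzero: "is_part \<nu> \<Longrightarrow> zz \<nu> \<noteq> 0"
  using Xp_notin_NN Xp_mult_NN_iff[OF Hm_1, of \<nu>] by auto

definition EV :: "nat list \<Rightarrow> (nat \<times> nat \<Rightarrow> nat) \<Rightarrow> hk set" where
  "EV \<nu> u = {y. (\<exists>h\<in>Hm (sum_list \<nu>). y = zz \<nu> * h) \<and> eigv (sum_list \<nu>) (cont \<nu> u) y}"

lemma EV_zz: "is_part \<nu> \<Longrightarrow> zz \<nu> \<in> EV \<nu> (tnu \<nu>)"
  unfolding EV_def using zz_eigv by (auto intro!: bexI[of _ 1])

lemma EV_far:
  assumes v: "standard \<nu> v" and f: "far \<nu> v i" and y: "y \<in> EV \<nu> v"
  shows "y * Ti i - smul (icoef (cont \<nu> v i) (cont \<nu> v (Suc i))) y \<in> EV \<nu> (sgen i \<circ> v)"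
proof -
  let ?x = "icoef (cont \<nu> v i) (cont \<nu> v (Suc i))"
  obtain h where h: "h \<in> Hm (sum_list \<nu>)" "y = zz \<nu> * h" and e: "eigv (sum_list \<nu>) (cont \<nu> v) y"
    using y unfolding EV_def by blast
  have i: "1 \<le> i" "i < sum_list \<nu>" using f by (auto simp: far_def)
  have "h * (Ti i - smul ?x 1) \<in> Hm (sum_list \<nu>)" using h i by (intro Hm_mult Hm_diff Hm_Ti Hm_smul Hm_1)
  moreover have "y * Ti i - smul ?x y = zz \<nu> * (h * (Ti i - smul ?x 1))"
    unfolding h(2) by (simp add: right_diff_distrib mult.assoc)
  ultimately show ?thesis unfolding EV_def using linked_far(1)[OF v f e] by blast
qed

lemma far_sgen: "tableau \<nu> v \<Longrightarrow> far \<nu> v i \<Longrightarrow> far \<nu> (sgen i \<circ> v) i"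
  unfolding far_def using pos_sgen[of \<nu> v i i] pos_sgen[of \<nu> v i "Suc i"] by auto

text \<open>A filtration of the copy of the Specht module by the length of d(u), with strict
  inequality: the error term in the expansion of a Murphy vector at v lies in the level of
  d(v).\<close>

definition LS :: "nat list \<Rightarrow> nat \<Rightarrow> hk set" where
  "LS \<nu> l = hk.span (\<Union>u\<in>{u. standard \<nu> u \<and> plen (dperm \<nu> u) < l}. EV \<nu> u)"

lemma LS_subspace: "hk.subspace (LS \<nu> l)"
  unfolding LS_def by (rule hk.subspace_span)

lemma LS_base: "standard \<nu> u \<Longrightarrow> plen (dperm \<nu> u) < l \<Longrightarrow> y \<in> EV \<nu> u \<Longrightarrow> y \<in> LS \<nu> l"
  unfolding LS_def by (rule hk.span_base) blast

text \<open>On an eigenvector T_i is a scalar, or an intertwiner plus a scalar; the intertwiner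
  changes d(u) by one simple reflection and so raises the level by at most one.\<close>

lemma LS_mult_Ti:
  assumes \<nu>: "is_part \<nu>" and i: "1 \<le> i" "i < sum_list \<nu>" and y: "y \<in> LS \<nu> l"
  shows "y * Ti i \<in> LS \<nu> (Suc l)"
  using y[unfolded LS_def]
proof (induction rule: hk.span_induct_alt)
  case base
  show ?case using hk.subspace_0[OF LS_subspace] by simp
next
  case (step c x y)
  obtain u where u: "standard \<nu> u" "plen (dperm \<nu> u) < l" "x \<in> EV \<nu> u" using step(1) by blast
  have e: "eigv (sum_list \<nu>) (cont \<nu> u) x" using u(3) by (simp add: EV_def)
  let ?x = "icoef (cont \<nu> u i) (cont \<nu> u (Suc i))"
  have xL: "smul ?x x \<in> LS \<nu> (Suc l)"
    by (rule hk.subspace_scale[OF LS_subspace LS_base[OF u(1) less_SucI[OF u(2)] u(3)]])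
  have "x * Ti i \<in> LS \<nu> (Suc l)"
  proof (cases "far \<nu> u i")
    case True
    have "plen (dperm \<nu> (sgen i \<circ> u)) \<le> Suc (plen (dperm \<nu> u))"
      unfolding dperm_sgen[OF standard_tab[OF u(1)] i]
      using plen_left_cases[OF dperm_SN[OF standard_tab[OF u(1)]] i(1)] by auto
    then have "x * Ti i - smul ?x x \<in> LS \<nu> (Suc l)"
      using u(2) by (intro LS_base[OF far_standard[OF \<nu> u(1) True] _ EV_far[OF u(1) True u(3)]]) simp
    from hk.subspace_add[OF LS_subspace this xL] show ?thesis by simp
  next
    case False
    then have "x * Ti i = smul ?x x" using near_or_far[OF \<nu> u(1) i] by (intro eigv_adjacent[OF e i]) blast
    then show ?thesis using xL by simp
  qed
  from hk.subspace_add[OF LS_subspace hk.subspace_scale[OF LS_subspace this] step.IH]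
  show ?case by (simp add: distrib_right)
qed

text \<open>Along an ascent from u to v, the leading eigenvector g is carried by the intertwiner to
  a nonzero eigenvector for v. The scalar part of T_i leaves a multiple of g, which belongs to the
  shorter tableau u.\<close>

lemma zz_triangular:
  assumes \<nu>: "is_part \<nu>" and v: "standard \<nu> v"
  shows "\<exists>g\<in>EV \<nu> v. g \<noteq> 0 \<and> zz \<nu> * TT (dperm \<nu> v) - g \<in> LS \<nu> (plen (dperm \<nu> v))"
  using v
proof (induction "plen (dperm \<nu> v)" arbitrary: v rule: less_induct)
  case less
  note t = standard_tab[OF less.prems]
  show ?case
  proof (cases "v = tnu \<nu>")
    case True
    show ?thesis unfolding True dperm_tnu
      by (rule bexI[OF _ EV_zz[OF \<nu>]]) (simp add: zz_nonzero[OF \<nu>] hk.subspace_0[OF LS_subspace])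
  next
    case False
    obtain i where i: "1 \<le> i" "i < sum_list \<nu>" "standard \<nu> (sgen i \<circ> v)" "inv (dperm \<nu> v) (Suc i) < inv (dperm \<nu> v) i"
      "fst (pos \<nu> v (Suc i)) < fst (pos \<nu> v i)" "snd (pos \<nu> v i) < snd (pos \<nu> v (Suc i))"
      by (rule standard_down_step[OF \<nu> less.prems False])
    define u where "u = sgen i \<circ> v"
    have v: "v = sgen i \<circ> u" by (simp add: u_def)
    have u: "standard \<nu> u" using i(3) by (simp add: u_def)
    have "far \<nu> v i" unfolding far_def using i by blast
    then have f: "far \<nu> u i" unfolding u_def by (rule far_sgen[OF t])
    have dv: "dperm \<nu> v = sgen i \<circ> dperm \<nu> u" unfolding v by (rule dperm_sgen[OF standard_tab[OF u] i(1,2)])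
    have du: "dperm \<nu> u = sgen i \<circ> dperm \<nu> v" unfolding u_def by (rule dperm_sgen[OF t i(1,2)])
    have len: "plen (dperm \<nu> v) = Suc (plen (dperm \<nu> u))"
      unfolding du by (rule plen_sgen_left_desc[OF dperm_SN[OF t] i(1,4)])
    obtain g where g: "g \<in> EV \<nu> u" "g \<noteq> 0" "zz \<nu> * TT (dperm \<nu> u) - g \<in> LS \<nu> (plen (dperm \<nu> u))"
      using less.hyps[OF _ u] len by auto
    let ?x = "icoef (cont \<nu> u i) (cont \<nu> u (Suc i))"
    define g' where "g' = g * Ti i - smul ?x g"
    have "eigv (sum_list \<nu>) (cont \<nu> u) g" using g(1) by (simp add: EV_def)
    then have "g' \<noteq> 0" unfolding g'_def by (rule linked_far(3)[OF u f _ g(2)])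
    moreover have "g' \<in> EV \<nu> v" unfolding g'_def v by (rule EV_far[OF u f g(1)])
    moreover have "zz \<nu> * TT (dperm \<nu> v) - g' \<in> LS \<nu> (plen (dperm \<nu> v))"
    proof -
      have "TT (dperm \<nu> v) = TT (dperm \<nu> u) * Ti i"
        unfolding dv by (rule TT_comp_sgen[OF dperm_permutes[OF standard_tab[OF u]] i(1)]) (use len dv in simp)
      then have "zz \<nu> * TT (dperm \<nu> v) - g' = (zz \<nu> * TT (dperm \<nu> u) - g) * Ti i + smul ?x g"
        by (simp add: g'_def left_diff_distrib mult.assoc)
      moreover have "(zz \<nu> * TT (dperm \<nu> u) - g) * Ti i \<in> LS \<nu> (plen (dperm \<nu> v))"
        unfolding len by (rule LS_mult_Ti[OF \<nu> i(1,2) g(3)])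
      moreover have "smul ?x g \<in> LS \<nu> (plen (dperm \<nu> v))"
        by (rule hk.subspace_scale[OF LS_subspace LS_base[OF u _ g(1)]]) (simp add: len)
      ultimately show ?thesis using hk.subspace_add[OF LS_subspace] by simp
    qed
    ultimately show ?thesis by blast
  qed
qed

text \<open>Transported to the row filling, an eigenvector in z H absorbs x_\<nu> and is a multiple
  of z by \<open>eigv_tnu_scalar\<close>. Returning by the common h' gives a line that does not
  depend on the vector.\<close>

lemma EV_line:
  assumes \<nu>: "is_part \<nu>" and u: "standard \<nu> u" and y: "y \<in> EV \<nu> u" and g: "g \<in> EV \<nu> u" "g \<noteq> 0"
  shows "\<exists>c. y = smul c g"
proof -
  obtain h h' where h: "h \<in> Hm (sum_list \<nu>)"
    "\<And>g. eigv (sum_list \<nu>) (cont \<nu> u) g \<Longrightarrow> eigv (sum_list \<nu>) (cont \<nu> (tnu \<nu>)) (g * h) \<and> g * h * h' = g"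
    using linked_tnu[OF \<nu> u] unfolding linked_def by blast
  have *: "\<exists>c. y = smul c (zz \<nu> * h')" if y: "y \<in> EV \<nu> u" for y
  proof -
    obtain k where k: "k \<in> Hm (sum_list \<nu>)" "y = zz \<nu> * k" and e: "eigv (sum_list \<nu>) (cont \<nu> u) y"
      using y unfolding EV_def by blast
    let ?p = "px (sum_list \<nu>) (blk \<nu>)"
    obtain c where c: "zz \<nu> * (k * h) * Xp \<nu> = smul c (zz \<nu>)"
      using eigv_tnu_scalar[OF \<nu> zz_eigv[OF \<nu>] Hm_mult[OF k(1) h(1)]] by blast
    have "y * h * Xp \<nu> = smul ?p (y * h)" using tnu_absorb[OF \<nu>] h(2)[OF e] by blast
    then have "smul ?p (y * h) = smul c (zz \<nu>)" using c unfolding k(2) by (simp add: mult.assoc)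
    then have "smul (inverse ?p) (smul ?p (y * h)) = smul (inverse ?p * c) (zz \<nu>)" by simp
    then have "y * h = smul (inverse ?p * c) (zz \<nu>)" by simp
    then have "y * h * h' = smul (inverse ?p * c) (zz \<nu> * h')" by simp
    then show ?thesis using h(2)[OF e] by auto
  qed
  obtain a where a: "y = smul a (zz \<nu> * h')" using *[OF y] ..
  obtain b where b: "g = smul b (zz \<nu> * h')" using *[OF g(1)] ..
  have "b \<noteq> 0" using b g(2) by auto
  then have "y = smul (a * inverse b) g" unfolding a b by simp
  then show ?thesis ..
qed

text \<open>Triangularity is inverted by induction on the length of d(u); that each eigenspace is a
  line extends the result from the leading vector to the whole eigenspace.\<close>

lemma EV_in_Murphy_span:
  assumes \<nu>: "is_part \<nu>" and u: "standard \<nu> u" and y: "y \<in> EV \<nu> u"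
  shows "y \<in> hk.span ((\<lambda>v. zz \<nu> * TT (dperm \<nu> v)) ` {v. standard \<nu> v})" (is "_ \<in> hk.span ?M")
  using u y
proof (induction "plen (dperm \<nu> u)" arbitrary: u y rule: less_induct)
  case less
  obtain g where g: "g \<in> EV \<nu> u" "g \<noteq> 0" "zz \<nu> * TT (dperm \<nu> u) - g \<in> LS \<nu> (plen (dperm \<nu> u))"
    using zz_triangular[OF \<nu> less.prems(1)] by blast
  have "LS \<nu> (plen (dperm \<nu> u)) \<subseteq> hk.span ?M"
    unfolding LS_def by (rule hk.span_minimal[OF _ hk.subspace_span]) (use less.hyps in blast)
  then have d: "zz \<nu> * TT (dperm \<nu> u) - g \<in> hk.span ?M" using g(3) by blast
  have "zz \<nu> * TT (dperm \<nu> u) \<in> hk.span ?M" using less.prems(1) by (intro hk.span_base imageI) simp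
  from hk.span_diff[OF this d]
  have "g \<in> hk.span ?M" by simp
  then show ?case using EV_line[OF \<nu> less.prems g(1,2)] hk.span_scale by auto
qed

lemma zz_mult_in_Murphy_span:
  assumes \<nu>: "is_part \<nu>" and h: "h \<in> Hm (sum_list \<nu>)"
  shows "zz \<nu> * h \<in> hk.span ((\<lambda>v. zz \<nu> * TT (dperm \<nu> v)) ` {v. standard \<nu> v})" (is "_ \<in> hk.span ?M")
proof -
  have LS: "LS \<nu> l \<subseteq> hk.span ?M" for l
    unfolding LS_def by (rule hk.span_minimal[OF _ hk.subspace_span]) (use EV_in_Murphy_span[OF \<nu>] in blast)
  \<comment> \<open>Starting from z, which is itself an eigenvector, each further letter of w raises
    the level by one. So all of z H lies in spans of eigenspaces.\<close>
  have zT: "zz \<nu> * TT w \<in> LS \<nu> (Suc (plen w))" if "w permutes {1..sum_list \<nu>}" for w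
    using that
  proof (induction rule: permutes_length_induct)
    case id
    show ?case unfolding TT_id mult_1_right
      by (rule LS_base[OF tnu_standard _ EV_zz[OF \<nu>]]) (simp add: dperm_tnu)
  next
    case (step w i)
    have "zz \<nu> * TT (sgen i \<circ> w) = zz \<nu> * TT w * Ti i"
      unfolding TT_comp_sgen[OF step(1,2,4)] by (simp add: mult.assoc)
    then show ?case using LS_mult_Ti[OF \<nu> step(2,3) step(5)] step(4) by (simp add: comp_def)
  qed
  show ?thesis using h
  proof (induction rule: Hm_induct)
    case zero
    show ?case by (simp add: hk.span_zero)
  next
    case (add a b)
    then show ?case by (simp add: distrib_left hk.span_add)
  next
    case (TT c w)
    then show ?case using hk.span_scale[OF subsetD[OF LS zT[OF TT]], of c] by simp
  qed
qed

section \<open>The seminormal idempotents\<close>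

lemma Lk_Hm: "p \<le> m \<Longrightarrow> Lk p \<in> Hm m"
proof -
  assume p: "p \<le> m"
  have "transpose (p - i) p permutes {1..m}" if "i \<in> {1..<p}" for i
    using that p by (intro permutes_swap_id) auto
  then show ?thesis unfolding Lk_def by (intro Hm_sum Hm_smul Hm_TT)
qed

lemma eigv_Lk:
  assumes e: "eigv m c y" and p: "1 \<le> p" "p \<le> m" shows "y * Lk p = smul (qint (c p)) y"
proof -
  have "y + smul (qq - 1) (y * Lk p) = smul (qq powi c p) y"
    using eigvD[OF e p] by (simp add: JM_Lk distrib_left)
  then have "smul (qq - 1) (y * Lk p) = smul (qq powi c p - 1) y" by (simp add: hk.scale_left_diff_distrib eq_diff_eq add.commute)
  then have "smul (inverse (qq - 1)) (smul (qq - 1) (y * Lk p)) = smul (inverse (qq - 1)) (smul (qq powi c p - 1) y)" by (rule arg_cong)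
  then show ?thesis by (simp add: qint_def divide_inverse mult.commute)
qed

definition efac :: "int \<Rightarrow> nat \<Rightarrow> int \<Rightarrow> hk" where
  "efac c p k = smul (inverse (qint c - qint k)) (Lk p + smul (- qint k) 1)"

definition evals :: "nat list \<Rightarrow> int \<Rightarrow> int list" where
  "evals \<nu> c = [k \<leftarrow> sorted_list_of_set (contents (sum_list \<nu>)). k \<noteq> c]"

definition EE :: "nat list \<Rightarrow> (nat \<times> nat \<Rightarrow> nat) \<Rightarrow> hk" where
  "EE \<nu> v = foldl (\<lambda>a p. foldl (\<lambda>a k. a * efac (cont \<nu> v p) p k) a (evals \<nu> (cont \<nu> v p))) 1 [1..<Suc (sum_list \<nu>)]"

lemma cf_foldl:
  assumes "\<And>a x. cf (G a x) = G' (cf a) x" shows "cf (foldl G a xs) = foldl G' (cf a) xs"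
  by (induction xs arbitrary: a) (simp_all add: assms)

lemma cf_hscale: "cf (smul c a) = hscale c (cf a)"
  by (rule ext) (simp add: hscale_def)

lemma cf_1: "cf 1 = Tb id"
  using cf_Tb[OF SN_id] by simp

lemma cf_efac: "cf (efac c p k) = hscale (inverse (qint c - qint k)) (hadd (Lp p) (hscale (- qint k) (Tb id)))"
  unfolding efac_def cf_hscale cf_hadd cf_Lk cf_1 ..

lemma cf_EE:
  assumes "tableau \<nu> v" shows "cf (EE \<nu> v) = E_t \<nu> v"
  unfolding EE_def E_t_def evals_def content_of_eq[OF assms] cf_1[symmetric]
  by (intro cf_foldl) (simp only: cf_mult cf_efac cf_1)

lemma foldl_Hm:
  assumes "\<And>a x. a \<in> Hm m \<Longrightarrow> x \<in> set xs \<Longrightarrow> G a x \<in> Hm m" "a \<in> Hm m" shows "foldl G a xs \<in> Hm m"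
  using assms by (induction xs arbitrary: a) simp_all

lemma EE_Hm: "EE \<nu> v \<in> Hm (sum_list \<nu>)"
  unfolding EE_def efac_def by (intro foldl_Hm Hm_mult Hm_smul Hm_add Lk_Hm Hm_1) auto

lemma foldl_scalar:
  assumes "\<And>a s k. k \<in> set ks \<Longrightarrow> y * a = smul s y \<Longrightarrow> y * G a k = smul (s * \<sigma> k) (y::hk)" "y * a = smul s y"
  shows "y * foldl G a ks = smul (s * prod_list (map \<sigma> ks)) y"
  using assms
proof (induction ks arbitrary: a s)
  case (Cons k ks)
  have "y * foldl G (G a k) ks = smul (s * \<sigma> k * prod_list (map \<sigma> ks)) y"
    by (rule Cons.IH) (use Cons.prems in simp_all)
  then show ?case by (simp add: mult.assoc)
qed simp

lemma prod_list_one: "(\<And>x. x \<in> set xs \<Longrightarrow> x = 1) \<Longrightarrow> prod_list xs = (1::'a::monoid_mult)"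
  by (induction xs) simp_all

lemma finite_contents: "finite (contents m)"
proof (rule finite_subset)
  show "contents m \<subseteq> {- int m..int m}"
  proof
    fix x assume "x \<in> contents m"
    then obtain c r \<nu> where x: "x = int c - int r" "partition_of m \<nu>" "(r, c) \<in> nodes \<nu>"
      unfolding contents_def by blast
    have \<nu>: "is_part \<nu>" and m: "sum_list \<nu> = m" using x(2) by (auto simp: partition_of_def)
    have "(\<lambda>i. (i, c)) ` {1..r} \<subseteq> nodes \<nu>" "(\<lambda>j. (r, j)) ` {1..c} \<subseteq> nodes \<nu>"
      using nodes_down[OF \<nu> x(3)] x(3) by (auto simp: nodes_iff)
    from this[THEN card_mono[OF finite_nodes]] have "r \<le> m" "c \<le> m"
      unfolding card_nodes m by (simp_all add: card_image inj_on_def)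
    then show "x \<in> {- int m..int m}" unfolding x(1) by simp
  qed
qed simp

lemma cont_in_contents:
  assumes "is_part \<nu>" "tableau \<nu> v" "p \<in> {1..sum_list \<nu>}" shows "cont \<nu> v p \<in> contents (sum_list \<nu>)"
proof -
  have "(fst (pos \<nu> v p), snd (pos \<nu> v p)) \<in> nodes \<nu>" using pos_in[OF assms(2,3)] by simp
  moreover have "partition_of (sum_list \<nu>) \<nu>" using assms(1) by (simp add: partition_of_def)
  ultimately show ?thesis unfolding contents_def cont_def by blast
qed

lemma set_evals: "set (evals \<nu> c) = contents (sum_list \<nu>) - {c}"
  unfolding evals_def using finite_contents by auto

section \<open>The action of E_v on eigenvectors\<close>

lemma eigv_EE_scalar:
  assumes e: "eigv (sum_list \<nu>) c y"
  shows "y * EE \<nu> v = smul (prod_list (map (\<lambda>p. prod_list (map (\<lambda>k. (qint (c p) - qint k) / (qint (cont \<nu> v p) - qint k))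
     (evals \<nu> (cont \<nu> v p)))) [1..<Suc (sum_list \<nu>)])) y"
    (is "_ = smul (prod_list (map ?P _)) _")
proof -
  have "y * EE \<nu> v = smul (1 * prod_list (map ?P [1..<Suc (sum_list \<nu>)])) y"
    unfolding EE_def
  proof (rule foldl_scalar)
    fix a s p assume p: "p \<in> set [1..<Suc (sum_list \<nu>)]" and a: "y * a = smul s y"
    show "y * foldl (\<lambda>a k. a * efac (cont \<nu> v p) p k) a (evals \<nu> (cont \<nu> v p)) = smul (s * ?P p) y"
    proof (rule foldl_scalar[OF _ a])
      fix a s k assume a: "y * a = smul s y"
      have "y * Lk p = smul (qint (c p)) y" using p by (intro eigv_Lk[OF e]) auto
      then have "y * efac (cont \<nu> v p) p k = smul ((qint (c p) - qint k) / (qint (cont \<nu> v p) - qint k)) y"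
        by (simp add: efac_def right_diff_distrib divide_inverse hk.scale_left_diff_distrib hk.scale_right_diff_distrib algebra_simps)
      then show "y * (a * efac (cont \<nu> v p) p k) = smul (s * ((qint (c p) - qint k) / (qint (cont \<nu> v p) - qint k))) y"
        by (simp flip: mult.assoc add: a)
    qed
  qed simp
  then show ?thesis by simp
qed

lemma eigv_EE_same:
  assumes e: "eigv (sum_list \<nu>) (cont \<nu> v) y" shows "y * EE \<nu> v = y"
proof -
  let ?\<sigma> = "\<lambda>p k. (qint (cont \<nu> v p) - qint k) / (qint (cont \<nu> v p) - qint k)"
  have "?\<sigma> p k = 1" if "k \<in> set (evals \<nu> (cont \<nu> v p))" for k p
    using that unfolding set_evals by (auto simp: qint_eq_iff)
  then have "prod_list (map (?\<sigma> p) (evals \<nu> (cont \<nu> v p))) = 1" for p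
    by (intro prod_list_one) (metis (no_types, lifting) imageE set_map)
  then have "prod_list (map (\<lambda>p. prod_list (map (?\<sigma> p) (evals \<nu> (cont \<nu> v p)))) [1..<Suc (sum_list \<nu>)]) = 1"
    by (intro prod_list_one) (metis (no_types, lifting) imageE set_map)
  then show ?thesis unfolding eigv_EE_scalar[OF e] by simp
qed

text \<open>The content vectors of u and v differ at some p, and the content of p in u is among the
  values ranging over the factors of E_v at p; that factor vanishes on y.\<close>

lemma eigv_EE_other:
  assumes \<nu>: "is_part \<nu>" and u: "standard \<nu> u" and v: "standard \<nu> v" and ne: "u \<noteq> v"
    and e: "eigv (sum_list \<nu>) (cont \<nu> u) y" shows "y * EE \<nu> v = 0"
proof -
  obtain p where p: "p \<in> {1..sum_list \<nu>}" "cont \<nu> u p \<noteq> cont \<nu> v p" using cont_inject[OF \<nu> u v] ne by blast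
  let ?\<sigma> = "\<lambda>p k. (qint (cont \<nu> u p) - qint k) / (qint (cont \<nu> v p) - qint k)"
  have "cont \<nu> u p \<in> set (evals \<nu> (cont \<nu> v p))"
    unfolding set_evals using cont_in_contents[OF \<nu> standard_tab[OF u] p(1)] p(2) by blast
  then have "?\<sigma> p (cont \<nu> u p) \<in> set (map (?\<sigma> p) (evals \<nu> (cont \<nu> v p)))" unfolding set_map by (rule imageI)
  then have "prod_list (map (?\<sigma> p) (evals \<nu> (cont \<nu> v p))) = 0" unfolding prod_list_zero_iff by simp
  moreover have "p \<in> set [1..<Suc (sum_list \<nu>)]" using p(1) by auto
  ultimately have "0 \<in> set (map (\<lambda>p. prod_list (map (?\<sigma> p) (evals \<nu> (cont \<nu> v p)))) [1..<Suc (sum_list \<nu>)])"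
    unfolding set_map by (intro image_eqI[of _ _ p]) simp_all
  then have "prod_list (map (\<lambda>p. prod_list (map (?\<sigma> p) (evals \<nu> (cont \<nu> v p)))) [1..<Suc (sum_list \<nu>)]) = 0"
    unfolding prod_list_zero_iff .
  then show ?thesis unfolding eigv_EE_scalar[OF e] by simp
qed

definition fel :: "nat list \<Rightarrow> (nat \<times> nat \<Rightarrow> nat) \<Rightarrow> hk" where
  "fel \<nu> v = Xp \<nu> * TT (dperm \<nu> v) * EE \<nu> v"

lemma cf_Murphy: "tableau \<nu> v \<Longrightarrow> cf (Xp \<nu> * TT (dperm \<nu> v)) = x_uv \<nu> (tnu \<nu>) v"
  using x_uv_eq[OF tnu_tableau, of \<nu> v] by (simp add: dperm_tnu)

lemma cf_fel: "tableau \<nu> v \<Longrightarrow> cf (fel \<nu> v) = f_t \<nu> v"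
  unfolding fel_def f_t_def cf_mult[of "_ * _"] cf_EE cf_Murphy ..

text \<open>E_v removes the lower terms in the triangular expansion of z T_d(v) and fixes the
  leading eigenvector g. So f_v, modulo the ideal, corresponds to g.\<close>

lemma seminormal_vector:
  assumes \<nu>: "is_part \<nu>" and v: "standard \<nu> v"
  obtains g where "g \<noteq> 0" "eigv (sum_list \<nu>) (cont \<nu> v) g"
    "\<And>k. k \<in> Hm (sum_list \<nu>) \<Longrightarrow> fel \<nu> v * k \<in> NN \<nu> \<longleftrightarrow> g * k = 0"
proof -
  obtain g where g: "g \<in> EV \<nu> v" "g \<noteq> 0" "zz \<nu> * TT (dperm \<nu> v) - g \<in> LS \<nu> (plen (dperm \<nu> v))"
    using zz_triangular[OF \<nu> v] by blast
  have e: "eigv (sum_list \<nu>) (cont \<nu> v) g" using g(1) by (simp add: EV_def)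
  have "y * EE \<nu> v = 0" if "y \<in> LS \<nu> (plen (dperm \<nu> v))" for y
    using that[unfolded LS_def]
  proof (induction rule: hk.span_induct_alt)
    case (step c x y)
    obtain u where u: "standard \<nu> u" "plen (dperm \<nu> u) < plen (dperm \<nu> v)" "x \<in> EV \<nu> u" using step(1) by blast
    have "x * EE \<nu> v = 0" by (rule eigv_EE_other[OF \<nu> u(1) v]) (use u in \<open>auto simp: EV_def\<close>)
    then show ?case using step.IH by (simp add: distrib_right)
  qed simp
  from this[OF g(3)] have zg: "zz \<nu> * TT (dperm \<nu> v) * EE \<nu> v = g" using eigv_EE_same[OF e] by (simp add: left_diff_distrib)
  show thesis
  proof (rule that[OF g(2) e])
    fix k assume k: "k \<in> Hm (sum_list \<nu>)"
    then have "TT (dperm \<nu> v) * EE \<nu> v * k \<in> Hm (sum_list \<nu>)"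
      by (intro Hm_mult Hm_TT dperm_permutes[OF standard_tab[OF v]] EE_Hm)
    from Xp_mult_NN_iff[OF this] show "fel \<nu> v * k \<in> NN \<nu> \<longleftrightarrow> g * k = 0"
      unfolding zg[symmetric] fel_def by (simp only: mult.assoc)
  qed
qed

section \<open>Integrality\<close>

lemma kpoly_ring: "kpoly p + kpoly r = kpoly (p + r)" "kpoly p * kpoly r = kpoly (p * r)" "- kpoly p = kpoly (- p)"
  "kpoly 1 = 1" "kpoly 0 = 0" "kpoly [:0, 1:] = qq"
  by (simp_all add: kpoly_def qq_def One_fract_def Zero_fract_def)

lemma kpoly_eq_0: "kpoly p = 0 \<longleftrightarrow> p = 0"
  by (simp add: kpoly_def Zero_fract_def eq_fract)

lemma qq_power_kpoly: "qq ^ n = kpoly ([:0, 1:] ^ n)"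
  by (induction n) (simp_all only: power_0 power_Suc kpoly_ring flip: kpoly_ring(6))

text \<open>Powers of q can be cleared because q does not vanish at \<zeta>, so the ring is the
  localization of the polynomial ring at this point.\<close>

lemma A_zeta_iff:
  assumes z: "z \<noteq> 0" shows "x \<in> A_zeta z \<longleftrightarrow> (\<exists>p b. poly b z \<noteq> 0 \<and> x = kpoly p / kpoly b)"
proof
  assume "x \<in> A_zeta z"
  then obtain p k b l where x: "x = (kpoly p / qq ^ k) / (kpoly b / qq ^ l)" "poly b z / z ^ l \<noteq> 0"
    unfolding A_zeta_def Alaur_def by blast
  have "x = kpoly (p * [:0, 1:] ^ l) / kpoly (b * [:0, 1:] ^ k)"
    unfolding x(1) qq_power_kpoly by (simp add: mult.commute flip: kpoly_ring(2))
  moreover have "poly (b * [:0, 1:] ^ k) z \<noteq> 0" using x(2) z by (simp add: poly_power)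
  ultimately show "\<exists>p b. poly b z \<noteq> 0 \<and> x = kpoly p / kpoly b" by blast
next
  assume "\<exists>p b. poly b z \<noteq> 0 \<and> x = kpoly p / kpoly b"
  then obtain p b where x: "poly b z \<noteq> 0" "x = kpoly p / kpoly b" by blast
  have "kpoly p \<in> Alaur" unfolding Alaur_def by (rule CollectI, rule exI[of _ p], rule exI[of _ 0]) simp
  moreover have "\<exists>p k. kpoly b = kpoly p / qq ^ k \<and> poly p z / z ^ k \<noteq> 0"
    by (rule exI[of _ b], rule exI[of _ 0]) (simp add: x)
  ultimately show "x \<in> A_zeta z" unfolding A_zeta_def x(2) by blast
qed

definition integral :: "complex \<Rightarrow> hk \<Rightarrow> bool" where
  "integral z a \<longleftrightarrow> (\<forall>w. cf a w \<in> A_zeta z)"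

context
  fixes z :: complex
  assumes z: "z \<noteq> 0"
begin

lemma Az_kpoly: "kpoly p \<in> A_zeta z"
  unfolding A_zeta_iff[OF z] by (rule exI[of _ p], rule exI[of _ 1]) (simp add: kpoly_ring)

lemma Az_0: "0 \<in> A_zeta z" and Az_1: "1 \<in> A_zeta z" and Az_qq: "qq \<in> A_zeta z"
  using Az_kpoly[of 0] Az_kpoly[of 1] Az_kpoly[of "[:0, 1:]"] by (simp_all add: kpoly_ring)

lemma Az_inverse_qq: "inverse qq \<in> A_zeta z"
  unfolding A_zeta_iff[OF z] by (rule exI[of _ 1], rule exI[of _ "[:0, 1:]"]) (simp add: kpoly_ring z divide_inverse)

lemma Az_mult: assumes "x \<in> A_zeta z" "y \<in> A_zeta z" shows "x * y \<in> A_zeta z"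
proof -
  obtain p b p' b' where "poly b z \<noteq> 0" "x = kpoly p / kpoly b" "poly b' z \<noteq> 0" "y = kpoly p' / kpoly b'"
    using assms unfolding A_zeta_iff[OF z] by blast
  then have "poly (b * b') z \<noteq> 0" "x * y = kpoly (p * p') / kpoly (b * b')" by (simp_all flip: kpoly_ring)
  then show ?thesis unfolding A_zeta_iff[OF z] by blast
qed

lemma Az_add: assumes "x \<in> A_zeta z" "y \<in> A_zeta z" shows "x + y \<in> A_zeta z"
proof -
  obtain p b p' b' where *: "poly b z \<noteq> 0" "x = kpoly p / kpoly b" "poly b' z \<noteq> 0" "y = kpoly p' / kpoly b'"
    using assms unfolding A_zeta_iff[OF z] by blast
  then have "kpoly b \<noteq> 0" "kpoly b' \<noteq> 0" unfolding kpoly_eq_0 by auto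
  then have "poly (b * b') z \<noteq> 0" "x + y = kpoly (p * b' + p' * b) / kpoly (b * b')"
    using * by (simp_all add: add_frac_eq flip: kpoly_ring(1,2))
  then show ?thesis unfolding A_zeta_iff[OF z] by blast
qed

lemma Az_uminus: "x \<in> A_zeta z \<Longrightarrow> - x \<in> A_zeta z"
  using Az_mult[OF Az_kpoly[of "- 1"], of x] by (simp flip: kpoly_ring(3) add: kpoly_ring(4))

lemma Az_diff: "x \<in> A_zeta z \<Longrightarrow> y \<in> A_zeta z \<Longrightarrow> x - y \<in> A_zeta z"
  using Az_add[OF _ Az_uminus] by simp

lemma Az_sum: "(\<And>i. i \<in> I \<Longrightarrow> f i \<in> A_zeta z) \<Longrightarrow> sum f I \<in> A_zeta z"
  by (induction I rule: infinite_finite_induct) (auto simp: Az_0 Az_add)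

lemma Az_power: "x \<in> A_zeta z \<Longrightarrow> x ^ n \<in> A_zeta z"
  by (induction n) (auto simp: Az_1 Az_mult)

lemma integral_sum: "(\<And>i. i \<in> I \<Longrightarrow> integral z (f i)) \<Longrightarrow> integral z (sum f I)"
  unfolding integral_def cf_sum by (auto intro: Az_sum)

lemma integral_smul: "c \<in> A_zeta z \<Longrightarrow> integral z a \<Longrightarrow> integral z (smul c a)"
  unfolding integral_def by (simp add: Az_mult)

lemma integral_TT: "w \<in> SN \<Longrightarrow> integral z (TT w)"
  unfolding integral_def by (simp add: cf_TT Az_0 Az_1)

lemma integral_mult_Ti: "1 \<le> i \<Longrightarrow> integral z a \<Longrightarrow> integral z (a * Ti i)"
  unfolding integral_def cf_mult_Ti mulTs_def Let_def by (auto intro!: Az_add Az_mult Az_diff Az_qq Az_1)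

lemma integral_mult_TT:
  assumes "w permutes {1..m}" "integral z a" shows "integral z (a * TT w)"
  using assms(1)
proof (induction rule: permutes_length_induct)
  case id
  show ?case using assms(2) by (simp add: TT_id[unfolded id_def])
next
  case (step w i)
  have "a * TT (sgen i \<circ> w) = a * TT w * Ti i" unfolding TT_comp_sgen[OF step(1,2,4)] by (simp add: mult.assoc)
  then show ?case using integral_mult_Ti[OF step(2,5)] by (simp add: comp_def)
qed

lemma integral_mult:
  assumes "integral z a" "integral z b" "b \<in> Hm m" shows "integral z (a * b)"
proof -
  have "integral z (\<Sum>w | w permutes {1..m}. smul (cf b w) (a * TT w))"
    using assms(2) by (intro integral_sum integral_smul integral_mult_TT[OF _ assms(1)]) (auto simp: integral_def)
  then show ?thesis by (subst Hm_expand[OF assms(3)]) (simp add: sum_distrib_left)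
qed

lemma integral_Xs: "integral z (Xs m b)"
  unfolding Xs_def by (intro integral_sum integral_TT Yg_SN)

lemma integral_Ys: "integral z (Ys m b)"
  unfolding Ys_def by (intro integral_sum integral_smul integral_TT Yg_SN Az_power Az_uminus Az_inverse_qq)

lemma integral_phi:
  assumes "standard \<nu> u" "integral z a" shows "phi \<nu> u a \<in> A_zeta z"
proof -
  have "integral z (a * TT (ecol \<nu> u) * Ys (sum_list \<nu>) (bcol \<nu>))"
    by (rule integral_mult[OF integral_mult_TT[OF ecol_permutes[OF standard_tab[OF assms(1)]] assms(2)] integral_Ys Ys_Hm])
  then show ?thesis unfolding phi_def integral_def by blast
qed

end

lemma span_image_sum:
  assumes "finite S" "x \<in> hk.span (f ` S)" shows "\<exists>c. x = (\<Sum>v\<in>S. smul (c v) (f v))"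
proof -
  have "hk.subspace {x. \<exists>c. x = (\<Sum>v\<in>S. smul (c v) (f v))}"
  proof (rule hk.subspaceI)
    show "0 \<in> {x. \<exists>c. x = (\<Sum>v\<in>S. smul (c v) (f v))}" by (auto intro!: exI[of _ "\<lambda>_. 0"])
    fix x y k assume "x \<in> {x. \<exists>c. x = (\<Sum>v\<in>S. smul (c v) (f v))}"
    then obtain c where c: "x = (\<Sum>v\<in>S. smul (c v) (f v))" by blast
    show "smul k x \<in> {x. \<exists>c. x = (\<Sum>v\<in>S. smul (c v) (f v))}"
      unfolding c by (auto simp: hk.scale_sum_right intro!: exI[of _ "\<lambda>v. k * c v"])
    assume "y \<in> {x. \<exists>c. x = (\<Sum>v\<in>S. smul (c v) (f v))}"
    then obtain d where d: "y = (\<Sum>v\<in>S. smul (d v) (f v))" by blast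
    show "x + y \<in> {x. \<exists>c. x = (\<Sum>v\<in>S. smul (c v) (f v))}"
      unfolding c d by (auto simp: hk.scale_left_distrib sum.distrib intro!: exI[of _ "\<lambda>v. c v + d v"])
  qed
  moreover have "f ` S \<subseteq> {x. \<exists>c. x = (\<Sum>v\<in>S. smul (c v) (f v))}"
  proof (rule image_subsetI)
    fix u assume u: "u \<in> S"
    have "f u = (\<Sum>v\<in>S. if v = u then f v else 0)" using u assms(1) by simp
    also have "\<dots> = (\<Sum>v\<in>S. smul (if v = u then 1 else 0) (f v))" by (rule sum.cong) auto
    finally have "f u = (\<Sum>v\<in>S. smul (if v = u then 1 else 0) (f v))" .
    then show "f u \<in> {x. \<exists>c. x = (\<Sum>v\<in>S. smul (c v) (f v))}" by (intro CollectI exI)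
  qed
  ultimately show ?thesis using hk.span_minimal assms(2) by blast
qed

text \<open>Coefficients in K exist because the Murphy vectors span z H. Their integrality follows
  by descending through the lengths of d(v) with the unitriangular functionals.\<close>

lemma Murphy_expansion:
  assumes z: "z \<noteq> 0" and \<nu>: "is_part \<nu>" and k: "k \<in> Hm (sum_list \<nu>)" "integral z k"
  shows "\<exists>c. (\<forall>v. standard \<nu> v \<longrightarrow> c v \<in> A_zeta z) \<and>
    Xp \<nu> * k - (\<Sum>v | standard \<nu> v. smul (c v) (Xp \<nu> * TT (dperm \<nu> v))) \<in> NN \<nu>"
proof -
  let ?S = "{v. standard \<nu> v}" and ?l = "\<lambda>v. plen (dperm \<nu> v)"
  obtain c where c: "zz \<nu> * k = (\<Sum>v\<in>?S. smul (c v) (zz \<nu> * TT (dperm \<nu> v)))"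
    using span_image_sum[OF finite_standard zz_mult_in_Murphy_span[OF \<nu> k(1)]] by blast
  let ?k = "k - (\<Sum>v\<in>?S. smul (c v) (TT (dperm \<nu> v)))"
  have "?k \<in> Hm (sum_list \<nu>)" using k(1) dperm_permutes standard_tab by (intro Hm_diff Hm_sum Hm_smul Hm_TT) blast+
  moreover have "zz \<nu> * ?k = 0" using c by (simp add: right_diff_distrib sum_distrib_left)
  ultimately have "Xp \<nu> * ?k \<in> NN \<nu>" using Xp_mult_NN_iff by blast
  then have N: "Xp \<nu> * k - (\<Sum>v\<in>?S. smul (c v) (Xp \<nu> * TT (dperm \<nu> v))) \<in> NN \<nu>"
    by (simp add: right_diff_distrib sum_distrib_left)
  have ph: "phi \<nu> u (Xp \<nu> * k) = (\<Sum>v\<in>?S. c v * phi \<nu> u (Xp \<nu> * TT (dperm \<nu> v)))" if "standard \<nu> u" for u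
    using phi_NN[OF \<nu> standard_tab[OF that] N] by (simp add: phi_diff phi_sum phi_smul)
  have iX: "integral z (Xp \<nu> * k)" by (rule integral_mult[OF z integral_Xs[OF z] k(2,1)])
  have "c v \<in> A_zeta z" if "standard \<nu> v" for v
  proof (rule ccontr)
    assume nc: "c v \<notin> A_zeta z"
    \<comment> \<open>A bad coefficient with d(u) of maximal length leads to a contradiction:
      \<open>phi \<nu> u\<close> sees it with factor 1, kills all other tableaux of at most that
      length, and meets only integral coefficients for longer ones.\<close>
    define B where "B = {v. standard \<nu> v \<and> c v \<notin> A_zeta z}"
    have B: "finite B" "B \<noteq> {}" using finite_standard[of \<nu>] that nc by (auto simp: B_def)
    have "Max (?l ` B) \<in> ?l ` B" using B by (intro Max_in) auto
    then obtain u where u: "u \<in> B" "?l u = Max (?l ` B)" by (metis imageE)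
    have us: "standard \<nu> u" "c u \<notin> A_zeta z" using u(1) by (auto simp: B_def)
    have mx: "c v \<in> A_zeta z" if "standard \<nu> v" "?l u < ?l v" for v
      using that Max_ge[of "?l ` B" "?l v"] B u(2) by (auto simp: B_def)
    have "phi \<nu> u (Xp \<nu> * k) = c u * phi \<nu> u (Xp \<nu> * TT (dperm \<nu> u)) + (\<Sum>v\<in>?S - {u}. c v * phi \<nu> u (Xp \<nu> * TT (dperm \<nu> v)))"
      unfolding ph[OF us(1)] by (rule sum.remove[OF finite_standard]) (use us in simp)
    also have "phi \<nu> u (Xp \<nu> * TT (dperm \<nu> u)) = 1" using phi_Murphy[OF \<nu> us(1) us(1)] by simp
    finally have "c u = phi \<nu> u (Xp \<nu> * k) - (\<Sum>v\<in>?S - {u}. c v * phi \<nu> u (Xp \<nu> * TT (dperm \<nu> v)))" by simp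
    also have "\<dots> \<in> A_zeta z"
    proof (intro Az_diff[OF z] Az_sum[OF z])
      show "phi \<nu> u (Xp \<nu> * k) \<in> A_zeta z" by (rule integral_phi[OF z us(1) iX])
      fix v assume v: "v \<in> ?S - {u}"
      have vp: "dperm \<nu> v permutes {1..sum_list \<nu>}" using v by (intro dperm_permutes standard_tab) simp
      show "c v * phi \<nu> u (Xp \<nu> * TT (dperm \<nu> v)) \<in> A_zeta z"
      proof (cases "?l v \<le> ?l u")
        case True
        then show ?thesis using phi_Murphy[OF \<nu> us(1), of v] v Az_0[OF z] by auto
      next
        case False
        then show ?thesis using mx v integral_phi[OF z us(1) integral_mult_TT[OF z vp integral_Xs[OF z]]]
          by (intro Az_mult[OF z]) auto
      qed
    qed
    finally show False using us(2) by blast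
  qed
  then show ?thesis using N by blast
qed

section \<open>Cosets and the integral form\<close>

lemma Nbar_cf:
  assumes "n \<in> Nbar \<nu>" shows "\<exists>a\<in>NN \<nu>. cf a = n"
proof -
  obtain F c where F: "finite F" "F \<subseteq> {x_uv \<rho> u v | \<rho> u v. partition_of (sum_list \<nu>) \<rho> \<and>
      strictly_dominates \<rho> \<nu> \<and> tableau \<rho> u \<and> tableau \<rho> v}" "n = (\<lambda>w. \<Sum>b\<in>F. c b * b w)"
    using assms unfolding Nbar_def span_in_def by blast
  have "b \<in> FS" if "b \<in> F" for b
  proof -
    obtain \<rho> u v where "b = x_uv \<rho> u v" "tableau \<rho> u" "tableau \<rho> v" using F(2) \<open>b \<in> F\<close> by blast
    then show ?thesis using x_uv_eq by simp
  qed
  then have "n \<in> FS" unfolding F(3) using F(1) by (intro FS_sum)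
  then obtain a where "cf a = n" using cf_surj by blast
  then show ?thesis using assms unfolding NN_def by blast
qed

lemma cls_cf: "cls \<nu> (cf a) = cf ` (\<lambda>b. a + b) ` NN \<nu>"
proof -
  have "Nbar \<nu> = cf ` NN \<nu>" using Nbar_cf unfolding NN_def by blast
  then show ?thesis unfolding cls_def by (simp add: image_image cf_hadd)
qed

lemma cls_eq_iff: "cls \<nu> (cf a) = cls \<nu> (cf b) \<longleftrightarrow> a - b \<in> NN \<nu>"
proof -
  have "cls \<nu> (cf a) = cls \<nu> (cf b) \<longleftrightarrow> (\<lambda>x. a + x) ` NN \<nu> = (\<lambda>x. b + x) ` NN \<nu>"
    unfolding cls_cf by (rule inj_image_eq_iff[OF inj_cf])
  also have "\<dots> \<longleftrightarrow> a - b \<in> NN \<nu>"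
  proof
    assume e: "(\<lambda>x. a + x) ` NN \<nu> = (\<lambda>x. b + x) ` NN \<nu>"
    have "a + 0 \<in> (\<lambda>x. a + x) ` NN \<nu>" by (intro imageI NN_zero)
    then obtain x where "x \<in> NN \<nu>" "a + 0 = b + x" unfolding e by (rule imageE)
    then show "a - b \<in> NN \<nu>" by (simp add: algebra_simps)
  next
    assume d: "a - b \<in> NN \<nu>"
    have sub: "(\<lambda>x. a + x) ` NN \<nu> \<subseteq> (\<lambda>x. b + x) ` NN \<nu>" if "a - b \<in> NN \<nu>" for a b
    proof (rule image_subsetI)
      fix x assume "x \<in> NN \<nu>"
      then have "a - b + x \<in> NN \<nu>" by (rule NN_add[OF that])
      then show "a + x \<in> (\<lambda>x. b + x) ` NN \<nu>" by (rule rev_image_eqI) (simp add: algebra_simps)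
    qed
    have "b - a \<in> NN \<nu>" using NN_smul[OF d, of "- 1"] by simp
    then show "(\<lambda>x. a + x) ` NN \<nu> = (\<lambda>x. b + x) ` NN \<nu>" by (intro equalityI sub d)
  qed
  finally show ?thesis .
qed

lemma H_over_cf: "h \<in> H_over (A_zeta z) m \<longleftrightarrow> (\<exists>k\<in>Hm m. integral z k \<and> h = cf k)"
proof
  assume h: "h \<in> H_over (A_zeta z) m"
  then have "h \<in> FS" unfolding FS_def H_over_def by blast
  then obtain k where "cf k = h" using cf_surj by blast
  then show "\<exists>k\<in>Hm m. integral z k \<and> h = cf k" using h by (intro bexI[of _ k]) (auto simp: H_over_def Hm_def integral_def)
qed (auto simp: H_over_def Hm_def integral_def)

text \<open>\<open>span_in\<close> sums over a set of vectors, so an expansion indexed by tableaux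
  can be rewritten in that form only if different tableaux give different vectors.\<close>

lemma Murphy_inject:
  assumes \<nu>: "is_part \<nu>" shows "inj_on (\<lambda>v. Xp \<nu> * TT (dperm \<nu> v)) {v. standard \<nu> v}"
proof -
  have *: "u = v" if "standard \<nu> u" "standard \<nu> v" "plen (dperm \<nu> v) \<le> plen (dperm \<nu> u)"
    "Xp \<nu> * TT (dperm \<nu> u) = Xp \<nu> * TT (dperm \<nu> v)" for u v
    using phi_Murphy[OF \<nu> that(1,1) order.refl] phi_Murphy[OF \<nu> that(1,2,3)] that(4) by (auto split: if_splits)
  show ?thesis
  proof (rule inj_onI)
    fix u v assume "u \<in> {v. standard \<nu> v}" "v \<in> {v. standard \<nu> v}" and e: "Xp \<nu> * TT (dperm \<nu> u) = Xp \<nu> * TT (dperm \<nu> v)"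
    then have "standard \<nu> u" "standard \<nu> v" by simp_all
    then show "u = v" using *[of u v] *[of v u] e e[symmetric] linear[of "plen (dperm \<nu> u)" "plen (dperm \<nu> v)"] by blast
  qed
qed

text \<open>Identifies the span of the Murphy vectors with the cyclic module generated by e_\<nu>,
  which is the form in which the image of the map arises.\<close>

lemma Specht_over_eq:
  assumes z: "z \<noteq> 0" and \<nu>: "is_part \<nu>"
  shows "Specht_over (A_zeta z) \<nu> = (\<lambda>h. cls \<nu> (x_nu \<nu> \<star> h)) ` H_over (A_zeta z) (sum_list \<nu>)"
proof -
  let ?f = "\<lambda>v. Xp \<nu> * TT (dperm \<nu> v)" and ?S = "{v. standard \<nu> v}"
  have g: "{x_uv \<nu> (tnu \<nu>) v | v. standard \<nu> v} = cf ` ?f ` ?S"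
    using cf_Murphy[OF standard_tab] by (auto simp: image_image)
  have Xk: "x_nu \<nu> \<star> cf k = cf (Xp \<nu> * k)" for k by (simp add: cf_mult cf_Xp)
  show ?thesis
  proof (intro equalityI subsetI)
    fix C assume "C \<in> Specht_over (A_zeta z) \<nu>"
    then obtain b where b: "b \<in> span_in (A_zeta z) (cf ` ?f ` ?S)" "C = cls \<nu> b" unfolding Specht_over_def g by blast
    obtain F c where F: "F \<subseteq> cf ` ?f ` ?S" "finite F" "b = (\<lambda>w. \<Sum>b\<in>F. c b * b w)" using b(1) unfolding span_in_def by blast
    have "b \<in> FS" unfolding F(3) using F(1,2) by (intro FS_sum) auto
    then obtain a where a: "cf a = b" using cf_surj by blast
    obtain t c where t: "t \<subseteq> ?f ` ?S" "\<forall>y\<in>t. c y \<in> A_zeta z" "a = (\<Sum>y\<in>t. smul (c y) y)"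
      using b(1) unfolding a[symmetric] span_in_cf by blast
    define V where "V y = (SOME v. standard \<nu> v \<and> ?f v = y)" for y
    have V: "standard \<nu> (V y)" "?f (V y) = y" if "y \<in> t" for y
    proof -
      have "\<exists>v. standard \<nu> v \<and> ?f v = y" using t(1) that by blast
      from someI_ex[OF this] show "standard \<nu> (V y)" "?f (V y) = y" unfolding V_def by blast+
    qed
    define k where "k = (\<Sum>y\<in>t. smul (c y) (TT (dperm \<nu> (V y))))"
    have "k \<in> Hm (sum_list \<nu>)" unfolding k_def by (intro Hm_sum Hm_smul Hm_TT dperm_permutes standard_tab V(1))
    moreover have "integral z k" unfolding k_def
      using t(2) by (intro integral_sum[OF z] integral_smul[OF z] integral_TT[OF z] dperm_SN standard_tab V(1)) blast+
    moreover have "a = Xp \<nu> * k" unfolding k_def t(3) sum_distrib_left by (rule sum.cong) (simp_all add: V)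
    ultimately show "C \<in> (\<lambda>h. cls \<nu> (x_nu \<nu> \<star> h)) ` H_over (A_zeta z) (sum_list \<nu>)"
      unfolding b(2) a[symmetric] by (intro image_eqI[of _ _ "cf k"]) (auto simp: Xk H_over_cf)
  next
    fix C assume "C \<in> (\<lambda>h. cls \<nu> (x_nu \<nu> \<star> h)) ` H_over (A_zeta z) (sum_list \<nu>)"
    then obtain k where k: "k \<in> Hm (sum_list \<nu>)" "integral z k" "C = cls \<nu> (cf (Xp \<nu> * k))"
      unfolding image_iff by (metis H_over_cf Xk)
    obtain c where c: "\<forall>v. standard \<nu> v \<longrightarrow> c v \<in> A_zeta z" "Xp \<nu> * k - (\<Sum>v\<in>?S. smul (c v) (?f v)) \<in> NN \<nu>"
      using Murphy_expansion[OF z \<nu> k(1,2)] by blast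
    let ?a = "\<Sum>v\<in>?S. smul (c v) (?f v)"
    note inj = Murphy_inject[OF \<nu>]
    have "cf ?a \<in> span_in (A_zeta z) (cf ` ?f ` ?S)" unfolding span_in_cf
    proof (intro exI conjI)
      show "?a = (\<Sum>y\<in>?f ` ?S. smul (c (the_inv_into ?S ?f y)) y)"
        unfolding sum.reindex[OF inj] by (rule sum.cong) (simp_all add: the_inv_into_f_f[OF inj])
      show "\<forall>y\<in>?f ` ?S. c (the_inv_into ?S ?f y) \<in> A_zeta z"
        using c(1) the_inv_into_f_f[OF inj] by simp
    qed (use finite_standard in auto)
    moreover have "C = cls \<nu> (cf ?a)" unfolding k(3) cls_eq_iff by (rule c(2))
    ultimately show "C \<in> Specht_over (A_zeta z) \<nu>" unfolding Specht_over_def g by blast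
  qed
qed

section \<open>Shapes of truncated tableaux\<close>

lemma shape_le:
  assumes la: "is_part la" and t: "standard la t"
  shows "is_part (shape_le la t m)" "nodes (shape_le la t m) = {x \<in> nodes la. t x \<le> m}"
    and "m \<le> sum_list la \<Longrightarrow> sum_list (shape_le la t m) = m"
proof -
  let ?S = "{x \<in> nodes la. t x \<le> m}"
  have "\<exists>\<nu>. is_part \<nu> \<and> nodes \<nu> = ?S"
  proof (rule down_closed_diagram)
    fix r c r' c' assume x: "(r, c) \<in> ?S" and le: "1 \<le> r'" "r' \<le> r" "1 \<le> c'" "c' \<le> c"
    then have "(r', c') \<in> nodes la" "t (r', c') \<le> t (r, c)"
      using nodes_down[OF la, of r c r' c'] standard_le[OF la t, of r c r' c'] by simp_all
    then show "(r', c') \<in> ?S" using x by simp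
  qed (auto simp: nodes_iff)
  then obtain \<nu> where \<nu>: "is_part \<nu> \<and> nodes \<nu> = ?S" ..
  have s: "shape_le la t m = \<nu>" unfolding shape_le_def
    by (rule the_equality) (use \<nu> nodes_inject in auto)
  show 1: "is_part (shape_le la t m)" "nodes (shape_le la t m) = ?S" using \<nu> unfolding s by simp_all
  assume m: "m \<le> sum_list la"
  have "t ` ?S = {1..m}"
  proof (intro equalityI subsetI)
    fix k assume k: "k \<in> {1..m}"
    then have "k \<in> {1..sum_list la}" using m by simp
    from pos_in[OF standard_tab[OF t] this] tab_pos[OF standard_tab[OF t] this]
    show "k \<in> t ` ?S" using k by (intro image_eqI[of _ _ "pos la t k"]) auto
  qed (use tab_range[OF standard_tab[OF t]] in auto)
  moreover have "inj_on t ?S" using tab_inj[OF standard_tab[OF t]] by (auto intro: inj_onI)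
  ultimately have "card ?S = m" using card_image[of t ?S] by simp
  then show "sum_list (shape_le la t m) = m" unfolding card_nodes[symmetric] 1(2) .
qed

text \<open>The second claim is what the construction is made for: on 1, ..., r - 1 the contents are
  those of the row filling of the smaller shape, so the highest eigenvector of that shape
  appears.\<close>

lemma t_le:
  assumes la: "is_part la" and t: "standard la t" and r: "1 \<le> r" "r \<le> s" "s \<le> sum_list la"
  defines "\<nu> \<equiv> shape_le la t s" and "\<mu> \<equiv> shape_le la t (r - 1)"
  shows "standard \<nu> (t_le la t r s)"
    and "p \<in> {1..r - 1} \<Longrightarrow> cont \<nu> (t_le la t r s) p = cont \<mu> (tnu \<mu>) p"
proof -
  have \<nu>: "is_part \<nu>" "nodes \<nu> = {x \<in> nodes la. t x \<le> s}" "sum_list \<nu> = s"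
    unfolding \<nu>_def using shape_le[OF la t, of s] r by simp_all
  have \<mu>: "is_part \<mu>" "nodes \<mu> = {x \<in> nodes la. t x \<le> r - 1}" "sum_list \<mu> = r - 1"
    unfolding \<mu>_def using shape_le[OF la t, of "r - 1"] r by simp_all
  let ?R = "{x \<in> nodes \<nu>. r \<le> t x \<and> t x \<le> s}" and ?T = "t_le la t r s"
  \<comment> \<open>Removing the nodes that keep the entries r, ..., s leaves precisely the diagram
    of \<open>\<mu>\<close>, so the row filling of the rest is \<open>tnu \<mu>\<close>.\<close>
  have NR: "nodes \<nu> - ?R = nodes \<mu>" unfolding \<nu>(2) \<mu>(2) using r by auto
  have T: "?T x = (if x \<in> ?R then t x else tnu \<mu> x)" for x
    unfolding t_le_def Let_def tnu_def NR[symmetric] \<nu>_def ..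
  have N: "nodes \<nu> = nodes \<mu> \<union> ?R" using NR by blast
  have dis: "x \<notin> ?R" if "x \<in> nodes \<mu>" for x using that NR by blast
  have Tm: "?T x = tnu \<mu> x" if "x \<in> nodes \<mu>" for x by (rule trans[OF T if_not_P[OF dis[OF that]]])
  have TR: "?T x = t x" if "x \<in> ?R" for x by (rule trans[OF T if_P[OF that]])
  have "bij_betw ?T (nodes \<mu>) {1..r - 1}"
    using tableau_bij[OF tnu_tableau, of \<mu>] Tm \<mu>(3) bij_betw_cong[of "nodes \<mu>" ?T "tnu \<mu>"] by simp
  moreover have "bij_betw t ?R {r..s}"
  proof (rule bij_betw_imageI)
    show "inj_on t ?R" using tab_inj[OF standard_tab[OF t]] unfolding \<nu>(2) by (auto intro: inj_onI)
    show "t ` ?R = {r..s}"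
    proof (intro equalityI subsetI)
      fix k assume k: "k \<in> {r..s}"
      then have "k \<in> {1..sum_list la}" using r by simp
      from pos_in[OF standard_tab[OF t] this] tab_pos[OF standard_tab[OF t] this]
      show "k \<in> t ` ?R" using k unfolding \<nu>(2) by (intro image_eqI[of _ _ "pos la t k"]) auto
    qed auto
  qed
  then have "bij_betw ?T ?R {r..s}" using TR bij_betw_cong[of ?R ?T t] by blast
  ultimately have "bij_betw ?T (nodes \<mu> \<union> ?R) ({1..r - 1} \<union> {r..s})" by (rule bij_betw_combine) auto
  moreover have "{1..r - 1} \<union> {r..s} = {1..s}" using r by auto
  ultimately have "bij_betw ?T (nodes \<nu>) {1..sum_list \<nu>}" using N \<nu>(3) by simp
  moreover have "?T x = 0" if "x \<notin> nodes \<nu>" for x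
  proof -
    have "x \<notin> nodes \<mu>" "x \<notin> ?R" using that N by blast+
    then show ?thesis using trans[OF trans[OF T if_not_P] tab_out[OF tnu_tableau]] by blast
  qed
  ultimately have tab: "tableau \<nu> ?T" unfolding tableau_def by blast
  show "standard \<nu> ?T"
  proof (rule standardI[OF tab])
    fix x y assume x: "x \<in> nodes \<nu>" and y: "y \<in> nodes \<nu>" and le: "fst x \<le> fst y" "snd x \<le> snd y" "x \<noteq> y"
    have "x \<in> nodes la" "y \<in> nodes la" using x y unfolding \<nu>(2) by auto
    then have lt: "t x < t y" by (rule standard_less[OF la t _ _ le])
    show "?T x < ?T y"
    proof (cases "y \<in> ?R")
      case True
      show ?thesis
      proof (cases "x \<in> ?R")
        case xR: True
        show ?thesis unfolding TR[OF True] TR[OF xR] by (rule lt)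
      next
        case False
        then have xm: "x \<in> nodes \<mu>" using x NR by blast
        have "tnu \<mu> x \<le> r - 1" using tab_range[OF tnu_tableau xm] \<mu>(3) by simp
        moreover have "r \<le> t y" using True by simp
        ultimately show ?thesis unfolding TR[OF True] Tm[OF xm] using r(1) by linarith
      qed
    next
      case False
      then have ym: "y \<in> nodes \<mu>" using y NR by blast
      then have xm: "x \<in> nodes \<mu>" using lt x unfolding \<nu>(2) \<mu>(2) by simp
      show ?thesis unfolding Tm[OF ym] Tm[OF xm] by (rule standard_less[OF \<mu>(1) tnu_standard xm ym le])
    qed
  qed
  show "cont \<nu> ?T p = cont \<mu> (tnu \<mu>) p" if p: "p \<in> {1..r - 1}"
  proof -
    let ?x = "pos \<mu> (tnu \<mu>) p"
    have x: "?x \<in> nodes \<mu>" "tnu \<mu> ?x = p" using pos_in[OF tnu_tableau] tab_pos[OF tnu_tableau] p \<mu>(3) by simp_all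
    then have "?T ?x = p" using Tm by simp
    then have "pos \<nu> ?T p = ?x" using pos_tab[OF tab, of ?x] x(1) N by auto
    then show ?thesis unfolding cont_def by simp
  qed
qed

text \<open>One implication of the assumption makes the map well defined on values of P, the other
  makes it injective.\<close>

lemma transported_map:
  assumes "\<And>x y. x \<in> A \<Longrightarrow> y \<in> A \<Longrightarrow> P x = P y \<longleftrightarrow> Q x = Q y"
  shows "\<exists>f. bij_betw f {P x | x. x \<in> A} (Q ` A) \<and> (\<forall>x\<in>A. f (P x) = Q x)"
proof -
  define f where "f c = Q (SOME x. x \<in> A \<and> P x = c)" for c
  have f: "f (P x) = Q x" if "x \<in> A" for x
  proof -
    have "\<exists>y. y \<in> A \<and> P y = P x" using that by blast
    from someI_ex[OF this] show ?thesis unfolding f_def using assms that by blast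
  qed
  have "bij_betw f {P x | x. x \<in> A} (Q ` A)"
  proof (rule bij_betw_imageI)
    show "inj_on f {P x | x. x \<in> A}"
    proof (rule inj_onI)
      fix c d assume "c \<in> {P x | x. x \<in> A}" "d \<in> {P x | x. x \<in> A}" "f c = f d"
      then obtain x y where "x \<in> A" "y \<in> A" "c = P x" "d = P y" "Q x = Q y" using f by auto
      then show "c = d" using assms by simp
    qed
    have "{P x | x. x \<in> A} = P ` A" by blast
    then show "f ` {P x | x. x \<in> A} = Q ` A" using f by (simp add: image_image cong: image_cong)
  qed
  then show ?thesis using f by blast
qed

theorem theorem3:
  fixes \<zeta> :: complex and n r s :: nat and la :: "nat list" and t :: "nat \<times> nat \<Rightarrow> nat"
  assumes "\<zeta> \<noteq> 0"
    and "partition_of n la"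
    and "standard la t"
    and "1 \<le> r" and "r \<le> s" and "s \<le> n"
  shows "\<exists>\<phi>. bij_betw \<phi>
              {cls (shape_le la t s) (f_t (shape_le la t s) (t_le la t r s) \<star> h) | h.
                 h \<in> H_over (A_zeta \<zeta>) (r - 1)}
              (Specht_over (A_zeta \<zeta>) (shape_le la t (r - 1)))
          \<and> (\<forall>h \<in> H_over (A_zeta \<zeta>) (r - 1).
               \<phi> (cls (shape_le la t s) (f_t (shape_le la t s) (t_le la t r s) \<star> h))
               = cls (shape_le la t (r - 1)) (x_nu (shape_le la t (r - 1)) \<star> h))"
proof -
  have la: "is_part la" "sum_list la = n" using assms(2) by (simp_all add: partition_of_def)
  note t = assms(3)
  define \<nu> \<mu> v where "\<nu> = shape_le la t s" and "\<mu> = shape_le la t (r - 1)" and "v = t_le la t r s"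
  have \<nu>: "is_part \<nu>" "sum_list \<nu> = s"
    unfolding \<nu>_def using shape_le(1,3)[OF la(1) t, of s] la(2) assms(6) by simp_all
  have \<mu>: "is_part \<mu>" "sum_list \<mu> = r - 1"
    unfolding \<mu>_def using shape_le(1,3)[OF la(1) t, of "r - 1"] la(2) assms(5,6) by simp_all
  have v: "standard \<nu> v" unfolding \<nu>_def v_def using t_le(1)[OF la(1) t] assms(4-6) la(2) by blast
  have cv: "cont \<nu> v p = cont \<mu> (tnu \<mu>) p" if "p \<in> {1..r - 1}" for p
    unfolding \<nu>_def \<mu>_def v_def using t_le(2)[OF la(1) t assms(4,5) _ that] assms(6) la(2) by blast
  obtain g where g: "g \<noteq> 0" "eigv (sum_list \<nu>) (cont \<nu> v) g"
    "\<And>k. k \<in> Hm (sum_list \<nu>) \<Longrightarrow> fel \<nu> v * k \<in> NN \<nu> \<longleftrightarrow> g * k = 0"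
    by (rule seminormal_vector[OF \<nu>(1) v]) blast
  \<comment> \<open>The vector g comes from rank s; restricting attention to the first r - 1
    Jucys-Murphy elements makes it a highest eigenvector for \<open>\<mu>\<close>.\<close>
  have ge: "eigv (sum_list \<mu>) (cont \<mu> (tnu \<mu>)) g"
    using g(2) cv assms(5) unfolding eigv_def \<nu>(2) \<mu>(2) by simp
  \<comment> \<open>Both membership conditions are equivalent to g k = 0, the first by the choice of
    g and the second by the annihilator theorem for \<open>\<mu>\<close>.\<close>
  have key: "fel \<nu> v * k \<in> NN \<nu> \<longleftrightarrow> Xp \<mu> * k \<in> NN \<mu>" if k: "k \<in> Hm (r - 1)" for k
  proof -
    have "r - 1 \<le> s" using assms(5) by simp
    then have "k \<in> Hm (sum_list \<nu>)" using Hm_mono k \<nu>(2) by blast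
    from g(3)[OF this] eigv_tnu_annihilator[OF \<mu>(1) ge g(1), of k] k show ?thesis unfolding \<mu>(2) by blast
  qed
  let ?P = "\<lambda>h. cls \<nu> (f_t \<nu> v \<star> h)" and ?Q = "\<lambda>h. cls \<mu> (x_nu \<mu> \<star> h)"
  have "\<exists>\<phi>. bij_betw \<phi> {?P h | h. h \<in> H_over (A_zeta \<zeta>) (r - 1)} (?Q ` H_over (A_zeta \<zeta>) (r - 1)) \<and>
      (\<forall>h\<in>H_over (A_zeta \<zeta>) (r - 1). \<phi> (?P h) = ?Q h)"
  proof (rule transported_map)
    fix h h' assume "h \<in> H_over (A_zeta \<zeta>) (r - 1)" "h' \<in> H_over (A_zeta \<zeta>) (r - 1)"
    then obtain k k' where k: "k \<in> Hm (r - 1)" "h = cf k" "k' \<in> Hm (r - 1)" "h' = cf k'" unfolding H_over_cf by blast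
    have "?P (cf a) = cls \<nu> (cf (fel \<nu> v * a))" "?Q (cf a) = cls \<mu> (cf (Xp \<mu> * a))" for a
      by (simp_all add: cf_mult cf_fel[OF standard_tab[OF v]] cf_Xp)
    then show "?P h = ?P h' \<longleftrightarrow> ?Q h = ?Q h'"
      unfolding k(2,4) using key[OF Hm_diff[OF k(1,3)]] by (simp add: cls_eq_iff right_diff_distrib)
  qed
  then show ?thesis
    unfolding \<nu>_def[symmetric] \<mu>_def[symmetric] v_def[symmetric] Specht_over_eq[OF assms(1) \<mu>(1)] \<mu>(2) .
qed

end
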